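(* Fix an integer $p\geq2$, a unit vector $\theta_1^0\in\mathbb{R}^p$, $v>0$ and a positive real sequence $(r_n)$ satisfying (i) $r_n\equiv1$ or (ii) $r_n=o(1)$ with $\sqrt n\,r_n\to\infty$. Then the test $\phi_{\rm HPV}$ is locally asymptotically maximin at level $\alpha$ (for any $\alpha\in(0,1)$) when testing $\mathcal H_0^{(n)}:\theta_1=\theta_1^0$ against $\mathcal H_1^{(n)}:\theta_1\neq\theta_1^0$. Moreover, for any sequence $\tau_n\to\tau$ in $\mathbb{R}^p$ such that $\theta_1^0+\tau_n/(\sqrt n\,r_n)$ is a unit vector for every $n$, the statistic $Q_{\rm HPV}$ is, under $\mathrm{P}_{\theta_1^0+\tau_n/(\sqrt n\,r_n),r_n,v}$, asymptotically non-central chi-square with $p-1$ degrees of freedom and with non-centrality parameter $$\frac{v^2}{1+\delta v}\|\tau\|^2,$$ where $\delta=1$ in case (i) and $\delta=0$ in case (ii).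
   Context: Model: for a unit vector $\theta_1\in\mathbb{R}^p$, $v>0$ and a positive sequence $(r_n)$, $\mathrm{P}_{\theta_1,r_n,v}$ denotes the (sequence of) hypotheses under which, for each $n$, $X_{n1},\ldots,X_{nn}$ are i.i.d. $p$-variate normal with mean $0$ and covariance matrix $I_p+r_nv\,\theta_1\theta_1'$ (a triangular array; the dimension $p$ is fixed). Prime denotes transpose. Let $\bar X_n=\frac1n\sum_{i=1}^nX_{ni}$ and $S_n=\frac1n\sum_{i=1}^n(X_{ni}-\bar X_n)(X_{ni}-\bar X_n)'$. Let $\hat\lambda_{n1}\geq\cdots\geq\hat\lambda_{np}$ be the eigenvalues of $S_n$ and $\hat\theta_{nj}$ a unit eigenvector of $S_n$ associated with $\hat\lambda_{nj}$ (almost surely unique up to sign for $n>p$; the sign is irrelevant here). Let $\tilde\theta_{n2},\ldots,\tilde\theta_{np}$ be obtained by Gram–Schmidt orthogonalization of $\theta_1^0,\hat\theta_{n2},\ldots,\hat\theta_{np}$, i.e. recursively for $j=2,\ldots,p$, $$\tilde\theta_{nj}=\frac{(I_p-\theta_1^0\theta_1^{0\prime}-\sum_{k=2}^{j-1}\tilde\theta_{nk}\tilde\theta_{nk}')\hat\theta_{nj}}{\|(I_p-\theta_1^0\theta_1^{0\prime}-\sum_{k=2}^{j-1}\tilde\theta_{nk}\tilde\theta_{nk}')\hat\theta_{nj}\|}.$$ Then $Q_{\rm HPV}=\frac{n}{\hat\lambda_{n1}}\sum_{j=2}^p\hat\lambda_{nj}^{-1}(\tilde\theta_{nj}'S_n\theta_1^0)^2$,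 and $\phi_{\rm HPV}$ rejects the null hypothesis at asymptotic level $\alpha$ when $Q_{\rm HPV}>\chi^2_{p-1,1-\alpha}$, the $\alpha$-upper quantile of the $\chi^2_{p-1}$ distribution. The test $\phi_{\rm HPV}$ is identified with its rejection indicator. Local asymptotic maximinity (standard Le Cam notion, here for fixed $v$ and $(r_n)$, with localization rate $\nu_n=1/(\sqrt n\,r_n)$): a sequence of tests $\phi_n$ is locally asymptotically maximin at level $\alpha$ if $\limsup_n\mathrm{E}_{\mathrm{P}_{\theta_1^0,r_n,v}}[\phi_n]\leq\alpha$ and, for all $0<c\leq C<\infty$ and every sequence of tests $\psi_n$ with $\limsup_n\mathrm{E}_{\mathrm{P}_{\theta_1^0,r_n,v}}[\psi_n]\leq\alpha$, $$\limsup_n\inf_{\theta\in A_n(c,C)}\mathrm{E}_{\mathrm{P}_{\theta,r_n,v}}[\psi_n]\leq\liminf_n\inf_{\theta\in A_n(c,C)}\mathrm{E}_{\mathrm{P}_{\theta,r_n,v}}[\phi_n],$$ where $A_n(c,C)=\{\theta\in\mathbb{R}^p:\|\theta\|=1,\ c\leq\nu_n^{-1}\|\theta-\theta_1^0\|\leq C\}$ (nonempty for $n$ large). *)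

theory Defs
  imports "HOL-Probability.Probability"
begin

definition outer_product :: "real ^ 'p \<Rightarrow> real ^ 'p \<Rightarrow> real ^ 'p ^ 'p" where
  "outer_product u w = (\<chi> i j. u $ i * w $ j)"

(* The usual density formula; it describes N(mu, Sigma) for positive definite Sigma. *)
definition mvnormal_density ::
    "real ^ 'p \<Rightarrow> real ^ 'p ^ 'p \<Rightarrow> real ^ 'p \<Rightarrow> real" where
  "mvnormal_density \<mu> \<Sigma> x =
     exp (- ((x - \<mu>) \<bullet> (matrix_inv \<Sigma> *v (x - \<mu>))) / 2) / sqrt ((2 * pi) ^ CARD('p) * det \<Sigma>)"

definition mvnormal :: "real ^ 'p \<Rightarrow> real ^ 'p ^ 'p \<Rightarrow> (real ^ 'p) measure" where
  "mvnormal \<mu> \<Sigma> = density lborel (\<lambda>x. ennreal (mvnormal_density \<mu> \<Sigma> x))"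

(* The law of Z_1^2 + ... + Z_k^2 for independent Z_i ~ N(mu_i, 1) depends on mu only through
   the non-centrality parameter c = mu_1^2 + ... + mu_k^2; here mu = (sqrt c, 0, ..., 0). *)
definition noncentral_chi_square :: "nat \<Rightarrow> real \<Rightarrow> real measure" where
  "noncentral_chi_square k c =
     distr (\<Pi>\<^sub>M i\<in>{1..k}. density lborel
              (\<lambda>x. ennreal (normal_density (if i = 1 then sqrt c else 0) 1 x)))
       borel (\<lambda>z. \<Sum>i=1..k. (z i)\<^sup>2)"

definition chi_square :: "nat \<Rightarrow> real measure" where
  "chi_square k = noncentral_chi_square k 0"

definition quantile :: "real measure \<Rightarrow> real \<Rightarrow> real" where
  "quantile M u = Inf {x. u \<le> cdf M x}"

(* A sample of size n is a function x whose relevant values are x 1, ..., x n. *)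
definition sample_space :: "nat \<Rightarrow> (nat \<Rightarrow> real ^ 'p) measure" where
  "sample_space n = (\<Pi>\<^sub>M i\<in>{1..n}. borel)"

definition spiked_model ::
    "(nat \<Rightarrow> real) \<Rightarrow> real \<Rightarrow> nat \<Rightarrow> real ^ 'p \<Rightarrow> (nat \<Rightarrow> real ^ 'p) measure" where
  "spiked_model r v n \<theta> =
     (\<Pi>\<^sub>M i\<in>{1..n}. mvnormal 0 (mat 1 + (r n * v) *\<^sub>R outer_product \<theta> \<theta>))"

definition sample_mean :: "nat \<Rightarrow> (nat \<Rightarrow> real ^ 'p) \<Rightarrow> real ^ 'p" where
  "sample_mean n x = (1 / real n) *\<^sub>R (\<Sum>i=1..n. x i)"

definition sample_cov :: "nat \<Rightarrow> (nat \<Rightarrow> real ^ 'p) \<Rightarrow> real ^ 'p ^ 'p" where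
  "sample_cov n x =
     (1 / real n) *\<^sub>R (\<Sum>i=1..n. outer_product (x i - sample_mean n x) (x i - sample_mean n x))"

(* Eigenvalues repeated according to multiplicity (roots of the characteristic polynomial), in
   nonincreasing order; existence and uniqueness of the list hold for symmetric matrices. *)
definition eigenvalue_list :: "real ^ 'p ^ 'p \<Rightarrow> real list" where
  "eigenvalue_list A =
     (THE l. length l = CARD('p) \<and> sorted_wrt (\<ge>) l \<and>
             (\<forall>t. det (mat t - A) = (\<Prod>s\<leftarrow>l. t - s)))"

(* The j-th largest eigenvalue, 1 <= j <= p. *)
definition eigenvalue :: "real ^ 'p ^ 'p \<Rightarrow> nat \<Rightarrow> real" where
  "eigenvalue A j = eigenvalue_list A ! (j - 1)"

(* E n j x is the j-th empirical eigenvector at the sample x. Signs, and the choice of unit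
   eigenvectors when eigenvalues coincide, are left arbitrary subject to measurability. *)
definition sample_eigenvectors ::
    "(nat \<Rightarrow> nat \<Rightarrow> (nat \<Rightarrow> real ^ 'p) \<Rightarrow> real ^ 'p) \<Rightarrow> bool" where
  "sample_eigenvectors E \<longleftrightarrow>
     (\<forall>n\<ge>1. \<forall>j\<in>{1..CARD('p)}.
        E n j \<in> borel_measurable (sample_space n) \<and>
        (\<forall>x\<in>space (sample_space n).
           norm (E n j x) = 1 \<and>
           sample_cov n x *v E n j x = eigenvalue (sample_cov n x) j *\<^sub>R E n j x))"

(* Gram-Schmidt on \<theta>0, e 2, e 3, ...; only indices j >= 2 are meaningful. *)
fun gram_schmidt :: "real ^ 'p \<Rightarrow> (nat \<Rightarrow> real ^ 'p) \<Rightarrow> nat \<Rightarrow> real ^ 'p" where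
  "gram_schmidt \<theta>0 e j =
     (let w = (mat 1 - outer_product \<theta>0 \<theta>0
                - (\<Sum>k\<in>{2..<j}. outer_product (gram_schmidt \<theta>0 e k) (gram_schmidt \<theta>0 e k))) *v e j
      in (1 / norm w) *\<^sub>R w)"

declare gram_schmidt.simps [simp del]

definition Q_HPV ::
    "real ^ 'p \<Rightarrow> (nat \<Rightarrow> nat \<Rightarrow> (nat \<Rightarrow> real ^ 'p) \<Rightarrow> real ^ 'p) \<Rightarrow> nat \<Rightarrow> (nat \<Rightarrow> real ^ 'p) \<Rightarrow> real" where
  "Q_HPV \<theta>0 E n x =
     real n / eigenvalue (sample_cov n x) 1 *
     (\<Sum>j=2..CARD('p). inverse (eigenvalue (sample_cov n x) j) *
        (gram_schmidt \<theta>0 (\<lambda>k. E n k x) j \<bullet> (sample_cov n x *v \<theta>0))\<^sup>2)"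

definition phi_HPV ::
    "real ^ 'p \<Rightarrow> (nat \<Rightarrow> nat \<Rightarrow> (nat \<Rightarrow> real ^ 'p) \<Rightarrow> real ^ 'p) \<Rightarrow> real \<Rightarrow>
     nat \<Rightarrow> (nat \<Rightarrow> real ^ 'p) \<Rightarrow> real" where
  "phi_HPV \<theta>0 E \<alpha> n =
     indicator {x. Q_HPV \<theta>0 E n x > quantile (chi_square (CARD('p) - 1)) (1 - \<alpha>)}"

(* Tests may be randomized. *)
definition test_sequence :: "(nat \<Rightarrow> (nat \<Rightarrow> real ^ 'p) \<Rightarrow> real) \<Rightarrow> bool" where
  "test_sequence \<psi> \<longleftrightarrow>
     (\<forall>n\<ge>1. \<psi> n \<in> borel_measurable (sample_space n) \<and>
            (\<forall>x\<in>space (sample_space n). 0 \<le> \<psi> n x \<and> \<psi> n x \<le> 1))"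

definition local_alternatives :: "real ^ 'p \<Rightarrow> real \<Rightarrow> real \<Rightarrow> real \<Rightarrow> (real ^ 'p) set" where
  "local_alternatives \<theta>0 \<nu> c C =
     {\<theta>. norm \<theta> = 1 \<and> c \<le> inverse \<nu> * norm (\<theta> - \<theta>0) \<and> inverse \<nu> * norm (\<theta> - \<theta>0) \<le> C}"

definition asymptotic_level ::
    "(nat \<Rightarrow> (nat \<Rightarrow> real ^ 'p) measure) \<Rightarrow> real \<Rightarrow> (nat \<Rightarrow> (nat \<Rightarrow> real ^ 'p) \<Rightarrow> real) \<Rightarrow> bool" where
  "asymptotic_level P0 \<alpha> \<psi> \<longleftrightarrow> limsup (\<lambda>n. ereal (\<integral>x. \<psi> n x \<partial>P0 n)) \<le> ereal \<alpha>"

(* The infima are taken in ereal; the index sets are nonempty for large n when p >= 2. *)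
definition locally_asymptotically_maximin ::
    "(nat \<Rightarrow> real ^ 'p \<Rightarrow> (nat \<Rightarrow> real ^ 'p) measure) \<Rightarrow> (nat \<Rightarrow> real) \<Rightarrow> real ^ 'p \<Rightarrow> real \<Rightarrow>
     (nat \<Rightarrow> (nat \<Rightarrow> real ^ 'p) \<Rightarrow> real) \<Rightarrow> bool" where
  "locally_asymptotically_maximin P \<nu> \<theta>0 \<alpha> \<phi> \<longleftrightarrow>
     test_sequence \<phi> \<and>
     asymptotic_level (\<lambda>n. P n \<theta>0) \<alpha> \<phi> \<and>
     (\<forall>c C. 0 < c \<and> c \<le> C \<longrightarrow>
       (\<forall>\<psi>. test_sequence \<psi> \<and> asymptotic_level (\<lambda>n. P n \<theta>0) \<alpha> \<psi> \<longrightarrow>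
          limsup (\<lambda>n. INF \<theta>\<in>local_alternatives \<theta>0 (\<nu> n) c C. ereal (\<integral>x. \<psi> n x \<partial>P n \<theta>))
          \<le> liminf (\<lambda>n. INF \<theta>\<in>local_alternatives \<theta>0 (\<nu> n) c C. ereal (\<integral>x. \<phi> n x \<partial>P n \<theta>))))"

end

theory Submission
  imports Defs
begin

text \<open>Write the sample as \<open>X\<^sub>i = (1 + r\<^sub>n v \<theta>\<theta>')\<^sup>1\<^sup>/\<^sup>2 T z\<^sub>i\<close> for a fixed standard Gaussian array \<open>z\<close> and an orthogonal
  \<open>T\<close> with \<open>T e\<^sub>k = \<theta>\<^sub>0\<close>.  Let \<open>score\<close> be the sum over \<open>i\<close> of the vectors \<open>z\<^sub>i\<close> without their \<open>k\<close>-th coordinate,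
  weighted by the normalised \<open>k\<close>-th coordinates.  Conditionally on these weights it is standard
  Gaussian in dimension \<open>p - 1\<close>, for every \<open>n\<close>, so no central limit theorem is needed.  On events of
  large probability the second moments of \<open>z\<close> are within \<open>O(n\<^sup>-\<^sup>1\<^sup>/\<^sup>2)\<close> of their means; perturbation bounds
  for eigenvalues then show that \<open>Q\<close> differs by \<open>o(1)\<close> from the squared norm of the score shifted by a
  vector of norm \<open>v \<parallel>\<tau>\<parallel> / (1 + \<delta>v)\<^sup>1\<^sup>/\<^sup>2\<close>.  The Gram-Schmidt vectors are well defined almost surely, because an
  eigenvector orthogonal to \<open>\<theta>\<^sub>0\<close> makes a Krylov determinant vanish, and this determinant is a nonzero
  polynomial in the sample.

  On the same events the log-likelihood ratio of a local alternative in direction \<open>s\<close> is that of a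
  Gaussian shift of the score, uniformly in \<open>s\<close>.  The average of the shift likelihoods over the sphere is
  an increasing function of the norm of the score, so by the Neyman-Pearson lemma no test has
  asymptotically a larger minimal power on a sphere than the chi-square test.  That the statistic
  attains this bound uniformly over the shell of alternatives follows by extracting a
  convergent subsequence of nearly least favourable alternatives.\<close>

section \<open>Gaussian vectors and their linear images\<close>

text \<open>The obstacle is that every expansion must hold uniformly over an event, and for the
  likelihood also over directions, whereas limit calculus speaks of deterministic limits. The locale
  \<open>spiked_limit\<close> therefore works along an arbitrary filter: on pairs (n, z), or triples
  (n, z, s), restricted by a fixed bound on \<open>tight_bound\<close>, an ordinary limit along the
  filter is a uniform limit over that restriction.

  When r_n tends to 0 the limiting covariance is the identity and no spectral gap remains, so the
  eigenvectors are asked for nothing but orthonormality. This suffices: the eigenvalues with j at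
  least 2 are all close to 1, and with equal weights the sum in \<open>Q_HPV\<close> is the squared
  length of the component of \<open>S *v \<theta>0\<close> orthogonal to \<open>\<theta>0\<close>,
  whatever basis the Gram-Schmidt vectors form. The divergence of sqrt n r_n makes sampling errors
  of order 1/sqrt n negligible even after division by r_n.

  The upper bound on the minimal power is proved for every radius t in [c, C], so it can be applied
  at the very radius to which the extracted subsequence of alternatives converges.\<close>

lemma PiM_density:
  assumes fin: "finite I" and M: "product_sigma_finite M"
    and D: "product_sigma_finite (\<lambda>i. density (M i) (f i))"
    and f [measurable]: "\<And>i. f i \<in> borel_measurable (M i)"
  shows "PiM I (\<lambda>i. density (M i) (f i)) = density (PiM I M) (\<lambda>x. \<Prod>i\<in>I. f i (x i))"
proof -
  interpret M: product_sigma_finite M by fact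
  interpret D: product_sigma_finite "\<lambda>i. density (M i) (f i)" by fact
  show ?thesis
  proof (rule D.PiM_eqI[symmetric])
    show "sets (density (PiM I M) (\<lambda>x. \<Prod>i\<in>I. f i (x i))) = sets (PiM I (\<lambda>i. density (M i) (f i)))"
      by (simp cong: sets_PiM_cong)
  next
    fix A assume "\<And>i. i \<in> I \<Longrightarrow> A i \<in> sets (density (M i) (f i))"
    then have A [measurable]: "\<And>i. i \<in> I \<Longrightarrow> A i \<in> sets (M i)" by simp
    have "emeasure (density (PiM I M) (\<lambda>x. \<Prod>i\<in>I. f i (x i))) (Pi\<^sub>E I A)
      = (\<integral>\<^sup>+x. (\<Prod>i\<in>I. f i (x i)) * indicator (Pi\<^sub>E I A) x \<partial>PiM I M)"
      using fin by (subst emeasure_density) (auto intro!: sets_PiM_I_finite)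
    also have "\<dots> = (\<integral>\<^sup>+x. (\<Prod>i\<in>I. f i (x i) * indicator (A i) (x i)) \<partial>PiM I M)"
    proof (rule nn_integral_cong)
      fix x assume x: "x \<in> space (PiM I M)"
      show "(\<Prod>i\<in>I. f i (x i)) * indicator (Pi\<^sub>E I A) x = (\<Prod>i\<in>I. f i (x i) * indicator (A i) (x i))"
      proof (cases "x \<in> Pi\<^sub>E I A")
        case True then show ?thesis by (auto simp: PiE_iff intro!: prod.cong)
      next
        case False
        then obtain i where "i \<in> I" "x i \<notin> A i" using x by (auto simp: space_PiM PiE_iff)
        then show ?thesis using False fin by (auto simp: prod_zero_iff intro!: sym[OF prod_zero] bexI[of _ i])
      qed
    qed
    also have "\<dots> = (\<Prod>i\<in>I. \<integral>\<^sup>+x. f i x * indicator (A i) x \<partial>M i)"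
      using fin by (subst M.product_nn_integral_prod) auto
    also have "\<dots> = (\<Prod>i\<in>I. emeasure (density (M i) (f i)) (A i))"
      by (intro prod.cong refl) (simp add: emeasure_density)
    finally show "emeasure (density (PiM I M) (\<lambda>x. \<Prod>i\<in>I. f i (x i))) (Pi\<^sub>E I A)
      = (\<Prod>i\<in>I. emeasure (density (M i) (f i)) (A i))" .
  qed (fact fin)
qed

section \<open>Lebesgue and standard Gaussian measure in coordinates\<close>

lemma borel_measurable_vec_nth [measurable]:
  "(\<lambda>x::real^'p. x $ j) \<in> borel_measurable borel"
  by (intro borel_measurable_continuous_onI continuous_intros)

lemma borel_measurable_vec [measurable (raw)]:
  fixes f :: "'a \<Rightarrow> 'p::finite \<Rightarrow> real"
  assumes "\<And>j. (\<lambda>x. f x j) \<in> borel_measurable M"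
  shows "(\<lambda>x. \<chi> j. f x j) \<in> borel_measurable M"
proof (rule borel_measurable_euclidean_space[THEN iffD2], rule ballI)
  fix b :: "real^'p" assume "b \<in> Basis"
  then obtain j where "b = axis j 1" by (auto simp: Basis_vec_def)
  then show "(\<lambda>x. (\<chi> j. f x j) \<bullet> b) \<in> borel_measurable M"
    using assms by (simp add: inner_axis)
qed

lemma measurable_vec_lambda_PiM [measurable]:
  "(\<lambda>f. \<chi> j. f j) \<in> borel_measurable (PiM (UNIV :: 'p::finite set) (\<lambda>_. borel :: real measure))"
  by measurable

lemma borel_measurable_matrix_vector_mult [measurable (raw)]:
  fixes A :: "'a \<Rightarrow> real^'n^'m" and y :: "'a \<Rightarrow> real^'n"
  assumes "A \<in> borel_measurable M" "y \<in> borel_measurable M"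
  shows "(\<lambda>x. A x *v y x) \<in> borel_measurable M"
proof -
  have "continuous_on UNIV (\<lambda>p :: (real^'n^'m) \<times> (real^'n). fst p *v snd p)"
    unfolding matrix_vector_mult_def by (intro continuous_intros)
  then have "(\<lambda>p :: (real^'n^'m) \<times> (real^'n). fst p *v snd p) \<in> borel_measurable borel"
    by (rule borel_measurable_continuous_onI)
  from measurable_compose[OF borel_measurable_Pair[OF assms] this] show ?thesis by simp
qed

lemma prod_Basis_vec: "(\<Prod>b\<in>Basis. g b) = (\<Prod>j\<in>UNIV. g (axis j (1::real)))"
  for g :: "real^'p \<Rightarrow> real"
proof -
  have *: "Basis = (\<lambda>j. axis j (1::real)) ` (UNIV :: 'p set)" by (auto simp: Basis_vec_def)
  show ?thesis unfolding * by (subst prod.reindex) (auto simp: inj_on_def axis_eq_axis)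
qed

text \<open>Lebesgue measure is determined by its values on boxes, and a box pulls back to a product
  of intervals. This links densities on vectors with products over coordinates.\<close>

lemma lborel_vec:
  "distr (PiM UNIV (\<lambda>_. lborel)) borel (\<lambda>f. \<chi> j. f j) = (lborel :: (real^'p) measure)"
proof (rule lborel_eqI[symmetric])
  interpret product_sigma_finite "\<lambda>_::'p. lborel :: real measure"
    by standard
  have m [measurable]: "(\<lambda>f. \<chi> j. f j) \<in> measurable (PiM UNIV (\<lambda>_::'p. lborel :: real measure)) borel"
    using measurable_vec_lambda_PiM by (simp cong: measurable_cong_sets sets_PiM_cong)
  fix l u :: "real^'p" assume lu: "\<And>b. b \<in> Basis \<Longrightarrow> l \<bullet> b \<le> u \<bullet> b"
  have lu': "l $ j \<le> u $ j" for j using lu[of "axis j 1"] by (simp add: inner_axis axis_in_Basis_iff)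
  have "emeasure (distr (PiM UNIV (\<lambda>_. lborel)) borel (\<lambda>f. \<chi> j. f j)) (box l u)
     = emeasure (PiM UNIV (\<lambda>_. lborel)) (Pi\<^sub>E UNIV (\<lambda>j. {l $ j <..< u $ j}))"
    by (subst emeasure_distr) (auto simp: box_def Basis_vec_def inner_axis space_PiM intro!: arg_cong2[where f=emeasure])
  also have "\<dots> = (\<Prod>j\<in>UNIV. ennreal (u $ j - l $ j))"
    by (subst emeasure_PiM) (auto simp: lu')
  also have "\<dots> = ennreal (\<Prod>j\<in>UNIV. u $ j - l $ j)" by (rule prod_ennreal) (simp add: lu')
  also have "(\<Prod>j\<in>UNIV. u $ j - l $ j) = (\<Prod>b\<in>Basis. (u - l) \<bullet> b)"
    by (simp add: prod_Basis_vec inner_axis)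
  finally show "emeasure (distr (PiM UNIV (\<lambda>_. lborel)) borel (\<lambda>f. \<chi> j. f j)) (box l u) = ennreal (\<Prod>b\<in>Basis. (u - l) \<bullet> b)" .
qed simp

text \<open>Taken as the law of a vector of independent standard normals, so that arrays of
  independent coordinates map onto it directly; the density is recovered in
  \<open>std_gauss_density\<close>.\<close>

definition std_gauss :: "(real^'p) measure" where
  "std_gauss = distr (PiM UNIV (\<lambda>_. std_normal_distribution)) borel (\<lambda>f. \<chi> j. f j)"

lemma sets_std_gauss [measurable_cong, simp]: "sets std_gauss = sets borel"
  by (simp add: std_gauss_def)

lemma space_std_gauss [simp]: "space std_gauss = UNIV"
  by (simp add: std_gauss_def)

lemma prob_space_std_normal: "prob_space std_normal_distribution"
  by (rule prob_space_normal_density) simp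

lemma product_prob_space_std_normal: "product_prob_space (\<lambda>_. std_normal_distribution)"
  by (intro product_prob_spaceI prob_space_std_normal)

lemma product_sigma_finite_std_normal: "product_sigma_finite (\<lambda>_. std_normal_distribution)"
  by (simp add: product_sigma_finite_def prob_space_imp_sigma_finite prob_space_std_normal)

lemma prob_space_PiM_std_normal: "prob_space (PiM I (\<lambda>_. std_normal_distribution))"
  by (intro prob_space_PiM prob_space_std_normal)

lemma measurable_vec_lambda_std_normal [measurable]:
  "(\<lambda>f. \<chi> j. f j) \<in> measurable (PiM UNIV (\<lambda>_::'p::finite. std_normal_distribution)) borel"
  using measurable_vec_lambda_PiM by (simp cong: measurable_cong_sets sets_PiM_cong)

lemma prob_space_std_gauss: "prob_space std_gauss"
  unfolding std_gauss_def by (intro prob_space.prob_space_distr prob_space_PiM_std_normal) simp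

lemma std_gauss_density:
  "(std_gauss :: (real^'p) measure) =
     density lborel (\<lambda>x. ennreal (exp (- (norm x)\<^sup>2 / 2) / sqrt ((2 * pi) ^ CARD('p))))"
proof -
  have m [measurable]: "(\<lambda>f. \<chi> j. f j) \<in> measurable (PiM UNIV (\<lambda>_::'p. lborel :: real measure)) borel"
    using measurable_vec_lambda_PiM by (simp cong: measurable_cong_sets sets_PiM_cong)
  have "std_gauss = distr (density (PiM (UNIV :: 'p set) (\<lambda>_. lborel))
      (\<lambda>x. \<Prod>i\<in>UNIV. ennreal (std_normal_density (x i)))) borel (\<lambda>f. \<chi> j. f j)"
    unfolding std_gauss_def
    by (subst PiM_density) (auto simp: product_sigma_finite_std_normal product_sigma_finite_def lborel.sigma_finite_measure_axioms)
  also have "\<dots> = distr (density (PiM (UNIV :: 'p set) (\<lambda>_. lborel))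
      (\<lambda>x. ennreal (exp (- (norm (\<chi> j. x j))\<^sup>2 / 2) / sqrt ((2 * pi) ^ CARD('p))))) borel (\<lambda>f. \<chi> j. f j)"
  proof (intro arg_cong2[where f="\<lambda>d. distr d borel"] arg_cong2[where f=density] refl ext)
    fix x :: "'p \<Rightarrow> real"
    have "(\<Prod>i\<in>UNIV. ennreal (std_normal_density (x i))) = ennreal (\<Prod>i\<in>UNIV. std_normal_density (x i))"
      by (rule prod_ennreal) simp
    also have "(\<Prod>i\<in>UNIV. std_normal_density (x i)) = (\<Prod>i\<in>(UNIV :: 'p set). 1 / sqrt (2*pi)) * exp (\<Sum>i\<in>UNIV. - (x i)\<^sup>2 / 2)"
      unfolding exp_sum[OF finite] prod.distrib[symmetric] by (simp add: std_normal_density_def)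
    also have "(\<Sum>i\<in>UNIV. - (x i)\<^sup>2 / 2) = - (norm (\<chi> j. x j))\<^sup>2 / 2"
      by (simp add: norm_vec_def L2_set_def sum_nonneg sum_negf sum_divide_distrib)
    also have "(\<Prod>i\<in>(UNIV :: 'p set). 1 / sqrt (2*pi)) = 1 / sqrt ((2 * pi) ^ CARD('p))"
      by (simp only: prod_constant power_one_over real_sqrt_power)
    finally show "(\<Prod>i\<in>UNIV. ennreal (std_normal_density (x i))) =
        ennreal (exp (- (norm (\<chi> j. x j))\<^sup>2 / 2) / sqrt ((2 * pi) ^ CARD('p)))" by simp
  qed
  also have "\<dots> = density (distr (PiM (UNIV :: 'p set) (\<lambda>_. lborel)) borel (\<lambda>f. \<chi> j. f j))
      (\<lambda>x. ennreal (exp (- (norm x)\<^sup>2 / 2) / sqrt ((2 * pi) ^ CARD('p))))"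
    by (subst density_distr) auto
  finally show ?thesis by (simp only: lborel_vec)
qed

text \<open>Uniqueness of Haar measure: a translation-invariant measure is a multiple of Lebesgue measure,
  by Fubini for \<open>f x * g (y - x)\<close>; the ball, being preserved by orthogonal maps, fixes the constant.\<close>

lemma lborel_orthogonal:
  fixes U :: "'a::euclidean_space \<Rightarrow> 'a"
  assumes U: "orthogonal_transformation U"
  shows "distr lborel borel U = lborel"
proof -
  have lin: "linear U" using U by (simp add: orthogonal_transformation)
  have [measurable]: "U \<in> borel_measurable borel"
    by (intro borel_measurable_continuous_onI linear_continuous_on linear_conv_bounded_linear[THEN iffD1] lin)
  define M where "M = distr lborel borel U"
  have [simp, measurable_cong]: "sets M = sets borel" by (simp add: M_def)
  have trans: "(\<integral>\<^sup>+x. h (x + a) \<partial>M) = (\<integral>\<^sup>+x. h x \<partial>M)" if [measurable]: "h \<in> borel_measurable borel" for h a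
  proof -
    obtain b where b: "U b = a" using U by (metis orthogonal_transformation_surj surjD)
    have "(\<integral>\<^sup>+x. h (x + a) \<partial>M) = (\<integral>\<^sup>+x. h (U (b + x)) \<partial>lborel)"
      unfolding M_def by (subst nn_integral_distr) (auto simp: linear_add[OF lin] b add.commute)
    also have "\<dots> = (\<integral>\<^sup>+x. h (U x) \<partial>distr lborel borel ((+) b))"
      by (subst nn_integral_distr) auto
    also have "\<dots> = (\<integral>\<^sup>+x. h x \<partial>M)" unfolding lborel_distr_plus M_def by (subst nn_integral_distr) auto
    finally show ?thesis .
  qed
  have trans': "(\<integral>\<^sup>+x. h (x + a) \<partial>lborel) = (\<integral>\<^sup>+x. h x \<partial>lborel)" if [measurable]: "h \<in> borel_measurable borel" for h and a :: 'a
    using nn_integral_distr[of "(+) a" lborel borel h] by (simp add: lborel_distr_plus add.commute)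
  have ball: "U -` cball 0 n = cball 0 n" for n using orthogonal_transformation_norm[OF U] by auto
  have Mball: "emeasure M (cball 0 n) = emeasure lborel (cball 0 n :: 'a set)" for n
    unfolding M_def by (subst emeasure_distr) (auto simp: ball)
  have "sigma_finite_measure M"
  proof
    show "\<exists>A. countable A \<and> A \<subseteq> sets M \<and> \<Union> A = space M \<and> (\<forall>a\<in>A. emeasure M a \<noteq> \<infinity>)"
    proof (intro exI[of _ "range (\<lambda>n::nat. cball 0 (real n))"] conjI ballI)
      show "\<Union> (range (\<lambda>n::nat. cball 0 (real n))) = space M"
        using real_arch_simple by (auto simp: M_def)
    next
      fix a assume "a \<in> range (\<lambda>n::nat. cball (0::'a) (real n))"
      then obtain n :: nat where "a = cball 0 (real n)" by auto
      then show "emeasure M a \<noteq> \<infinity>" using emeasure_lborel_cball_finite[of "0::'a" "real n"] by (simp add: Mball)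
    qed auto
  qed
  then interpret pair_sigma_finite M lborel
    by (simp add: pair_sigma_finite_def lborel.sigma_finite_measure_axioms)
  let ?B = "cball 0 1 :: 'a set"
  have key: "emeasure M A * emeasure lborel ?B = emeasure M ?B * emeasure lborel A" if [measurable]: "A \<in> sets borel" for A
  proof -
    let ?g = "indicator ?B :: 'a \<Rightarrow> ennreal" and ?f = "indicator A :: 'a \<Rightarrow> ennreal"
    have [measurable]: "?g \<in> borel_measurable borel" by (intro borel_measurable_indicator) simp
    have "emeasure M A * emeasure lborel ?B = (\<integral>\<^sup>+x. (\<integral>\<^sup>+y. ?f x * ?g y \<partial>lborel) \<partial>M)"
      by (subst nn_integral_cmult) (auto simp: nn_integral_multc)
    also have "\<dots> = (\<integral>\<^sup>+x. (\<integral>\<^sup>+y. ?f x * ?g (y + (- x)) \<partial>lborel) \<partial>M)"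
    proof (rule nn_integral_cong)
      fix x :: 'a
      show "(\<integral>\<^sup>+y. ?f x * ?g y \<partial>lborel) = (\<integral>\<^sup>+y. ?f x * ?g (y + (- x)) \<partial>lborel)"
        by (rule trans'[symmetric]) measurable
    qed
    also have "\<dots> = (\<integral>\<^sup>+y. (\<integral>\<^sup>+x. ?f x * ?g (y + (- x)) \<partial>M) \<partial>lborel)"
      by (subst Fubini') auto
    also have "\<dots> = (\<integral>\<^sup>+y. (\<integral>\<^sup>+x. ?f (x + y) * ?g (- x) \<partial>M) \<partial>lborel)"
    proof (rule nn_integral_cong)
      fix y :: 'a
      show "(\<integral>\<^sup>+x. ?f x * ?g (y + (- x)) \<partial>M) = (\<integral>\<^sup>+x. ?f (x + y) * ?g (- x) \<partial>M)"
        using trans[of "\<lambda>x. ?f x * ?g (y + (- x))" y] by simp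
    qed
    also have "\<dots> = (\<integral>\<^sup>+x. (\<integral>\<^sup>+y. ?f (x + y) * ?g (- x) \<partial>lborel) \<partial>M)"
      by (subst Fubini') auto
    also have "\<dots> = (\<integral>\<^sup>+x. (\<integral>\<^sup>+y. ?f y \<partial>lborel) * ?g (- x) \<partial>M)"
    proof (rule nn_integral_cong)
      fix x :: 'a
      show "(\<integral>\<^sup>+y. ?f (x + y) * ?g (- x) \<partial>lborel) = (\<integral>\<^sup>+y. ?f y \<partial>lborel) * ?g (- x)"
        using trans'[of ?f x] by (simp add: nn_integral_multc add.commute[of x])
    qed
    also have "\<dots> = emeasure lborel A * (\<integral>\<^sup>+x. ?g (- x) \<partial>M)"
      by (subst nn_integral_cmult) auto
    also have "(\<lambda>x. ?g (- x)) = ?g" by (auto simp: indicator_def fun_eq_iff)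
    finally show ?thesis by (simp add: mult.commute)
  qed
  have "emeasure lborel ?B \<noteq> 0"
    using content_cball_pos[of 1 "0::'a"] by (auto simp: measure_def)
  moreover have "emeasure lborel ?B \<noteq> \<top>" using emeasure_lborel_cball_finite[of "0::'a" 1] by (simp add: less_top)
  ultimately have "emeasure M A = emeasure lborel A" if "A \<in> sets borel" for A
    using key[OF that] unfolding Mball by (simp add: mult.commute[of _ "emeasure lborel ?B"] ennreal_mult_cancel_left)
  then show ?thesis unfolding M_def[symmetric] by (intro measure_eqI) auto
qed

section \<open>Change of variables under linear maps\<close>

definition diag_mat :: "('p \<Rightarrow> real) \<Rightarrow> real^'p^'p" where
  "diag_mat d = (\<chi> i j. if i = j then d i else 0)"

lemma diag_mat_mult: "diag_mat d *v x = (\<chi> i. d i * x $ i)"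
  by (simp add: diag_mat_def matrix_vector_mult_def vec_eq_iff if_distrib[of "\<lambda>x. x * _"] cong: if_cong)

lemma det_diag_mat: "det (diag_mat d) = (\<Prod>i\<in>UNIV. d i)"
  by (subst det_diagonal) (auto simp: diag_mat_def)

text \<open>The orthogonal factors preserve Lebesgue measure, which leaves a scaling of the
  coordinates. The form \<open>U ** diag_mat d ** V\<close> covers all maps that occur later, since
  a spike matrix is diagonalised by any orthogonal matrix that carries a coordinate axis to the
  spike.\<close>

lemma lborel_linear_image:
  fixes U V :: "real^'p^'p"
  assumes U: "orthogonal_matrix U" and V: "orthogonal_matrix V" and d: "\<And>j. d j \<noteq> 0"
    and L: "L = U ** diag_mat d ** V"
  shows "density (distr lborel borel ((*v) L)) (\<lambda>_. ennreal \<bar>det L\<bar>) = lborel"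
proof -
  have oU: "distr lborel borel ((*v) U) = lborel" and oV: "distr lborel borel ((*v) V) = lborel"
    using U V by (auto intro!: lborel_orthogonal simp: orthogonal_transformation_matrix)
  \<comment> \<open>The scaling theorem takes one factor per basis vector; the inner sum reads off
    \<open>d\<close> at the index of the basis vector \<open>j\<close>.\<close>
  have eq: "(\<lambda>x. 0 + (\<Sum>j\<in>Basis. ((\<Sum>i\<in>UNIV. d i * j $ i) * (x \<bullet> j)) *\<^sub>R j)) = (*v) (diag_mat d)"
  proof (rule ext, rule vector_eq_ldot[THEN iffD1], rule allI)
    fix x z :: "real^'p"
    have *: "Basis = (\<lambda>j. axis j (1::real)) ` (UNIV :: 'p set)" by (auto simp: Basis_vec_def)
    have "z \<bullet> (\<Sum>j\<in>Basis. ((\<Sum>i\<in>UNIV. d i * j $ i) * (x \<bullet> j)) *\<^sub>R j)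
       = (\<Sum>k\<in>UNIV. (\<Sum>i\<in>UNIV. d i * axis k 1 $ i) * (x \<bullet> axis k 1) * (z \<bullet> axis k 1))"
      unfolding * inner_sum_right
      by (subst sum.reindex) (auto simp: inj_on_def axis_eq_axis)
    also have "\<dots> = z \<bullet> (diag_mat d *v x)"
      by (simp add: inner_axis diag_mat_mult inner_vec_def axis_def if_distrib[of "\<lambda>x. _ * x"] mult_ac cong: if_cong)
    finally show "z \<bullet> (0 + (\<Sum>j\<in>Basis. ((\<Sum>i\<in>UNIV. d i * j $ i) * (x \<bullet> j)) *\<^sub>R j)) = z \<bullet> (diag_mat d *v x)" by simp
  qed
  have "(\<Sum>i\<in>UNIV. d i * j $ i) \<noteq> 0" if "j \<in> Basis" for j :: "real^'p"
    using d that by (auto simp: Basis_vec_def axis_def if_distrib[of "\<lambda>x. _ * x"] cong: if_cong)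
  from lborel_affine_euclidean[where c="\<lambda>j::real^'p. \<Sum>i\<in>UNIV. d i * j $ i" and t=0, OF this]
  have D: "density (distr lborel borel ((*v) (diag_mat d))) (\<lambda>_. \<Prod>j\<in>Basis. \<bar>\<Sum>i\<in>UNIV. d i * j $ i\<bar>) = lborel"
    unfolding eq by simp
  have "(\<Prod>j\<in>Basis. \<bar>\<Sum>i\<in>UNIV. d i * (j :: real^'p) $ i\<bar>) = \<bar>det (diag_mat d)\<bar>"
    by (simp add: prod_Basis_vec det_diag_mat axis_def if_distrib[of "\<lambda>x. _ * x"] abs_prod cong: if_cong)
  also have "\<dots> = \<bar>det L\<bar>"
    using det_orthogonal_matrix[OF U] det_orthogonal_matrix[OF V] by (auto simp: L det_mul)
  finally have D': "density (distr lborel borel ((*v) (diag_mat d))) (\<lambda>_. ennreal \<bar>det L\<bar>) = lborel"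
    using D by (simp add: prod_ennreal)
  have "distr lborel borel ((*v) L) = distr (distr (distr lborel borel ((*v) V)) borel ((*v) (diag_mat d))) borel ((*v) U)"
    by (simp add: distr_distr o_def L matrix_vector_mul_assoc matrix_mul_assoc)
  also have "\<dots> = distr (distr lborel borel ((*v) (diag_mat d))) borel ((*v) U)" by (simp add: oV)
  finally have "density (distr lborel borel ((*v) L)) (\<lambda>_. ennreal \<bar>det L\<bar>)
     = distr (density (distr lborel borel ((*v) (diag_mat d))) (\<lambda>_. ennreal \<bar>det L\<bar>)) borel ((*v) U)"
    by (simp add: density_distr)
  then show ?thesis by (simp add: D' oU)
qed

lemma matrix_inv_eqI:
  fixes A :: "real^'n^'n"
  assumes "A ** B = mat 1"
  shows "matrix_inv A = B"
proof -
  have "B ** A = mat 1" using assms by (simp add: matrix_left_right_inverse)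
  then have "A ** matrix_inv A = mat 1 \<and> matrix_inv A ** A = mat 1"
    unfolding matrix_inv_def using assms by (intro someI) auto
  then show ?thesis by (metis assms matrix_mul_assoc matrix_mul_lid matrix_mul_rid)
qed

lemma distr_density_linear:
  fixes L L' :: "real^'p^'p"
  assumes sc: "density (distr lborel borel ((*v) L)) (\<lambda>_. ennreal \<bar>det L\<bar>) = lborel"
    and L': "L ** L' = mat 1" and f [measurable]: "f \<in> borel_measurable borel"
  shows "distr (density lborel (\<lambda>x. ennreal (f x))) borel ((*v) L) = density lborel (\<lambda>x. ennreal (f (L' *v x) / \<bar>det L\<bar>))"
proof -
  have LL: "L' ** L = mat 1" using L' by (simp add: matrix_left_right_inverse)
  have inv: "invertible L" using L' by (auto simp: invertible_right_inverse)
  have d: "det L \<noteq> 0" using inv by (simp add: invertible_det_nz)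
  let ?D = "distr lborel borel ((*v) L)"
  have "distr (density lborel (\<lambda>x. ennreal (f x))) borel ((*v) L)
     = distr (density lborel (\<lambda>x. ennreal (f (L' *v (L *v x))))) borel ((*v) L)"
    by (simp add: matrix_vector_mul_assoc LL)
  also have "\<dots> = density ?D (\<lambda>x. ennreal (f (L' *v x)))"
    by (subst density_distr) auto
  also have "\<dots> = density ?D (\<lambda>x. ennreal \<bar>det L\<bar> * ennreal (f (L' *v x) / \<bar>det L\<bar>))"
    using d by (simp flip: ennreal_mult')
  also have "\<dots> = density (density ?D (\<lambda>_. ennreal \<bar>det L\<bar>)) (\<lambda>x. ennreal (f (L' *v x) / \<bar>det L\<bar>))"
    by (subst density_density_eq) auto
  also have "\<dots> = density lborel (\<lambda>x. ennreal (f (L' *v x) / \<bar>det L\<bar>))"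
    by (simp only: sc)
  finally show ?thesis .
qed

lemma inner_transpose_mult:
  fixes A :: "real^'n^'m"
  shows "x \<bullet> (transpose A *v y) = (A *v x) \<bullet> y"
  by (simp add: vector_transpose_matrix inner_commute dot_lmul_matrix flip: vector_transpose_matrix)
     (metis dot_lmul_matrix inner_commute transpose_matrix_vector)

text \<open>The inverse of L times its transpose has quadratic form the squared norm of the preimage
  under L, and the absolute determinant of L is the square root of the determinant of that
  product.\<close>

lemma distr_std_gauss_linear:
  fixes U V :: "real^'p^'p"
  assumes U: "orthogonal_matrix U" and V: "orthogonal_matrix V" and d: "\<And>j. d j \<noteq> 0"
    and L: "L = U ** diag_mat d ** V"
  shows "distr std_gauss borel ((*v) L) = mvnormal 0 (L ** transpose L)"
proof -
  have "det L \<noteq> 0"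
    using det_orthogonal_matrix[OF U] det_orthogonal_matrix[OF V] d by (auto simp: L det_mul det_diag_mat)
  then have "invertible L" by (simp add: invertible_det_nz)
  then obtain L' where L': "L ** L' = mat 1" "L' ** L = mat 1" unfolding invertible_def by blast
  have "transpose L ** transpose L' = mat 1"
    by (metis L'(2) matrix_transpose_mul transpose_mat)
  then have i: "L ** transpose L ** (transpose L' ** L') = mat 1"
    by (metis L'(1) matrix_mul_assoc matrix_mul_rid)
  have q: "x \<bullet> (matrix_inv (L ** transpose L) *v x) = (norm (L' *v x))\<^sup>2" for x
    unfolding matrix_inv_eqI[OF i]
    by (simp only: matrix_vector_mul_assoc[symmetric] inner_transpose_mult power2_norm_eq_inner)
  have sd: "sqrt (det (L ** transpose L)) = \<bar>det L\<bar>"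
    by (simp add: det_mul det_transpose flip: power2_eq_square)
  have "sqrt ((2 * pi) ^ CARD('p) * det (L ** transpose L)) = sqrt ((2 * pi) ^ CARD('p)) * \<bar>det L\<bar>"
    by (simp only: real_sqrt_mult sd)
  then show ?thesis
    unfolding std_gauss_density mvnormal_def
    by (subst distr_density_linear[OF lborel_linear_image[OF assms] L'(1)]) (auto simp: mvnormal_density_def q)
qed

lemma std_gauss_orthogonal:
  fixes f :: "real^'p \<Rightarrow> real^'p"
  assumes "orthogonal_transformation f"
  shows "distr std_gauss borel f = std_gauss"
proof -
  have n: "norm (f x) = norm x" for x by (rule orthogonal_transformation_norm[OF assms])
  have [measurable]: "f \<in> borel_measurable borel"
    using assms by (intro borel_measurable_continuous_onI linear_continuous_on linear_conv_bounded_linear[THEN iffD1])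
      (simp add: orthogonal_transformation)
  have "distr std_gauss borel f = distr (density lborel (\<lambda>x. ennreal (exp (- (norm (f x))\<^sup>2 / 2) / sqrt ((2 * pi) ^ CARD('p))))) borel f"
    by (simp add: std_gauss_density n)
  also have "\<dots> = std_gauss"
    unfolding std_gauss_density by (subst density_distr[symmetric]) (auto simp: lborel_orthogonal[OF assms])
  finally show ?thesis .
qed

text \<open>Cameron-Martin formula, by completing the square. The exponential factor is the form
  which the likelihood ratios of the model approach.\<close>

lemma std_gauss_shift:
  fixes m :: "real^'p"
  shows "distr std_gauss borel (\<lambda>x. x + m) = density std_gauss (\<lambda>x. ennreal (exp (m \<bullet> x - (norm m)\<^sup>2 / 2)))"
proof -
  let ?c = "sqrt ((2 * pi) ^ CARD('p))"
  have [measurable]: "(\<lambda>x. m \<bullet> x) \<in> borel_measurable borel" by simp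
  let ?g = "\<lambda>x::real^'p. exp (- (norm x)\<^sup>2 / 2) / ?c"
  have "distr std_gauss borel (\<lambda>x. x + m) = distr (density lborel (\<lambda>x. ennreal (?g (m + x - m)))) borel ((+) m)"
    unfolding std_gauss_density by (intro distr_cong) (auto simp: add.commute)
  also have "\<dots> = density (distr lborel borel ((+) m)) (\<lambda>x. ennreal (?g (x - m)))"
    by (subst density_distr) auto
  also have "\<dots> = density lborel (\<lambda>x. ennreal (?g (x - m)))" by (simp add: lborel_distr_plus)
  also have "\<dots> = density lborel (\<lambda>x. ennreal (?g x) * ennreal (exp (m \<bullet> x - (norm m)\<^sup>2 / 2)))"
  proof (intro arg_cong2[where f=density] refl ext)
    fix x :: "real^'p"
    have "(norm (x - m))\<^sup>2 = (norm x)\<^sup>2 - 2 * (m \<bullet> x) + (norm m)\<^sup>2"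
      by (simp add: power2_norm_eq_inner inner_diff_left inner_diff_right inner_commute)
    then have "- (norm (x - m))\<^sup>2 / 2 = - (norm x)\<^sup>2 / 2 + (m \<bullet> x - (norm m)\<^sup>2 / 2)" by (simp add: field_simps)
    then have "?g (x - m) = ?g x * exp (m \<bullet> x - (norm m)\<^sup>2 / 2)" by (simp only: exp_add) simp
    moreover have "0 \<le> ?g x" by (intro divide_nonneg_nonneg) auto
    ultimately show "ennreal (?g (x - m)) = ennreal (?g x) * ennreal (exp (m \<bullet> x - (norm m)\<^sup>2 / 2))"
      by (simp only: ennreal_mult'[symmetric])
  qed
  also have "\<dots> = density std_gauss (\<lambda>x. ennreal (exp (m \<bullet> x - (norm m)\<^sup>2 / 2)))"
    unfolding std_gauss_density by (subst density_density_eq) auto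
  finally show ?thesis .
qed

section \<open>Eigenvalues of symmetric matrices\<close>

text \<open>Reflection in the hyperplane orthogonal to \<open>u\<close>; division by zero makes it
  the identity for \<open>u = 0\<close>. It provides explicit orthogonal maps that carry one vector
  to another of the same norm.\<close>

definition householder :: "'a::real_inner \<Rightarrow> 'a \<Rightarrow> 'a" where
  "householder u x = x - (2 * (u \<bullet> x) / (u \<bullet> u)) *\<^sub>R u"

lemma orthogonal_householder: "orthogonal_transformation (householder u)"
proof -
  have "linear (householder u)"
    by (rule linearI) (simp_all add: householder_def inner_add_right algebra_simps add_divide_distrib)
  moreover have "householder u x \<bullet> householder u y = x \<bullet> y" for x y
    by (cases "u = 0")
       (auto simp: householder_def inner_diff_left inner_diff_right inner_commute field_simps)
  ultimately show ?thesis by (simp add: orthogonal_transformation_def)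
qed

lemma householder_swap:
  assumes "norm w = norm w'"
  shows "householder (w - w') w = w'"
proof (cases "w = w'")
  case False
  have "w \<bullet> w = w' \<bullet> w'" using assms by (simp add: norm_eq_sqrt_inner)
  then have "(w - w') \<bullet> (w - w') = 2 * ((w - w') \<bullet> w)"
    by (simp add: inner_diff_left inner_diff_right inner_commute)
  moreover have "(w - w') \<bullet> (w - w') \<noteq> 0" using False by simp
  ultimately show ?thesis by (simp add: householder_def)
qed (simp add: householder_def)

section \<open>Orthonormal systems and the spectral theorem\<close>

definition orthonormal_on :: "'i set \<Rightarrow> ('i \<Rightarrow> 'a::real_inner) \<Rightarrow> bool" where
  "orthonormal_on I f \<longleftrightarrow> (\<forall>i\<in>I. \<forall>j\<in>I. f i \<bullet> f j = (if i = j then 1 else 0))"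

lemma orthonormal_onD: "orthonormal_on I f \<Longrightarrow> i \<in> I \<Longrightarrow> j \<in> I \<Longrightarrow> f i \<bullet> f j = (if i = j then 1 else 0)"
  by (simp add: orthonormal_on_def)

lemma inner_sum_orthonormal:
  assumes "orthonormal_on I f" "finite I" "i \<in> I"
  shows "f i \<bullet> (\<Sum>j\<in>I. c j *\<^sub>R f j) = c i"
proof -
  have "f i \<bullet> (\<Sum>j\<in>I. c j *\<^sub>R f j) = (\<Sum>j\<in>I. if j = i then c i else 0)"
    unfolding inner_sum_right using assms by (intro sum.cong) (auto simp: orthonormal_onD)
  then show ?thesis using assms by simp
qed

text \<open>As many orthonormal vectors as the dimension span the space, so the residual of the
  expansion is orthogonal to everything, in particular to itself.\<close>

lemma orthonormal_expand:
  fixes f :: "'i \<Rightarrow> 'a::euclidean_space"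
  assumes f: "orthonormal_on I f" and fin: "finite I" and card: "card I = DIM('a)"
  shows "(\<Sum>i\<in>I. (f i \<bullet> x) *\<^sub>R f i) = x"
proof -
  have nz: "f i \<noteq> 0" if "i \<in> I" for i using orthonormal_onD[OF f that that] by auto
  have inj: "inj_on f I"
    by (rule inj_onI) (metis f orthonormal_onD zero_neq_one)
  have "independent (f ` I)"
  proof (rule pairwise_orthogonal_independent)
    show "pairwise orthogonal (f ` I)"
      by (auto simp: pairwise_def orthogonal_def orthonormal_onD[OF f])
  qed (use nz in auto)
  then have span: "UNIV \<subseteq> span (f ` I)"
    using card inj by (intro card_ge_dim_independent) (auto simp: card_image dim_UNIV)
  define y where "y = x - (\<Sum>i\<in>I. (f i \<bullet> x) *\<^sub>R f i)"
  have "f i \<bullet> y = 0" if "i \<in> I" for i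
    unfolding y_def inner_diff_right inner_sum_orthonormal[OF f fin that] by simp
  then have "orthogonal y (f i)" if "i \<in> I" for i
    using that by (simp add: orthogonal_def inner_commute)
  then have "orthogonal y y"
    using span by (intro orthogonal_to_span[of y "f ` I"]) blast+
  then show ?thesis by (simp add: orthogonal_def y_def)
qed

lemma orthonormal_parseval:
  fixes f :: "'i \<Rightarrow> 'a::euclidean_space"
  assumes f: "orthonormal_on I f" and fin: "finite I" and card: "card I = DIM('a)"
  shows "(\<Sum>i\<in>I. (f i \<bullet> x)\<^sup>2) = (norm x)\<^sup>2"
proof -
  have "x \<bullet> x = x \<bullet> (\<Sum>i\<in>I. (f i \<bullet> x) *\<^sub>R f i)" by (simp add: orthonormal_expand[OF assms])
  also have "\<dots> = (\<Sum>i\<in>I. (f i \<bullet> x)\<^sup>2)" by (simp add: inner_sum_right power2_eq_square inner_commute)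
  finally show ?thesis by (simp add: power2_norm_eq_inner)
qed

lemma symmetric_inner:
  fixes S :: "real^'p^'p"
  assumes "transpose S = S"
  shows "x \<bullet> (S *v y) = (S *v x) \<bullet> y"
  using inner_transpose_mult[of x S y] assms by simp

text \<open>Maximise the Rayleigh quotient over the unit sphere of \<open>V\<close>. If the
  maximiser \<open>e\<close> were no eigenvector, moving it along its residual \<open>w\<close>
  would increase the quotient.\<close>

lemma symmetric_invariant_eigenvector:
  fixes S :: "real^'p^'p"
  assumes sym: "transpose S = S" and V: "subspace V" and inv: "\<And>x. x \<in> V \<Longrightarrow> S *v x \<in> V"
    and nz: "\<exists>x\<in>V. x \<noteq> 0"
  shows "\<exists>e\<in>V. norm e = 1 \<and> (\<exists>l. S *v e = l *\<^sub>R e)"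
proof -
  define q where "q x = x \<bullet> (S *v x)" for x
  have "compact (V \<inter> sphere 0 1)" using V by (intro closed_Int_compact closed_subspace) auto
  moreover obtain x where x: "x \<in> V" "x \<noteq> 0" using nz by auto
  then have "sgn x \<in> V \<inter> sphere 0 1" using V by (auto simp: sgn_div_norm subspace_scale)
  moreover have "continuous_on (V \<inter> sphere 0 1) q"
    unfolding q_def by (intro continuous_intros linear_continuous_on) auto
  ultimately have "\<exists>e\<in>V \<inter> sphere 0 1. \<forall>y\<in>V \<inter> sphere 0 1. q y \<le> q e"
    by (intro continuous_attains_sup) auto
  then obtain e where e: "e \<in> V" "norm e = 1" and max: "\<And>y. y \<in> V \<Longrightarrow> norm y = 1 \<Longrightarrow> q y \<le> q e"
    by auto
  have le: "q y \<le> q e * (y \<bullet> y)" if "y \<in> V" for y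
  proof (cases "y = 0")
    case False
    have "q (sgn y) \<le> q e" using False V that by (intro max) (auto simp: sgn_div_norm subspace_scale norm_sgn)
    moreover have "q (sgn y) = q y / (y \<bullet> y)"
      by (simp add: q_def sgn_div_norm matrix_vector_mult_scaleR flip: power2_norm_eq_inner)
         (simp add: power2_eq_square divide_inverse)
    moreover have "y \<bullet> y > 0" using False by simp
    ultimately show ?thesis by (simp add: pos_divide_le_eq)
  qed (simp add: q_def)
  define w where "w = S *v e - q e *\<^sub>R e"
  have wV: "w \<in> V" unfolding w_def using V e inv by (simp add: subspace_diff subspace_scale)
  define g where "g = q e * (w \<bullet> w) - q w"
  have g: "g \<ge> 0" using le[OF wV] by (simp add: g_def)
  \<comment> \<open>To first order the move gains 2 t (w . w) and to second order it loses t^2 g;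
    this step length keeps t g at most w . w, so the gain wins unless \<open>w\<close> is 0.\<close>
  define t where "t = (w \<bullet> w) / (1 + g)"
  have ee: "e \<bullet> e = 1" using e by (simp flip: power2_norm_eq_inner)
  have "q (e + t *\<^sub>R w) \<le> q e * ((e + t *\<^sub>R w) \<bullet> (e + t *\<^sub>R w))"
    using V e wV by (intro le) (simp add: subspace_add subspace_scale)
  moreover have "q (e + t *\<^sub>R w) = q e + 2 * t * (w \<bullet> (S *v e)) + t\<^sup>2 * q w"
    using symmetric_inner[OF sym, of e w]
    by (simp add: q_def matrix_vector_right_distrib matrix_vector_mult_scaleR inner_add_left inner_add_right
        inner_commute power2_eq_square algebra_simps)
  moreover have "w \<bullet> (S *v e) = w \<bullet> w + q e * (w \<bullet> e)"
    by (simp add: w_def inner_diff_right)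
  ultimately have "2 * t * (w \<bullet> w) \<le> t\<^sup>2 * g"
    by (simp add: g_def inner_add_left inner_add_right ee inner_commute power2_eq_square algebra_simps)
  have "w \<bullet> w = 0"
  proof (rule ccontr)
    assume "w \<bullet> w \<noteq> 0"
    then have pos: "w \<bullet> w > 0" by simp
    then have "t > 0" using g by (simp add: t_def)
    with \<open>2 * t * (w \<bullet> w) \<le> t\<^sup>2 * g\<close> have "2 * (w \<bullet> w) \<le> t * g" by (simp add: power2_eq_square)
    also have "t * g \<le> w \<bullet> w" using g pos by (simp add: t_def field_simps)
    finally show False using pos by simp
  qed
  then have "S *v e = q e *\<^sub>R e" by (simp add: w_def)
  then show ?thesis using e by blast
qed

text \<open>Induction over the indices already served: by symmetry the orthogonal complement of the
  eigenvectors found so far is invariant, and it is nonzero for reasons of dimension, so it contains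
  a further eigenvector.\<close>

lemma symmetric_orthonormal_eigenbasis:
  fixes S :: "real^'p^'p"
  assumes sym: "transpose S = S"
  shows "\<exists>(f :: 'p \<Rightarrow> real^'p) l. orthonormal_on UNIV f \<and> (\<forall>j. S *v f j = l j *\<^sub>R f j)"
proof -
  have "\<exists>(f :: 'p \<Rightarrow> real^'p) l. orthonormal_on I f \<and> (\<forall>j\<in>I. S *v f j = l j *\<^sub>R f j)" for I :: "'p set"
    using finite[of I]
  proof (induction I rule: finite_induct)
    case empty then show ?case by (auto simp: orthonormal_on_def)
  next
    case (insert i I)
    then obtain f :: "'p \<Rightarrow> real^'p" and l where f: "orthonormal_on I f" and l: "\<forall>j\<in>I. S *v f j = l j *\<^sub>R f j" by blast
    define V where "V = {x. \<forall>j\<in>I. f j \<bullet> x = 0}"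
    have "subspace V" by (auto simp: V_def subspace_def inner_add_right)
    moreover have "S *v x \<in> V" if "x \<in> V" for x
      using that by (auto simp: V_def symmetric_inner[OF sym] l)
    moreover have "\<exists>x\<in>V. x \<noteq> 0"
    proof -
      have "dim (f ` I) \<le> card (f ` I)" by (rule dim_le_card') (simp add: insert)
      also have "\<dots> \<le> card I" by (rule card_image_le) (simp add: insert)
      also have "\<dots> < CARD('p)" using insert by (intro psubset_card_mono) auto
      finally have "dim (f ` I) < DIM(real^'p)" by simp
      from orthogonal_to_subspace_exists[OF this] obtain x
        where x: "x \<noteq> 0" "\<And>y. y \<in> span (f ` I) \<Longrightarrow> orthogonal x y" by blast
      have "f j \<bullet> x = 0" if "j \<in> I" for j
        using x(2)[of "f j"] span_base[of "f j" "f ` I"] that by (simp add: orthogonal_def inner_commute)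
      then show ?thesis using x(1) by (auto simp: V_def)
    qed
    ultimately obtain e m where e: "e \<in> V" "norm e = 1" "S *v e = m *\<^sub>R e"
      using symmetric_invariant_eigenvector[OF sym, of V] by blast
    have ee: "e \<bullet> e = 1" using e by (simp flip: power2_norm_eq_inner)
    show ?case
    proof (intro exI[of _ "f(i := e)"] exI[of _ "l(i := m)"] conjI ballI)
      show "orthonormal_on (insert i I) (f(i := e))"
        using insert(2) e(1) ee f by (auto simp: orthonormal_on_def V_def inner_commute)
    next
      fix j assume "j \<in> insert i I"
      then show "S *v (f(i := e)) j = (l(i := m)) j *\<^sub>R (f(i := e)) j" using insert(2) l e by auto
    qed
  qed
  from this[of UNIV] show ?thesis by simp
qed

lemma det_eigenbasis:
  fixes S :: "real^'p^'p"
  assumes f: "orthonormal_on UNIV f" and l: "\<And>j::'p. S *v f j = l j *\<^sub>R f j"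
  shows "det (mat t - S) = (\<Prod>j\<in>UNIV. t - l j)"
proof -
  define O' :: "real^'p^'p" where "O' = (\<chi> a j. f j $ a)"
  have O: "transpose O' ** O' = mat 1"
    using orthonormal_onD[OF f] by (simp add: O'_def matrix_matrix_mult_def transpose_def mat_def vec_eq_iff inner_vec_def)
  then have O2: "O' ** transpose O' = mat 1" by (simp add: matrix_left_right_inverse)
  have "(mat t - S) ** O' = O' ** diag_mat (\<lambda>j. t - l j)"
  proof (rule matrix_eq[THEN iffD2], rule allI)
    have c: "O' *v x = (\<Sum>j\<in>UNIV. x $ j *\<^sub>R f j)" for x
      by (simp add: O'_def matrix_vector_mult_def vec_eq_iff mult.commute)
    fix x
    have "(mat t - S) ** O' *v x = (mat t - S) *v (\<Sum>j\<in>UNIV. x $ j *\<^sub>R f j)"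
      by (simp add: c flip: matrix_vector_mul_assoc)
    also have "\<dots> = (\<Sum>j\<in>UNIV. x $ j *\<^sub>R ((mat t - S) *v f j))"
      by (subst linear_sum[OF matrix_vector_mul_linear]) (simp add: matrix_vector_mult_scaleR)
    also have "\<dots> = (\<Sum>j\<in>UNIV. (t - l j) *\<^sub>R x $ j *\<^sub>R f j)"
    proof (intro sum.cong refl)
      fix j
      have "(mat t - S) *v f j = (t - l j) *\<^sub>R f j"
      proof -
        have "mat t *v f j = t *\<^sub>R f j" by (simp add: mat_def matrix_vector_mult_def vec_eq_iff if_distrib[of "\<lambda>x. x * _"] cong: if_cong)
        then show ?thesis by (simp add: matrix_vector_mult_diff_rdistrib l scaleR_diff_left)
      qed
      then show "x $ j *\<^sub>R ((mat t - S) *v f j) = (t - l j) *\<^sub>R x $ j *\<^sub>R f j" by simp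
    qed
    also have "\<dots> = O' ** diag_mat (\<lambda>j. t - l j) *v x"
      by (simp add: c diag_mat_mult flip: matrix_vector_mul_assoc)
    finally show "(mat t - S) ** O' *v x = O' ** diag_mat (\<lambda>j. t - l j) *v x" .
  qed
  then have "det (mat t - S) * det O' = det O' * (\<Prod>j\<in>UNIV. t - l j)"
    by (metis det_diag_mat det_mul)
  moreover have "det O' \<noteq> 0"
    using O2 by (metis invertible_det_nz invertible_right_inverse)
  ultimately show ?thesis by simp
qed

text \<open>Both lists are the multiset of roots of one polynomial, and sorting fixes the order.
  This is the uniqueness behind the definite description in \<open>eigenvalue_list\<close>.\<close>

lemma prod_list_linear_unique:
  fixes l m :: "real list"
  assumes l: "sorted_wrt (\<ge>) l" and m: "sorted_wrt (\<ge>) m"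
    and eq: "\<And>t. (\<Prod>s\<leftarrow>l. t - s) = (\<Prod>s\<leftarrow>m. t - s)"
  shows "l = m"
proof -
  have poly: "poly (\<Prod>s\<leftarrow>xs. [:- s, 1:]) t = (\<Prod>s\<leftarrow>xs. t - s)" for xs and t :: real
    by (induction xs) (auto simp: algebra_simps)
  have roots: "proots (\<Prod>s\<leftarrow>xs. [:- s, 1:]) = mset xs" for xs :: "real list"
  proof (induction xs)
    case (Cons a xs)
    have "(\<Prod>s\<leftarrow>xs. [:- s, 1:]) \<noteq> 0" by (auto simp: prod_list_zero_iff)
    then show ?case using Cons by (simp add: proots_mult del: mult_pCons_left)
  qed simp
  have "(\<Prod>s\<leftarrow>l. [:- s, 1:]) = (\<Prod>s\<leftarrow>m. [:- s, 1:])"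
    by (simp add: poly eq fun_eq_iff flip: poly_eq_poly_eq_iff)
  then have "mset l = mset m" using roots by metis
  then have "mset (rev l) = mset (rev m)" by simp
  moreover have "sorted (rev l)" "sorted (rev m)" using l m by (auto simp: sorted_wrt_rev)
  ultimately have "rev l = rev m" by (metis properties_for_sort)
  then show ?thesis by simp
qed

text \<open>The eigenvalues of an orthonormal eigenbasis, sorted decreasingly, satisfy the
  description in \<open>eigenvalue_list\<close>; by uniqueness \<open>eigenvalue\<close> enumerates
  exactly them.\<close>

lemma eigenvalue_symmetric:
  fixes S :: "real^'p^'p"
  assumes sym: "transpose S = S"
  obtains f :: "nat \<Rightarrow> real^'p" where "orthonormal_on {1..CARD('p)} f"
    "\<And>j. j \<in> {1..CARD('p)} \<Longrightarrow> S *v f j = eigenvalue S j *\<^sub>R f j"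
    "\<And>i j. 1 \<le> i \<Longrightarrow> i \<le> j \<Longrightarrow> j \<le> CARD('p) \<Longrightarrow> eigenvalue S j \<le> eigenvalue S i"
proof -
  obtain f l where f: "orthonormal_on UNIV f" and l: "\<And>j::'p. S *v f j = l j *\<^sub>R f j"
    using symmetric_orthonormal_eigenbasis[OF sym] by blast
  obtain xs :: "'p list" where xs: "set xs = UNIV" "distinct xs" using finite_distinct_list[of "UNIV :: 'p set"] by auto
  define ys where "ys = rev (sort_key l xs)"
  have ys: "set ys = UNIV" "distinct ys" using xs by (auto simp: ys_def)
  have len: "length ys = CARD('p)" using distinct_card[OF ys(2)] ys(1) by simp
  have sorted: "sorted_wrt (\<ge>) (map l ys)" unfolding ys_def rev_map[symmetric] sorted_wrt_rev by simp
  have prod: "det (mat t - S) = (\<Prod>s\<leftarrow>map l ys. t - s)" for t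
  proof -
    have "det (mat t - S) = (\<Prod>j\<in>set ys. t - l j)" by (simp add: det_eigenbasis[OF f l] ys)
    also have "\<dots> = (\<Prod>j\<leftarrow>ys. t - l j)" using ys(2) by (rule prod.distinct_set_conv_list)
    finally show ?thesis by (simp add: o_def)
  qed
  have "eigenvalue_list S = map l ys"
    unfolding eigenvalue_list_def
  proof (rule the_equality)
    fix m assume "length m = CARD('p) \<and> sorted_wrt (\<ge>) m \<and> (\<forall>t. det (mat t - S) = (\<Prod>s\<leftarrow>m. t - s))"
    then show "m = map l ys" using prod sorted by (intro prod_list_linear_unique) auto
  qed (use len sorted prod in auto)
  then have ev: "eigenvalue S j = l (ys ! (j - 1))" if "j \<in> {1..CARD('p)}" for j
    using that len nth_map[of "j - 1" ys l] by (auto simp: eigenvalue_def)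
  show thesis
  proof
    show "orthonormal_on {1..CARD('p)} (\<lambda>j. f (ys ! (j - 1)))"
      using orthonormal_onD[OF f] ys(2) len by (auto simp: orthonormal_on_def nth_eq_iff_index_eq)
    show "S *v f (ys ! (j - 1)) = eigenvalue S j *\<^sub>R f (ys ! (j - 1))" if "j \<in> {1..CARD('p)}" for j
      using that by (simp add: ev l)
    fix i j assume ij: "1 \<le> i" "i \<le> j" "j \<le> CARD('p)"
    show "eigenvalue S j \<le> eigenvalue S i"
    proof (cases "i = j")
      case False
      then show ?thesis using ij len sorted_wrt_nth_less[OF sorted, of "i - 1" "j - 1"] by (simp add: ev)
    qed simp
  qed
qed

text \<open>This almost sure condition carries all the genericity of the sample: it forces simple
  eigenvalues, and it makes every Gram-Schmidt residual nonzero.\<close>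

definition no_eigenvector_perp :: "real^'p \<Rightarrow> real^'p^'p \<Rightarrow> bool" where
  "no_eigenvector_perp \<theta> S \<longleftrightarrow> (\<forall>e l. S *v e = l *\<^sub>R e \<and> \<theta> \<bullet> e = 0 \<longrightarrow> e = 0)"

text \<open>A repeated eigenvalue would have an eigenspace of dimension at least two, and this meets
  the hyperplane orthogonal to \<open>\<theta>\<close> in a nonzero eigenvector.\<close>

lemma eigenvalue_strict_decreasing:
  fixes S :: "real^'p^'p"
  assumes sym: "transpose S = S" and np: "no_eigenvector_perp \<theta> S"
    and ij: "1 \<le> i" "i < j" "j \<le> CARD('p)"
  shows "eigenvalue S j < eigenvalue S i"
proof -
  obtain f :: "nat \<Rightarrow> real^'p" where f: "orthonormal_on {1..CARD('p)} f"
    and ev: "\<And>j. j \<in> {1..CARD('p)} \<Longrightarrow> S *v f j = eigenvalue S j *\<^sub>R f j"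
    and mono: "\<And>i j. 1 \<le> i \<Longrightarrow> i \<le> j \<Longrightarrow> j \<le> CARD('p) \<Longrightarrow> eigenvalue S j \<le> eigenvalue S i"
    using eigenvalue_symmetric[OF sym] by blast
  have I: "i \<in> {1..CARD('p)}" "j \<in> {1..CARD('p)}" using ij by auto
  have "eigenvalue S j \<noteq> eigenvalue S i"
  proof
    assume eq: "eigenvalue S j = eigenvalue S i"
    define e where "e = (\<theta> \<bullet> f j) *\<^sub>R f i - (\<theta> \<bullet> f i) *\<^sub>R f j"
    have "S *v e = eigenvalue S i *\<^sub>R e"
      using I by (simp add: e_def matrix_vector_mult_diff_distrib matrix_vector_mult_scaleR ev eq scaleR_diff_right mult.commute)
    moreover have "\<theta> \<bullet> e = 0" by (simp add: e_def inner_diff_right)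
    ultimately have "e = 0" using np by (simp add: no_eigenvector_perp_def)
    then have "f i \<bullet> e = 0" "f j \<bullet> e = 0" by auto
    then have "\<theta> \<bullet> f i = 0"
      using ij by (simp add: e_def inner_diff_right orthonormal_onD[OF f I(1) I(1)] orthonormal_onD[OF f I(2) I(2)]
          orthonormal_onD[OF f I(1) I(2)] orthonormal_onD[OF f I(2) I(1)])
    then have "f i = 0" using np ev[OF I(1)] by (auto simp: no_eigenvector_perp_def)
    then show False using orthonormal_onD[OF f I(1) I(1)] by simp
  qed
  then show ?thesis using mono[of i j] ij by simp
qed

text \<open>Eigenvectors to distinct eigenvalues of a symmetric matrix are orthogonal. Hence any
  choice of unit eigenvectors, whatever the signs, is orthonormal.\<close>

lemma eigenvectors_orthonormal:
  fixes S :: "real^'p^'p"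
  assumes sym: "transpose S = S" and np: "no_eigenvector_perp \<theta> S"
    and e: "\<And>j. j \<in> {1..CARD('p)} \<Longrightarrow> norm (e j) = 1"
    and ev: "\<And>j. j \<in> {1..CARD('p)} \<Longrightarrow> S *v e j = eigenvalue S j *\<^sub>R e j"
  shows "orthonormal_on {1..CARD('p)} e"
  unfolding orthonormal_on_def
proof (intro ballI)
  fix i j assume I: "i \<in> {1..CARD('p)}" "j \<in> {1..CARD('p)}"
  show "e i \<bullet> e j = (if i = j then 1 else 0)"
  proof (cases "i = j")
    case True then show ?thesis using e[OF I(1)] by (simp add: norm_eq_1)
  next
    case False
    then have ne: "eigenvalue S i \<noteq> eigenvalue S j"
      using eigenvalue_strict_decreasing[OF sym np, of i j] eigenvalue_strict_decreasing[OF sym np, of j i] I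
      by (cases i j rule: linorder_cases) auto
    have "eigenvalue S j * (e i \<bullet> e j) = eigenvalue S i * (e i \<bullet> e j)"
      using symmetric_inner[OF sym, of "e i" "e j"] I by (simp add: ev)
    then show ?thesis using ne False by simp
  qed
qed

text \<open>Testing the form at \<open>\<theta>\<close> bounds the top eigenvalue from below. For j
  at least 2, the plane spanned by \<open>e 1\<close> and \<open>e j\<close> contains a vector
  orthogonal to \<open>\<theta>\<close>, where the spike is invisible; this bounds the smaller of
  the two eigenvalues from above. The argument covers \<open>\<kappa> = 0\<close>, where no gap
  separates the top eigenvalue from the rest.\<close>

lemma eigenvalue_perturbation:
  fixes S :: "real^'p^'p"
  assumes sym: "transpose S = S" and e: "orthonormal_on {1..CARD('p)} e"
    and ev: "\<And>j. j \<in> {1..CARD('p)} \<Longrightarrow> S *v e j = eigenvalue S j *\<^sub>R e j"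
    and \<theta>: "norm \<theta> = 1" and \<kappa>: "\<kappa> \<ge> 0"
    and close: "\<And>x. \<bar>x \<bullet> (S *v x) - ((norm x)\<^sup>2 + \<kappa> * (\<theta> \<bullet> x)\<^sup>2)\<bar> \<le> \<eta> * (norm x)\<^sup>2"
  shows "\<bar>eigenvalue S 1 - (1 + \<kappa>)\<bar> \<le> \<eta>"
    and "j \<in> {2..CARD('p)} \<Longrightarrow> \<bar>eigenvalue S j - 1\<bar> \<le> \<eta>"
proof -
  have p: "CARD('p) \<ge> 1" by (simp add: Suc_le_eq)
  obtain f :: "nat \<Rightarrow> real^'p" where "orthonormal_on {1..CARD('p)} f"
    "\<And>j. j \<in> {1..CARD('p)} \<Longrightarrow> S *v f j = eigenvalue S j *\<^sub>R f j"
    and mono: "\<And>i j. 1 \<le> i \<Longrightarrow> i \<le> j \<Longrightarrow> j \<le> CARD('p) \<Longrightarrow> eigenvalue S j \<le> eigenvalue S i"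
    using eigenvalue_symmetric[OF sym] by blast
  have ee: "e j \<bullet> e j = 1" "norm (e j) = 1" if "j \<in> {1..CARD('p)}" for j
    using orthonormal_onD[OF e that that] by (auto simp: norm_eq_1)
  have q: "e j \<bullet> (S *v e j) = eigenvalue S j" if "j \<in> {1..CARD('p)}" for j
    using that by (simp add: ev ee)
  have t: "(\<theta> \<bullet> e j)\<^sup>2 \<le> 1" if "j \<in> {1..CARD('p)}" for j
  proof -
    have "\<bar>\<theta> \<bullet> e j\<bar> \<le> 1" using Cauchy_Schwarz_ineq2[of \<theta> "e j"] \<theta> ee[OF that] by simp
    then show ?thesis by (simp add: abs_square_le_1)
  qed
  have ub: "eigenvalue S j \<le> 1 + \<kappa> + \<eta>" and lb: "1 - \<eta> \<le> eigenvalue S j" if "j \<in> {1..CARD('p)}" for j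
  proof -
    have "\<kappa> * (\<theta> \<bullet> e j)\<^sup>2 \<le> \<kappa>" "0 \<le> \<kappa> * (\<theta> \<bullet> e j)\<^sup>2" using mult_left_le[OF t[OF that] \<kappa>] \<kappa> by auto
    then show "eigenvalue S j \<le> 1 + \<kappa> + \<eta>" "1 - \<eta> \<le> eigenvalue S j"
      using close[of "e j"] q[OF that] ee[OF that] by auto
  qed
  have ex: "(\<Sum>j\<in>{1..CARD('p)}. (e j \<bullet> \<theta>) *\<^sub>R e j) = \<theta>"
    by (rule orthonormal_expand[OF e]) auto
  have "\<theta> \<bullet> (S *v \<theta>) = \<theta> \<bullet> (S *v (\<Sum>j\<in>{1..CARD('p)}. (e j \<bullet> \<theta>) *\<^sub>R e j))"
    by (simp only: ex)
  also have "\<dots> = (\<Sum>j\<in>{1..CARD('p)}. eigenvalue S j * (e j \<bullet> \<theta>)\<^sup>2)"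
    by (subst linear_sum[OF matrix_vector_mul_linear])
       (auto simp: inner_sum_right matrix_vector_mult_scaleR ev power2_eq_square inner_commute mult_ac intro!: sum.cong)
  also have "\<dots> \<le> (\<Sum>j\<in>{1..CARD('p)}. eigenvalue S 1 * (e j \<bullet> \<theta>)\<^sup>2)"
    by (intro sum_mono mult_right_mono mono) auto
  also have "\<dots> = eigenvalue S 1" using orthonormal_parseval[OF e, of \<theta>] \<theta> by (simp flip: sum_distrib_left)
  finally have "1 + \<kappa> - \<eta> \<le> eigenvalue S 1"
    using close[of \<theta>] \<theta> by (simp add: power2_norm_eq_inner[symmetric])
  then show "\<bar>eigenvalue S 1 - (1 + \<kappa>)\<bar> \<le> \<eta>" using ub[of 1] p by auto
  assume j: "j \<in> {2..CARD('p)}"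
  then have I: "1 \<in> {1..CARD('p)}" "j \<in> {1..CARD('p)}" and "j \<noteq> 1" by auto
  note o = orthonormal_onD[OF e I(1) I(1)] orthonormal_onD[OF e I(2) I(2)]
     orthonormal_onD[OF e I(1) I(2)] orthonormal_onD[OF e I(2) I(1)]
  define a where "a = \<theta> \<bullet> e j"
  define b where "b = \<theta> \<bullet> e 1"
  have "eigenvalue S j \<le> 1 + \<eta>"
  proof (cases "a = 0 \<and> b = 0")
    case True
    then show ?thesis using close[of "e j"] q[OF I(2)] ee[OF I(2)] by (auto simp: a_def)
  next
    case False
    \<comment> \<open>a vector of \<open>span {e 1, e j}\<close> orthogonal to \<open>\<theta>\<close>\<close>
    define x where "x = a *\<^sub>R e 1 - b *\<^sub>R e j"
    have nx: "(norm x)\<^sup>2 = a\<^sup>2 + b\<^sup>2"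
      using \<open>j \<noteq> 1\<close> by (simp add: x_def power2_norm_eq_inner inner_diff_left inner_diff_right o[unfolded One_nat_def]) (simp add: power2_eq_square)
    have pos: "a\<^sup>2 + b\<^sup>2 > 0" using False by (simp add: sum_power2_gt_zero_iff)
    have "x \<bullet> (S *v x) = eigenvalue S 1 * a\<^sup>2 + eigenvalue S j * b\<^sup>2"
      using \<open>j \<noteq> 1\<close> by (simp add: x_def matrix_vector_mult_diff_distrib matrix_vector_mult_scaleR ev[OF I(1), unfolded One_nat_def] ev[OF I(2)]
          inner_diff_left inner_diff_right o[unfolded One_nat_def]) (simp add: power2_eq_square mult_ac)
    moreover have "\<theta> \<bullet> x = 0" by (simp add: x_def a_def b_def inner_diff_right)
    ultimately have "eigenvalue S 1 * a\<^sup>2 + eigenvalue S j * b\<^sup>2 \<le> (1 + \<eta>) * (a\<^sup>2 + b\<^sup>2)"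
      using close[of x] by (simp add: nx algebra_simps)
    moreover have "eigenvalue S j * a\<^sup>2 \<le> eigenvalue S 1 * a\<^sup>2" using mono[of 1 j] j by (intro mult_right_mono) auto
    ultimately have "eigenvalue S j * (a\<^sup>2 + b\<^sup>2) \<le> (1 + \<eta>) * (a\<^sup>2 + b\<^sup>2)" by (simp add: algebra_simps)
    then show ?thesis using pos by simp
  qed
  then show "\<bar>eigenvalue S j - 1\<bar> \<le> \<eta>" using lb[OF I(2)] by auto
qed

section \<open>Bounds for the statistic\<close>

lemma outer_product_mult: "outer_product u w *v x = (w \<bullet> x) *\<^sub>R u"
  by (simp add: outer_product_def matrix_vector_mult_def vec_eq_iff inner_vec_def sum_distrib_right sum_distrib_left mult_ac)

lemma matrix_vector_mult_sum_left: "(\<Sum>k\<in>I. A k) *v x = (\<Sum>k\<in>I. A k *v x)"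
  for A :: "'i \<Rightarrow> real^'n^'m"
  by (induction I rule: infinite_finite_induct) (auto simp: matrix_vector_mult_add_rdistrib)

lemma gram_schmidt_eq:
  "gram_schmidt \<theta> e j = sgn (e j - (\<theta> \<bullet> e j) *\<^sub>R \<theta> - (\<Sum>k\<in>{2..<j}. (gram_schmidt \<theta> e k \<bullet> e j) *\<^sub>R gram_schmidt \<theta> e k))"
  by (subst gram_schmidt.simps)
     (simp add: Let_def sgn_div_norm matrix_vector_mult_diff_rdistrib matrix_vector_mult_sum_left outer_product_mult inverse_eq_divide)

text \<open>The danger is a zero residual. The invariant keeps all vectors in the span of
  \<open>\<theta>\<close> and \<open>e 2\<close>, \<open>e 3\<close>, and so on; this span leaves
  out \<open>e 1\<close>, which is how the condition on \<open>\<theta> \<bullet> e 1\<close> takes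
  effect.\<close>

lemma gram_schmidt_orthonormal:
  fixes e :: "nat \<Rightarrow> real^'p"
  assumes e: "orthonormal_on {1..CARD('p)} e" and \<theta>: "norm \<theta> = 1" and t1: "\<theta> \<bullet> e 1 \<noteq> 0"
    and m: "m \<le> CARD('p)"
  shows "orthonormal_on {2..m} (gram_schmidt \<theta> e) \<and> (\<forall>j\<in>{2..m}. \<theta> \<bullet> gram_schmidt \<theta> e j = 0 \<and>
     gram_schmidt \<theta> e j \<in> span (insert \<theta> (e ` {2..m})))"
  using m
proof (induction m)
  case 0 then show ?case by (auto simp: orthonormal_on_def)
next
  case (Suc m)
  show ?case
  proof (cases "m = 0")
    case True then show ?thesis by (auto simp: orthonormal_on_def)
  next
    case False
    let ?g = "gram_schmidt \<theta> e"
    have IH: "orthonormal_on {2..m} ?g" "\<And>j. j \<in> {2..m} \<Longrightarrow> \<theta> \<bullet> ?g j = 0"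
      "\<And>j. j \<in> {2..m} \<Longrightarrow> ?g j \<in> span (insert \<theta> (e ` {2..m}))" using Suc by auto
    have I: "Suc m \<in> {1..CARD('p)}" "1 \<in> {1..CARD('p)}" using Suc.prems by auto
    define x where "x = e (Suc m)"
    define y where "y = (\<theta> \<bullet> x) *\<^sub>R \<theta> + (\<Sum>k\<in>{2..m}. (?g k \<bullet> x) *\<^sub>R ?g k)"
    define w where "w = x - y"
    have "{2..<Suc m} = {2..m}" by auto
    then have g: "?g (Suc m) = sgn w"
      by (subst gram_schmidt_eq) (simp add: w_def y_def x_def diff_diff_eq)
    have y: "y \<in> span (insert \<theta> (e ` {2..m}))"
      unfolding y_def by (intro span_add span_scale span_sum IH span_base) auto
    \<comment> \<open>A vanishing residual would give x = c theta + y with y in the span of the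
      earlier \<open>e\<close> vectors. Pairing with \<open>e 1\<close> yields c (e 1 . theta) = 0,
      hence c = 0, while pairing with \<open>x\<close> yields c (x . theta) = 1.\<close>
    have "w \<noteq> 0"
    proof
      assume "w = 0"
      then have "x \<in> span (insert \<theta> (e ` {2..m}))" using y by (simp add: w_def)
      then obtain c where c: "x - c *\<^sub>R \<theta> \<in> span (e ` {2..m})" by (auto simp: span_insert)
      have "orthogonal (e i) z" if "i \<in> {1..CARD('p)}" "i \<notin> {2..m}" "z \<in> span (e ` {2..m})" for i z
      proof (rule orthogonal_to_span[OF that(3)])
        fix u assume "u \<in> e ` {2..m}"
        then show "orthogonal (e i) u"
          using orthonormal_onD[OF e that(1)] that(2) Suc.prems by (auto simp: orthogonal_def)
      qed
      from this[OF I(2) _ c] this[OF I(1) _ c]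
      have "e 1 \<bullet> x = c * (e 1 \<bullet> \<theta>)" "x \<bullet> x = c * (x \<bullet> \<theta>)" by (auto simp: orthogonal_def inner_diff_right x_def)
      moreover have "e 1 \<bullet> x = 0" "x \<bullet> x = 1"
        using orthonormal_onD[OF e I(2) I(1)] orthonormal_onD[OF e I(1) I(1)] False by (auto simp: x_def)
      ultimately show False using t1 by (auto simp: inner_commute)
    qed
    have tw: "\<theta> \<bullet> w = 0"
      using IH(2) \<theta> by (simp add: w_def y_def inner_diff_right inner_add_right inner_sum_right norm_eq_1)
    have gw: "?g k \<bullet> w = 0" if "k \<in> {2..m}" for k
      using inner_sum_orthonormal[OF IH(1) _ that, of "\<lambda>k. ?g k \<bullet> x"] IH(2)[OF that]
      by (simp add: w_def y_def inner_diff_right inner_add_right inner_commute[of _ \<theta>])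
    have sw: "sgn w \<bullet> sgn w = 1" using \<open>w \<noteq> 0\<close> by (simp add: norm_sgn flip: norm_eq_1)
    have set: "{2..Suc m} = insert (Suc m) {2..m}" using False by auto
    have sub: "span (insert \<theta> (e ` {2..m})) \<subseteq> span (insert \<theta> (e ` {2..Suc m}))"
      by (intro span_mono) auto
    have "x \<in> span (insert \<theta> (e ` {2..Suc m}))"
      unfolding x_def using False by (intro span_base) auto
    then have "w \<in> span (insert \<theta> (e ` {2..Suc m}))"
      unfolding w_def using y sub by (intro span_diff) blast+
    then have "sgn w \<in> span (insert \<theta> (e ` {2..Suc m}))" by (simp add: sgn_div_norm span_scale)
    moreover have "orthonormal_on {2..Suc m} ?g"
    proof -
      have gs: "?g k \<bullet> sgn w = 0" "sgn w \<bullet> ?g k = 0" if "k \<in> {2..m}" for k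
        using gw[OF that] by (simp_all add: sgn_div_norm inner_commute)
      show ?thesis
        unfolding orthonormal_on_def set
      proof (intro ballI)
        fix i j assume "i \<in> insert (Suc m) {2..m}" "j \<in> insert (Suc m) {2..m}"
        then show "?g i \<bullet> ?g j = (if i = j then 1 else 0)"
          using gs sw g orthonormal_onD[OF IH(1)] by (elim insertE) (auto simp only: atLeastAtMost_iff, auto)
      qed
    qed
    moreover have "\<theta> \<bullet> sgn w = 0" using tw by (simp add: sgn_div_norm)
    moreover have "?g j \<in> span (insert \<theta> (e ` {2..Suc m}))" if "j \<in> {2..m}" for j
      using IH(3)[OF that] sub by blast
    ultimately show ?thesis
      using IH(2) unfolding set by (intro conjI ballI) (auto simp: g simp del: image_insert)
  qed
qed

text \<open>Together with \<open>\<theta>\<close> the Gram-Schmidt vectors form an orthonormal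
  basis, so the sum forgets the eigenvectors. This is why the statistic can be studied through
  \<open>S *v \<theta>\<close> and the eigenvalues alone.\<close>

lemma gram_schmidt_parseval:
  fixes e :: "nat \<Rightarrow> real^'p"
  assumes e: "orthonormal_on {1..CARD('p)} e" and \<theta>: "norm \<theta> = 1" and t1: "\<theta> \<bullet> e 1 \<noteq> 0"
  shows "(\<Sum>j=2..CARD('p). (gram_schmidt \<theta> e j \<bullet> x)\<^sup>2) = (norm (x - (\<theta> \<bullet> x) *\<^sub>R \<theta>))\<^sup>2"
proof -
  let ?g = "\<lambda>j. if j = 1 then \<theta> else gram_schmidt \<theta> e j"
  let ?y = "x - (\<theta> \<bullet> x) *\<^sub>R \<theta>"
  note gs = gram_schmidt_orthonormal[OF e \<theta> t1 order_refl]
  have set: "{1..CARD('p)} = insert 1 {2..CARD('p)}" by auto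
  have "orthonormal_on {1..CARD('p)} ?g"
  proof -
    have gt: "gram_schmidt \<theta> e j \<bullet> \<theta> = 0" "\<theta> \<bullet> gram_schmidt \<theta> e j = 0" if "j \<in> {2..CARD('p)}" for j
      using gs that by (auto simp: inner_commute)
    have tt: "\<theta> \<bullet> \<theta> = 1" using \<theta> by (simp add: norm_eq_1)
    show ?thesis
      unfolding orthonormal_on_def
    proof (intro ballI)
      fix i j assume ij: "i \<in> {1..CARD('p)}" "j \<in> {1..CARD('p)}"
      show "?g i \<bullet> ?g j = (if i = j then 1 else 0)"
        using ij tt gt[of i] gt[of j] orthonormal_onD[OF conjunct1[OF gs], of i j]
        by (cases "i = 1"; cases "j = 1") simp_all
    qed
  qed
  then have "(\<Sum>j\<in>{1..CARD('p)}. (?g j \<bullet> ?y)\<^sup>2) = (norm ?y)\<^sup>2" by (intro orthonormal_parseval) auto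
  also have "(\<Sum>j\<in>{1..CARD('p)}. (?g j \<bullet> ?y)\<^sup>2) = (\<theta> \<bullet> ?y)\<^sup>2 + (\<Sum>j\<in>{2..CARD('p)}. (?g j \<bullet> ?y)\<^sup>2)"
    unfolding set by (subst sum.insert) auto
  also have "\<theta> \<bullet> ?y = 0" using \<theta> by (simp add: inner_diff_right norm_eq_1)
  also have "(\<Sum>j\<in>{2..CARD('p)}. (?g j \<bullet> ?y)\<^sup>2) = (\<Sum>j=2..CARD('p). (gram_schmidt \<theta> e j \<bullet> x)\<^sup>2)"
    using gs by (intro sum.cong) (auto simp: inner_diff_right inner_commute[of _ \<theta>])
  finally show ?thesis by simp
qed

lemma transpose_sample_cov: "transpose (sample_cov n x) = sample_cov n x"
proof -
  have "(\<Sum>i\<in>I. A i) $ a $ b = (\<Sum>i\<in>I. A i $ a $ b)" for A :: "'i \<Rightarrow> real^'n^'m" and I a b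
    by (induction I rule: infinite_finite_induct) auto
  then show ?thesis
    by (simp add: sample_cov_def transpose_def vec_eq_iff outer_product_def mult.commute)
qed

text \<open>By \<open>eigenvalue_perturbation\<close> the first eigenvalue is within eta of 1 +
  kappa and the others are within eta of 1. Replacing the weights by these extremes leaves the
  unweighted sum, which is \<open>D\<close> by Parseval.\<close>

lemma Q_HPV_bounds:
  fixes \<theta> :: "real^'p"
  defines "p \<equiv> CARD('p)"
  assumes S: "S = sample_cov n x"
    and \<theta>: "norm \<theta> = 1" and np: "no_eigenvector_perp \<theta> S"
    and e: "\<And>j. j \<in> {1..p} \<Longrightarrow> norm (E n j x) = 1"
    and ev: "\<And>j. j \<in> {1..p} \<Longrightarrow> S *v E n j x = eigenvalue S j *\<^sub>R E n j x"
    and \<kappa>: "\<kappa> \<ge> 0" and \<eta>: "0 \<le> \<eta>" "\<eta> < 1"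
    and close: "\<And>y. \<bar>y \<bullet> (S *v y) - ((norm y)\<^sup>2 + \<kappa> * (\<theta> \<bullet> y)\<^sup>2)\<bar> \<le> \<eta> * (norm y)\<^sup>2"
    and D: "D = real n * (norm (S *v \<theta> - (\<theta> \<bullet> (S *v \<theta>)) *\<^sub>R \<theta>))\<^sup>2"
  shows "D / ((1 + \<kappa> + \<eta>) * (1 + \<eta>)) \<le> Q_HPV \<theta> E n x"
    and "Q_HPV \<theta> E n x \<le> D / ((1 + \<kappa> - \<eta>) * (1 - \<eta>))"
proof -
  have sym: "transpose S = S" by (simp add: S transpose_sample_cov)
  have on: "orthonormal_on {1..p} (\<lambda>j. E n j x)"
    using e ev unfolding p_def by (intro eigenvectors_orthonormal[OF sym np]) auto
  have p1: "1 \<in> {1..p}" by (simp add: p_def Suc_le_eq)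
  have "E n 1 x \<noteq> 0" using e[OF p1] by auto
  then have "\<theta> \<bullet> E n 1 x \<noteq> 0" using np ev[OF p1] unfolding no_eigenvector_perp_def by blast
  from gram_schmidt_parseval[OF on[unfolded p_def] \<theta> this, of "S *v \<theta>", folded p_def]
  have pars: "real n * (\<Sum>j=2..p. (gram_schmidt \<theta> (\<lambda>j. E n j x) j \<bullet> (S *v \<theta>))\<^sup>2) = D" by (simp add: D)
  let ?g = "\<lambda>j. (gram_schmidt \<theta> (\<lambda>j. E n j x) j \<bullet> (S *v \<theta>))\<^sup>2"
  note pert = eigenvalue_perturbation[OF sym on[unfolded p_def] ev[unfolded p_def] \<theta> \<kappa> close, folded p_def]
  have l1: "1 + \<kappa> - \<eta> \<le> eigenvalue S 1" "eigenvalue S 1 \<le> 1 + \<kappa> + \<eta>" using pert(1) by (auto simp: abs_le_iff)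
  have lj: "1 - \<eta> \<le> eigenvalue S j" "eigenvalue S j \<le> 1 + \<eta>" if "j \<in> {2..p}" for j
    using pert(2)[OF _ that] by (auto simp: abs_le_iff)
  have D0: "D \<ge> 0" by (simp add: D)
  have Q: "Q_HPV \<theta> E n x = 1 / eigenvalue S 1 * (real n * (\<Sum>j=2..p. inverse (eigenvalue S j) * ?g j))"
    by (simp add: Q_HPV_def S p_def)
  have "(\<Sum>j=2..p. inverse (eigenvalue S j) * ?g j) \<le> (\<Sum>j=2..p. inverse (1 - \<eta>) * ?g j)"
    using lj \<eta> by (intro sum_mono mult_right_mono le_imp_inverse_le) auto
  then have "real n * (\<Sum>j=2..p. inverse (eigenvalue S j) * ?g j) \<le> real n * (\<Sum>j=2..p. inverse (1 - \<eta>) * ?g j)"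
    by (intro mult_left_mono) auto
  also have "\<dots> = inverse (1 - \<eta>) * D" by (simp add: pars[symmetric] sum_distrib_left mult_ac)
  finally have ub: "real n * (\<Sum>j=2..p. inverse (eigenvalue S j) * ?g j) \<le> inverse (1 - \<eta>) * D" .
  have "(\<Sum>j=2..p. inverse (1 + \<eta>) * ?g j) \<le> (\<Sum>j=2..p. inverse (eigenvalue S j) * ?g j)"
  proof (intro sum_mono mult_right_mono le_imp_inverse_le)
    fix j assume "j \<in> {2..p}"
    then show "eigenvalue S j \<le> 1 + \<eta>" "0 < eigenvalue S j" using lj[of j] \<eta> by linarith+
  qed auto
  then have "real n * (\<Sum>j=2..p. inverse (1 + \<eta>) * ?g j) \<le> real n * (\<Sum>j=2..p. inverse (eigenvalue S j) * ?g j)"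
    by (intro mult_left_mono) auto
  moreover have "real n * (\<Sum>j=2..p. inverse (1 + \<eta>) * ?g j) = inverse (1 + \<eta>) * D"
    by (simp add: pars[symmetric] sum_distrib_left mult_ac)
  ultimately have lb: "inverse (1 + \<eta>) * D \<le> real n * (\<Sum>j=2..p. inverse (eigenvalue S j) * ?g j)" by simp
  define R where "R = real n * (\<Sum>j=2..p. inverse (eigenvalue S j) * ?g j)"
  note ub = ub[folded R_def] and lb = lb[folded R_def] and Q = Q[folded R_def]
  have "0 \<le> inverse (1 + \<eta>) * D" using D0 \<eta> by simp
  then have R0: "0 \<le> R" using lb by simp
  have l: "0 < 1 + \<kappa> - \<eta>" "0 < eigenvalue S 1" "0 < 1 + \<kappa> + \<eta>" using \<kappa> \<eta> l1 by linarith+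
  have "1 / eigenvalue S 1 * R \<le> 1 / (1 + \<kappa> - \<eta>) * (inverse (1 - \<eta>) * D)"
    using l l1 \<eta> R0 ub by (intro mult_mono divide_left_mono mult_pos_pos) auto
  also have "\<dots> = D / ((1 + \<kappa> - \<eta>) * (1 - \<eta>))" by (simp add: divide_inverse)
  finally show "Q_HPV \<theta> E n x \<le> D / ((1 + \<kappa> - \<eta>) * (1 - \<eta>))" by (simp only: Q)
  have "D / ((1 + \<kappa> + \<eta>) * (1 + \<eta>)) = 1 / (1 + \<kappa> + \<eta>) * (inverse (1 + \<eta>) * D)" by (simp add: divide_inverse)
  also have "\<dots> \<le> 1 / eigenvalue S 1 * R"
    using l l1 \<eta> D0 lb by (intro mult_mono divide_left_mono mult_pos_pos) auto
  finally show "D / ((1 + \<kappa> + \<eta>) * (1 + \<eta>)) \<le> Q_HPV \<theta> E n x" by (simp only: Q)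
qed

section \<open>Eigenvectors are almost surely not orthogonal to the null direction\<close>

text \<open>Polynomials in any number of variables, kept as functions: the null set argument uses
  only that they are closed under the ring operations and become univariate polynomials when all
  coordinates but one are frozen.\<close>

inductive poly_fun :: "(('i \<Rightarrow> real) \<Rightarrow> real) \<Rightarrow> bool" where
  const: "poly_fun (\<lambda>_. c)"
| coord: "poly_fun (\<lambda>z. z i)"
| add: "poly_fun f \<Longrightarrow> poly_fun g \<Longrightarrow> poly_fun (\<lambda>z. f z + g z)"
| mult: "poly_fun f \<Longrightarrow> poly_fun g \<Longrightarrow> poly_fun (\<lambda>z. f z * g z)"

lemma poly_fun_sum: "(\<And>i. i \<in> I \<Longrightarrow> poly_fun (f i)) \<Longrightarrow> poly_fun (\<lambda>z. \<Sum>i\<in>I. f i z)"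
  by (induction I rule: infinite_finite_induct) (auto intro: poly_fun.intros)

lemma poly_fun_prod: "(\<And>i. i \<in> I \<Longrightarrow> poly_fun (f i)) \<Longrightarrow> poly_fun (\<lambda>z. \<Prod>i\<in>I. f i z)"
  by (induction I rule: infinite_finite_induct) (auto intro: poly_fun.intros)

lemma poly_fun_diff: "poly_fun f \<Longrightarrow> poly_fun g \<Longrightarrow> poly_fun (\<lambda>z. f z - g z)"
  using poly_fun.add[of f "\<lambda>z. -1 * g z"] poly_fun.mult[OF poly_fun.const[of "-1"], of g] by simp

lemma poly_fun_measurable:
  assumes "poly_fun f"
  shows "(\<lambda>z. f (\<lambda>i. if i \<in> I then z i else c i)) \<in> borel_measurable (PiM I (\<lambda>_. std_normal_distribution))"
  using assms
proof (induction rule: poly_fun.induct)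
  case (coord i) show ?case by (cases "i \<in> I") auto
qed auto

lemma poly_fun_line:
  assumes "poly_fun f"
  shows "\<exists>p. \<forall>t. f (z(i := t)) = poly p t"
  using assms
proof (induction rule: poly_fun.induct)
  case (const c) show ?case by (rule exI[of _ "[:c:]"]) simp
next
  case (coord j) show ?case
    by (cases "j = i") (auto intro: exI[of _ "[:0, 1:]"] exI[of _ "[:z j:]"])
next
  case (add f g) then show ?case by (metis poly_add)
next
  case (mult f g) then show ?case by (metis poly_mult)
qed

lemma AE_std_normal_not_in_finite: "finite F \<Longrightarrow> AE y in std_normal_distribution. y \<notin> F"
  by (subst AE_density) (auto intro!: AE_not_in countable_imp_null_set_lborel countable_finite eventually_mono[OF AE_not_in[of F]])

text \<open>The coordinates are released one at a time, those outside \<open>I\<close> staying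
  frozen at the witness \<open>c\<close>. Each released coordinate has to avoid the finitely many
  roots of a nonzero univariate polynomial.\<close>

lemma AE_poly_fun_nonzero_override:
  assumes f: "poly_fun f" and I: "finite I" and c: "f c \<noteq> 0"
  shows "AE z in PiM I (\<lambda>_. std_normal_distribution). f (\<lambda>i. if i \<in> I then z i else c i) \<noteq> 0"
  using I
proof (induction I rule: finite_induct)
  case empty then show ?case using c by simp
next
  case (insert i I)
  interpret product_sigma_finite "\<lambda>_::'a. std_normal_distribution" by (rule product_sigma_finite_std_normal)
  define g where "g z = f (\<lambda>j. if j \<in> insert i I then z j else c j)" for z
  have [measurable]: "g \<in> borel_measurable (PiM (insert i I) (\<lambda>_. std_normal_distribution))"
    unfolding g_def by (rule poly_fun_measurable[OF f])
  have "emeasure (PiM (insert i I) (\<lambda>_. std_normal_distribution)) {z \<in> space (PiM (insert i I) (\<lambda>_. std_normal_distribution)). g z = 0}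
    = (\<integral>\<^sup>+z. indicator {z \<in> space (PiM (insert i I) (\<lambda>_. std_normal_distribution)). g z = 0} z \<partial>PiM (insert i I) (\<lambda>_. std_normal_distribution))"
    by (subst nn_integral_indicator) auto
  also have "\<dots> = (\<integral>\<^sup>+z. (if g z = 0 then 1 else 0) \<partial>PiM (insert i I) (\<lambda>_. std_normal_distribution))"
    by (intro nn_integral_cong) (auto simp: indicator_def)
  also have "\<dots> = (\<integral>\<^sup>+x. (\<integral>\<^sup>+y. (if g (x(i := y)) = 0 then 1 else 0) \<partial>std_normal_distribution) \<partial>PiM I (\<lambda>_. std_normal_distribution))"
    by (subst product_nn_integral_insert) (use insert in auto)
  also have "\<dots> = (\<integral>\<^sup>+x. 0 \<partial>PiM I (\<lambda>_. std_normal_distribution))"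
  proof (rule nn_integral_cong_AE, use insert.IH in eventually_elim)
    fix x assume x: "f (\<lambda>j. if j \<in> I then x j else c j) \<noteq> 0"
    let ?x = "\<lambda>j. if j \<in> I then x j else c j"
    obtain p where p: "\<And>t. f (?x(i := t)) = poly p t" using poly_fun_line[OF f] by meson
    \<comment> \<open>Since \<open>i\<close> is not in \<open>I\<close>, the value
      \<open>c i\<close> is still in force there; hence the univariate polynomial is nonzero at
      \<open>c i\<close>.\<close>
    have "?x(i := c i) = ?x" using insert by auto
    then have "p \<noteq> 0" using x p[of "c i"] by auto
    then have "finite {y. poly p y = 0}" by (rule poly_roots_finite)
    then have "AE y in std_normal_distribution. y \<notin> {y. poly p y = 0}" by (rule AE_std_normal_not_in_finite)
    moreover have "(\<lambda>j. if j \<in> insert i I then (x(i := y)) j else c j) = ?x(i := y)" for y using insert by auto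
    ultimately have "AE y in std_normal_distribution. g (x(i := y)) \<noteq> 0" by (simp add: p g_def)
    then have "(\<integral>\<^sup>+y. (if g (x(i := y)) = 0 then 1 else 0) \<partial>std_normal_distribution) = (\<integral>\<^sup>+y. 0 \<partial>std_normal_distribution)"
      by (intro nn_integral_cong_AE) (auto elim!: eventually_mono)
    then show "(\<integral>\<^sup>+y. (if g (x(i := y)) = 0 then 1 else 0) \<partial>std_normal_distribution) = 0" by simp
  qed
  finally have z: "emeasure (PiM (insert i I) (\<lambda>_. std_normal_distribution)) {z \<in> space (PiM (insert i I) (\<lambda>_. std_normal_distribution)). g z = 0} = 0" by simp
  have "AE z in PiM (insert i I) (\<lambda>_. std_normal_distribution). g z \<noteq> 0" by (rule AE_I[OF _ z]) auto
  then show ?case by (simp only: g_def)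
qed

lemma AE_poly_fun_nonzero:
  assumes f: "poly_fun f" and I: "finite I" and c: "f c \<noteq> 0"
    and dep: "\<And>z. f (\<lambda>i. if i \<in> I then z i else c i) = f z"
  shows "AE z in PiM I (\<lambda>_. std_normal_distribution). f z \<noteq> 0"
  using AE_poly_fun_nonzero_override[where f=f and I=I and c=c] f I c by (simp add: dep)

text \<open>The columns are the vectors S^m theta. The map \<open>idx\<close> assigns exponents to
  columns, because the index type carries no order.\<close>

definition krylov :: "('p \<Rightarrow> nat) \<Rightarrow> real^'p \<Rightarrow> real^'p^'p \<Rightarrow> real^'p^'p" where
  "krylov idx \<theta> S = (\<chi> a j. (((*v) S) ^^ idx j) \<theta> $ a)"

lemma transpose_krylov_mult: "(transpose (krylov idx \<theta> S) *v e) $ j = (((*v) S) ^^ idx j) \<theta> \<bullet> e"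
  unfolding krylov_def transpose_def matrix_vector_mult_def inner_vec_def by simp

lemma det_zero_kernel:
  fixes A :: "real^'p^'p"
  shows "det A \<noteq> 0 \<longleftrightarrow> (\<forall>x. A *v x = 0 \<longrightarrow> x = 0)"
  by (metis invertible_det_nz invertible_left_inverse matrix_left_invertible_ker)

text \<open>An eigenvector orthogonal to \<open>\<theta>\<close> is orthogonal to every S^m theta,
  hence lies in the kernel of the transposed Krylov matrix.\<close>

lemma det_krylov_no_eigenvector_perp:
  assumes sym: "transpose S = S" and d: "det (krylov idx \<theta> S) \<noteq> 0"
  shows "no_eigenvector_perp \<theta> S"
  unfolding no_eigenvector_perp_def
proof (intro allI impI, elim conjE)
  fix e l assume e: "S *v e = l *\<^sub>R e" "\<theta> \<bullet> e = 0"
  have "(((*v) S) ^^ m) \<theta> \<bullet> e = 0" for m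
  proof (induction m)
    case (Suc m)
    then show ?case using symmetric_inner[OF sym, of "(((*v) S) ^^ m) \<theta>" e] by (simp add: e)
  qed (simp add: e)
  then have "transpose (krylov idx \<theta> S) *v e = 0" by (simp add: vec_eq_iff transpose_krylov_mult del: transpose_matrix_vector)
  moreover have "det (transpose (krylov idx \<theta> S)) \<noteq> 0" using d by (simp add: det_transpose)
  ultimately show "e = 0" using det_zero_kernel by blast
qed

lemma matrix_vector_mult_nth: "(A *v x) $ a = (\<Sum>b\<in>UNIV. A $ a $ b * x $ b)"
  by (simp add: matrix_vector_mult_def)

lemma poly_fun_det_krylov:
  assumes "\<And>a b. poly_fun (\<lambda>z. S z $ a $ b)"
  shows "poly_fun (\<lambda>z. det (krylov idx \<theta> (S z)))"
proof -
  have "poly_fun (\<lambda>z. (((*v) (S z)) ^^ m) \<theta> $ a)" for m a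
  proof (induction m arbitrary: a)
    case (Suc m)
    have "poly_fun (\<lambda>z. \<Sum>b\<in>UNIV. S z $ a $ b * (((*v) (S z)) ^^ m) \<theta> $ b)"
      by (intro poly_fun_sum poly_fun.mult assms Suc)
    then show ?case by (simp add: matrix_vector_mult_nth)
  qed (auto intro: poly_fun.const)
  then show ?thesis
    unfolding det_def krylov_def
    by (intro poly_fun_sum poly_fun.mult poly_fun_prod poly_fun.const) simp
qed

text \<open>In the eigenbasis S^m theta has coordinates lam_j^m (b_j . theta), a Vandermonde matrix
  with rescaled rows. A vector \<open>c\<close> in the kernel of the transpose makes the sum of
  q(lam_j) w_j vanish for all polynomials q of degree below p, and interpolation then isolates each
  w_j.\<close>

lemma det_krylov_nonzero:
  fixes b :: "'p \<Rightarrow> real^'p"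
  assumes b: "orthonormal_on UNIV b" and ev: "\<And>j. S *v b j = lam j *\<^sub>R b j" and inj: "inj lam"
    and \<theta>: "\<And>j. b j \<bullet> \<theta> \<noteq> 0" and idx: "{..<CARD('p)} \<subseteq> range idx"
  shows "det (krylov idx \<theta> S) \<noteq> 0"
proof -
  have "\<forall>c. transpose (krylov idx \<theta> S) *v c = 0 \<longrightarrow> c = 0"
  proof (intro allI impI)
    fix c assume c: "transpose (krylov idx \<theta> S) *v c = 0"
    define w where "w j = (b j \<bullet> \<theta>) * (b j \<bullet> c)" for j
    have pow: "(((*v) S) ^^ m) \<theta> = (\<Sum>j\<in>UNIV. (lam j ^ m * (b j \<bullet> \<theta>)) *\<^sub>R b j)" for m
    proof (induction m)
      case 0 then show ?case by (simp add: orthonormal_expand[OF b])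
    next
      case (Suc m)
      then show ?case
        by (simp add: linear_sum[OF matrix_vector_mul_linear] matrix_vector_mult_scaleR ev mult_ac)
    qed
    have "(\<Sum>j\<in>UNIV. lam j ^ m * w j) = 0" if m: "m < CARD('p)" for m
    proof -
      obtain i where i: "m = idx i" using m idx by auto
      have "(\<Sum>j\<in>UNIV. lam j ^ m * w j) = (((*v) S) ^^ idx i) \<theta> \<bullet> c"
        by (simp add: pow i inner_sum_left w_def mult_ac)
      also have "\<dots> = 0" using c transpose_krylov_mult[of idx \<theta> S c i] by simp
      finally show ?thesis .
    qed
    then have poly: "(\<Sum>j\<in>UNIV. poly q (lam j) * w j) = 0" if "degree q < CARD('p)" for q
    proof -
      have "(\<Sum>j\<in>UNIV. poly q (lam j) * w j) = (\<Sum>i\<le>degree q. coeff q i * (\<Sum>j\<in>UNIV. lam j ^ i * w j))"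
        unfolding poly_altdef sum_distrib_right sum_distrib_left by (subst sum.swap) (simp add: mult_ac)
      also have "\<dots> = 0" using that \<open>\<And>m. m < CARD('p) \<Longrightarrow> (\<Sum>j\<in>UNIV. lam j ^ m * w j) = 0\<close> by (intro sum.neutral) auto
      finally show ?thesis .
    qed
    have "w j = 0" for j
    proof -
      \<comment> \<open>The numerator of the Lagrange polynomial at \<open>lam j\<close>: degree p -
        1, and zero at all other eigenvalues.\<close>
      define q where "q = (\<Prod>l\<in>UNIV - {j}. [:- lam l, 1:])"
      have "degree q \<le> (\<Sum>l\<in>UNIV - {j}. degree [:- lam l, 1:])" 
        using degree_prod_sum_le[of "UNIV - {j}" "\<lambda>l. [:- lam l, 1:]"] by (simp add: q_def o_def)
      also have "\<dots> = CARD('p) - 1" by (simp add: card_Diff_singleton)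
      also have "\<dots> < CARD('p)" by simp
      finally have "(\<Sum>i\<in>UNIV. poly q (lam i) * w i) = 0" by (rule poly)
      moreover have "poly q (lam i) = 0" if "i \<noteq> j" for i
        using that by (auto simp: q_def poly_prod prod_zero_iff)
      then have "(\<Sum>i\<in>UNIV. poly q (lam i) * w i) = (\<Sum>i\<in>{j}. poly q (lam i) * w i)"
        by (intro sum.mono_neutral_right) auto
      moreover have "poly q (lam j) \<noteq> 0"
        using inj by (auto simp: q_def poly_prod prod_zero_iff inj_eq)
      ultimately show ?thesis by simp
    qed
    then have "b j \<bullet> c = 0" for j using \<theta>[of j] by (auto simp: w_def)
    then show "c = 0" using orthonormal_expand[OF b, of c] by simp
  qed
  then have "det (transpose (krylov idx \<theta> S)) \<noteq> 0" using det_zero_kernel by blast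
  then show ?thesis by (simp add: det_transpose)
qed

section \<open>A sample whose Krylov determinant does not vanish\<close>

lemma sample_cov_nth:
  "sample_cov n x $ a $ b = 1 / real n * (\<Sum>i=1..n. (x i $ a - sample_mean n x $ a) * (x i $ b - sample_mean n x $ b))"
  by (simp add: sample_cov_def outer_product_def)

lemma sample_mean_nth: "sample_mean n x $ a = 1 / real n * (\<Sum>i=1..n. x i $ a)"
  by (simp add: sample_mean_def)

lemma sample_cov_cong: "(\<And>i. i \<in> {1..n} \<Longrightarrow> x i = y i) \<Longrightarrow> sample_cov n x = sample_cov n y"
  by (simp add: sample_cov_def sample_mean_def)

text \<open>What is wanted is a covariance with distinct eigenvalues and an eigenbasis none of whose
  members is orthogonal to \<open>\<theta>\<close>. Taking p points together with their negatives
  makes the mean zero, hence the bound 2p on the sample size; any further points are 0.\<close>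

lemma exists_sample_det_krylov_nonzero:
  fixes \<theta> :: "real^'p"
  assumes \<theta>: "norm \<theta> = 1" and n: "2 * CARD('p) \<le> n"
  obtains idx and x :: "nat \<Rightarrow> real^'p" where "det (krylov idx \<theta> (sample_cov n x)) \<noteq> 0"
proof -
  let ?p = "CARD('p)"
  have p0: "?p > 0" by simp
  then have "n > 0" using n by linarith
  then have n0: "real n > 0" "?p > 0" using p0 by simp_all
  obtain h where h: "bij_betw h {1..?p} (UNIV :: 'p set)"
    using bij_betw_iff_card[of "{1..?p}" "UNIV :: 'p set"] by auto
  define k where "k = the_inv_into {1..?p} h"
  have kh: "k (h i) = i" if "i \<in> {1..?p}" for i
    unfolding k_def using h that by (intro the_inv_into_f_f) (auto simp: bij_betw_def)
  have hk: "h (k j) = j" "k j \<in> {1..?p}" for j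
    using h f_the_inv_into_f_bij_betw[OF h, of j] the_inv_into_into[of h "{1..?p}" j "{1..?p}"]
    by (auto simp: k_def bij_betw_def)
  \<comment> \<open>All coordinates of \<open>u\<close> are equal. The reflection carrying
    \<open>u\<close> to \<open>\<theta>\<close> therefore turns the standard basis into one whose
    members all have inner product 1/sqrt p with \<open>\<theta>\<close>.\<close>
  define u :: "real^'p" where "u = (\<chi> j. 1 / sqrt ?p)"
  have "norm u = 1" by (simp add: u_def norm_vec_def L2_set_def power_divide)
  define f where "f = householder (u - \<theta>)"
  have fu: "f u = \<theta>" unfolding f_def by (rule householder_swap) (simp add: \<open>norm u = 1\<close> \<theta>)
  have fo: "f y \<bullet> f z = y \<bullet> z" for y z
    using orthogonal_householder[of "u - \<theta>"] by (simp add: f_def orthogonal_transformation_def)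
  define b where "b j = f (axis j 1)" for j
  have b: "orthonormal_on UNIV b" by (simp add: orthonormal_on_def b_def fo inner_axis_axis)
  have bt: "b j \<bullet> \<theta> \<noteq> 0" for j
    using n0 by (simp add: fu[symmetric] b_def fo inner_axis' u_def del: fu)
  \<comment> \<open>The lengths 1, ..., p along the basis vectors produce the distinct eigenvalues 2
    i^2 / n.\<close>
  define x where "x i = (if i \<in> {1..?p} then real i *\<^sub>R b (h i) else if i \<in> {?p+1..?p+?p} then - (real (i - ?p) *\<^sub>R b (h (i - ?p))) else 0)" for i
  have split: "(\<Sum>i=1..n. F (x i)) = (\<Sum>i=1..?p. F (real i *\<^sub>R b (h i)) + F (- (real i *\<^sub>R b (h i))))" if "F 0 = 0"
    for F :: "real^'p \<Rightarrow> 'a::comm_monoid_add"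
  proof -
    have "(\<Sum>i=1..n. F (x i)) = (\<Sum>i\<in>{1..?p} \<union> {?p+1..?p+?p}. F (x i))"
      using n that by (intro sum.mono_neutral_right) (auto simp: x_def)
    also have "\<dots> = (\<Sum>i=1..?p. F (x i)) + (\<Sum>i=?p+1..?p+?p. F (x i))" by (rule sum.union_disjoint) auto
    also have "(\<Sum>i=?p+1..?p+?p. F (x i)) = (\<Sum>i=1..?p. F (x (i + ?p)))"
      by (subst sum.shift_bounds_cl_nat_ivl[symmetric]) (simp add: add.commute)
    finally show ?thesis by (simp add: x_def sum.distrib)
  qed
  have mean: "sample_mean n x = 0"
    unfolding sample_mean_def by (subst split) auto
  have "sample_cov n x = (1 / real n) *\<^sub>R (\<Sum>i=1..?p. outer_product (real i *\<^sub>R b (h i)) (real i *\<^sub>R b (h i))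
      + outer_product (- (real i *\<^sub>R b (h i))) (- (real i *\<^sub>R b (h i))))"
    unfolding sample_cov_def mean using split[of "\<lambda>y. outer_product y y"]
    by (simp add: outer_product_def vec_eq_iff)
  also have "\<dots> = (1 / real n) *\<^sub>R (\<Sum>i=1..?p. (2 * (real i)\<^sup>2) *\<^sub>R outer_product (b (h i)) (b (h i)))"
    by (intro arg_cong2[where f=scaleR] refl sum.cong) (simp add: outer_product_def vec_eq_iff power2_eq_square)
  finally have S: "sample_cov n x = (1 / real n) *\<^sub>R (\<Sum>i=1..?p. (2 * (real i)\<^sup>2) *\<^sub>R outer_product (b (h i)) (b (h i)))" .
  have ev: "sample_cov n x *v b j = (2 * (real (k j))\<^sup>2 / real n) *\<^sub>R b j" for j
  proof -
    have "(\<Sum>i=1..?p. (2 * (real i)\<^sup>2) *\<^sub>R outer_product (b (h i)) (b (h i))) *v b j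
      = (\<Sum>i=1..?p. (2 * (real i)\<^sup>2 * (b (h i) \<bullet> b j)) *\<^sub>R b (h i))"
      by (simp add: matrix_vector_mult_sum_left outer_product_mult flip: scaleR_matrix_vector_assoc)
    also have "\<dots> = (\<Sum>i=1..?p. if i = k j then (2 * (real (k j))\<^sup>2) *\<^sub>R b j else 0)"
      using kh hk by (intro sum.cong) (auto simp: orthonormal_onD[OF b])
    also have "\<dots> = (2 * (real (k j))\<^sup>2) *\<^sub>R b j" using hk by simp
    finally show ?thesis by (simp add: S flip: scaleR_matrix_vector_assoc)
  qed
  have "det (krylov (\<lambda>j. k j - 1) \<theta> (sample_cov n x)) \<noteq> 0"
  proof (rule det_krylov_nonzero[OF b ev _ bt])
    show "inj (\<lambda>j. 2 * (real (k j))\<^sup>2 / real n)"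
    proof (rule injI)
      fix i j assume "2 * (real (k i))\<^sup>2 / real n = 2 * (real (k j))\<^sup>2 / real n"
      then have "k i = k j" using n0 by simp
      then show "i = j" using hk by metis
    qed
    show "{..<?p} \<subseteq> range (\<lambda>j. k j - 1)"
    proof
      fix m assume "m \<in> {..<?p}"
      then show "m \<in> range (\<lambda>j. k j - 1)" using kh[of "Suc m"] by (intro image_eqI[of _ _ "h (Suc m)"]) auto
    qed
  qed
  then show thesis using that by blast
qed

text \<open>The Krylov determinant is a polynomial in the array \<open>z\<close>; pulling a good
  sample back through the inverse of \<open>L\<close> gives an array where it is nonzero.\<close>

lemma AE_no_eigenvector_perp:
  fixes L :: "real^'p^'p"
  assumes \<theta>: "norm \<theta> = 1" and n: "2 * CARD('p) \<le> n" and L: "invertible L"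
  shows "AE z in PiM ({1..n} \<times> UNIV) (\<lambda>_. std_normal_distribution). no_eigenvector_perp \<theta> (sample_cov n (\<lambda>i. L *v (\<chi> j. z (i, j))))"
proof -
  obtain idx and x :: "nat \<Rightarrow> real^'p" where x: "det (krylov idx \<theta> (sample_cov n x)) \<noteq> 0"
    using exists_sample_det_krylov_nonzero[OF \<theta> n] by blast
  obtain L' where L': "L ** L' = mat 1" using L by (auto simp: invertible_right_inverse)
  define c where "c = (\<lambda>(i, j). (L' *v x i) $ j)"
  let ?S = "\<lambda>z. sample_cov n (\<lambda>i. L *v (\<chi> j. z (i, j)))"
  have "L *v (\<chi> j. c (i, j)) = x i" for i by (simp add: c_def matrix_vector_mul_assoc L')
  then have c: "det (krylov idx \<theta> (?S c)) \<noteq> 0" using x by simp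
  have "AE z in PiM ({1..n} \<times> UNIV) (\<lambda>_. std_normal_distribution). det (krylov idx \<theta> (?S z)) \<noteq> 0"
  proof (rule AE_poly_fun_nonzero[where f="\<lambda>z. det (krylov idx \<theta> (?S z))" and c=c], rule poly_fun_det_krylov)
    fix a b
    have L1: "poly_fun (\<lambda>z. (L *v (\<chi> j. z (i, j))) $ a)" for i a
      unfolding matrix_vector_mult_def by (simp add: poly_fun_sum poly_fun.mult poly_fun.const poly_fun.coord)
    then show "poly_fun (\<lambda>z. ?S z $ a $ b)"
      unfolding sample_cov_nth sample_mean_nth by (intro poly_fun_sum poly_fun.mult poly_fun.const poly_fun_diff L1)
  next
    fix z :: "nat \<times> 'p \<Rightarrow> real"
    show "det (krylov idx \<theta> (?S (\<lambda>i. if i \<in> {1..n} \<times> UNIV then z i else c i))) = det (krylov idx \<theta> (?S z))"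
      by (intro arg_cong[where f="\<lambda>S. det (krylov idx \<theta> S)"] sample_cov_cong) auto
  qed (use c in simp_all)
  then show ?thesis
    by (rule eventually_mono) (rule det_krylov_no_eigenvector_perp[OF transpose_sample_cov])
qed

section \<open>The score\<close>

declare One_nat_def [simp del]

section \<open>Independence of disjoint blocks of Gaussian coordinates\<close>

lemma indep_vars_coordinates:
  assumes K: "K \<noteq> {}"
  shows "prob_space.indep_vars (PiM K (\<lambda>_. std_normal_distribution)) (\<lambda>_. borel) (\<lambda>k z. z k) K"
proof -
  interpret prob_space "PiM K (\<lambda>_. std_normal_distribution)" by (rule prob_space_PiM_std_normal)
  have c: "distr (PiM K (\<lambda>_. std_normal_distribution)) borel (\<lambda>z. z k) = std_normal_distribution" if "k \<in> K" for k
    using distr_PiM_component[of K "\<lambda>_. std_normal_distribution" k] that prob_space_std_normal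
    by (simp cong: distr_cong)
  have "distr (PiM K (\<lambda>_. std_normal_distribution)) (PiM K (\<lambda>_. borel)) (\<lambda>z. \<lambda>k\<in>K. z k) = distr (PiM K (\<lambda>_. std_normal_distribution)) (PiM K (\<lambda>_. std_normal_distribution)) (\<lambda>z. z)"
    by (intro distr_cong refl) (auto simp: space_PiM cong: sets_PiM_cong)
  also have "\<dots> = PiM K (\<lambda>k. distr (PiM K (\<lambda>_. std_normal_distribution)) borel (\<lambda>z. z k))"
    by (simp add: c cong: PiM_cong)
  finally show ?thesis
    using K by (subst indep_vars_iff_distr_eq_PiM') auto
qed

lemma indep_vars_std_normal_blocks:
  assumes ne: "(\<Union>l\<in>L. K l) \<noteq> {}" and disj: "disjoint_family_on K L"
    and F: "\<And>l. l \<in> L \<Longrightarrow> F l \<in> measurable (PiM (K l) (\<lambda>_. std_normal_distribution)) (N l)"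
  shows "prob_space.indep_vars (PiM (\<Union>l\<in>L. K l) (\<lambda>_. std_normal_distribution)) N (\<lambda>l z. F l (restrict z (K l))) L"
proof -
  interpret prob_space "PiM (\<Union>l\<in>L. K l) (\<lambda>_. std_normal_distribution)" by (rule prob_space_PiM_std_normal)
  have "indep_vars (\<lambda>l. PiM (K l) (\<lambda>_. borel)) (\<lambda>l z. restrict (\<lambda>k. z k) (K l)) L"
    by (rule indep_vars_restrict[OF indep_vars_coordinates[OF ne] _ disj]) auto
  then show ?thesis
    by (rule indep_vars_compose2[where Y=F]) (use F in \<open>simp cong: measurable_cong_sets sets_PiM_cong\<close>)
qed

text \<open>Applied with the rows of the array as blocks for the sample, with its columns for the
  score, and with single coordinates for the noncentral chi-square law.\<close>

lemma distr_PiM_std_normal_blocks: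
  assumes L: "L \<noteq> {}" and fin: "finite (\<Union>l\<in>L. K l)" and ne: "(\<Union>l\<in>L. K l) \<noteq> {}"
    and disj: "disjoint_family_on K L"
    and F [measurable]: "\<And>l. l \<in> L \<Longrightarrow> F l \<in> measurable (PiM (K l) (\<lambda>_. std_normal_distribution)) (N l)"
  shows "distr (PiM (\<Union>l\<in>L. K l) (\<lambda>_. std_normal_distribution)) (PiM L N) (\<lambda>z. \<lambda>l\<in>L. F l (restrict z (K l)))
     = PiM L (\<lambda>l. distr (PiM (K l) (\<lambda>_. std_normal_distribution)) (N l) (F l))"
proof -
  let ?K = "\<Union>l\<in>L. K l"
  let ?M = "PiM ?K (\<lambda>_. std_normal_distribution)"
  interpret prob_space ?M by (rule prob_space_PiM_std_normal)
  interpret P: product_prob_space "\<lambda>_. std_normal_distribution" by (rule product_prob_space_std_normal)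
  have ind: "indep_vars N (\<lambda>l z. F l (restrict z (K l))) L"
    by (rule indep_vars_std_normal_blocks[OF ne disj F])
  have rv: "random_variable (N l) (\<lambda>z. F l (restrict z (K l)))" if l: "l \<in> L" for l
  proof -
    have "(\<lambda>z. restrict z (K l)) \<in> measurable ?M (PiM (K l) (\<lambda>_. std_normal_distribution))"
      using l by (intro measurable_restrict_subset) auto
    from measurable_compose[OF this F[OF l]] show ?thesis .
  qed
  have "distr ?M (PiM L N) (\<lambda>z. \<lambda>l\<in>L. F l (restrict z (K l))) = PiM L (\<lambda>l. distr ?M (N l) (\<lambda>z. F l (restrict z (K l))))"
    using indep_vars_iff_distr_eq_PiM'[where I=L and M'=N and X="\<lambda>l z. F l (restrict z (K l))"] ind rv L by simp
  also have "\<dots> = PiM L (\<lambda>l. distr (PiM (K l) (\<lambda>_. std_normal_distribution)) (N l) (F l))"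
  proof (intro PiM_cong refl)
    fix l assume l: "l \<in> L"
    have "PiM (K l) (\<lambda>_. std_normal_distribution) = distr ?M (PiM (K l) (\<lambda>_. std_normal_distribution)) (\<lambda>z. restrict z (K l))"
      using l fin by (intro P.distr_restrict) auto
    then have "distr (PiM (K l) (\<lambda>_. std_normal_distribution)) (N l) (F l)
      = distr (distr ?M (PiM (K l) (\<lambda>_. std_normal_distribution)) (\<lambda>z. restrict z (K l))) (N l) (F l)" by simp
    also have "\<dots> = distr ?M (N l) (F l \<circ> (\<lambda>z. restrict z (K l)))"
      using l by (intro distr_distr F measurable_restrict_subset) auto
    finally show "distr ?M (N l) (\<lambda>z. F l (restrict z (K l))) = distr (PiM (K l) (\<lambda>_. std_normal_distribution)) (N l) (F l)"
      by (simp add: o_def)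
  qed
  finally show ?thesis .
qed

lemma distr_PiM_std_normal_reindex:
  assumes f: "inj_on f I" "f ` I \<subseteq> K"
  shows "distr (PiM K (\<lambda>_. std_normal_distribution)) (PiM I (\<lambda>_. std_normal_distribution)) (\<lambda>z. \<lambda>i\<in>I. z (f i)) = PiM I (\<lambda>_. std_normal_distribution)"
  by (rule distr_PiM_reindex) (use f prob_space_std_normal in auto)

abbreviation gauss_array :: "nat \<Rightarrow> (nat \<times> 'p \<Rightarrow> real) measure" where
  "gauss_array n \<equiv> PiM ({1..n} \<times> UNIV) (\<lambda>_. std_normal_distribution)"

lemma distr_gauss_array_sample:
  fixes U V :: "real^'p^'p"
  assumes U: "orthogonal_matrix U" and V: "orthogonal_matrix V" and d: "\<And>j. d j \<noteq> 0"
    and L: "L = U ** diag_mat d ** V" and n: "n \<ge> 1"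
  shows "distr (gauss_array n) (sample_space n) (\<lambda>z. \<lambda>i\<in>{1..n}. L *v (\<chi> j. z (i, j)))
     = PiM {1..n} (\<lambda>_. mvnormal 0 (L ** transpose L))"
proof -
  define K where "K i = {i} \<times> (UNIV :: 'p set)" for i :: nat
  have K: "(\<Union>i\<in>{1..n}. K i) = {1..n} \<times> UNIV" by (auto simp: K_def)
  define F :: "nat \<Rightarrow> (nat \<times> 'p \<Rightarrow> real) \<Rightarrow> real^'p" where "F i f = L *v (\<chi> j. f (i, j))" for i f
  have F: "F i \<in> borel_measurable (PiM (K i) (\<lambda>_. std_normal_distribution))" for i
  proof -
    have "(\<lambda>f. f (i, j)) \<in> borel_measurable (PiM (K i) (\<lambda>_. std_normal_distribution))" for j
      using measurable_component_singleton[of "(i, j)" "K i" "\<lambda>_. std_normal_distribution"] by (simp add: K_def)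
    then show ?thesis unfolding F_def by measurable
  qed
  have "distr (PiM (\<Union>i\<in>{1..n}. K i) (\<lambda>_. std_normal_distribution)) (PiM {1..n} (\<lambda>_. borel)) (\<lambda>z. \<lambda>i\<in>{1..n}. F i (restrict z (K i)))
     = PiM {1..n} (\<lambda>i. distr (PiM (K i) (\<lambda>_. std_normal_distribution)) borel (F i))"
    by (rule distr_PiM_std_normal_blocks) (use n F in \<open>auto simp: K disjoint_family_on_def\<close>, auto simp: K_def)
  moreover have "(\<lambda>z. \<lambda>i\<in>{1..n}. F i (restrict z (K i))) = (\<lambda>z. \<lambda>i\<in>{1..n}. L *v (\<chi> j. z (i, j)))"
    by (auto simp: F_def K_def fun_eq_iff)
  moreover have "distr (PiM (K i) (\<lambda>_. std_normal_distribution)) borel (F i) = mvnormal 0 (L ** transpose L)" for i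
  proof -
    have "distr (PiM (K i) (\<lambda>_. std_normal_distribution)) borel (F i)
      = distr (PiM (K i) (\<lambda>_. std_normal_distribution)) borel ((*v) L \<circ> ((\<lambda>f. \<chi> j. f j) \<circ> (\<lambda>z. \<lambda>j\<in>UNIV. z (i, j))))"
      by (intro distr_cong) (auto simp: F_def restrict_UNIV)
    also have "\<dots> = distr (distr (distr (PiM (K i) (\<lambda>_. std_normal_distribution)) (PiM UNIV (\<lambda>_. std_normal_distribution)) (\<lambda>z. \<lambda>j\<in>UNIV. z (i, j))) borel (\<lambda>f. \<chi> j. f j)) borel ((*v) L)"
    proof -
      have [measurable]: "(\<lambda>z. \<lambda>j\<in>UNIV. z (i, j)) \<in> measurable (PiM (K i) (\<lambda>_. std_normal_distribution)) (PiM (UNIV :: 'p set) (\<lambda>_. std_normal_distribution))"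
        by (intro measurable_restrict measurable_component_singleton) (auto simp: K_def)
      show ?thesis by (subst distr_distr, measurable, subst distr_distr, measurable) (simp add: o_assoc)
    qed
    also have "\<dots> = distr std_gauss borel ((*v) L)"
      by (subst distr_PiM_std_normal_reindex) (auto simp: K_def inj_on_def std_gauss_def)
    also have "\<dots> = mvnormal 0 (L ** transpose L)" by (rule distr_std_gauss_linear[OF U V d L])
    finally show ?thesis .
  qed
  ultimately show ?thesis by (simp only: K sample_space_def)
qed

lemma sum_std_normal:
  assumes I: "finite I" and c: "(\<Sum>i\<in>I. (c i)\<^sup>2) = 1"
  shows "distr (PiM I (\<lambda>_. std_normal_distribution)) borel (\<lambda>z. \<Sum>i\<in>I. c i * z i) = std_normal_distribution"
proof -
  \<comment> \<open>A zero coefficient would contribute a degenerate normal law, so the sum is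
    restricted to the nonzero ones.\<close>
  define J where "J = {i \<in> I. c i \<noteq> 0}"
  have J: "finite J" "J \<subseteq> I" "J \<noteq> {}" using I c by (auto simp: J_def) (metis (no_types, lifting) power_zero_numeral sum.neutral zero_neq_one)
  then have I0: "I \<noteq> {}" by auto
  interpret prob_space "PiM I (\<lambda>_. std_normal_distribution)" by (rule prob_space_PiM_std_normal)
  have ind: "indep_vars (\<lambda>_. borel) (\<lambda>i z. c i * z i) J"
    using indep_vars_compose2[OF indep_vars_subset[OF indep_vars_coordinates[OF I0] J(2)], of "\<lambda>i x. c i * x" "\<lambda>_. borel"] by simp
  have dist: "distributed (PiM I (\<lambda>_. std_normal_distribution)) lborel (\<lambda>z. c i * z i) (normal_density 0 \<bar>c i\<bar>)" if i: "i \<in> J" for i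
  proof -
    have "distr (PiM I (\<lambda>_. std_normal_distribution)) std_normal_distribution (\<lambda>z. z i) = std_normal_distribution"
      using i J by (intro distr_PiM_component) (auto simp: prob_space_std_normal)
    then have "distributed (PiM I (\<lambda>_. std_normal_distribution)) lborel (\<lambda>z. z i) std_normal_density"
      using i J by (auto simp: distributed_def cong: distr_cong)
    from normal_density_affine[OF this, of "c i" 0] show ?thesis using i by (simp add: J_def)
  qed
  have "distributed (PiM I (\<lambda>_. std_normal_distribution)) lborel (\<lambda>z. \<Sum>i\<in>J. c i * z i) (normal_density (\<Sum>i\<in>J. 0) (sqrt (\<Sum>i\<in>J. \<bar>c i\<bar>\<^sup>2)))"
    using J ind dist by (intro sum_indep_normal) (auto simp: J_def)
  also have "(\<lambda>z. \<Sum>i\<in>J. c i * z i) = (\<lambda>z. \<Sum>i\<in>I. c i * z i)"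
    using I by (intro ext sum.mono_neutral_left) (auto simp: J_def)
  also have "(\<Sum>i\<in>J. \<bar>c i\<bar>\<^sup>2) = (\<Sum>i\<in>I. (c i)\<^sup>2)"
    using I by (simp, intro sum.mono_neutral_left) (auto simp: J_def)
  finally have "distr (PiM I (\<lambda>_. std_normal_distribution)) lborel (\<lambda>z. \<Sum>i\<in>I. c i * z i) = std_normal_distribution"
    by (simp add: c distributed_def)
  then show ?thesis by (simp cong: distr_cong)
qed

section \<open>The score and its exact law\<close>

definition proj_perp :: "'p \<Rightarrow> real^'p \<Rightarrow> real^'p" where
  "proj_perp k x = (\<chi> j. if j = k then 0 else x $ j)"

lemma proj_perp_nth [simp]: "proj_perp k x $ j = (if j = k then 0 else x $ j)"
  by (simp add: proj_perp_def)

lemma linear_proj_perp: "linear (proj_perp k)"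
  by (rule linearI) (auto simp: vec_eq_iff)

lemma proj_perp_measurable [measurable]: "proj_perp k \<in> borel_measurable borel"
  by (intro borel_measurable_continuous_onI linear_continuous_on linear_conv_bounded_linear[THEN iffD1] linear_proj_perp)

text \<open>When \<open>u = 0\<close>, a null event, any unit vector of coefficients will do.\<close>

definition unit_coeff :: "nat \<Rightarrow> (nat \<Rightarrow> real) \<Rightarrow> nat \<Rightarrow> real" where
  "unit_coeff n u i = (if (\<Sum>i=1..n. (u i)\<^sup>2) = 0 then 1 / sqrt n else u i / sqrt (\<Sum>i=1..n. (u i)\<^sup>2))"

lemma sum_unit_coeff:
  assumes "n \<ge> 1"
  shows "(\<Sum>i=1..n. (unit_coeff n u i)\<^sup>2) = 1"
proof -
  have "(\<Sum>i=1..n. (u i)\<^sup>2) \<ge> 0" by (intro sum_nonneg) auto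
  then show ?thesis
    using assms unfolding unit_coeff_def
    by (cases "(\<Sum>i=1..n. (u i)\<^sup>2) = 0") (simp_all add: power_divide flip: sum_divide_distrib)
qed

lemma sum_unit_coeff_mult:
  "sqrt (\<Sum>i=1..n. (u i)\<^sup>2) * (\<Sum>i=1..n. unit_coeff n u i * y i) = (\<Sum>i=1..n. u i * y i)"
proof (cases "(\<Sum>i=1..n. (u i)\<^sup>2) = 0")
  case True
  then have "u i = 0" if "i \<in> {1..n}" for i using that by (simp add: sum_nonneg_eq_0_iff)
  then show ?thesis by (simp add: True)
next
  case False
  then show ?thesis by (simp add: unit_coeff_def sum_distrib_left)
qed

definition score :: "nat \<Rightarrow> 'p \<Rightarrow> (nat \<times> 'p \<Rightarrow> real) \<Rightarrow> real^'p" where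
  "score n k z = (\<chi> j. if j = k then 0 else \<Sum>i=1..n. unit_coeff n (\<lambda>i. z (i, k)) i * z (i, j))"

lemma score_measurable [measurable]: "score n k \<in> borel_measurable (gauss_array n)"
proof -
  have [measurable]: "(\<lambda>z. z (i, j)) \<in> borel_measurable (gauss_array n)" if "i \<in> {1..n}" for i and j :: 'p
    using measurable_component_singleton[of "(i, j)" "{1..n} \<times> UNIV" "\<lambda>_. std_normal_distribution"] that by simp
  have [measurable]: "(\<lambda>z. \<Sum>i=1..n. (z (i, k))\<^sup>2) \<in> borel_measurable (gauss_array n)"
    by (intro borel_measurable_sum borel_measurable_power) simp
  have [measurable]: "(\<lambda>z. unit_coeff n (\<lambda>i. z (i, k)) i) \<in> borel_measurable (gauss_array n)" if "i \<in> {1..n}" for i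
    unfolding unit_coeff_def using that by measurable
  have "(\<lambda>z. if j = k then 0 else \<Sum>i=1..n. unit_coeff n (\<lambda>i. z (i, k)) i * z (i, j)) \<in> borel_measurable (gauss_array n)" for j
    by (cases "j = k") (auto intro!: borel_measurable_sum borel_measurable_times)
  then show ?thesis unfolding score_def by measurable
qed

text \<open>Conditionally on the \<open>k\<close>-th coordinates of the sample, the score is exactly Gaussian, with a
  law that does not depend on them.\<close>

lemma distr_score:
  assumes n: "n \<ge> 1" and p: "CARD('p::finite) \<ge> 2"
  shows "distr (gauss_array n) borel (score n (k::'p::finite)) = distr std_gauss borel (proj_perp k)"
proof -
  interpret product_sigma_finite "\<lambda>_::nat \<times> 'p. std_normal_distribution" by (rule product_sigma_finite_std_normal)
  \<comment> \<open>The coordinates in \<open>I\<close> determine the weights. Those in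
    \<open>J\<close> are integrated first, with the former frozen at \<open>x\<close>; since the
    weights have unit norm, the result does not depend on \<open>x\<close>.\<close>
  define I where "I = {1..n} \<times> {k}"
  define J where "J = {1..n} \<times> (UNIV - {k})"
  have IJ: "I \<inter> J = {}" "finite I" "finite J" "I \<union> J = {1..n} \<times> UNIV" by (auto simp: I_def J_def)
  define G :: "('p \<Rightarrow> real) \<Rightarrow> real^'p" where "G f = (\<chi> j. if j = k then 0 else f j)" for f
  have G [measurable]: "G \<in> borel_measurable (PiM (UNIV - {k}) (\<lambda>_. std_normal_distribution))"
  proof -
    have "(\<lambda>f. if j = k then 0 else f j) \<in> borel_measurable (PiM (UNIV - {k}) (\<lambda>_. std_normal_distribution))" for j :: 'p
      using measurable_component_singleton[of j "UNIV - {k}" "\<lambda>_. std_normal_distribution"] by (cases "j = k") auto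
    then show ?thesis unfolding G_def by measurable
  qed
  have ne: "UNIV - {k} \<noteq> {}"
  proof
    assume "UNIV - {k} = {}"
    then have "card (UNIV - {k}) = 0" by (simp only: card.empty)
    then show False using p by (simp add: card_Diff_singleton)
  qed
  have inner: "distr (PiM J (\<lambda>_. std_normal_distribution)) borel (\<lambda>y. score n k (merge I J (x, y))) = distr (PiM (UNIV - {k}) (\<lambda>_. std_normal_distribution)) borel G" for x
  proof -
    define c where "c = unit_coeff n (\<lambda>i. x (i, k))"
    define K where "K j = {1..n} \<times> {j}" for j :: 'p
    define F :: "'p \<Rightarrow> (nat \<times> 'p \<Rightarrow> real) \<Rightarrow> real" where "F j f = (\<Sum>i=1..n. c i * f (i, j))" for j f
    have K: "(\<Union>j\<in>UNIV-{k}. K j) = J" by (auto simp: K_def J_def)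
    have comp [measurable]: "(\<lambda>f. f (i, j)) \<in> borel_measurable (PiM (K j) (\<lambda>_. std_normal_distribution))" if "i \<in> {1..n}" for i j
      using measurable_component_singleton[of "(i, j)" "K j" "\<lambda>_. std_normal_distribution"] that by (simp add: K_def)
    have F [measurable]: "F j \<in> borel_measurable (PiM (K j) (\<lambda>_. std_normal_distribution))" for j
      unfolding F_def by (intro borel_measurable_sum borel_measurable_times comp) auto
    have blocks: "distr (PiM (\<Union>j\<in>UNIV-{k}. K j) (\<lambda>_. std_normal_distribution)) (PiM (UNIV-{k}) (\<lambda>_. borel)) (\<lambda>z. \<lambda>j\<in>UNIV-{k}. F j (restrict z (K j)))
       = PiM (UNIV-{k}) (\<lambda>j. distr (PiM (K j) (\<lambda>_. std_normal_distribution)) borel (F j))"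
    proof (rule distr_PiM_std_normal_blocks)
      show "(\<Union>j\<in>UNIV-{k}. K j) \<noteq> {}" using n ne by (auto simp: K_def)
    qed (use ne F in \<open>auto simp: K_def disjoint_family_on_def\<close>)
    have Fd: "distr (PiM (K j) (\<lambda>_. std_normal_distribution)) borel (F j) = std_normal_distribution" for j
    proof -
      have [measurable]: "(\<lambda>z. \<lambda>i\<in>{1..n}. z (i, j)) \<in> measurable (PiM (K j) (\<lambda>_. std_normal_distribution)) (PiM {1..n} (\<lambda>_. std_normal_distribution))"
        by (intro measurable_restrict measurable_component_singleton) (auto simp: K_def)
      have c1: "(\<lambda>f. f i) \<in> borel_measurable (PiM {1..n} (\<lambda>_. std_normal_distribution))" if "i \<in> {1..n}" for i
        using measurable_component_singleton[of i "{1..n}" "\<lambda>_. std_normal_distribution"] that by simp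
      have [measurable]: "(\<lambda>f. \<Sum>i=1..n. c i * f i) \<in> borel_measurable (PiM {1..n} (\<lambda>_. std_normal_distribution))"
        by (intro borel_measurable_sum borel_measurable_times borel_measurable_const c1)
      have "distr (PiM (K j) (\<lambda>_. std_normal_distribution)) borel (F j)
        = distr (PiM (K j) (\<lambda>_. std_normal_distribution)) borel ((\<lambda>f. \<Sum>i=1..n. c i * f i) \<circ> (\<lambda>z. \<lambda>i\<in>{1..n}. z (i, j)))"
        by (intro distr_cong) (auto simp: F_def)
      also have "\<dots> = distr (distr (PiM (K j) (\<lambda>_. std_normal_distribution)) (PiM {1..n} (\<lambda>_. std_normal_distribution)) (\<lambda>z. \<lambda>i\<in>{1..n}. z (i, j))) borel (\<lambda>f. \<Sum>i=1..n. c i * f i)"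
        by (subst distr_distr) auto
      also have "\<dots> = distr (PiM {1..n} (\<lambda>_. std_normal_distribution)) borel (\<lambda>f. \<Sum>i=1..n. c i * f i)"
        by (subst distr_PiM_std_normal_reindex) (auto simp: K_def inj_on_def)
      also have "\<dots> = std_normal_distribution" by (rule sum_std_normal) (auto simp: c_def sum_unit_coeff[OF n])
      finally show ?thesis .
    qed
    have blocks': "distr (PiM J (\<lambda>_. std_normal_distribution)) (PiM (UNIV-{k}) (\<lambda>_. std_normal_distribution)) (\<lambda>z. \<lambda>j\<in>UNIV-{k}. F j (restrict z (K j))) = PiM (UNIV-{k}) (\<lambda>_. std_normal_distribution)"
      using blocks unfolding K Fd by (simp cong: distr_cong sets_PiM_cong)
    have "distr (PiM J (\<lambda>_. std_normal_distribution)) borel (\<lambda>y. score n k (merge I J (x, y)))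
       = distr (PiM J (\<lambda>_. std_normal_distribution)) borel (G \<circ> (\<lambda>z. \<lambda>j\<in>UNIV-{k}. F j (restrict z (K j))))"
    proof (intro distr_cong refl)
      fix y
      have 1: "merge I J (x, y) (i, k) = x (i, k)" if "i \<in> {1..n}" for i using that by (simp add: merge_def I_def)
      have "unit_coeff n (\<lambda>i. merge I J (x, y) (i, k)) i = c i" if "i \<in> {1..n}" for i
      proof -
        have "(\<Sum>i=1..n. (merge I J (x, y) (i, k))\<^sup>2) = (\<Sum>i=1..n. (x (i, k))\<^sup>2)" by (intro sum.cong refl) (simp only: 1)
        then show ?thesis using 1[OF that] by (simp add: unit_coeff_def c_def)
      qed
      moreover have "merge I J (x, y) (i, j) = y (i, j)" if "i \<in> {1..n}" "j \<noteq> k" for i j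
        using that by (simp add: merge_def I_def J_def)
      ultimately show "score n k (merge I J (x, y)) = (G \<circ> (\<lambda>z. \<lambda>j\<in>UNIV-{k}. F j (restrict z (K j)))) y"
        by (auto simp: score_def G_def F_def K_def vec_eq_iff intro!: sum.cong)
    qed
    also have "\<dots> = distr (distr (PiM J (\<lambda>_. std_normal_distribution)) (PiM (UNIV-{k}) (\<lambda>_. std_normal_distribution)) (\<lambda>z. \<lambda>j\<in>UNIV-{k}. F j (restrict z (K j)))) borel G"
    proof (subst distr_distr)
      show "(\<lambda>z. \<lambda>j\<in>UNIV-{k}. F j (restrict z (K j))) \<in> measurable (PiM J (\<lambda>_. std_normal_distribution)) (PiM (UNIV-{k}) (\<lambda>_. std_normal_distribution))"
      proof (rule measurable_restrict)
        fix j assume "j \<in> UNIV - {k}"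
        then have "(\<lambda>z. restrict z (K j)) \<in> measurable (PiM J (\<lambda>_. std_normal_distribution)) (PiM (K j) (\<lambda>_. std_normal_distribution))"
          by (intro measurable_restrict_subset) (auto simp: K_def J_def)
        from measurable_compose[OF this F] show "(\<lambda>z. F j (restrict z (K j))) \<in> measurable (PiM J (\<lambda>_. std_normal_distribution)) std_normal_distribution" by simp
      qed
    qed auto
    finally show ?thesis by (simp only: blocks')
  qed
  have outer: "distr std_gauss borel (proj_perp k) = distr (PiM (UNIV - {k}) (\<lambda>_. std_normal_distribution)) borel G"
  proof -
    have [measurable]: "(\<lambda>z. \<lambda>i\<in>UNIV - {k}. z i) \<in> measurable (PiM (UNIV :: 'p set) (\<lambda>_. std_normal_distribution)) (PiM (UNIV - {k}) (\<lambda>_. std_normal_distribution))"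
      by (intro measurable_restrict measurable_component_singleton) auto
    have "distr std_gauss borel (proj_perp k) = distr (PiM UNIV (\<lambda>_. std_normal_distribution)) borel (G \<circ> (\<lambda>z. \<lambda>i\<in>UNIV - {k}. z i))"
      unfolding std_gauss_def by (subst distr_distr) (auto simp: o_def proj_perp_def G_def fun_eq_iff intro!: distr_cong)
    also have "\<dots> = distr (distr (PiM UNIV (\<lambda>_. std_normal_distribution)) (PiM (UNIV - {k}) (\<lambda>_. std_normal_distribution)) (\<lambda>z. \<lambda>i\<in>UNIV - {k}. z i)) borel G"
      by (subst distr_distr) auto
    also have "\<dots> = distr (PiM (UNIV - {k}) (\<lambda>_. std_normal_distribution)) borel G"
      using distr_PiM_std_normal_reindex[of "\<lambda>i. i" "UNIV - {k}" UNIV] by simp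
    finally show ?thesis .
  qed
  show ?thesis
  proof (rule measure_eqI)
    fix A assume "A \<in> sets (distr (gauss_array n) borel (score n k))"
    then have A [measurable]: "A \<in> sets borel" by simp
    interpret PI: prob_space "PiM I (\<lambda>_. std_normal_distribution)" by (rule prob_space_PiM_std_normal)
    have sm: "(\<lambda>z. indicator A (score n k z) :: ennreal) \<in> borel_measurable (PiM (I \<union> J) (\<lambda>_. std_normal_distribution))"
      unfolding IJ(4) by measurable
    have "emeasure (distr (gauss_array n) borel (score n k)) A = (\<integral>\<^sup>+z. indicator A z \<partial>distr (gauss_array n) borel (score n k))" by simp
    also have "\<dots> = (\<integral>\<^sup>+z. indicator A (score n k z) \<partial>PiM (I \<union> J) (\<lambda>_. std_normal_distribution))"
      unfolding IJ(4) by (subst nn_integral_distr) auto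
    also have "\<dots> = (\<integral>\<^sup>+x. (\<integral>\<^sup>+y. indicator A (score n k (merge I J (x, y))) \<partial>PiM J (\<lambda>_. std_normal_distribution)) \<partial>PiM I (\<lambda>_. std_normal_distribution))"
      by (rule product_nn_integral_fold[OF IJ(1-3) sm])
    also have "\<dots> = (\<integral>\<^sup>+x. emeasure (distr (PiM (UNIV - {k}) (\<lambda>_. std_normal_distribution)) borel G) A \<partial>PiM I (\<lambda>_. std_normal_distribution))"
    proof (rule nn_integral_cong)
      fix x assume x: "x \<in> space (PiM I (\<lambda>_. std_normal_distribution))"
      have "(\<lambda>y. merge I J (x, y)) \<in> measurable (PiM J (\<lambda>_. std_normal_distribution)) (PiM (I \<union> J) (\<lambda>_. std_normal_distribution))"
        using measurable_compose[OF measurable_Pair1'[OF x] measurable_merge] .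
      from measurable_compose[OF this[unfolded IJ(4)] score_measurable]
      have m: "(\<lambda>y. score n k (merge I J (x, y))) \<in> borel_measurable (PiM J (\<lambda>_. std_normal_distribution))" .
      have "(\<integral>\<^sup>+y. indicator A (score n k (merge I J (x, y))) \<partial>PiM J (\<lambda>_. std_normal_distribution))
         = (\<integral>\<^sup>+w. indicator A w \<partial>distr (PiM J (\<lambda>_. std_normal_distribution)) borel (\<lambda>y. score n k (merge I J (x, y))))"
        by (subst nn_integral_distr[OF m]) auto
      then show "(\<integral>\<^sup>+y. indicator A (score n k (merge I J (x, y))) \<partial>PiM J (\<lambda>_. std_normal_distribution))
         = emeasure (distr (PiM (UNIV - {k}) (\<lambda>_. std_normal_distribution)) borel G) A"
        by (simp add: inner)
    qed
    also have "\<dots> = emeasure (distr (PiM (UNIV - {k}) (\<lambda>_. std_normal_distribution)) borel G) A"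
      by (simp add: PI.emeasure_space_1)
    finally show "emeasure (distr (gauss_array n) borel (score n k)) A = emeasure (distr std_gauss borel (proj_perp k)) A"
      by (simp add: outer)
  qed simp
qed

section \<open>Second moments and tightness\<close>

lemma (in prob_space) second_moment_sum:
  fixes Y :: "'i \<Rightarrow> 'a \<Rightarrow> real"  and s :: real
  assumes I: "finite I" and ind: "indep_vars (\<lambda>_. borel) Y I"
    and int: "\<And>i. i \<in> I \<Longrightarrow> integrable M (Y i)" and int2: "\<And>i. i \<in> I \<Longrightarrow> integrable M (\<lambda>x. (Y i x)\<^sup>2)"
    and mean: "\<And>i. i \<in> I \<Longrightarrow> expectation (Y i) = 0"
    and var: "\<And>i. i \<in> I \<Longrightarrow> expectation (\<lambda>x. (Y i x)\<^sup>2) = s"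
  shows "integrable M (\<lambda>x. (\<Sum>i\<in>I. Y i x)\<^sup>2) \<and> expectation (\<lambda>x. (\<Sum>i\<in>I. Y i x)\<^sup>2) = card I * s"
  using assms
proof (induction I rule: finite_induct)
  case (insert i I)
  have IH: "integrable M (\<lambda>x. (\<Sum>i\<in>I. Y i x)\<^sup>2)" "expectation (\<lambda>x. (\<Sum>i\<in>I. Y i x)\<^sup>2) = card I * s"
    using insert.IH[OF indep_vars_subset[OF insert.prems(1)]] insert.prems by auto
  have iv: "indep_var borel (Y i) borel (\<lambda>x. \<Sum>i\<in>I. Y i x)"
    using insert by (intro indep_vars_sum) auto
  have si: "integrable M (\<lambda>x. \<Sum>i\<in>I. Y i x)" using insert.prems by (intro Bochner_Integration.integrable_sum) auto
  have prod: "integrable M (\<lambda>x. Y i x * (\<Sum>i\<in>I. Y i x))" "expectation (\<lambda>x. Y i x * (\<Sum>i\<in>I. Y i x)) = 0"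
    using indep_var_integrable[OF iv _ si] indep_var_lebesgue_integral[OF iv _ si] insert.prems by auto
  have eq: "(\<Sum>i\<in>insert i I. Y i x)\<^sup>2 = (Y i x)\<^sup>2 + 2 * (Y i x * (\<Sum>i\<in>I. Y i x)) + (\<Sum>i\<in>I. Y i x)\<^sup>2" for x
    using insert by (simp add: power2_sum)
  show ?case
    unfolding eq using IH prod insert.prems insert.hyps by (simp add: algebra_simps)
qed simp

lemma std_normal_moments:
  "integrable std_normal_distribution (\<lambda>x. x ^ m)" "(\<integral>x. x \<partial>std_normal_distribution) = 0" "(\<integral>x. x\<^sup>2 \<partial>std_normal_distribution) = 1" "(\<integral>x. x ^ 4 \<partial>std_normal_distribution) = 3"
proof -
  show "integrable std_normal_distribution (\<lambda>x. x ^ m)" by (rule integrable_std_normal_distribution_moment)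
  show "(\<integral>x. x \<partial>std_normal_distribution) = 0" using integral_std_normal_distribution_moment_odd[of 1] by simp
  show "(\<integral>x. x\<^sup>2 \<partial>std_normal_distribution) = 1" using std_normal_distribution_even_moments(1)[of 1] by (simp add: fact_numeral)
  show "(\<integral>x. x ^ 4 \<partial>std_normal_distribution) = 3" using std_normal_distribution_even_moments(1)[of 2] by (simp add: fact_numeral)
qed

lemma coordinate_moments:
  assumes "k \<in> K"
  shows "integrable (PiM K (\<lambda>_. std_normal_distribution)) (\<lambda>z. z k ^ m)"
    and "(\<integral>z. z k ^ m \<partial>PiM K (\<lambda>_. std_normal_distribution)) = (\<integral>x. x ^ m \<partial>std_normal_distribution)"
proof -
  have d: "distr (PiM K (\<lambda>_. std_normal_distribution)) std_normal_distribution (\<lambda>z. z k) = std_normal_distribution"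
    using assms prob_space_std_normal by (intro distr_PiM_component) auto
  have comp: "(\<lambda>z. z k) \<in> measurable (PiM K (\<lambda>_. std_normal_distribution)) std_normal_distribution"
    using assms by (intro measurable_component_singleton)
  then have [measurable]: "(\<lambda>z. z k) \<in> borel_measurable (PiM K (\<lambda>_. std_normal_distribution))" by simp
  have m: "(\<lambda>x. x ^ m) \<in> borel_measurable std_normal_distribution" by simp
  have "integrable (distr (PiM K (\<lambda>_. std_normal_distribution)) std_normal_distribution (\<lambda>z. z k)) (\<lambda>x. x ^ m)"
    unfolding d by (rule std_normal_moments)
  then show "integrable (PiM K (\<lambda>_. std_normal_distribution)) (\<lambda>z. z k ^ m)"
    by (subst (asm) integrable_distr_eq) auto
  have "(\<integral>x. x ^ m \<partial>distr (PiM K (\<lambda>_. std_normal_distribution)) std_normal_distribution (\<lambda>z. z k)) = (\<integral>z. z k ^ m \<partial>PiM K (\<lambda>_. std_normal_distribution))"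
    by (subst integral_distr) auto
  then show "(\<integral>z. z k ^ m \<partial>PiM K (\<lambda>_. std_normal_distribution)) = (\<integral>x. x ^ m \<partial>std_normal_distribution)" by (simp only: d)
qed

definition moment_dev :: "nat \<Rightarrow> (nat \<times> 'p \<Rightarrow> real) \<Rightarrow> 'p \<Rightarrow> 'p \<Rightarrow> real" where
  "moment_dev n z a b = 1 / real n * (\<Sum>i=1..n. z (i, a) * z (i, b)) - (if a = b then 1 else 0)"

definition coord_mean :: "nat \<Rightarrow> (nat \<times> 'p \<Rightarrow> real) \<Rightarrow> 'p \<Rightarrow> real" where
  "coord_mean n z a = 1 / real n * (\<Sum>i=1..n. z (i, a))"

lemma indep_vars_rows:
  fixes f :: "(nat \<times> 'p::finite \<Rightarrow> real) \<Rightarrow> nat \<Rightarrow> real"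
  assumes n: "n \<ge> 1" and f: "\<And>z i. f z i = g (\<lambda>j. z (i, j))"
    and meas: "\<And>i. i \<in> {1..n} \<Longrightarrow> (\<lambda>z. f z i) \<in> borel_measurable (PiM ({i} \<times> UNIV) (\<lambda>_. std_normal_distribution))"
  shows "prob_space.indep_vars (gauss_array n) (\<lambda>_. borel) (\<lambda>i z. f z i) {1..n}"
proof -
  interpret prob_space "gauss_array n :: (nat \<times> 'p \<Rightarrow> real) measure" by (rule prob_space_PiM_std_normal)
  have K: "(\<Union>i\<in>{1..n}. {i} \<times> (UNIV :: 'p set)) = {1..n} \<times> UNIV" by auto
  have "prob_space.indep_vars (PiM (\<Union>i\<in>{1..n}. {i} \<times> (UNIV :: 'p set)) (\<lambda>_. std_normal_distribution)) (\<lambda>_. borel)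
     (\<lambda>i z. f (restrict z ({i} \<times> UNIV)) i) {1..n}"
    by (rule indep_vars_std_normal_blocks) (use n meas in \<open>auto simp: disjoint_family_on_def\<close>)
  then show ?thesis unfolding K f by simp
qed

text \<open>The centred square of a standard normal has variance 3 - 1 = 2, a product of two
  independent ones has variance 1. The bound 2 is thus uniform in n and in the entries.\<close>

lemma moment_dev_second_moment:
  fixes a b :: "'p::finite"
  assumes n: "n \<ge> 1"
  defines "M \<equiv> gauss_array n :: (nat \<times> 'p \<Rightarrow> real) measure"
  shows "integrable M (\<lambda>z. (sqrt n * moment_dev n z a b)\<^sup>2)" "(\<integral>z. (sqrt n * moment_dev n z a b)\<^sup>2 \<partial>M) \<le> 2"
proof -
  interpret prob_space M unfolding M_def by (rule prob_space_PiM_std_normal)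
  define Y :: "nat \<Rightarrow> (nat \<times> 'p \<Rightarrow> real) \<Rightarrow> real" where "Y i z = z (i, a) * z (i, b) - (if a = b then 1 else 0)" for i z
  define s :: real where "s = (if a = b then 2 else 1)"
  have I: "(i, j) \<in> {1..n} \<times> (UNIV :: 'p set)" if "i \<in> {1..n}" for i and j :: 'p using that by auto
  have mom: "integrable M (\<lambda>z. z (i, j) ^ m)" "expectation (\<lambda>z. z (i, j) ^ m) = (\<integral>x. x ^ m \<partial>std_normal_distribution)"
    if "i \<in> {1..n}" for i and j :: 'p and m
    unfolding M_def by (rule coordinate_moments[OF I[OF that]])+
  have ind: "indep_vars (\<lambda>_. borel) Y {1..n}"
    unfolding M_def Y_def
  proof (rule indep_vars_rows[OF n])
    fix i show "(\<lambda>z. z (i, a) * z (i, b) - (if a = b then 1 else 0)) \<in> borel_measurable (PiM ({i} \<times> UNIV) (\<lambda>_. std_normal_distribution))"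
      using measurable_component_singleton[of "(i, a)" "{i} \<times> UNIV" "\<lambda>_. std_normal_distribution"]
        measurable_component_singleton[of "(i, b)" "{i} \<times> UNIV" "\<lambda>_. std_normal_distribution"]
      by (intro borel_measurable_diff borel_measurable_times) auto
  qed (rule refl)
  have moments: "integrable M (Y i) \<and> integrable M (\<lambda>z. (Y i z)\<^sup>2) \<and> expectation (Y i) = 0 \<and> expectation (\<lambda>z. (Y i z)\<^sup>2) = s"
    if i: "i \<in> {1..n}" for i
  proof (cases "a = b")
    case True
    have sq: "integrable M (\<lambda>z. (z (i, b))\<^sup>2)" "(\<integral>z. (z (i, b))\<^sup>2 \<partial>M) = 1"
      and f: "integrable M (\<lambda>z. z (i, b) ^ 4)" "(\<integral>z. z (i, b) ^ 4 \<partial>M) = 3"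
      using mom[OF i, of b 2] mom[OF i, of b 4] by (simp_all add: std_normal_moments)
    have Y: "Y i = (\<lambda>z. (z (i, b))\<^sup>2 - 1)" by (simp add: Y_def True power2_eq_square fun_eq_iff)
    have Y2: "(\<lambda>z. (Y i z)\<^sup>2) = (\<lambda>z. z (i, b) ^ 4 - 2 * (z (i, b))\<^sup>2 + 1)"
      by (simp add: Y fun_eq_iff power2_eq_square power4_eq_xxxx algebra_simps)
    show ?thesis unfolding Y2 using sq f by (simp add: Y s_def True prob_space)
  next
    case False
    have ne: "{1..n} \<times> (UNIV :: 'p set) \<noteq> {}" using n by auto
    have iv: "indep_var borel (\<lambda>z. z (i, a)) borel (\<lambda>z. z (i, b))"
    proof -
      have "indep_var (PiM {(i, a)} (\<lambda>_. borel)) (\<lambda>z. restrict z {(i, a)}) (PiM {(i, b)} (\<lambda>_. borel)) (\<lambda>z. restrict z {(i, b)})"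
        using indep_var_restrict[OF indep_vars_coordinates[OF ne, folded M_def], of "{(i, a)}" "{(i, b)}"] I[OF i] False
        by (auto simp: restrict_def)
      from indep_var_compose[OF this, of "\<lambda>f. f (i, a)" borel "\<lambda>f. f (i, b)" borel] show ?thesis by (simp add: o_def)
    qed
    have iv2: "indep_var borel (\<lambda>z. (z (i, a))\<^sup>2) borel (\<lambda>z. (z (i, b))\<^sup>2)"
      using indep_var_compose[OF iv, of "\<lambda>x. x\<^sup>2" borel "\<lambda>x. x\<^sup>2" borel] by (simp add: o_def)
    have l: "integrable M (\<lambda>z. z (i, j))" "expectation (\<lambda>z. z (i, j)) = 0" for j
      using mom[OF i, of j 1] by (simp_all add: std_normal_moments)
    have q: "integrable M (\<lambda>z. (z (i, j))\<^sup>2)" "expectation (\<lambda>z. (z (i, j))\<^sup>2) = 1" for j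
      using mom[OF i, of j 2] by (simp_all add: std_normal_moments)
    have Y: "Y i = (\<lambda>z. z (i, a) * z (i, b))" by (simp add: Y_def False fun_eq_iff)
    show ?thesis
      using indep_var_integrable[OF iv l(1) l(1)] indep_var_lebesgue_integral[OF iv l(1) l(1)]
        indep_var_integrable[OF iv2 q(1) q(1)] indep_var_lebesgue_integral[OF iv2 q(1) q(1)]
      by (simp add: Y l q s_def False power_mult_distrib)
  qed
  have sum: "integrable M (\<lambda>z. (\<Sum>i=1..n. Y i z)\<^sup>2)" "(\<integral>z. (\<Sum>i=1..n. Y i z)\<^sup>2 \<partial>M) = n * s"
    using second_moment_sum[where s=s, OF _ ind] moments by auto
  have eq: "(sqrt n * moment_dev n z a b)\<^sup>2 = (1 / n) * (\<Sum>i=1..n. Y i z)\<^sup>2" for z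
  proof -
    have "moment_dev n z a b = (1 / n) * (\<Sum>i=1..n. Y i z)"
      using n by (simp add: moment_dev_def Y_def sum_subtractf right_diff_distrib)
    then show ?thesis using n by (simp add: power_mult_distrib power_divide) (simp add: power2_eq_square)
  qed
  show "integrable M (\<lambda>z. (sqrt n * moment_dev n z a b)\<^sup>2)" unfolding eq using sum(1) by simp
  show "(\<integral>z. (sqrt n * moment_dev n z a b)\<^sup>2 \<partial>M) \<le> 2"
    unfolding eq using sum(2) n by (simp add: s_def)
qed

lemma coord_mean_second_moment:
  fixes a :: "'p::finite"
  assumes n: "n \<ge> 1"
  defines "M \<equiv> gauss_array n :: (nat \<times> 'p \<Rightarrow> real) measure"
  shows "integrable M (\<lambda>z. (sqrt n * coord_mean n z a)\<^sup>2)" "(\<integral>z. (sqrt n * coord_mean n z a)\<^sup>2 \<partial>M) \<le> 2"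
proof -
  interpret prob_space M unfolding M_def by (rule prob_space_PiM_std_normal)
  have I: "(i, j) \<in> {1..n} \<times> (UNIV :: 'p set)" if "i \<in> {1..n}" for i and j :: 'p using that by auto
  have mom: "integrable M (\<lambda>z. z (i, j) ^ m)" "expectation (\<lambda>z. z (i, j) ^ m) = (\<integral>x. x ^ m \<partial>std_normal_distribution)"
    if "i \<in> {1..n}" for i and j :: 'p and m
    unfolding M_def by (rule coordinate_moments[OF I[OF that]])+
  have ind: "indep_vars (\<lambda>_. borel) (\<lambda>i z. z (i, a)) {1..n}"
    unfolding M_def
  proof (rule indep_vars_rows[OF n])
    fix i show "(\<lambda>z. z (i, a)) \<in> borel_measurable (PiM ({i} \<times> UNIV) (\<lambda>_. std_normal_distribution))"
      using measurable_component_singleton[of "(i, a)" "{i} \<times> UNIV" "\<lambda>_. std_normal_distribution"] by simp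
  qed (rule refl)
  have sum: "integrable M (\<lambda>z. (\<Sum>i=1..n. z (i, a))\<^sup>2)" "(\<integral>z. (\<Sum>i=1..n. z (i, a))\<^sup>2 \<partial>M) = n"
  proof -
    have "integrable M (\<lambda>z. z (i, a))" "integrable M (\<lambda>z. (z (i, a))\<^sup>2)" "expectation (\<lambda>z. z (i, a)) = 0"
      "expectation (\<lambda>z. (z (i, a))\<^sup>2) = 1" if "i \<in> {1..n}" for i
      using mom(1)[OF that, of a 1] mom(2)[OF that, of a 1] mom(1)[OF that, of a 2] mom(2)[OF that, of a 2]
      by (simp_all add: std_normal_moments)
    then show "integrable M (\<lambda>z. (\<Sum>i=1..n. z (i, a))\<^sup>2)" "(\<integral>z. (\<Sum>i=1..n. z (i, a))\<^sup>2 \<partial>M) = n"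
      using second_moment_sum[where s=1, OF _ ind] by auto
  qed
  have eq: "(sqrt n * coord_mean n z a)\<^sup>2 = (1 / n) * (\<Sum>i=1..n. z (i, a))\<^sup>2" for z
    using n by (simp add: coord_mean_def power_mult_distrib power_divide) (simp add: power2_eq_square)
  show "integrable M (\<lambda>z. (sqrt n * coord_mean n z a)\<^sup>2)" unfolding eq using sum(1) by simp
  show "(\<integral>z. (sqrt n * coord_mean n z a)\<^sup>2 \<partial>M) \<le> 2" unfolding eq using sum(2) n by simp
qed

text \<open>Everything that has to stay bounded is added up in one quantity, so that a single event
  controls the second moments, the means and the score at once.\<close>

definition tight_bound :: "nat \<Rightarrow> 'p::finite \<Rightarrow> (nat \<times> 'p \<Rightarrow> real) \<Rightarrow> real" where
  "tight_bound n k z = (\<Sum>a\<in>UNIV. \<Sum>b\<in>UNIV. \<bar>sqrt n * moment_dev n z a b\<bar>) + (\<Sum>a\<in>UNIV. \<bar>sqrt n * coord_mean n z a\<bar>) + norm (score n k z)"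

lemma gauss_array_component [measurable]:
  "i \<in> {1..n} \<Longrightarrow> (\<lambda>z. z (i, j)) \<in> borel_measurable (gauss_array n)"
  using measurable_component_singleton[of "(i, j)" "{1..n} \<times> UNIV" "\<lambda>_. std_normal_distribution"] by simp

lemma moment_dev_measurable [measurable]: "(\<lambda>z. moment_dev n z a b) \<in> borel_measurable (gauss_array n)"
  unfolding moment_dev_def
  by (intro borel_measurable_diff borel_measurable_times borel_measurable_sum borel_measurable_const gauss_array_component) auto

lemma coord_mean_measurable [measurable]: "(\<lambda>z. coord_mean n z a) \<in> borel_measurable (gauss_array n)"
  unfolding coord_mean_def
  by (intro borel_measurable_times borel_measurable_sum borel_measurable_const gauss_array_component) auto

lemma tight_bound_measurable [measurable]: "tight_bound n k \<in> borel_measurable (gauss_array n)"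
  unfolding tight_bound_def by measurable

text \<open>The moment part is bounded by Markov's inequality with constants free of n; the score
  has the same law for every n, so one quantile serves for all.\<close>

lemma tightness:
  assumes p: "CARD('p::finite) \<ge> 2" and \<epsilon>: "\<epsilon> > 0"
  obtains K where "\<And>n. n \<ge> 1 \<Longrightarrow> measure (gauss_array n) {z \<in> space (gauss_array n). tight_bound n (k :: 'p) z > K} \<le> \<epsilon>"
proof -
  define q where "q = real CARD('p)"
  \<comment> \<open>There are p^2 second moments and p means, each with absolute first moment at
    most 2.\<close>
  define C where "C = (q * q + q) * 2"
  have C0: "C \<ge> 0" by (simp add: C_def q_def)
  let ?T = "\<lambda>n z. (\<Sum>a\<in>UNIV. \<Sum>b\<in>UNIV. \<bar>sqrt n * moment_dev n z a b\<bar>) + (\<Sum>a\<in>(UNIV :: 'p set). \<bar>sqrt n * coord_mean n z a\<bar>)"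
  have bound: "measure (gauss_array n) {z \<in> space (gauss_array n). ?T n z \<ge> c} \<le> C / c" if n: "n \<ge> 1" and c: "c > 0" for n :: nat and c
  proof -
    let ?M = "gauss_array n :: (nat \<times> 'p \<Rightarrow> real) measure"
    interpret prob_space ?M by (rule prob_space_PiM_std_normal)
    \<comment> \<open>Turns the second moment bound 2 into the bound 1 + 2/2 = 2 for the first
      absolute moment.\<close>
    have ax: "\<bar>x\<bar> \<le> 1 + x\<^sup>2 / 2" for x :: real
      using zero_le_power2[of "\<bar>x\<bar> - 1"] by (simp add: power2_diff)
    have abs: "integrable ?M (\<lambda>z. \<bar>f z\<bar>) \<and> (\<integral>z. \<bar>f z\<bar> \<partial>?M) \<le> 2"
      if [measurable]: "f \<in> borel_measurable ?M" and f2: "integrable ?M (\<lambda>z. (f z)\<^sup>2)" "(\<integral>z. (f z)\<^sup>2 \<partial>?M) \<le> 2" for f :: "_ \<Rightarrow> real"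
    proof -
      have d: "integrable ?M (\<lambda>z. 1 + (f z)\<^sup>2 / 2)" using f2 by simp
      have i: "integrable ?M (\<lambda>z. \<bar>f z\<bar>)"
        by (rule Bochner_Integration.integrable_bound[OF d]) (auto intro: ax order_trans[OF _ abs_ge_self])
      have "(\<integral>z. \<bar>f z\<bar> \<partial>?M) \<le> (\<integral>z. 1 + (f z)\<^sup>2 / 2 \<partial>?M)" by (rule integral_mono[OF i d]) (rule ax)
      also have "\<dots> \<le> 2" using f2 by (simp add: prob_space)
      finally show ?thesis using i by simp
    qed
    have m: "integrable ?M (\<lambda>z. \<bar>sqrt n * moment_dev n z a b\<bar>) \<and> (\<integral>z. \<bar>sqrt n * moment_dev n z a b\<bar> \<partial>?M) \<le> 2" for a b
      by (rule abs) (use moment_dev_second_moment[OF n] in auto)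
    have m': "integrable ?M (\<lambda>z. \<bar>sqrt n * coord_mean n z a\<bar>) \<and> (\<integral>z. \<bar>sqrt n * coord_mean n z a\<bar> \<partial>?M) \<le> 2" for a
      by (rule abs) (use coord_mean_second_moment[OF n] in auto)
    have iT: "integrable ?M (\<lambda>z. ?T n z)" using m m' by (intro Bochner_Integration.integrable_add Bochner_Integration.integrable_sum) auto
    have "(\<integral>z. ?T n z \<partial>?M) = (\<Sum>a\<in>UNIV. \<Sum>b\<in>UNIV. \<integral>z. \<bar>sqrt n * moment_dev n z a b\<bar> \<partial>?M) + (\<Sum>a\<in>UNIV. \<integral>z. \<bar>sqrt n * coord_mean n z a\<bar> \<partial>?M)"
      using m m' by (subst Bochner_Integration.integral_add) (auto simp: Bochner_Integration.integral_sum intro!: Bochner_Integration.integrable_sum)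
    also have "\<dots> \<le> (\<Sum>a\<in>(UNIV :: 'p set). \<Sum>b\<in>(UNIV :: 'p set). 2) + (\<Sum>a\<in>(UNIV :: 'p set). 2)"
      by (intro add_mono sum_mono) (use m m' in auto)
    also have "\<dots> = C" by (simp add: C_def q_def algebra_simps)
    finally have "(\<integral>z. ?T n z \<partial>?M) / c \<le> C / c" using c by (intro divide_right_mono) auto
    moreover have "measure ?M {z \<in> space ?M. ?T n z \<ge> c} \<le> (\<integral>z. ?T n z \<partial>?M) / c"
      by (rule integral_Markov_inequality_measure[OF iT sets.top]) (use c in \<open>auto intro!: AE_I2 add_nonneg_nonneg sum_nonneg\<close>)
    ultimately show ?thesis by simp
  qed
  define \<mu> where "\<mu> = distr (std_gauss :: (real^'p) measure) borel (\<lambda>g. norm (proj_perp k g))"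
  interpret sg: prob_space "std_gauss :: (real^'p) measure" by (rule prob_space_std_gauss)
  interpret \<mu>: real_distribution \<mu> unfolding \<mu>_def by (intro sg.real_distribution_distr) measurable
  have "eventually (\<lambda>x. cdf \<mu> x > 1 - \<epsilon> / 2) at_top"
    using order_tendstoD(1)[OF \<mu>.cdf_lim_at_top_prob, of "1 - \<epsilon> / 2"] \<epsilon> by simp
  then obtain K1 where K1: "cdf \<mu> K1 > 1 - \<epsilon> / 2" by (auto simp: eventually_at_top_linorder)
  \<comment> \<open>Large enough for \<open>C / K2\<close> to be at most half of
    \<open>\<epsilon>\<close>; the summand 1 keeps it positive.\<close>
  define K2 where "K2 = 2 * C / \<epsilon> + 1"
  have K2: "K2 > 0" "C / K2 \<le> \<epsilon> / 2"
  proof -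
    show "K2 > 0" using C0 \<epsilon> by (simp add: K2_def add_nonneg_pos)
    then show "C / K2 \<le> \<epsilon> / 2" using \<epsilon> C0 by (simp add: K2_def field_simps)
  qed
  show thesis
  proof (rule that[of "K1 + K2"])
    fix n :: nat assume n: "n \<ge> 1"
    let ?M = "gauss_array n :: (nat \<times> 'p \<Rightarrow> real) measure"
    interpret prob_space ?M by (rule prob_space_PiM_std_normal)
    have "measure ?M {z \<in> space ?M. norm (score n k z) \<le> K1} = measure (distr ?M borel (score n k)) {w. norm w \<le> K1}"
      by (subst measure_distr) (auto intro!: arg_cong[where f="measure ?M"])
    also have "\<dots> = cdf \<mu> K1"
      unfolding distr_score[OF n p] \<mu>_def cdf_def by (subst (1 2) measure_distr) (auto intro!: arg_cong[where f="measure std_gauss"])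
    finally have "measure ?M {z \<in> space ?M. norm (score n k z) \<le> K1} = cdf \<mu> K1" .
    moreover have "measure ?M {z \<in> space ?M. norm (score n k z) > K1} = 1 - measure ?M {z \<in> space ?M. norm (score n k z) \<le> K1}"
      by (subst prob_compl[symmetric]) (auto intro!: arg_cong[where f="measure ?M"])
    ultimately have 1: "measure ?M {z \<in> space ?M. norm (score n k z) > K1} \<le> \<epsilon> / 2" using K1 by simp
    have "measure ?M {z \<in> space ?M. tight_bound n k z > K1 + K2}
      \<le> measure ?M ({z \<in> space ?M. ?T n z \<ge> K2} \<union> {z \<in> space ?M. norm (score n k z) > K1})"
      by (intro finite_measure_mono) (auto simp: tight_bound_def)
    also have "\<dots> \<le> measure ?M {z \<in> space ?M. ?T n z \<ge> K2} + measure ?M {z \<in> space ?M. norm (score n k z) > K1}"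
      by (intro measure_Un_le) measurable
    also have "\<dots> \<le> \<epsilon> / 2 + \<epsilon> / 2" using order_trans[OF bound[OF n K2(1)] K2(2)] 1 by (rule add_mono)
    finally show "measure ?M {z \<in> space ?M. tight_bound n k z > K1 + K2} \<le> \<epsilon>" by simp
  qed
qed

section \<open>The limiting chi-square laws\<close>

lemma distr_std_normal_shift:
  "distr std_normal_distribution borel (\<lambda>x. x + \<mu>) = density lborel (\<lambda>x. ennreal (normal_density \<mu> 1 x))"
proof -
  interpret prob_space std_normal_distribution by (rule prob_space_std_normal)
  have "distributed std_normal_distribution lborel (\<lambda>x. x) std_normal_density"
    by (auto simp: distributed_def distr_id2 cong: distr_cong)
  from normal_density_affine[OF this, of 1 \<mu>]
  have "distributed std_normal_distribution lborel (\<lambda>x. \<mu> + x) (normal_density \<mu> 1)" by simp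
  then have "distr std_normal_distribution lborel (\<lambda>x. \<mu> + x) = density lborel (normal_density \<mu> 1)" by (simp add: distributed_def)
  then show ?thesis by (simp add: add.commute cong: distr_cong)
qed

text \<open>Moves the non-centrality from the measure into the integrand, so that the law can be
  compared with a shifted standard Gaussian vector.\<close>

lemma noncentral_chi_square_eq:
  assumes k: "k \<ge> 1"
  shows "noncentral_chi_square k c = distr (PiM {1..k} (\<lambda>_. std_normal_distribution)) borel (\<lambda>z. \<Sum>i=1..k. (z i + (if i = 1 then sqrt c else 0))\<^sup>2)"
proof -
  define \<mu> where "\<mu> i = (if i = (1::nat) then sqrt c else 0)" for i
  have K: "(\<Union>i\<in>{1..k}. {i}) = {1..k}" by auto
  have comp: "(\<lambda>f. f i) \<in> borel_measurable (PiM I (\<lambda>_. std_normal_distribution))" if "i \<in> I" for i :: nat and I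
    using measurable_component_singleton[of i I "\<lambda>_. std_normal_distribution"] that by simp
  have "distr (PiM (\<Union>i\<in>{1..k}. {i}) (\<lambda>_. std_normal_distribution)) (PiM {1..k} (\<lambda>_. borel)) (\<lambda>z. \<lambda>i\<in>{1..k}. restrict z {i} i + \<mu> i)
      = PiM {1..k} (\<lambda>i. distr (PiM {i} (\<lambda>_. std_normal_distribution)) borel (\<lambda>f. f i + \<mu> i))"
    by (rule distr_PiM_std_normal_blocks) (use k comp in \<open>auto simp: disjoint_family_on_def intro!: borel_measurable_add\<close>)
  moreover have "distr (PiM {i} (\<lambda>_. std_normal_distribution)) borel (\<lambda>f. f i + \<mu> i) = density lborel (\<lambda>x. ennreal (normal_density (\<mu> i) 1 x))" for i
  proof -
    have d: "distr (PiM {i} (\<lambda>_. std_normal_distribution)) std_normal_distribution (\<lambda>f. f i) = std_normal_distribution"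
      by (rule distr_PiM_component) (auto simp: prob_space_std_normal)
    have "distr (PiM {i} (\<lambda>_. std_normal_distribution)) borel (\<lambda>f. f i + \<mu> i) = distr (distr (PiM {i} (\<lambda>_. std_normal_distribution)) std_normal_distribution (\<lambda>f. f i)) borel (\<lambda>x. x + \<mu> i)"
      using comp[of i "{i}"] by (subst distr_distr) (auto simp: o_def)
    then show ?thesis by (simp only: d distr_std_normal_shift)
  qed
  ultimately have P: "distr (PiM {1..k} (\<lambda>_. std_normal_distribution)) (PiM {1..k} (\<lambda>_. borel)) (\<lambda>z. \<lambda>i\<in>{1..k}. z i + \<mu> i)
      = PiM {1..k} (\<lambda>i. density lborel (\<lambda>x. ennreal (normal_density (\<mu> i) 1 x)))"
    unfolding K by simp
  have s: "(\<lambda>z. \<Sum>i=1..k. (z i)\<^sup>2) \<in> borel_measurable (PiM {1..k} (\<lambda>_. borel :: real measure))"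
    by (intro borel_measurable_sum borel_measurable_power measurable_component_singleton)
  have t: "(\<lambda>z. \<lambda>i\<in>{1..k}. z i + \<mu> i) \<in> measurable (PiM {1..k} (\<lambda>_. std_normal_distribution)) (PiM {1..k} (\<lambda>_. borel))"
    by (intro measurable_restrict borel_measurable_add comp) auto
  have "noncentral_chi_square k c = distr (distr (PiM {1..k} (\<lambda>_. std_normal_distribution)) (PiM {1..k} (\<lambda>_. borel)) (\<lambda>z. \<lambda>i\<in>{1..k}. z i + \<mu> i)) borel (\<lambda>z. \<Sum>i=1..k. (z i)\<^sup>2)"
    unfolding P noncentral_chi_square_def by (simp only: \<mu>_def)
  also have "\<dots> = distr (PiM {1..k} (\<lambda>_. std_normal_distribution)) borel (\<lambda>z. \<Sum>i=1..k. (z i + \<mu> i)\<^sup>2)"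
    by (subst distr_distr[OF s t]) (auto intro!: distr_cong sum.cong)
  finally show ?thesis by (simp only: \<mu>_def)
qed

lemma proj_perp_id: "m $ k = 0 \<Longrightarrow> proj_perp k m = m"
  by (auto simp: vec_eq_iff)

lemma inner_proj_perp: "m $ k = 0 \<Longrightarrow> proj_perp k x \<bullet> m = x \<bullet> m"
  unfolding inner_vec_def by (rule sum.cong) auto

lemma norm_proj_perp_le: "norm (proj_perp k x) \<le> norm x"
  by (rule norm_le_componentwise_cart) auto

lemma proj_perp_householder:
  assumes "u $ k = 0"
  shows "proj_perp k (householder u g) = householder u (proj_perp k g)"
proof -
  have "u \<bullet> proj_perp k g = u \<bullet> g" using inner_proj_perp[OF assms] by (metis inner_commute)
  then show ?thesis unfolding vec_eq_iff householder_def by (simp add: assms)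
qed

lemma distr_std_gauss_householder_invariant:
  assumes f: "f \<in> borel_measurable borel"
  shows "distr std_gauss borel (\<lambda>g. f (householder u g)) = distr (std_gauss :: (real^'p) measure) borel f"
proof -
  have [measurable]: "householder u \<in> borel_measurable borel" for u :: "real^'p"
    using orthogonal_householder[of u]
    by (intro borel_measurable_continuous_onI linear_continuous_on linear_conv_bounded_linear[THEN iffD1])
       (simp add: orthogonal_transformation)
  have "distr std_gauss borel (\<lambda>g. f (householder u g)) = distr (distr std_gauss borel (householder u)) borel f"
    using f by (subst distr_distr) (auto simp: o_def)
  then show ?thesis by (simp add: std_gauss_orthogonal[OF orthogonal_householder])
qed

lemma exists_other_coordinate:
  assumes "CARD('p::finite) \<ge> 2"
  obtains j :: "'p::finite" where "j \<noteq> k"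
proof -
  have "card (UNIV - {k}) \<noteq> 0" using assms by (simp add: card_Diff_singleton)
  then have "UNIV - {k} \<noteq> {}" by (metis card.empty)
  then show thesis using that by blast
qed

text \<open>A reflection along \<open>u\<close> with \<open>u $ k = 0\<close> commutes with the
  projection and preserves the Gaussian law. It rotates the shift onto a coordinate axis
  \<open>j\<close>, after which the coordinates other than \<open>k\<close> are listed with
  \<open>j\<close> in front.\<close>

lemma distr_norm_proj_shift:
  fixes m :: "real^'p"
  assumes p: "CARD('p) \<ge> 2" and m: "m $ k = 0"
  shows "distr std_gauss borel (\<lambda>g. (norm (proj_perp k g + m))\<^sup>2) = noncentral_chi_square (CARD('p) - 1) ((norm m)\<^sup>2)"
proof -
  obtain j :: 'p where j: "j \<noteq> k" using exists_other_coordinate[OF p] by blast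
  define m' :: "real^'p" where "m' = norm m *\<^sub>R axis j 1"
  define u where "u = m - m'"
  have uk: "u $ k = 0" using j m by (simp add: u_def m'_def axis_def)
  have Rm: "householder u m = m'" unfolding u_def by (rule householder_swap) (simp add: m'_def)
  have "norm (proj_perp k g + m) = norm (proj_perp k (householder u g) + m')" for g
  proof -
    have "norm (proj_perp k g + m) = norm (householder u (proj_perp k g + m))"
      using orthogonal_transformation_norm[OF orthogonal_householder] by metis
    also have "householder u (proj_perp k g + m) = householder u (proj_perp k g) + householder u m"
      by (simp add: linear_add[OF orthogonal_transformation_linear[OF orthogonal_householder]])
    finally show ?thesis by (simp add: Rm proj_perp_householder[OF uk])
  qed
  then have "distr std_gauss borel (\<lambda>g. (norm (proj_perp k g + m))\<^sup>2)
     = distr std_gauss borel (\<lambda>g. (norm (proj_perp k (householder u g) + m'))\<^sup>2)" by simp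
  also have "\<dots> = distr std_gauss borel (\<lambda>g. (norm (proj_perp k g + m'))\<^sup>2)"
    by (rule distr_std_gauss_householder_invariant) measurable
  also have "\<dots> = noncentral_chi_square (CARD('p) - 1) ((norm m)\<^sup>2)"
  proof -
    let ?d = "CARD('p) - 1"
    have d: "?d \<ge> 1" using p by simp
    obtain h0 where h0: "bij_betw h0 {2..?d} (UNIV - {k, j})"
    proof -
      have "card {2..?d} = card (UNIV - {k, j})" using j p by (simp add: card_Diff_subset)
      then show thesis using bij_betw_iff_card[of "{2..?d}" "UNIV - {k, j}"] that by auto
    qed
    \<comment> \<open>Index 1 must go to \<open>j\<close>, because
      \<open>noncentral_chi_square\<close> puts the whole shift into its first coordinate.\<close>
    define h where "h i = (if i = 1 then j else h0 i)" for i
    have set: "{1..?d} = insert 1 {2..?d}" using d by auto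
    have h: "bij_betw h {1..?d} (UNIV - {k})"
    proof -
      have "bij_betw h {2..?d} (UNIV - {k, j})" using h0 by (rule bij_betw_cong[THEN iffD1, rotated]) (auto simp: h_def)
      then have "bij_betw h (insert 1 {2..?d}) (insert (h 1) (UNIV - {k, j}))"
        by (subst notIn_Un_bij_betw[of 1, simplified]) (auto simp: h_def)
      moreover have "insert (h 1) (UNIV - {k, j}) = UNIV - {k}" using j by (auto simp: h_def)
      ultimately show ?thesis by (simp add: set)
    qed
    have h1: "h i = j \<longleftrightarrow> i = 1" if "i \<in> {1..?d}" for i
    proof -
      have "h 1 = j" "1 \<in> {1..?d}" using d by (simp_all add: h_def)
      then show ?thesis using inj_on_eq_iff[OF bij_betw_imp_inj_on[OF h] that, of 1] by simp
    qed
    have comp: "(\<lambda>f. f i) \<in> borel_measurable (PiM I (\<lambda>_. std_normal_distribution))" if "i \<in> I" for i and I :: "'i set"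
      using measurable_component_singleton[of i I "\<lambda>_. std_normal_distribution"] that by simp
    have eq: "(norm (proj_perp k (\<chi> i. z i) + m'))\<^sup>2 = (\<Sum>i=1..?d. ((\<lambda>i\<in>{1..?d}. z (h i)) i + (if i = 1 then norm m else 0))\<^sup>2)" for z :: "'p \<Rightarrow> real"
    proof -
      have "(norm (proj_perp k (\<chi> i. z i) + m'))\<^sup>2 = (\<Sum>i\<in>UNIV. ((proj_perp k (\<chi> i. z i) + m') $ i)\<^sup>2)"
        by (simp add: norm_vec_def L2_set_def sum_nonneg)
      also have "\<dots> = (\<Sum>i\<in>UNIV - {k}. ((proj_perp k (\<chi> i. z i) + m') $ i)\<^sup>2)"
        using j by (intro sum.mono_neutral_right) (auto simp: m'_def axis_def)
      also have "\<dots> = (\<Sum>i=1..?d. ((proj_perp k (\<chi> i. z i) + m') $ h i)\<^sup>2)"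
        by (rule sum.reindex_bij_betw[OF h, symmetric])
      also have "\<dots> = (\<Sum>i=1..?d. ((\<lambda>i\<in>{1..?d}. z (h i)) i + (if i = 1 then norm m else 0))\<^sup>2)"
      proof (intro sum.cong refl)
        fix i assume i: "i \<in> {1..?d}"
        then have "h i \<noteq> k" using bij_betwE[OF h] by auto
        then show "((proj_perp k (\<chi> i. z i) + m') $ h i)\<^sup>2 = ((\<lambda>i\<in>{1..?d}. z (h i)) i + (if i = 1 then norm m else 0))\<^sup>2"
          using i h1[OF i] by (simp add: m'_def axis_def)
      qed
      finally show ?thesis .
    qed
    have s: "(\<lambda>z. \<Sum>i=1..?d. (z i + (if i = 1 then norm m else 0))\<^sup>2) \<in> borel_measurable (PiM {1..?d} (\<lambda>_. std_normal_distribution))"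
      by (intro borel_measurable_sum borel_measurable_power borel_measurable_add comp borel_measurable_const)
    have t: "(\<lambda>z. \<lambda>i\<in>{1..?d}. z (h i)) \<in> measurable (PiM UNIV (\<lambda>_. std_normal_distribution)) (PiM {1..?d} (\<lambda>_. std_normal_distribution))"
      by (intro measurable_restrict measurable_component_singleton) auto
    have "distr std_gauss borel (\<lambda>g. (norm (proj_perp k g + m'))\<^sup>2) = distr (PiM UNIV (\<lambda>_. std_normal_distribution)) borel (\<lambda>z. (norm (proj_perp k (\<chi> i. z i) + m'))\<^sup>2)"
      unfolding std_gauss_def by (subst distr_distr) (auto simp: o_def)
    also have "\<dots> = distr (distr (PiM UNIV (\<lambda>_. std_normal_distribution)) (PiM {1..?d} (\<lambda>_. std_normal_distribution)) (\<lambda>z. \<lambda>i\<in>{1..?d}. z (h i))) borel (\<lambda>z. \<Sum>i=1..?d. (z i + (if i = 1 then norm m else 0))\<^sup>2)"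
      unfolding eq by (subst distr_distr[OF s t]) (simp add: o_def)
    also have "\<dots> = distr (PiM {1..?d} (\<lambda>_. std_normal_distribution)) borel (\<lambda>z. \<Sum>i=1..?d. (z i + (if i = 1 then norm m else 0))\<^sup>2)"
      by (subst distr_PiM_std_normal_reindex) (use h in \<open>auto simp: bij_betw_def\<close>)
    also have "\<dots> = noncentral_chi_square ?d ((norm m)\<^sup>2)" 
    proof -
      have "sqrt ((norm m)\<^sup>2) = norm m" by simp
      then show ?thesis unfolding noncentral_chi_square_eq[OF d] by (simp only:)
    qed
    finally show ?thesis .
  qed
  finally show ?thesis .
qed

text \<open>The level set is the zero set of a nonzero polynomial. This gives continuity of the
  limiting distribution functions, and with zero shift and level it shows that the projected vector
  has a direction almost surely.\<close>

lemma AE_norm_proj_shift_neq: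
  fixes m :: "real^'p"
  assumes p: "CARD('p) \<ge> 2"
  shows "AE g in std_gauss. (norm (proj_perp k g + m))\<^sup>2 \<noteq> q"
proof -
  obtain j :: 'p where j: "j \<noteq> k" using exists_other_coordinate[OF p] by blast
  define f where "f z = (\<Sum>i\<in>UNIV. ((if i = k then 0 else z i) + m $ i) * ((if i = k then 0 else z i) + m $ i)) - q" for z :: "'p \<Rightarrow> real"
  have f: "f z = (norm (proj_perp k (\<chi> i. z i) + m))\<^sup>2 - q" for z
    by (simp add: f_def norm_vec_def L2_set_def sum_nonneg power2_eq_square cong: if_cong)
  have "poly_fun (\<lambda>z. if i = k then 0 else z i)" for i by (cases "i = k") (auto intro: poly_fun.intros)
  then have poly: "poly_fun f" unfolding f_def
    by (intro poly_fun_diff poly_fun_sum poly_fun.mult poly_fun.add poly_fun.const)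
  \<comment> \<open>After the shift the coordinate \<open>j\<close> equals |q| + 1, whose square
    exceeds |q|.\<close>
  define c :: "'p \<Rightarrow> real" where "c i = (if i = j then \<bar>q\<bar> + 1 - m $ j else 0)" for i
  have "\<bar>q\<bar> < (\<bar>q\<bar> + 1)\<^sup>2" by (simp add: power2_eq_square algebra_simps add_pos_nonneg)
  also have "\<dots> = ((proj_perp k (\<chi> i. c i) + m) $ j)\<^sup>2" using j by (simp add: c_def)
  also have "\<dots> \<le> (norm (proj_perp k (\<chi> i. c i) + m))\<^sup>2"
    using component_le_norm_cart[of "proj_perp k (\<chi> i. c i) + m" j] by (metis abs_ge_zero power2_abs power_mono)
  finally have "f c \<noteq> 0" by (simp add: f)
  then have "AE z in PiM UNIV (\<lambda>_. std_normal_distribution). f z \<noteq> 0"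
    by (intro AE_poly_fun_nonzero[OF poly, of UNIV c]) auto
  then show ?thesis
    unfolding std_gauss_def by (subst AE_distr_iff) (auto simp: f)
qed

section \<open>Asymptotics of the statistic\<close>

text \<open>Serves as the covariance with a = r v, as its symmetric square root with 1 + a = sqrt (1
  + r v), and as the inverse of the covariance.\<close>

definition spike_mat :: "real \<Rightarrow> real^'p \<Rightarrow> real^'p^'p" where
  "spike_mat a \<theta> = mat 1 + a *\<^sub>R outer_product \<theta> \<theta>"

lemma spike_mat_mult: "spike_mat a \<theta> *v w = w + (a * (\<theta> \<bullet> w)) *\<^sub>R \<theta>"
  by (simp add: spike_mat_def matrix_vector_mult_add_rdistrib outer_product_mult flip: scaleR_matrix_vector_assoc)

lemma transpose_spike_mat: "transpose (spike_mat a \<theta>) = spike_mat a \<theta>"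
  by (simp add: spike_mat_def transpose_def vec_eq_iff outer_product_def mat_def)

lemma orthogonal_matrix_with_column:
  fixes \<theta> :: "real^'p"
  assumes "norm \<theta> = 1"
  obtains U where "orthogonal_matrix U" "U *v axis k 1 = \<theta>"
proof -
  define f where "f = householder (axis k 1 - \<theta>)"
  have o: "orthogonal_transformation f" unfolding f_def by (rule orthogonal_householder)
  then have lin: "linear f" by (simp add: orthogonal_transformation)
  have "f (axis k 1) = \<theta>" unfolding f_def by (rule householder_swap) (simp add: assms)
  then show thesis
    using that[of "matrix f"] o lin by (auto simp: orthogonal_transformation_matrix matrix_works)
qed

lemma orthogonal_matrix_mult_inverse:
  fixes T :: "real^'p^'p"
  assumes "orthogonal_matrix T"
  shows "T *v (transpose T *v w) = w" "transpose T *v (T *v w) = w" "norm (T *v w) = norm w"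
    "norm (transpose T *v w) = norm w"
proof -
  have t: "T ** transpose T = mat 1" "transpose T ** T = mat 1" using assms by (auto simp: orthogonal_matrix_def)
  show 1: "T *v (transpose T *v w) = w" "transpose T *v (T *v w) = w" for w
    by (simp_all only: matrix_vector_mul_assoc t matrix_vector_mul_lid)
  show 2: "norm (T *v w) = norm w" for w
    using orthogonal_transformation_norm[of "(*v) T" w] assms by (simp add: orthogonal_transformation_matrix)
  show "norm (transpose T *v w) = norm w" using 2[of "transpose T *v w"] 1 by simp
qed

lemma spike_mat_eq_diag:
  fixes \<theta> :: "real^'p"
  assumes U: "orthogonal_matrix U" "U *v axis k 1 = \<theta>"
  shows "spike_mat a \<theta> = U ** diag_mat (\<lambda>j. if j = k then 1 + a else 1) ** transpose U"
proof (rule matrix_eq[THEN iffD2], rule allI)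
  fix w
  define y where "y = transpose U *v w"
  have yk: "y $ k = \<theta> \<bullet> w"
    using inner_transpose_mult[of "axis k 1" U w] by (simp add: y_def U inner_axis' del: transpose_matrix_vector)
  have "diag_mat (\<lambda>j. if j = k then 1 + a else 1) *v y = y + (a * (y $ k)) *\<^sub>R axis k 1"
    by (auto simp: diag_mat_mult vec_eq_iff axis_def algebra_simps)
  then have "U *v (diag_mat (\<lambda>j. if j = k then 1 + a else 1) *v y) = U *v y + (a * (y $ k)) *\<^sub>R \<theta>"
    by (simp add: matrix_vector_right_distrib matrix_vector_mult_scaleR U)
  also have "U *v y = w" unfolding y_def by (rule orthogonal_matrix_mult_inverse[OF U(1)])
  finally show "spike_mat a \<theta> *v w = U ** diag_mat (\<lambda>j. if j = k then 1 + a else 1) ** transpose U *v w"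
    by (simp only: matrix_vector_mul_assoc[symmetric] y_def[symmetric] spike_mat_mult yk)
qed

lemma spike_mat_square:
  assumes \<theta>: "norm \<theta> = 1" and a: "a * (2 + a) = b"
  shows "spike_mat a \<theta> *v (spike_mat a \<theta> *v w) = w + (b * (\<theta> \<bullet> w)) *\<^sub>R \<theta>"
    and "(norm (spike_mat a \<theta> *v w))\<^sup>2 = (norm w)\<^sup>2 + b * (\<theta> \<bullet> w)\<^sup>2"
proof -
  have tt: "\<theta> \<bullet> \<theta> = 1" using \<theta> by (simp add: norm_eq_1)
  have "spike_mat a \<theta> *v (spike_mat a \<theta> *v w) = w + (a * (\<theta> \<bullet> w) + a * (\<theta> \<bullet> w + a * (\<theta> \<bullet> w))) *\<^sub>R \<theta>"
    by (simp add: spike_mat_mult inner_add_right tt scaleR_add_left)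
  also have "a * (\<theta> \<bullet> w) + a * (\<theta> \<bullet> w + a * (\<theta> \<bullet> w)) = b * (\<theta> \<bullet> w)"
    by (simp add: a[symmetric] algebra_simps)
  finally show "spike_mat a \<theta> *v (spike_mat a \<theta> *v w) = w + (b * (\<theta> \<bullet> w)) *\<^sub>R \<theta>" .
  show "(norm (spike_mat a \<theta> *v w))\<^sup>2 = (norm w)\<^sup>2 + b * (\<theta> \<bullet> w)\<^sup>2"
    unfolding spike_mat_mult power2_norm_eq_inner
    by (simp add: inner_add_left inner_add_right tt inner_commute a[symmetric] power2_eq_square algebra_simps)
qed

lemma spike_root:
  assumes "b > 0"
  shows "(sqrt (1 + b) - 1) * (2 + (sqrt (1 + b) - 1)) = b"
proof -
  have "(sqrt (1 + b))\<^sup>2 = 1 + b" using assms by simp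
  then show ?thesis by (simp add: power2_eq_square algebra_simps)
qed

text \<open>The square root of the covariance may be followed on the right by any orthogonal
  \<open>T\<close> without changing the law. All hypotheses of sample size n thus become images of
  one Gaussian array, and a common \<open>T\<close> can align the null direction with an
  axis.\<close>

lemma spiked_model_eq_distr:
  fixes \<theta> :: "real^'p"
  assumes T: "orthogonal_matrix T" and \<theta>: "norm \<theta> = 1" and n: "n \<ge> 1" and rv: "r n * v > 0"
    and L: "L = spike_mat (sqrt (1 + r n * v) - 1) \<theta> ** T"
  shows "spiked_model r v n \<theta> = distr (gauss_array n) (sample_space n) (\<lambda>z. \<lambda>i\<in>{1..n}. L *v (\<chi> j. z (i, j)))"
proof -
  define a where "a = sqrt (1 + r n * v) - 1"
  obtain k :: 'p where True by blast
  obtain U where U: "orthogonal_matrix U" "U *v axis k 1 = \<theta>" using orthogonal_matrix_with_column[OF \<theta>] by blast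
  have a1: "1 + a \<noteq> 0" using rv by (simp add: a_def)
  have V: "orthogonal_matrix (transpose U ** T)" using U T by (intro orthogonal_matrix_mul) auto
  have L': "L = U ** diag_mat (\<lambda>j. if j = k then 1 + a else 1) ** (transpose U ** T)"
    unfolding L a_def[symmetric] spike_mat_eq_diag[OF U] by (simp only: matrix_mul_assoc)
  have "L ** transpose L = mat 1 + (r n * v) *\<^sub>R outer_product \<theta> \<theta>"
  proof (rule matrix_eq[THEN iffD2], rule allI)
    fix w
    have "L ** transpose L *v w = spike_mat a \<theta> *v (spike_mat a \<theta> *v w)"
      by (simp only: L a_def[symmetric] matrix_transpose_mul transpose_spike_mat matrix_vector_mul_assoc[symmetric]
          orthogonal_matrix_mult_inverse[OF T])
    then show "L ** transpose L *v w = (mat 1 + (r n * v) *\<^sub>R outer_product \<theta> \<theta>) *v w"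
      using spike_mat_mult[of "r n * v" \<theta> w] spike_mat_square(1)[OF \<theta> spike_root[OF rv]] by (simp only: spike_mat_def a_def)
  qed
  then show ?thesis
    using distr_gauss_array_sample[OF U(1) V _ L' n] a1 by (simp add: spiked_model_def)
qed

text \<open>The sample covariance of the standard Gaussian array minus the identity.\<close>

definition dev_mat :: "nat \<Rightarrow> (nat \<times> 'p \<Rightarrow> real) \<Rightarrow> real^'p^'p" where
  "dev_mat n z = (\<chi> a b. moment_dev n z a b - coord_mean n z a * coord_mean n z b)"

lemma sample_cov_gauss:
  assumes n: "n \<ge> 1"
  shows "sample_cov n (\<lambda>i. \<chi> j. z (i, j)) *v w = w + dev_mat n z *v w"
proof -
  have "sample_cov n (\<lambda>i. \<chi> j. z (i, j)) = mat 1 + dev_mat n z"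
  proof (simp only: vec_eq_iff, intro allI)
    fix a b
    define ma where "ma = coord_mean n z a"
    define mb where "mb = coord_mean n z b"
    have s: "(\<Sum>i=1..n. z (i, a)) = n * ma" "(\<Sum>i=1..n. z (i, b)) = n * mb" using n by (simp_all add: ma_def mb_def coord_mean_def)
    have "sample_cov n (\<lambda>i. \<chi> j. z (i, j)) $ a $ b = 1 / n * (\<Sum>i=1..n. (z (i, a) - ma) * (z (i, b) - mb))"
      by (simp add: sample_cov_nth sample_mean_nth ma_def mb_def coord_mean_def)
    also have "(\<Sum>i=1..n. (z (i, a) - ma) * (z (i, b) - mb))
        = (\<Sum>i=1..n. z (i, a) * z (i, b)) - mb * (\<Sum>i=1..n. z (i, a)) - ma * (\<Sum>i=1..n. z (i, b)) + n * (ma * mb)"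
      by (simp add: algebra_simps sum.distrib sum_subtractf sum_distrib_left)
    also have "1 / n * \<dots> = 1 / n * (\<Sum>i=1..n. z (i, a) * z (i, b)) - ma * mb"
      unfolding s using n by (simp add: field_simps)
    finally show "sample_cov n (\<lambda>i. \<chi> j. z (i, j)) $ a $ b = (mat 1 + dev_mat n z) $ a $ b"
      by (simp add: dev_mat_def moment_dev_def mat_def ma_def mb_def)
  qed
  then show ?thesis by (simp add: matrix_vector_mult_add_rdistrib)
qed

lemma sample_cov_linear:
  "sample_cov n (\<lambda>i. L *v y i) *v w = L *v (sample_cov n y *v (transpose L *v w))"
proof -
  have m: "sample_mean n (\<lambda>i. L *v y i) = L *v sample_mean n y"
    by (simp add: sample_mean_def matrix_vector_mult_scaleR linear_sum[OF matrix_vector_mul_linear])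
  have o: "outer_product (L *v a) (L *v a) *v w = L *v (outer_product a a *v (transpose L *v w))" for a
    by (simp add: outer_product_mult matrix_vector_mult_scaleR inner_transpose_mult del: transpose_matrix_vector)
  show ?thesis
    unfolding sample_cov_def m
    by (simp add: matrix_vector_mult_diff_distrib[symmetric] matrix_vector_mult_sum_left o matrix_vector_mult_scaleR
        linear_sum[OF matrix_vector_mul_linear] del: transpose_matrix_vector flip: scaleR_matrix_vector_assoc)
qed

text \<open>A crude bound for the operator norm, chosen because \<open>tight_bound\<close> controls
  entries.\<close>

definition entry_sum :: "real^'n^'m \<Rightarrow> real" where
  "entry_sum B = (\<Sum>a\<in>UNIV. \<Sum>b\<in>UNIV. \<bar>B $ a $ b\<bar>)"

lemma entry_sum_nonneg: "entry_sum B \<ge> 0"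
  unfolding entry_sum_def by (intro sum_nonneg) auto

lemma norm_matrix_mult_le_entry_sum: "norm (B *v w) \<le> entry_sum B * norm w"
proof -
  have "norm (B *v w) \<le> (\<Sum>a\<in>UNIV. \<bar>(B *v w) $ a\<bar>)" by (rule norm_le_l1_cart)
  also have "\<dots> \<le> (\<Sum>a\<in>UNIV. \<Sum>b\<in>UNIV. \<bar>B $ a $ b\<bar> * norm w)"
  proof (intro sum_mono)
    fix a
    have "\<bar>(B *v w) $ a\<bar> \<le> (\<Sum>b\<in>UNIV. \<bar>B $ a $ b * w $ b\<bar>)" unfolding matrix_vector_mult_nth by (rule sum_abs)
    also have "\<dots> \<le> (\<Sum>b\<in>UNIV. \<bar>B $ a $ b\<bar> * norm w)"
      by (intro sum_mono) (auto simp: abs_mult intro!: mult_left_mono component_le_norm_cart)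
    finally show "\<bar>(B *v w) $ a\<bar> \<le> (\<Sum>b\<in>UNIV. \<bar>B $ a $ b\<bar> * norm w)" .
  qed
  finally show ?thesis by (simp add: entry_sum_def sum_distrib_right)
qed

lemma tight_boundD:
  assumes "tight_bound n k z \<le> K"
  shows "sqrt n * (\<Sum>a\<in>UNIV. \<Sum>b\<in>UNIV. \<bar>moment_dev n z a b\<bar>) \<le> K"
    and "sqrt n * (\<Sum>a\<in>UNIV. \<bar>coord_mean n z a\<bar>) \<le> K"
    and "norm (score n k z) \<le> K" and "K \<ge> 0"
proof -
  let ?A = "\<Sum>a\<in>UNIV. \<Sum>b\<in>UNIV. \<bar>moment_dev n z a b\<bar>" and ?B = "\<Sum>a\<in>UNIV. \<bar>coord_mean n z a\<bar>"
  have t: "tight_bound n k z = sqrt n * ?A + sqrt n * ?B + norm (score n k z)"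
    by (simp add: tight_bound_def abs_mult sum_distrib_left)
  have "0 \<le> sqrt n * ?A" "0 \<le> sqrt n * ?B" by (intro mult_nonneg_nonneg sum_nonneg; simp)+
  then show "sqrt n * ?A \<le> K" "sqrt n * ?B \<le> K" "norm (score n k z) \<le> K" "K \<ge> 0"
    using assms norm_ge_zero[of "score n k z"] unfolding t by linarith+
qed

lemma entry_sum_dev_mat:
  assumes t: "tight_bound n k z \<le> K" and n: "n \<ge> 1"
  shows "sqrt n * entry_sum (dev_mat n z) \<le> K + K\<^sup>2"
proof -
  let ?A = "\<Sum>a\<in>UNIV. \<Sum>b\<in>UNIV. \<bar>moment_dev n z a b\<bar>" and ?B = "\<Sum>a\<in>UNIV. \<bar>coord_mean n z a\<bar>"
  have B0: "0 \<le> ?B" by (intro sum_nonneg) auto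
  have s1: "sqrt n \<ge> 1" using n by simp
  have "entry_sum (dev_mat n z) \<le> (\<Sum>a\<in>UNIV. \<Sum>b\<in>UNIV. \<bar>moment_dev n z a b\<bar> + \<bar>coord_mean n z a\<bar> * \<bar>coord_mean n z b\<bar>)"
    unfolding entry_sum_def dev_mat_def by (intro sum_mono) (simp add: order_trans[OF abs_triangle_ineq4] abs_mult)
  also have "\<dots> = ?A + ?B * ?B" by (simp add: sum.distrib sum_product)
  finally have "sqrt n * entry_sum (dev_mat n z) \<le> sqrt n * (?A + ?B * ?B)"
    by (rule mult_left_mono) simp
  then have "sqrt n * entry_sum (dev_mat n z) \<le> sqrt n * ?A + sqrt n * (?B * ?B)"
    by (simp only: distrib_left)
  \<comment> \<open>The product of means is of the smaller order 1/n; bounding sqrt n by n is enough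
    here and produces the term K^2.\<close>
  also have "sqrt n * (?B * ?B) \<le> (sqrt n * ?B) * (sqrt n * ?B)"
    using mult_right_mono[OF s1, of "sqrt n * (?B * ?B)"] B0 by (simp add: mult_ac)
  also have "\<dots> \<le> K * K" using tight_boundD(2,4)[OF t] B0 by (intro mult_mono) auto
  finally show ?thesis using tight_boundD(1)[OF t] by (simp add: power2_eq_square)
qed

text \<open>Here the score enters: the off-diagonal second moments of column \<open>k\<close> are
  the length of the vector of k-th coordinates times the score, and only the product of means is
  left over.\<close>

lemma dev_mat_column:
  assumes n: "n \<ge> 1"
  shows "sqrt n *\<^sub>R proj_perp k (dev_mat n z *v axis k 1) = sqrt (1 + moment_dev n z k k) *\<^sub>R score n k z
     - (sqrt n * coord_mean n z k) *\<^sub>R proj_perp k (\<chi> a. coord_mean n z a)"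
proof (simp only: vec_eq_iff, rule allI)
  fix j
  show "(sqrt n *\<^sub>R proj_perp k (dev_mat n z *v axis k 1)) $ j = (sqrt (1 + moment_dev n z k k) *\<^sub>R score n k z
     - (sqrt n * coord_mean n z k) *\<^sub>R proj_perp k (\<chi> a. coord_mean n z a)) $ j"
  proof (cases "j = k")
    case True then show ?thesis by (simp add: score_def)
  next
    case False
    let ?u = "\<Sum>i=1..n. (z (i, k))\<^sup>2"
    have s: "sqrt (1 + moment_dev n z k k) = sqrt ?u / sqrt n"
      by (simp add: moment_dev_def power2_eq_square real_sqrt_divide)
    have "(\<Sum>i=1..n. z (i, j) * z (i, k)) = sqrt ?u * score n k z $ j"
      using False sum_unit_coeff_mult[where n=n and u="\<lambda>i. z (i, k)" and y="\<lambda>i. z (i, j)"] by (simp add: score_def mult.commute)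
    then have "sqrt n * moment_dev n z j k = sqrt (1 + moment_dev n z k k) * score n k z $ j"
    proof -
      assume S: "(\<Sum>i=1..n. z (i, j) * z (i, k)) = sqrt ?u * score n k z $ j"
      have "sqrt n * moment_dev n z j k = (sqrt n / n) * (sqrt ?u * score n k z $ j)"
        using False by (simp add: moment_dev_def S)
      also have "sqrt n / n = 1 / sqrt n"
        using n by (simp add: field_simps)
      finally show ?thesis by (simp only: s) simp
    qed
    then show ?thesis using False
      by (simp add: dev_mat_def right_diff_distrib mult_ac matrix_vector_mul_component inner_axis)
  qed
qed

section \<open>Limits along a filter of bounded arrays\<close>

lemma tendsto_norm_sq_diff:
  fixes f g :: "'a \<Rightarrow> 'b::real_normed_vector"
  assumes fg: "((\<lambda>x. f x - g x) \<longlongrightarrow> 0) F" and g: "\<forall>\<^sub>F x in F. norm (g x) \<le> C"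
  shows "((\<lambda>x. (norm (f x))\<^sup>2 - (norm (g x))\<^sup>2) \<longlongrightarrow> 0) F"
proof (rule Lim_null_comparison)
  show "\<forall>\<^sub>F x in F. norm ((norm (f x))\<^sup>2 - (norm (g x))\<^sup>2) \<le> norm (f x - g x) * (norm (f x - g x) + 2 * C)"
    using g
  proof eventually_elim
    case (elim x)
    have "(norm (f x))\<^sup>2 - (norm (g x))\<^sup>2 = (norm (f x) - norm (g x)) * (norm (f x) + norm (g x))"
      by (simp add: power2_eq_square algebra_simps)
    then have "norm ((norm (f x))\<^sup>2 - (norm (g x))\<^sup>2) = \<bar>norm (f x) - norm (g x)\<bar> * (norm (f x) + norm (g x))"
      by (simp add: abs_mult)
    also have "\<dots> \<le> norm (f x - g x) * (norm (f x - g x) + 2 * C)"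
      using norm_triangle_ineq2[of "f x" "g x"] elim by (intro mult_mono norm_triangle_ineq3) auto
    finally show ?case .
  qed
  have n: "((\<lambda>x. norm (f x - g x)) \<longlongrightarrow> 0) F" using fg by (simp add: tendsto_norm_zero_iff)
  have "((\<lambda>x. norm (f x - g x) * (norm (f x - g x) + 2 * C)) \<longlongrightarrow> 0 * (0 + 2 * C)) F"
    by (intro tendsto_intros n)
  then show "((\<lambda>x. norm (f x - g x) * (norm (f x - g x) + 2 * C)) \<longlongrightarrow> 0) F" by simp
qed

lemma tendsto_scaleR_null_bounded:
  fixes g :: "'a \<Rightarrow> 'b::real_normed_vector"
  assumes f: "(f \<longlongrightarrow> 0) F" and g: "\<forall>\<^sub>F x in F. norm (g x) \<le> C"
  shows "((\<lambda>x. f x *\<^sub>R g x) \<longlongrightarrow> 0) F"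
proof (rule Lim_null_comparison)
  show "\<forall>\<^sub>F x in F. norm (f x *\<^sub>R g x) \<le> \<bar>f x\<bar> * C"
    using g by eventually_elim (simp add: mult_left_mono)
  show "((\<lambda>x. \<bar>f x\<bar> * C) \<longlongrightarrow> 0) F"
    using tendsto_mult_left_zero[OF tendsto_rabs_zero[OF f], of C] by simp
qed

lemma norm_matrix_mult_tendsto_null:
  fixes B :: "'a \<Rightarrow> real^'n^'n"
  assumes g: "(g \<longlongrightarrow> 0) F" and B: "\<forall>\<^sub>F x in F. entry_sum (B x) \<le> C"
  shows "((\<lambda>x. B x *v g x) \<longlongrightarrow> 0) F"
proof (rule Lim_null_comparison)
  show "\<forall>\<^sub>F x in F. norm (B x *v g x) \<le> C * norm (g x)"
    using B by eventually_elim (metis norm_matrix_mult_le_entry_sum norm_ge_zero mult_right_mono order_trans)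
  show "((\<lambda>x. C * norm (g x)) \<longlongrightarrow> 0) F"
    using tendsto_mult_right_zero[OF tendsto_norm_zero[OF g], of C] .
qed

lemma entry_sum_scaleR: "entry_sum (c *\<^sub>R B) = \<bar>c\<bar> * entry_sum B"
  by (simp add: entry_sum_def abs_mult sum_distrib_left)

text \<open>Sample size, array and spike size are functions of one abstract index. This admits
  subsequences, and indices that carry the array or a direction as a component.\<close>

locale spiked_limit =
  fixes F :: "'a filter" and n :: "'a \<Rightarrow> nat" and z :: "'a \<Rightarrow> nat \<times> 'p::finite \<Rightarrow> real"
    and \<rho> :: "'a \<Rightarrow> real" and v \<delta> K :: real and k :: 'p
  assumes n: "filterlim n at_top F" and v: "v > 0" and \<delta>: "\<delta> \<ge> 0"
    and \<rho>_pos: "\<forall>\<^sub>F x in F. \<rho> x > 0" and \<rho>: "(\<rho> \<longlongrightarrow> \<delta>) F"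
    and n\<rho>: "filterlim (\<lambda>x. sqrt (n x) * \<rho> x) at_top F"
    and tight: "\<forall>\<^sub>F x in F. tight_bound (n x) k (z x) \<le> K"
begin

text \<open>The quantity 1 + a is the square root of the largest eigenvalue of the covariance, and
  \<open>\<sigma>\<close> is its limit.\<close>

definition "a x = sqrt (1 + \<rho> x * v) - 1"
definition "\<sigma> = sqrt (1 + \<delta> * v)"

lemma \<sigma>: "\<sigma> > 0" "\<sigma>\<^sup>2 = 1 + \<delta> * v"
proof -
  have "1 + \<delta> * v > 0" using \<delta> v by (intro add_pos_nonneg) auto
  then show "\<sigma> > 0" "\<sigma>\<^sup>2 = 1 + \<delta> * v" by (simp_all add: \<sigma>_def)
qed

lemma a: "((\<lambda>x. 1 + a x) \<longlongrightarrow> \<sigma>) F"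
  unfolding a_def \<sigma>_def by (auto intro!: tendsto_intros \<rho>)

lemma a0: "(a \<longlongrightarrow> \<sigma> - 1) F"
  using tendsto_diff[OF a tendsto_const[of 1]] by simp

lemma n1: "\<forall>\<^sub>F x in F. n x \<ge> 1"
  using n by (auto simp: filterlim_at_top)

lemma sqrt_n: "filterlim (\<lambda>x. sqrt (n x)) at_top F"
  by (rule filterlim_compose[OF sqrt_at_top filterlim_compose[OF filterlim_real_sequentially n]])

lemma bounded_over_sqrt_n:
  assumes "\<forall>\<^sub>F x in F. \<bar>sqrt (n x) * f x\<bar> \<le> C"
  shows "(f \<longlongrightarrow> 0) F"
proof (rule Lim_null_comparison)
  show "\<forall>\<^sub>F x in F. norm (f x) \<le> C / sqrt (n x)"
    using assms n1 by eventually_elim (simp add: field_simps abs_mult)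
  show "((\<lambda>x. C / sqrt (n x)) \<longlongrightarrow> 0) F"
    by (rule real_tendsto_divide_at_top[OF tendsto_const sqrt_n])
qed

text \<open>The place where the divergence of sqrt n rho acts: deviations of order 1/sqrt n vanish
  even relative to the spike.\<close>

lemma bounded_over_sqrt_n_\<rho>:
  assumes "\<forall>\<^sub>F x in F. \<bar>sqrt (n x) * f x\<bar> \<le> C"
  shows "((\<lambda>x. f x / \<rho> x) \<longlongrightarrow> 0) F"
proof (rule Lim_null_comparison)
  show "\<forall>\<^sub>F x in F. norm (f x / \<rho> x) \<le> C / (sqrt (n x) * \<rho> x)"
    using assms n1 \<rho>_pos by eventually_elim (simp add: field_simps abs_mult)
  show "((\<lambda>x. C / (sqrt (n x) * \<rho> x)) \<longlongrightarrow> 0) F"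
    by (rule real_tendsto_divide_at_top[OF tendsto_const n\<rho>])
qed

lemma dev_mat_bound: "\<forall>\<^sub>F x in F. sqrt (n x) * entry_sum (dev_mat (n x) (z x)) \<le> K + K\<^sup>2"
  using tight n1 by eventually_elim (rule entry_sum_dev_mat)

lemma dev_mat_null: "((\<lambda>x. entry_sum (dev_mat (n x) (z x))) \<longlongrightarrow> 0) F"
  by (rule bounded_over_sqrt_n) (use dev_mat_bound in eventually_elim, simp add: entry_sum_nonneg abs_mult)

lemma moment_dev_bound: "\<forall>\<^sub>F x in F. \<bar>sqrt (n x) * moment_dev (n x) (z x) b c\<bar> \<le> K"
  using tight
proof eventually_elim
  case (elim x)
  have "\<bar>moment_dev (n x) (z x) b c\<bar> \<le> (\<Sum>c\<in>UNIV. \<bar>moment_dev (n x) (z x) b c\<bar>)"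
    by (rule member_le_sum) auto
  also have "\<dots> \<le> (\<Sum>b\<in>UNIV. \<Sum>c\<in>UNIV. \<bar>moment_dev (n x) (z x) b c\<bar>)"
    by (rule member_le_sum) (auto intro: sum_nonneg)
  finally have "sqrt (n x) * \<bar>moment_dev (n x) (z x) b c\<bar> \<le> sqrt (n x) * (\<Sum>b\<in>UNIV. \<Sum>c\<in>UNIV. \<bar>moment_dev (n x) (z x) b c\<bar>)"
    by (rule mult_left_mono) simp
  also have "\<dots> \<le> K" by (rule tight_boundD(1)[OF elim])
  finally show ?case by (simp add: abs_mult)
qed

lemma moment_dev_null: "((\<lambda>x. moment_dev (n x) (z x) b c) \<longlongrightarrow> 0) F"
  by (rule bounded_over_sqrt_n[OF moment_dev_bound])

lemma coord_mean_bound: "\<forall>\<^sub>F x in F. \<bar>sqrt (n x) * coord_mean (n x) (z x) b\<bar> \<le> K"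
  using tight
proof eventually_elim
  case (elim x)
  have "\<bar>coord_mean (n x) (z x) b\<bar> \<le> (\<Sum>b\<in>UNIV. \<bar>coord_mean (n x) (z x) b\<bar>)"
    by (rule member_le_sum) auto
  then have "sqrt (n x) * \<bar>coord_mean (n x) (z x) b\<bar> \<le> sqrt (n x) * (\<Sum>b\<in>UNIV. \<bar>coord_mean (n x) (z x) b\<bar>)"
    by (rule mult_left_mono) simp
  also have "\<dots> \<le> K" by (rule tight_boundD(2)[OF elim])
  finally show ?case by (simp add: abs_mult)
qed

lemma score_bound: "\<forall>\<^sub>F x in F. norm (score (n x) k (z x)) \<le> K"
  using tight by eventually_elim (rule tight_boundD(3))

lemma scale_limit: "((\<lambda>x. sqrt (1 + moment_dev (n x) (z x) k k)) \<longlongrightarrow> 1) F"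
  using tendsto_real_sqrt[OF tendsto_add[OF tendsto_const[of 1] moment_dev_null[of k k]]] by simp

text \<open>In \<open>dev_mat_column\<close> the scale factor tends to 1, and the mean term is a
  bounded factor times a null one.\<close>

lemma column_limit:
  "((\<lambda>x. sqrt (n x) *\<^sub>R proj_perp k (dev_mat (n x) (z x) *v axis k 1) - score (n x) k (z x)) \<longlongrightarrow> 0) F"
proof -
  have mean: "((\<lambda>x. \<chi> b. coord_mean (n x) (z x) b) \<longlongrightarrow> 0) F"
    using bounded_over_sqrt_n[OF coord_mean_bound] by (intro vec_tendstoI) simp
  have 1: "((\<lambda>x. (sqrt (1 + moment_dev (n x) (z x) k k) - 1) *\<^sub>R score (n x) k (z x)) \<longlongrightarrow> 0) F"
    by (rule tendsto_scaleR_null_bounded[OF _ score_bound]) (use tendsto_diff[OF scale_limit tendsto_const[of 1]] in simp)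
  have 2: "((\<lambda>x. (sqrt (n x) * coord_mean (n x) (z x) k) *\<^sub>R proj_perp k (\<chi> b. coord_mean (n x) (z x) b)) \<longlongrightarrow> 0) F"
  proof (rule Lim_null_comparison)
    show "\<forall>\<^sub>F x in F. norm ((sqrt (n x) * coord_mean (n x) (z x) k) *\<^sub>R proj_perp k (\<chi> b. coord_mean (n x) (z x) b)) \<le> K * norm (\<chi> b. coord_mean (n x) (z x) b)"
      using coord_mean_bound[of k] by eventually_elim (simp only: norm_scaleR, intro mult_mono norm_proj_perp_le, auto)
    show "((\<lambda>x. K * norm (\<chi> b. coord_mean (n x) (z x) b)) \<longlongrightarrow> 0) F"
      using tendsto_mult_right_zero[OF tendsto_norm_zero[OF mean], of K] .
  qed
  have "\<forall>\<^sub>F x in F. (sqrt (1 + moment_dev (n x) (z x) k k) - 1) *\<^sub>R score (n x) k (z x)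
     - (sqrt (n x) * coord_mean (n x) (z x) k) *\<^sub>R proj_perp k (\<chi> b. coord_mean (n x) (z x) b)
     = sqrt (n x) *\<^sub>R proj_perp k (dev_mat (n x) (z x) *v axis k 1) - score (n x) k (z x)"
    using n1 by eventually_elim (simp add: dev_mat_column scaleR_diff_left)
  then show ?thesis using tendsto_cong tendsto_diff[OF 1 2] by force
qed

end

section \<open>The sample covariance under a local alternative\<close>

lemma sample_cov_spiked_mult:
  fixes z :: "nat \<times> 'p::finite \<Rightarrow> real"
  assumes n: "n \<ge> 1" and y: "y = transpose T *v (spike_mat a \<theta> *v w)"
  shows "sample_cov n (\<lambda>i\<in>{1..n}. (spike_mat a \<theta> ** T) *v (\<chi> j. z (i, j))) *v w = spike_mat a \<theta> *v (T *v (y + dev_mat n z *v y))"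
proof -
  have "sample_cov n (\<lambda>i\<in>{1..n}. (spike_mat a \<theta> ** T) *v (\<chi> j. z (i, j))) = sample_cov n (\<lambda>i. (spike_mat a \<theta> ** T) *v (\<chi> j. z (i, j)))"
    by (rule sample_cov_cong) simp
  then show ?thesis
    by (simp only: sample_cov_linear sample_cov_gauss[OF n] matrix_transpose_mul transpose_spike_mat y
        matrix_vector_mul_assoc[symmetric])
qed

text \<open>The three summands of \<open>\<eta>\<close> pay for the sampling error, for replacing
  \<open>\<rho>\<close> by its limit, and for replacing the true direction by the null
  direction.\<close>

lemma sample_cov_spiked_close:
  fixes z :: "nat \<times> 'p::finite \<Rightarrow> real"
  assumes n: "n \<ge> 1" and T: "orthogonal_matrix T" and \<theta>: "norm \<theta> = 1" and \<theta>0: "norm \<theta>0 = 1"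
    and a: "a * (2 + a) = \<rho> * v" and v: "v > 0" and \<rho>: "\<rho> > 0" and \<delta>: "\<delta> \<ge> 0"
    and S: "S = sample_cov n (\<lambda>i\<in>{1..n}. (spike_mat a \<theta> ** T) *v (\<chi> j. z (i, j)))"
    and \<eta>: "\<eta> = entry_sum (dev_mat n z) * (1 + \<rho> * v) + v * \<bar>\<rho> - \<delta>\<bar> + 2 * \<delta> * v * norm (\<theta> - \<theta>0)"
  shows "\<bar>w \<bullet> (S *v w) - ((norm w)\<^sup>2 + \<delta> * v * (\<theta>0 \<bullet> w)\<^sup>2)\<bar> \<le> \<eta> * (norm w)\<^sup>2"
proof -
  define y where "y = transpose T *v (spike_mat a \<theta> *v w)"
  define H where "H = dev_mat n z"
  have ny: "(norm y)\<^sup>2 = (norm w)\<^sup>2 + \<rho> * v * (\<theta> \<bullet> w)\<^sup>2"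
    unfolding y_def by (simp only: orthogonal_matrix_mult_inverse[OF T] spike_mat_square(2)[OF \<theta> a])
  have "w \<bullet> (S *v w) = w \<bullet> (spike_mat a \<theta> *v (T *v (y + H *v y)))"
    unfolding S H_def by (simp only: sample_cov_spiked_mult[OF n y_def])
  also have "\<dots> = (spike_mat a \<theta> *v w) \<bullet> (T *v (y + H *v y))"
    using inner_transpose_mult[of w "spike_mat a \<theta>" "T *v (y + H *v y)"] by (simp only: transpose_spike_mat)
  also have "\<dots> = y \<bullet> (y + H *v y)"
    using inner_transpose_mult[of "spike_mat a \<theta> *v w" "transpose T" "y + H *v y"] by (simp only: transpose_transpose y_def)
  finally have q: "w \<bullet> (S *v w) = (norm y)\<^sup>2 + y \<bullet> (H *v y)" by (simp add: inner_add_right power2_norm_eq_inner)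
  have tw: "(\<theta> \<bullet> w)\<^sup>2 \<le> (norm w)\<^sup>2"
    using Cauchy_Schwarz_ineq2[of \<theta> w] \<theta> by (metis abs_ge_zero mult_1 power2_abs power_mono)
  have h0: "entry_sum H \<ge> 0" by (rule entry_sum_nonneg)
  have "\<bar>y \<bullet> (H *v y)\<bar> \<le> norm y * norm (H *v y)" by (rule Cauchy_Schwarz_ineq2)
  also have "\<dots> \<le> norm y * (entry_sum H * norm y)" by (intro mult_left_mono norm_matrix_mult_le_entry_sum) auto
  also have "\<dots> = entry_sum H * (norm y)\<^sup>2" by (simp add: power2_eq_square)
  also have "\<dots> \<le> entry_sum H * ((1 + \<rho> * v) * (norm w)\<^sup>2)"
  proof (rule mult_left_mono[OF _ h0])
    have "\<rho> * v * (\<theta> \<bullet> w)\<^sup>2 \<le> \<rho> * v * (norm w)\<^sup>2" using tw \<rho> v by (intro mult_left_mono) auto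
    then show "(norm y)\<^sup>2 \<le> (1 + \<rho> * v) * (norm w)\<^sup>2" by (simp add: ny algebra_simps)
  qed
  finally have 1: "\<bar>y \<bullet> (H *v y)\<bar> \<le> entry_sum H * (1 + \<rho> * v) * (norm w)\<^sup>2" by (simp add: mult_ac)
  have "\<bar>(\<theta> \<bullet> w)\<^sup>2 - (\<theta>0 \<bullet> w)\<^sup>2\<bar> = \<bar>(\<theta> - \<theta>0) \<bullet> w\<bar> * \<bar>(\<theta> + \<theta>0) \<bullet> w\<bar>"
    by (simp add: abs_mult[symmetric] inner_diff_left inner_add_left power2_eq_square algebra_simps)
  also have "\<dots> \<le> (norm (\<theta> - \<theta>0) * norm w) * (norm (\<theta> + \<theta>0) * norm w)"
    by (intro mult_mono Cauchy_Schwarz_ineq2) auto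
  also have "\<dots> \<le> (norm (\<theta> - \<theta>0) * norm w) * (2 * norm w)"
    using norm_triangle_ineq[of \<theta> \<theta>0] \<theta> \<theta>0 by (intro mult_left_mono mult_right_mono) auto
  finally have 2: "\<bar>(\<theta> \<bullet> w)\<^sup>2 - (\<theta>0 \<bullet> w)\<^sup>2\<bar> \<le> 2 * norm (\<theta> - \<theta>0) * (norm w)\<^sup>2" by (simp add: power2_eq_square mult_ac)
  have "\<rho> * v * (\<theta> \<bullet> w)\<^sup>2 - \<delta> * v * (\<theta>0 \<bullet> w)\<^sup>2 = v * (\<rho> - \<delta>) * (\<theta> \<bullet> w)\<^sup>2 + \<delta> * v * ((\<theta> \<bullet> w)\<^sup>2 - (\<theta>0 \<bullet> w)\<^sup>2)"
    by (simp add: algebra_simps)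
  moreover have "\<bar>v * (\<rho> - \<delta>) * (\<theta> \<bullet> w)\<^sup>2\<bar> \<le> v * \<bar>\<rho> - \<delta>\<bar> * (norm w)\<^sup>2"
    using tw v by (simp add: abs_mult mult_left_mono)
  moreover have "\<bar>\<delta> * v * ((\<theta> \<bullet> w)\<^sup>2 - (\<theta>0 \<bullet> w)\<^sup>2)\<bar> \<le> \<delta> * v * (2 * norm (\<theta> - \<theta>0) * (norm w)\<^sup>2)"
    using 2 v \<delta> by (simp add: abs_mult mult_left_mono)
  ultimately have "\<bar>\<rho> * v * (\<theta> \<bullet> w)\<^sup>2 - \<delta> * v * (\<theta>0 \<bullet> w)\<^sup>2\<bar> \<le> v * \<bar>\<rho> - \<delta>\<bar> * (norm w)\<^sup>2 + \<delta> * v * (2 * norm (\<theta> - \<theta>0) * (norm w)\<^sup>2)"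
    by linarith
  moreover have "\<eta> * (norm w)\<^sup>2 = entry_sum H * (1 + \<rho> * v) * (norm w)\<^sup>2 + (v * \<bar>\<rho> - \<delta>\<bar> * (norm w)\<^sup>2 + \<delta> * v * (2 * norm (\<theta> - \<theta>0) * (norm w)\<^sup>2))"
    by (simp add: \<eta> H_def algebra_simps)
  ultimately show ?thesis using 1 unfolding q ny by linarith
qed

definition perp :: "'a::real_inner \<Rightarrow> 'a \<Rightarrow> 'a" where
  "perp \<theta> w = w - (\<theta> \<bullet> w) *\<^sub>R \<theta>"

lemma linear_perp: "linear (perp \<theta>)"
  by (rule linearI) (simp_all add: perp_def inner_add_right algebra_simps)

lemma perp_tendsto: "(f \<longlongrightarrow> l) F \<Longrightarrow> ((\<lambda>x. perp \<theta> (f x)) \<longlongrightarrow> perp \<theta> l) F"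
  unfolding perp_def by (intro tendsto_intros)

lemma perp_orthogonal_matrix:
  assumes T: "orthogonal_matrix T" and T0: "T *v axis k 1 = \<theta>0"
  shows "perp \<theta>0 (T *v u) = T *v proj_perp k u"
proof -
  have "\<theta>0 \<bullet> (T *v u) = u $ k"
    using inner_transpose_mult[of "axis k 1" "transpose T" "T *v u"] inner_transpose_mult[of "T *v u" T "axis k 1"]
      orthogonal_matrix_mult_inverse(2)[OF T, of u] inner_transpose_mult[of "axis k 1" T "T *v u"] T0
    by (metis inner_axis' inner_commute mult_1 inner_real_def)
  then have "perp \<theta>0 (T *v u) = T *v (u - (u $ k) *\<^sub>R axis k 1)"
    by (simp add: perp_def matrix_vector_mult_diff_distrib matrix_vector_mult_scaleR T0)
  also have "u - (u $ k) *\<^sub>R axis k 1 = proj_perp k u" by (simp add: vec_eq_iff axis_def)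
  finally show ?thesis .
qed

text \<open>An exact decomposition. The first term tends to the signal v tau and the second is
  asymptotically \<open>\<sigma>\<close> times the rotated score. The last two are remainders:
  \<open>e\<close>, the deviation of the square root applied to \<open>\<theta>0\<close> from (1 +
  a) theta0, and the displacement of the direction both tend to 0, while \<open>H\<close> stays
  bounded.\<close>

lemma sample_cov_spiked_perp:
  fixes z :: "nat \<times> 'p::finite \<Rightarrow> real"
  assumes n: "n \<ge> 1" and T: "orthogonal_matrix T" and T0: "T *v axis k 1 = \<theta>0"
    and \<theta>: "norm \<theta> = 1" and \<theta>0: "norm \<theta>0 = 1" and a: "a * (2 + a) = \<rho> * v"
    and S: "S = sample_cov n (\<lambda>i\<in>{1..n}. (spike_mat a \<theta> ** T) *v (\<chi> j. z (i, j)))"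
    and H: "H = sqrt n *\<^sub>R dev_mat n z" and e: "e = a *\<^sub>R ((\<theta> \<bullet> \<theta>0) *\<^sub>R \<theta> - \<theta>0)"
  shows "sqrt n *\<^sub>R perp \<theta>0 (S *v \<theta>0) =
     (v * (\<theta> \<bullet> \<theta>0)) *\<^sub>R perp \<theta>0 ((sqrt n * \<rho>) *\<^sub>R (\<theta> - \<theta>0))
     + (1 + a) *\<^sub>R (T *v (sqrt n *\<^sub>R proj_perp k (dev_mat n z *v axis k 1)))
     + perp \<theta>0 (T *v (H *v (transpose T *v e)))
     + (a * (\<theta> \<bullet> (T *v (H *v (transpose T *v (spike_mat a \<theta> *v \<theta>0)))))) *\<^sub>R perp \<theta>0 (\<theta> - \<theta>0)"
proof -
  let ?D = "dev_mat n z"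
  define y where "y = transpose T *v (spike_mat a \<theta> *v \<theta>0)"
  define s where "s = sqrt (real n)"
  have t0: "transpose T *v \<theta>0 = axis k 1" using orthogonal_matrix_mult_inverse(2)[OF T, of "axis k 1"] T0 by simp
  have A0: "spike_mat a \<theta> *v \<theta>0 = (1 + a) *\<^sub>R \<theta>0 + e"
    by (simp add: spike_mat_mult e algebra_simps)
  have y: "y = (1 + a) *\<^sub>R axis k 1 + transpose T *v e"
    unfolding y_def A0 by (simp only: matrix_vector_right_distrib matrix_vector_mult_scaleR t0)
  have Ty: "T *v y = spike_mat a \<theta> *v \<theta>0" unfolding y_def by (rule orthogonal_matrix_mult_inverse[OF T])
  have "S *v \<theta>0 = spike_mat a \<theta> *v (T *v (y + ?D *v y))"
    unfolding S by (rule sample_cov_spiked_mult[OF n y_def])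
  also have "\<dots> = spike_mat a \<theta> *v (spike_mat a \<theta> *v \<theta>0) + spike_mat a \<theta> *v (T *v (?D *v y))"
    by (simp only: matrix_vector_right_distrib Ty)
  also have "\<dots> = \<theta>0 + (\<rho> * v * (\<theta> \<bullet> \<theta>0)) *\<^sub>R \<theta> + T *v (?D *v y) + (a * (\<theta> \<bullet> (T *v (?D *v y)))) *\<^sub>R \<theta>"
    by (simp only: spike_mat_square(1)[OF \<theta> a]) (simp add: spike_mat_mult)
  finally have S0: "S *v \<theta>0 = \<theta>0 + (\<rho> * v * (\<theta> \<bullet> \<theta>0)) *\<^sub>R \<theta> + T *v (?D *v y) + (a * (\<theta> \<bullet> (T *v (?D *v y)))) *\<^sub>R \<theta>" .
  have p0: "perp \<theta>0 \<theta>0 = 0" using \<theta>0 by (simp add: perp_def norm_eq_1)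
  have pt: "perp \<theta>0 \<theta> = perp \<theta>0 (\<theta> - \<theta>0)" by (simp add: linear_diff[OF linear_perp] p0)
  have "T *v (?D *v y) = (1 + a) *\<^sub>R (T *v (?D *v axis k 1)) + T *v (?D *v (transpose T *v e))"
    unfolding y by (simp only: matrix_vector_right_distrib matrix_vector_mult_scaleR)
  then have TD: "perp \<theta>0 (T *v (?D *v y)) = (1 + a) *\<^sub>R (T *v proj_perp k (?D *v axis k 1)) + perp \<theta>0 (T *v (?D *v (transpose T *v e)))"
    by (simp only: linear_add[OF linear_perp] linear_scale[OF linear_perp] perp_orthogonal_matrix[OF T T0])
  have Hm: "H *v u = s *\<^sub>R (?D *v u)" for u by (simp only: H s_def scaleR_matrix_vector_assoc)
  have "perp \<theta>0 (S *v \<theta>0) = (\<rho> * v * (\<theta> \<bullet> \<theta>0)) *\<^sub>R perp \<theta>0 (\<theta> - \<theta>0)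
      + ((1 + a) *\<^sub>R (T *v proj_perp k (?D *v axis k 1)) + perp \<theta>0 (T *v (?D *v (transpose T *v e))))
      + (a * (\<theta> \<bullet> (T *v (?D *v y)))) *\<^sub>R perp \<theta>0 (\<theta> - \<theta>0)"
    unfolding S0 by (simp only: linear_add[OF linear_perp] linear_scale[OF linear_perp] p0 TD add_0_left pt)
  then show ?thesis
    unfolding Hm y_def[symmetric] s_def[symmetric]
    by (simp only: linear_scale[OF linear_perp] matrix_vector_mult_scaleR inner_scaleR_right scaleR_add_right scaleR_scaleR)
       (simp add: mult_ac)
qed

text \<open>For unit vectors theta0 . (theta - theta0) is minus half the squared distance. Being of
  second order it vanishes after rescaling, so the limit is tangent to the sphere.\<close>

lemma tangent_limit:
  fixes \<theta> :: "'a \<Rightarrow> 'b::real_inner"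
  assumes nontriv: "F \<noteq> bot" and w: "filterlim w at_top F" and \<theta>: "\<forall>\<^sub>F x in F. norm (\<theta> x) = 1" and \<theta>0: "norm \<theta>0 = 1"
    and \<tau>: "((\<lambda>x. w x *\<^sub>R (\<theta> x - \<theta>0)) \<longlongrightarrow> \<tau>) F"
  shows "((\<lambda>x. \<theta> x - \<theta>0) \<longlongrightarrow> 0) F" and "\<theta>0 \<bullet> \<tau> = 0"
proof -
  have tt: "\<theta>0 \<bullet> \<theta>0 = 1" using \<theta>0 by (simp add: norm_eq_1)
  have pos: "\<forall>\<^sub>F x in F. w x > 0" using w by (simp add: filterlim_at_top_dense)
  have "((\<lambda>x. inverse (w x) *\<^sub>R (w x *\<^sub>R (\<theta> x - \<theta>0))) \<longlongrightarrow> 0 *\<^sub>R \<tau>) F"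
    by (intro tendsto_scaleR \<tau> tendsto_inverse_0_at_top[OF w])
  moreover have "\<forall>\<^sub>F x in F. inverse (w x) *\<^sub>R (w x *\<^sub>R (\<theta> x - \<theta>0)) = \<theta> x - \<theta>0"
    using pos by eventually_elim simp
  ultimately show d: "((\<lambda>x. \<theta> x - \<theta>0) \<longlongrightarrow> 0) F" by (simp add: tendsto_cong)
  have "((\<lambda>x. \<theta>0 \<bullet> (w x *\<^sub>R (\<theta> x - \<theta>0))) \<longlongrightarrow> \<theta>0 \<bullet> \<tau>) F" by (intro tendsto_intros \<tau>)
  moreover have "((\<lambda>x. - ((w x *\<^sub>R (\<theta> x - \<theta>0)) \<bullet> (\<theta> x - \<theta>0)) / 2) \<longlongrightarrow> - (\<tau> \<bullet> 0) / 2) F"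
    by (intro tendsto_intros \<tau> d) simp
  moreover have "\<forall>\<^sub>F x in F. \<theta>0 \<bullet> (w x *\<^sub>R (\<theta> x - \<theta>0)) = - ((w x *\<^sub>R (\<theta> x - \<theta>0)) \<bullet> (\<theta> x - \<theta>0)) / 2"
    using \<theta>
  proof eventually_elim
    case (elim x)
    have "\<theta> x \<bullet> \<theta> x = 1" using elim by (simp add: norm_eq_1)
    then have "\<theta>0 \<bullet> (\<theta> x - \<theta>0) = - ((\<theta> x - \<theta>0) \<bullet> (\<theta> x - \<theta>0)) / 2"
      by (simp add: inner_diff_left inner_diff_right tt inner_commute)
    then show ?case by simp
  qed
  ultimately have "((\<lambda>x. \<theta>0 \<bullet> (w x *\<^sub>R (\<theta> x - \<theta>0))) \<longlongrightarrow> 0) F" by (simp add: tendsto_cong)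
  with \<open>((\<lambda>x. \<theta>0 \<bullet> (w x *\<^sub>R (\<theta> x - \<theta>0))) \<longlongrightarrow> \<theta>0 \<bullet> \<tau>) F\<close> show "\<theta>0 \<bullet> \<tau> = 0"
    using tendsto_unique[OF nontriv] by blast
qed

context spiked_limit
begin

text \<open>The rescaled orthogonal component \<open>V\<close> is asymptotic to \<open>V'\<close>,
  which is \<open>\<sigma>\<close> times a rotation of score plus shift. Its squared norm
  \<open>D\<close> is thus asymptotic to \<open>\<sigma>\<close> squared times \<open>Y\<close>, and
  the sandwich of \<open>Q_HPV_bounds\<close> divides \<open>D\<close> by quantities tending to
  \<open>\<sigma>\<close> squared.\<close>

lemma Q_HPV_limit:
  fixes \<theta>0 :: "real^'p" and \<theta> :: "'a \<Rightarrow> real^'p" and T :: "real^'p^'p"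
  defines "L x \<equiv> spike_mat (a x) (\<theta> x) ** T"
  defines "X x \<equiv> \<lambda>i\<in>{1..n x}. L x *v (\<chi> j. z x (i, j))"
  assumes T: "orthogonal_matrix T" and T0: "T *v axis k 1 = \<theta>0"
    and \<theta>: "\<forall>\<^sub>F x in F. norm (\<theta> x) = 1"
    and \<tau>: "((\<lambda>x. (sqrt (n x) * \<rho> x) *\<^sub>R (\<theta> x - \<theta>0)) \<longlongrightarrow> \<tau>) F"
    and E: "sample_eigenvectors E"
    and np: "\<forall>\<^sub>F x in F. no_eigenvector_perp \<theta>0 (sample_cov (n x) (X x))"
  shows "((\<lambda>x. Q_HPV \<theta>0 E (n x) (X x) - (norm (score (n x) k (z x) + (v / \<sigma>) *\<^sub>R (transpose T *v \<tau>)))\<^sup>2) \<longlongrightarrow> 0) F"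
\<comment> \<open>That \<open>\<tau>\<close> is tangent rests on uniqueness of limits, hence on a
  proper filter; along the trivial filter every limit holds.\<close>
proof (cases "F = bot")
  case nontriv: False
  have \<theta>0: "norm \<theta>0 = 1" using orthogonal_matrix_mult_inverse(3)[OF T, of "axis k 1"] T0 by simp
  have tt: "\<theta>0 \<bullet> \<theta>0 = 1" using \<theta>0 by (simp add: norm_eq_1)
  note d = tangent_limit(1)[OF nontriv n\<rho> \<theta> \<theta>0 \<tau>] and \<tau>0 = tangent_limit(2)[OF nontriv n\<rho> \<theta> \<theta>0 \<tau>]
  have tl: "(\<theta> \<longlongrightarrow> \<theta>0) F" using d by (simp add: LIM_zero_iff)
  have ti: "((\<lambda>x. \<theta> x \<bullet> \<theta>0) \<longlongrightarrow> 1) F" using tendsto_inner[OF tl tendsto_const[of \<theta>0]] by (simp add: tt)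
  have a2: "\<forall>\<^sub>F x in F. a x * (2 + a x) = \<rho> x * v"
    using \<rho>_pos by eventually_elim (simp only: a_def, rule spike_root, simp add: v)
  define H where "H x = sqrt (n x) *\<^sub>R dev_mat (n x) (z x)" for x
  have HB: "\<forall>\<^sub>F x in F. entry_sum (H x) \<le> K + K\<^sup>2"
    using dev_mat_bound by eventually_elim (simp add: H_def entry_sum_scaleR)
  define e where "e x = a x *\<^sub>R ((\<theta> x \<bullet> \<theta>0) *\<^sub>R \<theta> x - \<theta>0)" for x
  have e0: "(e \<longlongrightarrow> 0) F"
  proof -
    have "(e \<longlongrightarrow> (\<sigma> - 1) *\<^sub>R (1 *\<^sub>R \<theta>0 - \<theta>0)) F" unfolding e_def[abs_def] by (intro tendsto_intros a0 ti tl)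
    then show ?thesis by simp
  qed
  define S where "S x = sample_cov (n x) (X x)" for x
  define V where "V x = sqrt (n x) *\<^sub>R perp \<theta>0 (S x *v \<theta>0)" for x
  define W where "W x = score (n x) k (z x)" for x
  define m where "m = (v / \<sigma>) *\<^sub>R (transpose T *v \<tau>)"
  define V' where "V' x = \<sigma> *\<^sub>R (T *v (W x + m))" for x
  let ?t1 = "\<lambda>x. (v * (\<theta> x \<bullet> \<theta>0)) *\<^sub>R perp \<theta>0 ((sqrt (n x) * \<rho> x) *\<^sub>R (\<theta> x - \<theta>0))"
  let ?t2 = "\<lambda>x. (1 + a x) *\<^sub>R (T *v (sqrt (n x) *\<^sub>R proj_perp k (dev_mat (n x) (z x) *v axis k 1)))"
  let ?t3 = "\<lambda>x. perp \<theta>0 (T *v (H x *v (transpose T *v e x)))"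
  let ?t4 = "\<lambda>x. (a x * (\<theta> x \<bullet> (T *v (H x *v (transpose T *v (spike_mat (a x) (\<theta> x) *v \<theta>0)))))) *\<^sub>R perp \<theta>0 (\<theta> x - \<theta>0)"
  have mvt: "((\<lambda>x. B *v f x) \<longlongrightarrow> B *v l) F" if "(f \<longlongrightarrow> l) F" for B :: "real^'p^'p" and f l
    by (rule bounded_linear.tendsto[OF _ that]) (simp add: linear_conv_bounded_linear[symmetric])
  have t1: "(?t1 \<longlongrightarrow> v *\<^sub>R \<tau>) F"
  proof -
    have "(?t1 \<longlongrightarrow> (v * 1) *\<^sub>R perp \<theta>0 \<tau>) F" by (intro tendsto_intros ti perp_tendsto \<tau>)
    then show ?thesis by (simp add: perp_def \<tau>0)
  qed
  have t2: "((\<lambda>x. ?t2 x - \<sigma> *\<^sub>R (T *v W x)) \<longlongrightarrow> 0) F"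
  proof -
    have "((\<lambda>x. (1 + a x) *\<^sub>R (T *v (sqrt (n x) *\<^sub>R proj_perp k (dev_mat (n x) (z x) *v axis k 1) - W x))) \<longlongrightarrow> \<sigma> *\<^sub>R (T *v 0)) F"
      unfolding W_def by (intro tendsto_scaleR a mvt column_limit)
    moreover have "((\<lambda>x. (1 + a x - \<sigma>) *\<^sub>R (T *v W x)) \<longlongrightarrow> 0) F"
    proof (rule tendsto_scaleR_null_bounded)
      show "((\<lambda>x. 1 + a x - \<sigma>) \<longlongrightarrow> 0) F" using a by (simp add: LIM_zero_iff)
      show "\<forall>\<^sub>F x in F. norm (T *v W x) \<le> K"
        using score_bound by (simp add: W_def orthogonal_matrix_mult_inverse[OF T])
    qed
    ultimately have "((\<lambda>x. (1 + a x) *\<^sub>R (T *v (sqrt (n x) *\<^sub>R proj_perp k (dev_mat (n x) (z x) *v axis k 1) - W x))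
       + (1 + a x - \<sigma>) *\<^sub>R (T *v W x)) \<longlongrightarrow> \<sigma> *\<^sub>R (T *v 0) + 0) F" by (rule tendsto_add)
    then show ?thesis by (simp add: matrix_vector_mult_diff_distrib algebra_simps)
  qed
  have t3: "(?t3 \<longlongrightarrow> 0) F"
  proof -
    have "((\<lambda>x. transpose T *v e x) \<longlongrightarrow> transpose T *v 0) F" by (rule mvt[OF e0])
    then have "((\<lambda>x. transpose T *v e x) \<longlongrightarrow> 0) F" by (simp only: matrix_vector_mult_0_right)
    from perp_tendsto[OF mvt[OF norm_matrix_mult_tendsto_null[OF this HB]], of \<theta>0 T]
    show ?thesis by (simp only: matrix_vector_mult_0_right) (simp add: perp_def)
  qed
  have t4: "(?t4 \<longlongrightarrow> 0) F"
  proof -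
    have Ab: "((\<lambda>x. norm (spike_mat (a x) (\<theta> x) *v \<theta>0)) \<longlongrightarrow> norm (\<theta>0 + ((\<sigma> - 1) * 1) *\<^sub>R \<theta>0)) F"
      unfolding spike_mat_mult by (intro tendsto_intros a0 ti tl)
    define B where "B = norm (\<theta>0 + ((\<sigma> - 1) * 1) *\<^sub>R \<theta>0) + 1"
    have Ab': "\<forall>\<^sub>F x in F. norm (spike_mat (a x) (\<theta> x) *v \<theta>0) \<le> B"
      using order_tendstoD(2)[OF Ab, of B] by (auto simp: B_def elim: eventually_mono)
    have "\<forall>\<^sub>F x in F. \<bar>\<theta> x \<bullet> (T *v (H x *v (transpose T *v (spike_mat (a x) (\<theta> x) *v \<theta>0))))\<bar> \<le> (K + K\<^sup>2) * B"
      using HB Ab' \<theta>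
    proof eventually_elim
      case (elim x)
      let ?y = "transpose T *v (spike_mat (a x) (\<theta> x) *v \<theta>0)"
      have "\<bar>\<theta> x \<bullet> (T *v (H x *v ?y))\<bar> \<le> norm (H x *v ?y)"
        using Cauchy_Schwarz_ineq2[of "\<theta> x" "T *v (H x *v ?y)"] elim(3) by (simp only: orthogonal_matrix_mult_inverse[OF T])
      also have "\<dots> \<le> entry_sum (H x) * norm ?y" by (rule norm_matrix_mult_le_entry_sum)
      also have "\<dots> \<le> (K + K\<^sup>2) * B"
        using elim entry_sum_nonneg[of "H x"] by (intro mult_mono) (simp_all only: orthogonal_matrix_mult_inverse[OF T], auto)
      finally show ?case .
    qed
    moreover have "((\<lambda>x. a x *\<^sub>R perp \<theta>0 (\<theta> x - \<theta>0)) \<longlongrightarrow> (\<sigma> - 1) *\<^sub>R perp \<theta>0 0) F"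
      by (intro tendsto_intros a0 perp_tendsto d)
    then have pd: "((\<lambda>x. a x *\<^sub>R perp \<theta>0 (\<theta> x - \<theta>0)) \<longlongrightarrow> 0) F" by (simp add: perp_def)
    ultimately show ?thesis
    proof -
      assume b: "\<forall>\<^sub>F x in F. \<bar>\<theta> x \<bullet> (T *v (H x *v (transpose T *v (spike_mat (a x) (\<theta> x) *v \<theta>0))))\<bar> \<le> (K + K\<^sup>2) * B"
      show ?thesis
      proof (rule Lim_null_comparison)
        show "\<forall>\<^sub>F x in F. norm (?t4 x) \<le> ((K + K\<^sup>2) * B) * norm (a x *\<^sub>R perp \<theta>0 (\<theta> x - \<theta>0))"
          using b
        proof eventually_elim
          case (elim x)
          have "norm (?t4 x) = \<bar>\<theta> x \<bullet> (T *v (H x *v (transpose T *v (spike_mat (a x) (\<theta> x) *v \<theta>0))))\<bar> * norm (a x *\<^sub>R perp \<theta>0 (\<theta> x - \<theta>0))"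
            by (simp only: norm_scaleR abs_mult) (simp only: mult_ac)
          then show ?case using elim by (simp only: mult_right_mono norm_ge_zero)
        qed
        show "((\<lambda>x. ((K + K\<^sup>2) * B) * norm (a x *\<^sub>R perp \<theta>0 (\<theta> x - \<theta>0))) \<longlongrightarrow> 0) F"
          using tendsto_mult_right_zero[OF tendsto_norm_zero[OF pd]] .
      qed
    qed
  qed
  have V'eq: "V' x = v *\<^sub>R \<tau> + \<sigma> *\<^sub>R (T *v W x)" for x
  proof -
    have "T *v m = (v / \<sigma>) *\<^sub>R \<tau>" unfolding m_def by (simp only: matrix_vector_mult_scaleR orthogonal_matrix_mult_inverse[OF T])
    then show ?thesis using \<sigma>(1) by (simp add: V'_def matrix_vector_right_distrib scaleR_add_right)
  qed
  have Vd: "((\<lambda>x. V x - V' x) \<longlongrightarrow> 0) F"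
  proof -
    have "((\<lambda>x. (?t1 x - v *\<^sub>R \<tau>) + (?t2 x - \<sigma> *\<^sub>R (T *v W x)) + ?t3 x + ?t4 x) \<longlongrightarrow> (v *\<^sub>R \<tau> - v *\<^sub>R \<tau>) + 0 + 0 + 0) F"
      by (intro tendsto_add tendsto_diff t1 t2 t3 t4 tendsto_const)
    moreover have "\<forall>\<^sub>F x in F. V x - V' x = (?t1 x - v *\<^sub>R \<tau>) + (?t2 x - \<sigma> *\<^sub>R (T *v W x)) + ?t3 x + ?t4 x"
      using n1 \<theta> a2
    proof eventually_elim
      case (elim x)
      have "V x = ?t1 x + ?t2 x + ?t3 x + ?t4 x"
        unfolding V_def
        by (rule sample_cov_spiked_perp[OF elim(1) T T0 elim(2) \<theta>0 elim(3) _ H_def e_def]) (simp add: S_def X_def L_def)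
      then show ?case by (simp only: V'eq) (simp only: algebra_simps)
    qed
    ultimately show ?thesis by (simp add: tendsto_cong)
  qed
  have V'b: "\<forall>\<^sub>F x in F. norm (V' x) \<le> \<sigma> * (K + norm m)"
    using score_bound
  proof eventually_elim
    case (elim x)
    then have "norm (W x + m) \<le> K + norm m" using norm_triangle_ineq[of "W x" m] by (simp add: W_def)
    then show ?case using \<sigma>(1) by (simp add: V'_def orthogonal_matrix_mult_inverse[OF T])
  qed
  define D where "D x = (norm (V x))\<^sup>2" for x
  define Y where "Y x = (norm (W x + m))\<^sup>2" for x
  have V'Y: "(norm (V' x))\<^sup>2 = \<sigma>\<^sup>2 * Y x" for x
    by (simp add: V'_def Y_def orthogonal_matrix_mult_inverse[OF T] power_mult_distrib)
  have DY: "((\<lambda>x. D x - \<sigma>\<^sup>2 * Y x) \<longlongrightarrow> 0) F"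
    using tendsto_norm_sq_diff[OF Vd V'b] by (simp only: D_def V'Y)
  have Yb: "\<forall>\<^sub>F x in F. norm (Y x) \<le> (K + norm m)\<^sup>2"
    using score_bound
  proof eventually_elim
    case (elim x)
    then have "norm (W x + m) \<le> K + norm m" using norm_triangle_ineq[of "W x" m] by (simp add: W_def)
    then show ?case by (simp add: Y_def power_mono)
  qed
  define \<kappa> where "\<kappa> = \<delta> * v"
  have \<kappa>: "\<kappa> \<ge> 0" "\<sigma>\<^sup>2 = 1 + \<kappa>" using \<delta> v \<sigma>(2) by (auto simp: \<kappa>_def)
  define \<eta> where "\<eta> x = entry_sum (dev_mat (n x) (z x)) * (1 + \<rho> x * v) + v * \<bar>\<rho> x - \<delta>\<bar> + 2 * \<delta> * v * norm (\<theta> x - \<theta>0)" for x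
  have \<eta>0: "(\<eta> \<longlongrightarrow> 0) F"
  proof -
    have "(\<eta> \<longlongrightarrow> 0 * (1 + \<delta> * v) + v * \<bar>\<delta> - \<delta>\<bar> + 2 * \<delta> * v * norm (0 :: real^'p)) F"
      unfolding \<eta>_def[abs_def] by (intro tendsto_intros dev_mat_null \<rho> d)
    then show ?thesis by simp
  qed
  \<comment> \<open>Since \<open>Y\<close> is bounded, any multiplier tending to the reciprocal of
    sigma squared will do; this is used for both ends of the sandwich.\<close>
  have key: "((\<lambda>x. D x * c x - Y x) \<longlongrightarrow> 0) F" if c: "(c \<longlongrightarrow> 1 / \<sigma>\<^sup>2) F" for c
  proof -
    have "((\<lambda>x. (D x - \<sigma>\<^sup>2 * Y x) * c x) \<longlongrightarrow> 0 * (1 / \<sigma>\<^sup>2)) F" by (intro tendsto_mult DY c)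
    moreover have "((\<lambda>x. (\<sigma>\<^sup>2 * c x - 1) *\<^sub>R Y x) \<longlongrightarrow> 0) F"
    proof (rule tendsto_scaleR_null_bounded[OF _ Yb])
      have "((\<lambda>x. \<sigma>\<^sup>2 * c x - 1) \<longlongrightarrow> \<sigma>\<^sup>2 * (1 / \<sigma>\<^sup>2) - 1) F" by (intro tendsto_intros c)
      then show "((\<lambda>x. \<sigma>\<^sup>2 * c x - 1) \<longlongrightarrow> 0) F" using \<sigma>(1) by simp
    qed
    ultimately have "((\<lambda>x. (D x - \<sigma>\<^sup>2 * Y x) * c x + (\<sigma>\<^sup>2 * c x - 1) *\<^sub>R Y x) \<longlongrightarrow> 0 * (1 / \<sigma>\<^sup>2) + 0) F" by (rule tendsto_add)
    then show ?thesis by (simp add: algebra_simps)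
  qed
  have \<sigma>nz: "1 + \<kappa> \<noteq> 0" using \<kappa> by simp
  have c1: "((\<lambda>x. 1 / ((1 + \<kappa> + \<eta> x) * (1 + \<eta> x))) \<longlongrightarrow> 1 / \<sigma>\<^sup>2) F"
  proof -
    have "((\<lambda>x. 1 / ((1 + \<kappa> + \<eta> x) * (1 + \<eta> x))) \<longlongrightarrow> 1 / ((1 + \<kappa> + 0) * (1 + 0))) F"
      by (intro tendsto_intros \<eta>0) (use \<sigma>nz in simp)
    then show ?thesis by (simp add: \<kappa>)
  qed
  have c2: "((\<lambda>x. 1 / ((1 + \<kappa> - \<eta> x) * (1 - \<eta> x))) \<longlongrightarrow> 1 / \<sigma>\<^sup>2) F"
  proof -
    have "((\<lambda>x. 1 / ((1 + \<kappa> - \<eta> x) * (1 - \<eta> x))) \<longlongrightarrow> 1 / ((1 + \<kappa> - 0) * (1 - 0))) F"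
      by (intro tendsto_intros \<eta>0) (use \<sigma>nz in simp)
    then show ?thesis by (simp add: \<kappa>)
  qed
  have \<eta>1: "\<forall>\<^sub>F x in F. \<eta> x < 1" using order_tendstoD(2)[OF \<eta>0, of 1] by simp
  have bounds: "\<forall>\<^sub>F x in F. D x * (1 / ((1 + \<kappa> + \<eta> x) * (1 + \<eta> x))) \<le> Q_HPV \<theta>0 E (n x) (X x)
     \<and> Q_HPV \<theta>0 E (n x) (X x) \<le> D x * (1 / ((1 + \<kappa> - \<eta> x) * (1 - \<eta> x)))"
    using n1 \<theta> a2 \<eta>1 \<rho>_pos np
  proof eventually_elim
    case (elim x)
    have \<eta>nn: "0 \<le> \<eta> x" using elim(5) v \<delta> entry_sum_nonneg[of "dev_mat (n x) (z x)"] by (simp add: \<eta>_def)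
    have close: "\<bar>y \<bullet> (S x *v y) - ((norm y)\<^sup>2 + \<kappa> * (\<theta>0 \<bullet> y)\<^sup>2)\<bar> \<le> \<eta> x * (norm y)\<^sup>2" for y
      unfolding \<kappa>_def
      by (rule sample_cov_spiked_close[OF elim(1) T elim(2) \<theta>0 elim(3) v elim(5) \<delta> _ \<eta>_def]) (simp add: S_def X_def L_def)
    have Xs: "X x \<in> space (sample_space (n x))" by (simp add: X_def sample_space_def space_PiM)
    have En: "norm (E (n x) j (X x)) = 1" "S x *v E (n x) j (X x) = eigenvalue (S x) j *\<^sub>R E (n x) j (X x)" if "j \<in> {1..CARD('p)}" for j
      using E elim(1) that Xs unfolding sample_eigenvectors_def S_def by blast+
    have Dx: "D x = real (n x) * (norm (S x *v \<theta>0 - (\<theta>0 \<bullet> (S x *v \<theta>0)) *\<^sub>R \<theta>0))\<^sup>2"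
      by (simp add: D_def V_def perp_def power_mult_distrib)
    have np': "no_eigenvector_perp \<theta>0 (S x)" using elim(6) by (simp add: S_def)
    show ?case
      using Q_HPV_bounds[where E=E and n="n x" and x="X x" and S="S x", OF S_def[of x] \<theta>0 np' En \<kappa>(1) \<eta>nn elim(4) close Dx] by simp
  qed
  have "((\<lambda>x. Q_HPV \<theta>0 E (n x) (X x) - Y x) \<longlongrightarrow> 0) F"
  proof (rule tendsto_sandwich[OF _ _ key[OF c1] key[OF c2]])
    show "\<forall>\<^sub>F x in F. D x * (1 / ((1 + \<kappa> + \<eta> x) * (1 + \<eta> x))) - Y x \<le> Q_HPV \<theta>0 E (n x) (X x) - Y x"
      using bounds by eventually_elim simp
    show "\<forall>\<^sub>F x in F. Q_HPV \<theta>0 E (n x) (X x) - Y x \<le> D x * (1 / ((1 + \<kappa> - \<eta> x) * (1 - \<eta> x))) - Y x"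
      using bounds by eventually_elim simp
  qed
  then show ?thesis by (simp add: Y_def W_def m_def)
qed simp

end

section \<open>The likelihood ratio\<close>

lemma det_spike_mat:
  fixes \<theta> :: "real^'p"
  assumes "norm \<theta> = 1"
  shows "det (spike_mat a \<theta>) = 1 + a"
proof -
  obtain k :: 'p where True by blast
  obtain U where U: "orthogonal_matrix U" "U *v axis k 1 = \<theta>" using orthogonal_matrix_with_column[OF assms] by blast
  have "det U * det U = 1" using det_orthogonal_matrix[OF U(1)] by auto
  then show ?thesis
    by (simp add: spike_mat_eq_diag[OF U] det_mul det_transpose det_diag_mat prod.delta')
qed

text \<open>The Sherman-Morrison formula for a rank one update of the identity.\<close>

lemma matrix_inv_spike_mat:
  fixes \<theta> :: "real^'p"
  assumes \<theta>: "norm \<theta> = 1" and b: "b > 0"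
  shows "matrix_inv (spike_mat b \<theta>) = spike_mat (- (b / (1 + b))) \<theta>"
proof (rule matrix_inv_eqI, rule matrix_eq[THEN iffD2], rule allI)
  fix w
  define u where "u = \<theta> \<bullet> w"
  have tt: "\<theta> \<bullet> \<theta> = 1" using \<theta> by (simp add: norm_eq_1)
  have "- (b / (1 + b)) * u + b * (u + - (b / (1 + b)) * u) = 0"
    using b by (simp add: field_simps)
  moreover have "spike_mat b \<theta> *v (spike_mat (- (b / (1 + b))) \<theta> *v w) = w + (- (b / (1 + b)) * u + b * (u + - (b / (1 + b)) * u)) *\<^sub>R \<theta>"
    by (simp only: spike_mat_mult inner_add_right inner_scaleR_right tt u_def[symmetric]) (simp add: scaleR_add_left scaleR_diff_left)
  ultimately show "spike_mat b \<theta> ** spike_mat (- (b / (1 + b))) \<theta> *v w = mat 1 *v w"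
    by (simp only: matrix_vector_mul_assoc[symmetric]) simp
qed

lemma prob_space_mvnormal_spike:
  fixes \<theta> :: "real^'p"
  assumes \<theta>: "norm \<theta> = 1" and b: "b > 0"
  shows "prob_space (mvnormal 0 (spike_mat b \<theta>))"
proof -
  obtain k :: 'p where True by blast
  obtain U where U: "orthogonal_matrix U" "U *v axis k 1 = \<theta>" using orthogonal_matrix_with_column[OF \<theta>] by blast
  define a where "a = sqrt (1 + b) - 1"
  have aa: "a * (2 + a) = b" unfolding a_def by (rule spike_root[OF b])
  have "1 + a \<noteq> 0" using b by (simp add: a_def)
  then have d: "(if j = k then 1 + a else 1) \<noteq> 0" for j by simp
  have "spike_mat a \<theta> ** transpose (spike_mat a \<theta>) = spike_mat b \<theta>"
  proof (rule matrix_eq[THEN iffD2], rule allI)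
    fix w show "spike_mat a \<theta> ** transpose (spike_mat a \<theta>) *v w = spike_mat b \<theta> *v w"
      by (simp only: transpose_spike_mat matrix_vector_mul_assoc[symmetric] spike_mat_square(1)[OF \<theta> aa]) (simp only: spike_mat_mult)
  qed
  moreover have "orthogonal_matrix (transpose U)" using U(1) by simp
  ultimately have "distr std_gauss borel ((*v) (spike_mat a \<theta>)) = mvnormal 0 (spike_mat b \<theta>)"
    using distr_std_gauss_linear[OF U(1) _ d spike_mat_eq_diag[OF U]] by simp
  then show ?thesis
    using prob_space.prob_space_distr[OF prob_space_std_gauss, of "(*v) (spike_mat a \<theta>)" borel] by simp
qed

text \<open>Spikes of equal size have equal determinants, and their inverses differ only in the rank
  one part, so just the two squared projections survive in the ratio.\<close>

lemma mvnormal_spike_density: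
  fixes \<theta> \<theta>0 :: "real^'p"
  assumes \<theta>: "norm \<theta> = 1" and \<theta>0: "norm \<theta>0 = 1" and b: "b > 0"
  shows "mvnormal 0 (spike_mat b \<theta>) = density (mvnormal 0 (spike_mat b \<theta>0))
    (\<lambda>x. ennreal (exp (b / (2 * (1 + b)) * ((\<theta> \<bullet> x)\<^sup>2 - (\<theta>0 \<bullet> x)\<^sup>2))))"
proof -
  define C where "C = sqrt ((2 * pi) ^ CARD('p) * (1 + b))"
  have C: "C > 0" using b by (simp add: C_def)
  have dens: "mvnormal_density 0 (spike_mat b \<theta>) x = exp (b / (2 * (1 + b)) * (\<theta> \<bullet> x)\<^sup>2 - (norm x)\<^sup>2 / 2) / C"
    if "norm \<theta> = 1" for \<theta> x :: "real^'p"
  proof -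
    have "x \<bullet> (spike_mat (- (b / (1 + b))) \<theta> *v x) = (norm x)\<^sup>2 - b / (1 + b) * (\<theta> \<bullet> x)\<^sup>2"
      by (simp add: spike_mat_mult inner_add_right inner_diff_right power2_norm_eq_inner inner_commute[of x \<theta>]) (simp add: power2_eq_square)
    then have "- (x \<bullet> (spike_mat (- (b / (1 + b))) \<theta> *v x)) / 2 = b / (2 * (1 + b)) * (\<theta> \<bullet> x)\<^sup>2 - (norm x)\<^sup>2 / 2"
      by (simp add: diff_divide_distrib)
    then show ?thesis
      by (simp only: mvnormal_density_def matrix_inv_spike_mat[OF that b] det_spike_mat[OF that] C_def diff_zero)
  qed
  have "density (mvnormal 0 (spike_mat b \<theta>0)) (\<lambda>x. ennreal (exp (b / (2 * (1 + b)) * ((\<theta> \<bullet> x)\<^sup>2 - (\<theta>0 \<bullet> x)\<^sup>2))))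
    = density lborel (\<lambda>x. ennreal (mvnormal_density 0 (spike_mat b \<theta>0) x) * ennreal (exp (b / (2 * (1 + b)) * ((\<theta> \<bullet> x)\<^sup>2 - (\<theta>0 \<bullet> x)\<^sup>2))))"
    unfolding mvnormal_def dens[OF \<theta>0] by (rule density_density_eq) measurable
  also have "\<dots> = mvnormal 0 (spike_mat b \<theta>)"
    unfolding mvnormal_def
  proof (intro arg_cong2[where f=density] refl ext)
    fix x
    have gen: "c * X0 - N + c * (X - X0) = c * X - N" for c X0 X N :: real by (simp add: algebra_simps)
    have "exp (b / (2 * (1 + b)) * (\<theta>0 \<bullet> x)\<^sup>2 - (norm x)\<^sup>2 / 2) / C * exp (b / (2 * (1 + b)) * ((\<theta> \<bullet> x)\<^sup>2 - (\<theta>0 \<bullet> x)\<^sup>2))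
        = exp (b / (2 * (1 + b)) * (\<theta> \<bullet> x)\<^sup>2 - (norm x)\<^sup>2 / 2) / C"
      unfolding gen[of "b / (2 * (1 + b))" "(\<theta>0 \<bullet> x)\<^sup>2" "(norm x)\<^sup>2 / 2" "(\<theta> \<bullet> x)\<^sup>2", symmetric] exp_add by simp
    then show "ennreal (mvnormal_density 0 (spike_mat b \<theta>0) x) * ennreal (exp (b / (2 * (1 + b)) * ((\<theta> \<bullet> x)\<^sup>2 - (\<theta>0 \<bullet> x)\<^sup>2)))
       = ennreal (mvnormal_density 0 (spike_mat b \<theta>) x)"
      unfolding dens[OF \<theta>0] dens[OF \<theta>] using C by (simp flip: ennreal_mult)
  qed
  finally show ?thesis by simp
qed

definition log_lr :: "real \<Rightarrow> nat \<Rightarrow> real^'p \<Rightarrow> real^'p \<Rightarrow> (nat \<Rightarrow> real^'p) \<Rightarrow> real" where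
  "log_lr b n \<theta>0 \<theta> x = b / (2 * (1 + b)) * (\<Sum>i=1..n. (\<theta> \<bullet> x i)\<^sup>2 - (\<theta>0 \<bullet> x i)\<^sup>2)"

lemma spiked_model_density:
  fixes \<theta> \<theta>0 :: "real^'p"
  assumes \<theta>: "norm \<theta> = 1" and \<theta>0: "norm \<theta>0 = 1" and rv: "r n * v > 0"
  shows "spiked_model r v n \<theta> = density (spiked_model r v n \<theta>0) (\<lambda>x. ennreal (exp (log_lr (r n * v) n \<theta>0 \<theta> x)))"
proof -
  define b where "b = r n * v"
  have b: "b > 0" using rv by (simp add: b_def)
  let ?g = "\<lambda>x. ennreal (exp (b / (2 * (1 + b)) * ((\<theta> \<bullet> x)\<^sup>2 - (\<theta>0 \<bullet> x)\<^sup>2)))"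
  have sm: "spiked_model r v n \<theta> = PiM {1..n} (\<lambda>_. mvnormal 0 (spike_mat b \<theta>))" for \<theta> :: "real^'p"
    by (simp add: spiked_model_def spike_mat_def b_def)
  have psf: "product_sigma_finite (\<lambda>_. mvnormal 0 (spike_mat b \<theta>))" if "norm \<theta> = 1" for \<theta> :: "real^'p"
    using prob_space_mvnormal_spike[OF that b] by (simp add: product_sigma_finite_def prob_space_imp_sigma_finite)
  have eq: "density (mvnormal 0 (spike_mat b \<theta>0)) ?g = mvnormal 0 (spike_mat b \<theta>)"
    by (rule mvnormal_spike_density[OF \<theta> \<theta>0 b, symmetric])
  have meas: "?g \<in> borel_measurable (mvnormal 0 (spike_mat b \<theta>0))"
    by (simp add: mvnormal_def)
  have "spiked_model r v n \<theta> = PiM {1..n} (\<lambda>_. density (mvnormal 0 (spike_mat b \<theta>0)) ?g)"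
    by (simp only: eq sm)
  also have "\<dots> = density (PiM {1..n} (\<lambda>_. mvnormal 0 (spike_mat b \<theta>0))) (\<lambda>x. \<Prod>i\<in>{1..n}. ?g (x i))"
    by (rule PiM_density[where f="\<lambda>_. ?g"]) (simp_all only: eq finite_atLeastAtMost psf[OF \<theta>] psf[OF \<theta>0] meas)
  also have "(\<lambda>x. \<Prod>i\<in>{1..n}. ?g (x i)) = (\<lambda>x. ennreal (exp (log_lr b n \<theta>0 \<theta> x)))"
    by (simp add: fun_eq_iff prod_ennreal log_lr_def sum_distrib_left exp_sum)
  finally show ?thesis by (simp only: sm b_def)
qed

lemma moment_dev_column:
  assumes n: "n \<ge> 1" and j: "j \<noteq> k"
  shows "sqrt n * moment_dev n z j k = sqrt (1 + moment_dev n z k k) * score n k z $ j"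
  using arg_cong[where f="\<lambda>y. y $ j", OF dev_mat_column[OF n, of k z]] j
  by (simp add: dev_mat_def matrix_vector_mul_component inner_axis right_diff_distrib mult_ac)

text \<open>With \<open>u i\<close> the coordinate of the i-th vector along \<open>s\<close>, the
  exponent is a combination of the sums of z_k^2, z_k u and u^2. The first and last are second
  moments, the mixed one is the score in direction \<open>s\<close>.\<close>

lemma log_lr_spiked:
  fixes z :: "nat \<times> 'p::finite \<Rightarrow> real"
  assumes n: "n \<ge> 1" and T: "orthogonal_matrix T" and T0: "T *v axis k 1 = \<theta>0"
    and a: "a * (2 + a) = b" and s: "norm s = 1" "s $ k = 0" and cs: "cs\<^sup>2 + sn\<^sup>2 = 1"
    and \<theta>: "\<theta> = cs *\<^sub>R \<theta>0 + sn *\<^sub>R (T *v s)"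
    and sDs: "sDs = (\<Sum>i\<in>UNIV. \<Sum>j\<in>UNIV. s $ i * moment_dev n z i j * s $ j)"
  shows "log_lr b n \<theta>0 \<theta> (\<lambda>i\<in>{1..n}. (spike_mat a \<theta>0 ** T) *v (\<chi> j. z (i, j))) =
    n * b / (2 * (1 + b)) * (- sn\<^sup>2 * (b + (1 + b) * moment_dev n z k k - sDs)
      + 2 * cs * sn * (1 + a) * sqrt (1 + moment_dev n z k k) / sqrt n * (s \<bullet> score n k z))"
proof -
  let ?x = "\<lambda>i. (spike_mat a \<theta>0 ** T) *v (\<chi> j. z (i, j))"
  have \<theta>0: "norm \<theta>0 = 1" using orthogonal_matrix_mult_inverse(3)[OF T, of "axis k 1"] T0 by simp
  have tt: "\<theta>0 \<bullet> \<theta>0 = 1" using \<theta>0 by (simp add: norm_eq_1)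
  have Tin: "(T *v x) \<bullet> (T *v y) = x \<bullet> y" for x y
    using inner_transpose_mult[of x T "T *v y"] by (simp only: orthogonal_matrix_mult_inverse[OF T])
  have T0s: "\<theta>0 \<bullet> (T *v s) = 0" using Tin[of "axis k 1" s] s by (simp add: T0 inner_axis')
  define u where "u i = (\<Sum>j\<in>UNIV. s $ j * z (i, j))" for i
  have x0: "\<theta>0 \<bullet> ?x i = (1 + a) * z (i, k)" for i
  proof -
    have "\<theta>0 \<bullet> (T *v (\<chi> j. z (i, j))) = z (i, k)" using Tin[of "axis k 1"] by (simp add: T0 inner_axis')
    then show ?thesis
      by (simp only: matrix_vector_mul_assoc[symmetric] spike_mat_mult inner_add_right inner_scaleR_right tt) (simp add: algebra_simps)
  qed
  have xs: "(T *v s) \<bullet> ?x i = u i" for i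
  proof -
    have "(T *v s) \<bullet> (T *v (\<chi> j. z (i, j))) = u i" unfolding Tin u_def by (simp add: inner_vec_def)
    then show ?thesis using T0s
      by (simp only: matrix_vector_mul_assoc[symmetric] spike_mat_mult inner_add_right inner_scaleR_right) (simp add: inner_commute)
  qed
  have ab: "(1 + a)\<^sup>2 = 1 + b" using a by (simp add: power2_eq_square algebra_simps)
  have zk: "(\<Sum>i=1..n. (z (i, k))\<^sup>2) = n * (1 + moment_dev n z k k)"
    using n by (simp add: moment_dev_def power2_eq_square)
  have ss: "(\<Sum>j\<in>UNIV. (s $ j)\<^sup>2) = 1" using s(1) by (simp add: norm_vec_def L2_set_def)
  have uu: "(\<Sum>i=1..n. (u i)\<^sup>2) = n * (1 + sDs)"
  proof -
    have md: "n * moment_dev n z i j = (\<Sum>m=1..n. z (m, i) * z (m, j)) - (if i = j then n else 0)" for i j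
      using n by (simp add: moment_dev_def right_diff_distrib)
    have "n * sDs = (\<Sum>i\<in>UNIV. \<Sum>j\<in>UNIV. s $ i * s $ j * (n * moment_dev n z i j))"
      by (simp add: sDs sum_distrib_left mult_ac)
    also have "\<dots> = (\<Sum>i\<in>UNIV. \<Sum>j\<in>UNIV. s $ i * s $ j * (\<Sum>m=1..n. z (m, i) * z (m, j)))
       - (\<Sum>i\<in>UNIV. \<Sum>j\<in>UNIV. if i = j then s $ i * s $ j * n else 0)"
      unfolding md right_diff_distrib sum_subtractf by (intro arg_cong2[where f=minus] refl sum.cong) auto
    also have "(\<Sum>i\<in>UNIV. \<Sum>j\<in>UNIV. if i = j then s $ i * s $ j * n else 0) = n"
    proof -
      have "(\<Sum>i\<in>UNIV. \<Sum>j\<in>UNIV. if i = j then s $ i * s $ j * n else 0) = (\<Sum>i\<in>UNIV. (s $ i)\<^sup>2 * n)"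
        by (simp add: sum.delta power2_eq_square)
      then show ?thesis using ss by (simp flip: sum_distrib_right)
    qed
    also have "(\<Sum>i\<in>UNIV. \<Sum>j\<in>UNIV. s $ i * s $ j * (\<Sum>m=1..n. z (m, i) * z (m, j))) = (\<Sum>m=1..n. (u m)\<^sup>2)"
    proof -
      have "(\<Sum>m=1..n. (u m)\<^sup>2) = (\<Sum>m=1..n. \<Sum>i\<in>UNIV. \<Sum>j\<in>UNIV. s $ i * s $ j * (z (m, i) * z (m, j)))"
        by (simp add: u_def power2_eq_square sum_product mult_ac)
      also have "\<dots> = (\<Sum>i\<in>UNIV. \<Sum>m=1..n. \<Sum>j\<in>UNIV. s $ i * s $ j * (z (m, i) * z (m, j)))" by (rule sum.swap)
      also have "\<dots> = (\<Sum>i\<in>UNIV. \<Sum>j\<in>UNIV. \<Sum>m=1..n. s $ i * s $ j * (z (m, i) * z (m, j)))"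
        by (intro sum.cong refl sum.swap)
      finally show ?thesis by (simp add: sum_distrib_left)
    qed
    finally show ?thesis by (simp add: algebra_simps)
  qed
  have zu: "(\<Sum>i=1..n. z (i, k) * u i) = n * (sqrt (1 + moment_dev n z k k) / sqrt n * (s \<bullet> score n k z))"
  proof -
    have "(\<Sum>i=1..n. z (i, k) * u i) = (\<Sum>j\<in>UNIV. s $ j * (\<Sum>i=1..n. z (i, j) * z (i, k)))"
      unfolding u_def sum_distrib_left by (subst sum.swap) (simp add: mult_ac)
    also have "\<dots> = (\<Sum>j\<in>UNIV. n * (sqrt (1 + moment_dev n z k k) / sqrt n * (s $ j * score n k z $ j)))"
    proof (intro sum.cong refl)
      fix j
      show "s $ j * (\<Sum>i=1..n. z (i, j) * z (i, k)) = n * (sqrt (1 + moment_dev n z k k) / sqrt n * (s $ j * score n k z $ j))"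
      proof (cases "j = k")
        case False
        have "(\<Sum>i=1..n. z (i, j) * z (i, k)) = n * moment_dev n z j k" using False n by (simp add: moment_dev_def)
        also have "moment_dev n z j k = sqrt (1 + moment_dev n z k k) * score n k z $ j / sqrt n"
          using moment_dev_column[OF n False, of z] n by (simp add: field_simps)
        finally show ?thesis by (simp add: mult_ac)
      qed (simp add: s)
    qed
    also have "\<dots> = n * (sqrt (1 + moment_dev n z k k) / sqrt n * (s \<bullet> score n k z))"
      by (simp add: inner_vec_def sum_distrib_left)
    finally show ?thesis .
  qed
  have "(\<Sum>i=1..n. (\<theta> \<bullet> ?x i)\<^sup>2 - (\<theta>0 \<bullet> ?x i)\<^sup>2)
    = (\<Sum>i=1..n. (cs\<^sup>2 - 1) * (1 + b) * (z (i, k))\<^sup>2 + 2 * cs * sn * (1 + a) * (z (i, k) * u i) + sn\<^sup>2 * (u i)\<^sup>2)"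
  proof (intro sum.cong refl)
    fix i
    have "\<theta> \<bullet> ?x i = cs * ((1 + a) * z (i, k)) + sn * u i"
      unfolding \<theta> inner_add_left inner_scaleR_left x0 xs ..
    then have "(\<theta> \<bullet> ?x i)\<^sup>2 - (\<theta>0 \<bullet> ?x i)\<^sup>2 = (cs\<^sup>2 - 1) * (1 + a)\<^sup>2 * (z (i, k))\<^sup>2 + 2 * cs * sn * (1 + a) * (z (i, k) * u i) + sn\<^sup>2 * (u i)\<^sup>2"
      unfolding x0 by (simp add: power2_eq_square algebra_simps)
    then show "(\<theta> \<bullet> ?x i)\<^sup>2 - (\<theta>0 \<bullet> ?x i)\<^sup>2 = (cs\<^sup>2 - 1) * (1 + b) * (z (i, k))\<^sup>2 + 2 * cs * sn * (1 + a) * (z (i, k) * u i) + sn\<^sup>2 * (u i)\<^sup>2"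
      by (simp only: ab)
  qed
  also have "\<dots> = (cs\<^sup>2 - 1) * (1 + b) * (\<Sum>i=1..n. (z (i, k))\<^sup>2) + 2 * cs * sn * (1 + a) * (\<Sum>i=1..n. z (i, k) * u i) + sn\<^sup>2 * (\<Sum>i=1..n. (u i)\<^sup>2)"
    by (simp only: sum.distrib sum_distrib_left)
  \<comment> \<open>The two square sums now carry the weights -(1 + b) and 1 times the square of
    \<open>sn\<close>. Their means cancel down to b, which keeps the quadratic term bounded when b
    tends to 0.\<close>
  also have "cs\<^sup>2 - 1 = - sn\<^sup>2" using cs by simp
  finally have "(\<Sum>i=1..n. (\<theta> \<bullet> ?x i)\<^sup>2 - (\<theta>0 \<bullet> ?x i)\<^sup>2)
     = n * (- sn\<^sup>2 * (b + (1 + b) * moment_dev n z k k - sDs) + 2 * cs * sn * (1 + a) * sqrt (1 + moment_dev n z k k) / sqrt n * (s \<bullet> score n k z))"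
    unfolding zk uu zu by (simp add: algebra_simps)
  moreover have "log_lr b n \<theta>0 \<theta> (\<lambda>i\<in>{1..n}. ?x i) = b / (2 * (1 + b)) * (\<Sum>i=1..n. (\<theta> \<bullet> ?x i)\<^sup>2 - (\<theta>0 \<bullet> ?x i)\<^sup>2)"
    unfolding log_lr_def by (intro arg_cong2[where f=times] refl sum.cong) auto
  ultimately show ?thesis by simp
qed

context spiked_limit
begin

text \<open>Cosine and sine of the angle between the alternative and \<open>\<theta>0\<close>. The
  squared distance of the two unit vectors is 2 (1 - cs), so this cosine puts the alternative at
  distance exactly t / (sqrt n rho).\<close>

definition "cs t x = 1 - t\<^sup>2 / (2 * (sqrt (n x) * \<rho> x)\<^sup>2)"
definition "sn t x = sqrt (1 - (cs t x)\<^sup>2)"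

lemma cs_sn:
  shows cs_limit: "(cs t \<longlongrightarrow> 1) F"
    and sn_limit: "((\<lambda>x. (sqrt (n x) * \<rho> x)\<^sup>2 * (1 - (cs t x)\<^sup>2)) \<longlongrightarrow> t\<^sup>2) F"
    and cs_le: "\<forall>\<^sub>F x in F. (cs t x)\<^sup>2 \<le> 1"
proof -
  have w2: "filterlim (\<lambda>x. 2 * (sqrt (n x) * \<rho> x)\<^sup>2) at_top F"
    by (rule filterlim_tendsto_pos_mult_at_top[OF tendsto_const _ filterlim_pow_at_top[OF _ n\<rho>]]) auto
  have h: "((\<lambda>x. t\<^sup>2 / (2 * (sqrt (n x) * \<rho> x)\<^sup>2)) \<longlongrightarrow> 0) F"
    by (rule real_tendsto_divide_at_top[OF tendsto_const w2])
  show 1: "(cs t \<longlongrightarrow> 1) F" unfolding cs_def[abs_def] using tendsto_diff[OF tendsto_const[of 1] h] by simp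
  have pos: "\<forall>\<^sub>F x in F. sqrt (n x) * \<rho> x > 0" using n\<rho> by (simp add: filterlim_at_top_dense)
  have "((\<lambda>x. t\<^sup>2 / 2 * (1 + cs t x)) \<longlongrightarrow> t\<^sup>2 / 2 * (1 + 1)) F" by (intro tendsto_intros 1)
  moreover have "\<forall>\<^sub>F x in F. t\<^sup>2 / 2 * (1 + cs t x) = (sqrt (n x) * \<rho> x)\<^sup>2 * (1 - (cs t x)\<^sup>2)"
    using pos
  proof eventually_elim
    case (elim x)
    then have "(sqrt (n x) * \<rho> x)\<^sup>2 > 0" by (rule zero_less_power)
    then have w: "(sqrt (n x) * \<rho> x)\<^sup>2 \<noteq> 0" by (rule less_imp_neq[symmetric])
    have "(sqrt (n x) * \<rho> x)\<^sup>2 * (1 - cs t x) = t\<^sup>2 / 2" using w unfolding cs_def by (simp only: diff_diff_eq2) simp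
    moreover have "1 - (cs t x)\<^sup>2 = (1 - cs t x) * (1 + cs t x)" by (simp add: power2_eq_square algebra_simps)
    ultimately show ?case by (simp only: mult.assoc[symmetric])
  qed
  ultimately show "((\<lambda>x. (sqrt (n x) * \<rho> x)\<^sup>2 * (1 - (cs t x)\<^sup>2)) \<longlongrightarrow> t\<^sup>2) F" by (simp add: tendsto_cong)
  have "\<forall>\<^sub>F x in F. cs t x > 0" using order_tendstoD(1)[OF 1, of 0] by simp
  then show "\<forall>\<^sub>F x in F. (cs t x)\<^sup>2 \<le> 1"
  proof eventually_elim
    case (elim x)
    have "cs t x \<le> 1" by (simp add: cs_def)
    then show ?case using elim by (simp add: power_le_one)
  qed
qed

text \<open>The limit is the log-likelihood of a Gaussian shift of length v t / sigma in direction
  \<open>s x\<close>. The direction may vary with the index, which yields uniformity in it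
  later.\<close>

lemma log_lr_limit:
  fixes \<theta>0 :: "real^'p" and s :: "'a \<Rightarrow> real^'p" and T :: "real^'p^'p"
  assumes T: "orthogonal_matrix T" and T0: "T *v axis k 1 = \<theta>0" and t: "t \<ge> 0"
    and s: "\<forall>\<^sub>F x in F. norm (s x) = 1" "\<forall>\<^sub>F x in F. s x $ k = 0"
  shows "((\<lambda>x. log_lr (\<rho> x * v) (n x) \<theta>0 (cs t x *\<^sub>R \<theta>0 + sn t x *\<^sub>R (T *v s x)) (\<lambda>i\<in>{1..n x}. (spike_mat (a x) \<theta>0 ** T) *v (\<chi> j. z x (i, j)))
    - (v * t / \<sigma> * (s x \<bullet> score (n x) k (z x)) - (v * t / \<sigma>)\<^sup>2 / 2)) \<longlongrightarrow> 0) F"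
proof -
  define w where "w x = sqrt (n x) * \<rho> x" for x
  define \<mu> where "\<mu> x = moment_dev (n x) (z x) k k" for x
  define D where "D x = (\<Sum>i\<in>UNIV. \<Sum>j\<in>UNIV. s x $ i * moment_dev (n x) (z x) i j * s x $ j)" for x
  have Db: "\<forall>\<^sub>F x in F. \<bar>sqrt (n x) * D x\<bar> \<le> K"
    using s(1) tight
  proof eventually_elim
    case (elim x)
    have s1: "\<bar>s x $ i\<bar> \<le> 1" for i using component_le_norm_cart[of "s x" i] elim(1) by simp
    have "\<bar>D x\<bar> \<le> (\<Sum>i\<in>UNIV. \<Sum>j\<in>UNIV. \<bar>s x $ i * moment_dev (n x) (z x) i j * s x $ j\<bar>)"
      unfolding D_def by (intro order_trans[OF sum_abs] sum_mono sum_abs)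
    also have "\<dots> \<le> (\<Sum>i\<in>UNIV. \<Sum>j\<in>UNIV. \<bar>moment_dev (n x) (z x) i j\<bar>)"
    proof (intro sum_mono)
      fix i j
      have "\<bar>s x $ i\<bar> * \<bar>moment_dev (n x) (z x) i j\<bar> * \<bar>s x $ j\<bar> \<le> 1 * \<bar>moment_dev (n x) (z x) i j\<bar> * 1"
        by (intro mult_mono s1) auto
      then show "\<bar>s x $ i * moment_dev (n x) (z x) i j * s x $ j\<bar> \<le> \<bar>moment_dev (n x) (z x) i j\<bar>" by (simp add: abs_mult)
    qed
    finally have "sqrt (n x) * \<bar>D x\<bar> \<le> sqrt (n x) * (\<Sum>i\<in>UNIV. \<Sum>j\<in>UNIV. \<bar>moment_dev (n x) (z x) i j\<bar>)"
      by (intro mult_left_mono) auto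
    also have "\<dots> \<le> K" by (rule tight_boundD(1)[OF elim(2)])
    finally show ?case by (simp add: abs_mult)
  qed
  \<comment> \<open>The factor n rho^2 is pulled out and joined to the squared sine, where it tends
    to t^2; the deviations are left divided by one rho and vanish by
    \<open>bounded_over_sqrt_n_\<rho>\<close>.\<close>
  define c1 where "c1 x = v / (2 * (1 + \<rho> x * v)) * ((w x)\<^sup>2 * (1 - (cs t x)\<^sup>2)) * (v + ((1 + \<rho> x * v) * (\<mu> x / \<rho> x) - D x / \<rho> x))" for x
  define c2 where "c2 x = v / (1 + \<rho> x * v) * sqrt ((w x)\<^sup>2 * (1 - (cs t x)\<^sup>2)) * cs t x * (1 + a x) * sqrt (1 + \<mu> x)" for x
  have nz: "1 + \<delta> * v \<noteq> 0" using \<sigma> by (metis less_irrefl zero_less_power)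
  have c1: "(c1 \<longlongrightarrow> (v * t / \<sigma>)\<^sup>2 / 2) F"
  proof -
    have "(c1 \<longlongrightarrow> v / (2 * (1 + \<delta> * v)) * t\<^sup>2 * (v + ((1 + \<delta> * v) * 0 - 0))) F"
      unfolding c1_def[abs_def] w_def \<mu>_def
      by (intro tendsto_intros sn_limit \<rho> bounded_over_sqrt_n_\<rho>[OF moment_dev_bound] bounded_over_sqrt_n_\<rho>[OF Db]) (use nz in simp)
    then show ?thesis by (simp add: \<sigma>(2)[symmetric] power_mult_distrib power_divide power2_eq_square mult_ac)
  qed
  have c2: "(c2 \<longlongrightarrow> v * t / \<sigma>) F"
  proof -
    have "(c2 \<longlongrightarrow> v / (1 + \<delta> * v) * sqrt (t\<^sup>2) * 1 * \<sigma> * 1) F"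
      unfolding c2_def[abs_def] w_def \<mu>_def
      by (intro tendsto_mult tendsto_divide tendsto_add tendsto_const tendsto_real_sqrt sn_limit cs_limit a \<rho> scale_limit nz)
    then show ?thesis using t \<sigma>(1) by (simp add: \<sigma>(2)[symmetric] power2_eq_square)
  qed
  have "\<forall>\<^sub>F x in F. norm (s x \<bullet> score (n x) k (z x)) \<le> K"
    using s(1) score_bound
  proof eventually_elim
    case (elim x) then show ?case using Cauchy_Schwarz_ineq2[of "s x" "score (n x) k (z x)"] by simp
  qed
  then have "((\<lambda>x. (c2 x - v * t / \<sigma>) *\<^sub>R (s x \<bullet> score (n x) k (z x))) \<longlongrightarrow> 0) F"
    by (rule tendsto_scaleR_null_bounded[rotated]) (use c2 in \<open>simp add: LIM_zero_iff\<close>)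
  from tendsto_add[OF this tendsto_diff[OF tendsto_const[of "(v * t / \<sigma>)\<^sup>2 / 2"] c1]]
  have lim: "((\<lambda>x. (c2 x - v * t / \<sigma>) * (s x \<bullet> score (n x) k (z x)) + ((v * t / \<sigma>)\<^sup>2 / 2 - c1 x)) \<longlongrightarrow> 0) F" by simp
  have ev: "\<forall>\<^sub>F x in F. log_lr (\<rho> x * v) (n x) \<theta>0 (cs t x *\<^sub>R \<theta>0 + sn t x *\<^sub>R (T *v s x)) (\<lambda>i\<in>{1..n x}. (spike_mat (a x) \<theta>0 ** T) *v (\<chi> j. z x (i, j)))
    - (v * t / \<sigma> * (s x \<bullet> score (n x) k (z x)) - (v * t / \<sigma>)\<^sup>2 / 2)
    = (c2 x - v * t / \<sigma>) * (s x \<bullet> score (n x) k (z x)) + ((v * t / \<sigma>)\<^sup>2 / 2 - c1 x)"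
    using n1 \<rho>_pos s cs_le[of t]
  proof eventually_elim
    case (elim x)
    have aa: "a x * (2 + a x) = \<rho> x * v" unfolding a_def using elim(2) v by (intro spike_root) simp
    have snn: "sn t x \<ge> 0" "(sn t x)\<^sup>2 = 1 - (cs t x)\<^sup>2" using elim(5) by (simp_all add: sn_def)
    have L: "log_lr (\<rho> x * v) (n x) \<theta>0 (cs t x *\<^sub>R \<theta>0 + sn t x *\<^sub>R (T *v s x)) (\<lambda>i\<in>{1..n x}. (spike_mat (a x) \<theta>0 ** T) *v (\<chi> j. z x (i, j)))
      = n x * (\<rho> x * v) / (2 * (1 + \<rho> x * v)) * (- (sn t x)\<^sup>2 * (\<rho> x * v + (1 + \<rho> x * v) * \<mu> x - D x)
      + 2 * cs t x * sn t x * (1 + a x) * sqrt (1 + \<mu> x) / sqrt (n x) * (s x \<bullet> score (n x) k (z x)))"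
      unfolding \<mu>_def
      by (rule log_lr_spiked[OF elim(1) T T0 aa elim(3,4) _ refl D_def]) (simp add: snn)
    have w2: "(w x)\<^sup>2 = n x * (\<rho> x)\<^sup>2" by (simp add: w_def power_mult_distrib)
    define B where "B = 1 + \<rho> x * v"
    have r: "\<rho> x * (v + (B * (\<mu> x / \<rho> x) - D x / \<rho> x)) = \<rho> x * v + B * \<mu> x - D x"
      using elim(2) by (simp add: field_simps)
    have "c1 x = n x * (\<rho> x * v) / (2 * B) * ((sn t x)\<^sup>2 * (\<rho> x * (v + (B * (\<mu> x / \<rho> x) - D x / \<rho> x))))"
      unfolding c1_def w2 snn(2)[symmetric] B_def[symmetric] by (simp add: power2_eq_square)
    then have p1: "n x * (\<rho> x * v) / (2 * B) * ((sn t x)\<^sup>2 * (\<rho> x * v + B * \<mu> x - D x)) = c1 x" unfolding r by (rule sym)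
    have w1: "sqrt ((w x)\<^sup>2 * (1 - (cs t x)\<^sup>2)) = sqrt (n x) * \<rho> x * sn t x"
      using elim(2) by (simp add: real_sqrt_mult w2 sn_def)
    have n2: "real (n x) / sqrt (n x) = sqrt (n x)" by (rule real_div_sqrt) simp
    have "n x * (\<rho> x * v) / (2 * B) * (2 * cs t x * sn t x * (1 + a x) * sqrt (1 + \<mu> x) / sqrt (n x))
         = v / B * ((real (n x) / sqrt (n x)) * \<rho> x * sn t x) * cs t x * (1 + a x) * sqrt (1 + \<mu> x)"
      by (simp add: mult_ac)
    also have "\<dots> = c2 x" unfolding c2_def w1 n2 B_def ..
    finally have p2: "n x * (\<rho> x * v) / (2 * B) * (2 * cs t x * sn t x * (1 + a x) * sqrt (1 + \<mu> x) / sqrt (n x)) = c2 x" .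
    have "log_lr (\<rho> x * v) (n x) \<theta>0 (cs t x *\<^sub>R \<theta>0 + sn t x *\<^sub>R (T *v s x)) (\<lambda>i\<in>{1..n x}. (spike_mat (a x) \<theta>0 ** T) *v (\<chi> j. z x (i, j)))
       = - c1 x + c2 x * (s x \<bullet> score (n x) k (z x))"
      unfolding L p1[symmetric] p2[symmetric] B_def[symmetric] by (simp add: algebra_simps)
    then show ?case by (simp add: algebra_simps)
  qed
  show ?thesis
    by (rule Lim_transform_eventually[OF lim]) (use ev in eventually_elim, simp only:)
qed

end

section \<open>The limit law of the statistic\<close>

lemma sample_component_measurable:
  "i \<in> {1..n} \<Longrightarrow> (\<lambda>x. x i) \<in> borel_measurable (sample_space n :: (nat \<Rightarrow> real^'p) measure)"
  unfolding sample_space_def by (rule measurable_component_singleton)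

lemma borel_measurable_outer_product [measurable (raw)]:
  fixes f g :: "'a \<Rightarrow> real^'p"
  assumes "f \<in> borel_measurable M" "g \<in> borel_measurable M"
  shows "(\<lambda>x. outer_product (f x) (g x)) \<in> borel_measurable M"
proof -
  have "continuous_on UNIV (\<lambda>p :: (real^'p) \<times> (real^'p). outer_product (fst p) (snd p))"
    unfolding outer_product_def by (intro continuous_intros)
  then have "(\<lambda>p :: (real^'p) \<times> (real^'p). outer_product (fst p) (snd p)) \<in> borel_measurable borel"
    by (rule borel_measurable_continuous_onI)
  from measurable_compose[OF borel_measurable_Pair[OF assms] this] show ?thesis by simp
qed

lemma sample_cov_measurable [measurable]:
  "sample_cov n \<in> borel_measurable (sample_space n :: (nat \<Rightarrow> real^'p) measure)"
proof -
  have m: "sample_mean n \<in> borel_measurable (sample_space n :: (nat \<Rightarrow> real^'p) measure)"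
    unfolding sample_mean_def by (intro borel_measurable_scaleR borel_measurable_const borel_measurable_sum sample_component_measurable)
  show ?thesis
    unfolding sample_cov_def
    by (intro borel_measurable_scaleR borel_measurable_const borel_measurable_sum borel_measurable_outer_product
        borel_measurable_diff sample_component_measurable m)
qed

lemma gram_schmidt_measurable:
  fixes e :: "nat \<Rightarrow> 'a \<Rightarrow> real^'p"
  assumes "\<And>j. j \<in> {2..m} \<Longrightarrow> e j \<in> borel_measurable M" "j \<in> {2..m}"
  shows "(\<lambda>x. gram_schmidt \<theta> (\<lambda>k. e k x) j) \<in> borel_measurable M"
  using assms(2)
proof (induction j rule: less_induct)
  case (less j)
  have s: "(sgn :: real^'p \<Rightarrow> real^'p) \<in> borel_measurable borel"
    unfolding sgn_div_norm by measurable
  have e: "e j \<in> borel_measurable M" using assms(1) less.prems by auto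
  have g: "(\<lambda>x. gram_schmidt \<theta> (\<lambda>k. e k x) i) \<in> borel_measurable M" if "i \<in> {2..<j}" for i
    using less.IH[of i] that less.prems by auto
  have "(\<lambda>x. e j x - (\<theta> \<bullet> e j x) *\<^sub>R \<theta> - (\<Sum>k\<in>{2..<j}. (gram_schmidt \<theta> (\<lambda>k. e k x) k \<bullet> e j x) *\<^sub>R gram_schmidt \<theta> (\<lambda>k. e k x) k)) \<in> borel_measurable M"
    by (intro borel_measurable_diff borel_measurable_scaleR borel_measurable_inner borel_measurable_const borel_measurable_sum e g)
  from measurable_compose[OF this s] show ?case by (subst gram_schmidt_eq) simp
qed

text \<open>The eigenvalues are Rayleigh quotients of the given eigenvectors, so their measurability
  follows from that of \<open>E\<close>.\<close>

lemma Q_HPV_measurable: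
  fixes E :: "nat \<Rightarrow> nat \<Rightarrow> (nat \<Rightarrow> real^'p) \<Rightarrow> real^'p"
  assumes E: "sample_eigenvectors E" and n: "n \<ge> 1"
  shows "Q_HPV \<theta>0 E n \<in> borel_measurable (sample_space n)"
proof -
  have Em: "E n j \<in> borel_measurable (sample_space n)"
    and En: "\<And>x. x \<in> space (sample_space n) \<Longrightarrow> norm (E n j x) = 1 \<and> sample_cov n x *v E n j x = eigenvalue (sample_cov n x) j *\<^sub>R E n j x"
    if "j \<in> {1..CARD('p)}" for j
    using E n that unfolding sample_eigenvectors_def by blast+
  have ev: "(\<lambda>x. eigenvalue (sample_cov n x) j) \<in> borel_measurable (sample_space n :: (nat \<Rightarrow> real^'p) measure)" if j: "j \<in> {1..CARD('p)}" for j
  proof -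
    have "(\<lambda>x. E n j x \<bullet> (sample_cov n x *v E n j x)) \<in> borel_measurable (sample_space n)"
      by (intro borel_measurable_inner borel_measurable_matrix_vector_mult Em[OF j] sample_cov_measurable)
    then show ?thesis
    proof (rule measurable_cong[THEN iffD1, rotated])
      fix x assume "x \<in> space (sample_space n :: (nat \<Rightarrow> real^'p) measure)"
      from En[OF j this] show "E n j x \<bullet> (sample_cov n x *v E n j x) = eigenvalue (sample_cov n x) j"
        by (simp add: norm_eq_1)
    qed
  qed
  have p: "1 \<in> {1..CARD('p)}" by (simp add: Suc_le_eq One_nat_def)
  have gs: "(\<lambda>x. gram_schmidt \<theta>0 (\<lambda>k. E n k x) j) \<in> borel_measurable (sample_space n)" if "j \<in> {2..CARD('p)}" for j
    by (rule gram_schmidt_measurable[OF Em that]) auto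
  have "(\<lambda>x. real n / eigenvalue (sample_cov n x) 1 *
     (\<Sum>j=2..CARD('p). inverse (eigenvalue (sample_cov n x) j) *
        (gram_schmidt \<theta>0 (\<lambda>k. E n k x) j \<bullet> (sample_cov n x *v \<theta>0))\<^sup>2)) \<in> borel_measurable (sample_space n)"
    by (intro borel_measurable_times borel_measurable_divide borel_measurable_const borel_measurable_sum borel_measurable_inverse
        borel_measurable_power borel_measurable_inner borel_measurable_matrix_vector_mult sample_cov_measurable gs ev p) auto
  then show ?thesis by (simp only: Q_HPV_def[abs_def])
qed

lemma test_sequence_phi_HPV:
  fixes \<theta>0 :: "real^'p"
  assumes E: "sample_eigenvectors E"
  shows "test_sequence (phi_HPV \<theta>0 E \<alpha>)"
  unfolding test_sequence_def phi_HPV_def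
proof (intro allI impI conjI ballI)
  fix n :: nat assume n: "n \<ge> 1"
  have [measurable]: "Q_HPV \<theta>0 E n \<in> borel_measurable (sample_space n)" by (rule Q_HPV_measurable[OF E n])
  let ?q = "quantile (chi_square (CARD('p) - 1)) (1 - \<alpha>)"
  have "(\<lambda>x. indicator {y. y > ?q} (Q_HPV \<theta>0 E n x) :: real) \<in> borel_measurable (sample_space n)" by measurable
  also have "(\<lambda>x. indicator {y. y > ?q} (Q_HPV \<theta>0 E n x) :: real) = indicator {x. Q_HPV \<theta>0 E n x > ?q}"
    by (auto simp: indicator_def fun_eq_iff)
  finally show "(indicator {x. Q_HPV \<theta>0 E n x > ?q} :: _ \<Rightarrow> real) \<in> borel_measurable (sample_space n)" .
qed (auto simp: indicator_def)

lemma sample_map_measurable [measurable]: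
  "(\<lambda>z. \<lambda>i\<in>{1..n}. (L :: real^'p^'p) *v (\<chi> j. z (i, j))) \<in> measurable (gauss_array n) (sample_space n)"
  unfolding sample_space_def
proof (rule measurable_restrict)
  fix i assume "i \<in> {1..n}"
  then have "(\<lambda>z. \<chi> j. z (i, j)) \<in> borel_measurable (gauss_array n :: (nat \<times> 'p \<Rightarrow> real) measure)"
    by (intro borel_measurable_vec gauss_array_component)
  then show "(\<lambda>z. L *v (\<chi> j. z (i, j))) \<in> borel_measurable (gauss_array n)" by measurable
qed

text \<open>By continuity the level is attained and the set under the infimum is closed; its infimum
  belongs to it and cannot exceed a point where the level is attained.\<close>

lemma cdf_quantile:
  assumes M: "real_distribution M" and cont: "\<And>x. isCont (cdf M) x" and u: "0 < u" "u < 1"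
  shows "cdf M (quantile M u) = u"
proof -
  interpret real_distribution M by fact
  define A where "A = {x. u \<le> cdf M x}"
  have c: "continuous_on UNIV (cdf M)" using cont by (simp add: continuous_at_imp_continuous_on)
  obtain x1 where x1: "cdf M x1 < u"
    using order_tendstoD(2)[OF cdf_lim_at_bot u(1)] by (auto simp: eventually_at_bot_linorder)
  obtain x2 where x2: "cdf M x2 > u"
    using order_tendstoD(1)[OF cdf_lim_at_top_prob u(2)] by (auto simp: eventually_at_top_linorder)
  have "x1 \<le> x2" using x1 x2 cdf_nondecreasing[of x2 x1] by linarith
  then obtain x0 where x0: "cdf M x0 = u"
    using IVT'[of "cdf M" x1 u x2] x1 x2 continuous_on_subset[OF c] by force
  have ne: "A \<noteq> {}" using x0 by (auto simp: A_def)
  have bdd: "bdd_below A"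
  proof (rule bdd_belowI[of _ x1])
    fix x assume "x \<in> A"
    then show "x1 \<le> x" using x1 cdf_nondecreasing[of x x1] unfolding A_def by (metis linear mem_Collect_eq not_less order_trans)
  qed
  have "closed A" unfolding A_def by (intro closed_Collect_le continuous_on_const c)
  then have "Inf A \<in> A" using ne bdd by (intro closed_contains_Inf) auto
  moreover have "Inf A \<le> x0" using bdd x0 by (intro cInf_lower) (auto simp: A_def)
  then have "cdf M (Inf A) \<le> u" using cdf_nondecreasing[of "Inf A" x0] x0 by simp
  ultimately show ?thesis by (simp add: quantile_def A_def)
qed

text \<open>A Slutsky argument. Each approximating variable \<open>Y j\<close> has exactly the limit
  law, so the error comes from closeness and from continuity of the limit at \<open>q\<close>
  alone.\<close>

lemma prob_tendsto_of_close:
  fixes X Y :: "'i \<Rightarrow> 'a \<Rightarrow> real" and M :: "'i \<Rightarrow> 'a measure"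
  assumes M: "\<forall>\<^sub>F j in F. prob_space (M j) \<and> X j \<in> borel_measurable (M j) \<and> Y j \<in> borel_measurable (M j) \<and> distr (M j) borel (Y j) = \<mu>"
    and \<mu>: "real_distribution \<mu>" and q: "isCont (cdf \<mu>) q"
    and close: "\<And>\<epsilon> \<eta>. \<epsilon> > 0 \<Longrightarrow> \<eta> > 0 \<Longrightarrow> \<forall>\<^sub>F j in F. measure (M j) {z \<in> space (M j). \<bar>X j z - Y j z\<bar> > \<eta>} \<le> \<epsilon>"
  shows "((\<lambda>j. measure (M j) {z \<in> space (M j). X j z \<le> q}) \<longlongrightarrow> cdf \<mu> q) F"
proof (rule tendstoI)
  fix \<epsilon> :: real assume \<epsilon>: "\<epsilon> > 0"
  obtain d where d: "d > 0" "\<And>y. \<bar>y - q\<bar> < d \<Longrightarrow> \<bar>cdf \<mu> y - cdf \<mu> q\<bar> < \<epsilon> / 2"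
    using q \<epsilon> unfolding continuous_at_eps_delta dist_real_def by (meson half_gt_zero)
  define \<eta> where "\<eta> = d / 2"
  have \<eta>: "\<eta> > 0" "\<eta> < d" using d by (auto simp: \<eta>_def)
  have up: "cdf \<mu> (q + \<eta>) < cdf \<mu> q + \<epsilon> / 2" and lo: "cdf \<mu> (q - \<eta>) > cdf \<mu> q - \<epsilon> / 2"
  proof -
    have "\<bar>cdf \<mu> (q + \<eta>) - cdf \<mu> q\<bar> < \<epsilon> / 2" "\<bar>cdf \<mu> (q - \<eta>) - cdf \<mu> q\<bar> < \<epsilon> / 2"
      by (rule d(2); use \<eta> in simp)+
    then show "cdf \<mu> (q + \<eta>) < cdf \<mu> q + \<epsilon> / 2" "cdf \<mu> (q - \<eta>) > cdf \<mu> q - \<epsilon> / 2" by linarith+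
  qed
  have "\<epsilon> / 3 > 0" using \<epsilon> by simp
  from close[OF this \<eta>(1)] M
  show "\<forall>\<^sub>F j in F. dist (measure (M j) {z \<in> space (M j). X j z \<le> q}) (cdf \<mu> q) < \<epsilon>"
  proof eventually_elim
    case (elim j)
    interpret prob_space "M j" using elim(2) by blast
    have [measurable]: "X j \<in> borel_measurable (M j)" "Y j \<in> borel_measurable (M j)" using elim(2) by auto
    have Yd: "measure (M j) {z \<in> space (M j). Y j z \<le> y} = cdf \<mu> y" for y
    proof -
      have "cdf \<mu> y = measure (distr (M j) borel (Y j)) {..y}" using elim(2) by (simp add: cdf_def)
      also have "\<dots> = measure (M j) {z \<in> space (M j). Y j z \<le> y}"
        by (subst measure_distr) (auto intro!: arg_cong[where f="measure (M j)"])
      finally show ?thesis by simp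
    qed
    let ?D = "{z \<in> space (M j). \<bar>X j z - Y j z\<bar> > \<eta>}"
    have "measure (M j) {z \<in> space (M j). X j z \<le> q} \<le> measure (M j) ({z \<in> space (M j). Y j z \<le> q + \<eta>} \<union> ?D)"
      by (intro finite_measure_mono) auto
    also have "\<dots> \<le> measure (M j) {z \<in> space (M j). Y j z \<le> q + \<eta>} + measure (M j) ?D"
      by (intro measure_Un_le) measurable
    finally have 1: "measure (M j) {z \<in> space (M j). X j z \<le> q} \<le> cdf \<mu> (q + \<eta>) + \<epsilon> / 3" using elim(1) by (simp add: Yd)
    have "measure (M j) {z \<in> space (M j). Y j z \<le> q - \<eta>} \<le> measure (M j) ({z \<in> space (M j). X j z \<le> q} \<union> ?D)"
      by (intro finite_measure_mono) auto
    also have "\<dots> \<le> measure (M j) {z \<in> space (M j). X j z \<le> q} + measure (M j) ?D"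
      by (intro measure_Un_le) measurable
    finally have 2: "cdf \<mu> (q - \<eta>) \<le> measure (M j) {z \<in> space (M j). X j z \<le> q} + \<epsilon> / 3" using elim(1) by (simp add: Yd)
    show ?case unfolding dist_real_def using 1 2 up lo \<epsilon> by linarith
  qed
qed

lemma real_distribution_norm_proj_shift:
  "real_distribution (distr (std_gauss :: (real^'p) measure) borel (\<lambda>g. (norm (proj_perp k g + m))\<^sup>2))"
proof -
  interpret prob_space "std_gauss :: (real^'p) measure" by (rule prob_space_std_gauss)
  show ?thesis by (rule real_distribution_distr) measurable
qed

lemma isCont_cdf_norm_proj_shift:
  fixes m :: "real^'p"
  assumes p: "CARD('p) \<ge> 2"
  shows "isCont (cdf (distr std_gauss borel (\<lambda>g. (norm (proj_perp k g + m))\<^sup>2))) q"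
proof -
  interpret real_distribution "distr (std_gauss :: (real^'p) measure) borel (\<lambda>g. (norm (proj_perp k g + m))\<^sup>2)"
    by (rule real_distribution_norm_proj_shift)
  interpret S: prob_space "std_gauss :: (real^'p) measure" by (rule prob_space_std_gauss)
  have "measure (distr (std_gauss :: (real^'p) measure) borel (\<lambda>g. (norm (proj_perp k g + m))\<^sup>2)) {q}
     = measure std_gauss {g. (norm (proj_perp k g + m))\<^sup>2 = q}"
    by (subst measure_distr) (auto intro!: arg_cong[where f="measure std_gauss"])
  also have "\<dots> = 0"
    using AE_norm_proj_shift_neq[OF p, of k m q] by (subst S.prob_eq_0) auto
  finally show ?thesis by (simp add: isCont_cdf)
qed

text \<open>Stated along an index sequence \<open>N\<close> with directions of its own, because
  attainment of the power bound is shown on a subsequence of alternatives that is only selected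
  later.\<close>

lemma Q_HPV_cdf_limit:
  fixes \<theta>0 :: "real^'p" and E :: "nat \<Rightarrow> nat \<Rightarrow> (nat \<Rightarrow> real ^ 'p) \<Rightarrow> real ^ 'p" and \<theta> :: "nat \<Rightarrow> real^'p"
  assumes p: "CARD('p) \<ge> 2" and v: "v > 0" and \<delta>: "\<delta> \<ge> 0"
    and r: "\<And>n. n \<ge> 1 \<Longrightarrow> r n > 0" "r \<longlonglongrightarrow> \<delta>" "filterlim (\<lambda>n. sqrt (real n) * r n) at_top sequentially"
    and E: "sample_eigenvectors E"
    and T: "orthogonal_matrix T" and T0: "T *v axis k 1 = \<theta>0"
    and N: "filterlim N at_top sequentially" and \<theta>: "\<forall>\<^sub>F j in sequentially. norm (\<theta> j) = 1"
    and \<tau>: "(\<lambda>j. (sqrt (N j) * r (N j)) *\<^sub>R (\<theta> j - \<theta>0)) \<longlonglongrightarrow> \<tau>"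
  shows "(\<lambda>j. measure (spiked_model r v (N j) (\<theta> j)) {x \<in> space (sample_space (N j)). Q_HPV \<theta>0 E (N j) x \<le> q})
    \<longlonglongrightarrow> cdf (distr std_gauss borel (\<lambda>g. (norm (proj_perp k g + (v / sqrt (1 + \<delta> * v)) *\<^sub>R (transpose T *v \<tau>)))\<^sup>2)) q"
proof -
  define L where "L j = spike_mat (sqrt (1 + r (N j) * v) - 1) (\<theta> j) ** T" for j
  define X where "X j z = (\<lambda>i\<in>{1..N j}. L j *v (\<chi> l. z (i, l)))" for j and z :: "nat \<times> 'p \<Rightarrow> real"
  define m where "m = (v / sqrt (1 + \<delta> * v)) *\<^sub>R (transpose T *v \<tau>)"
  define \<mu> where "\<mu> = distr std_gauss borel (\<lambda>g. (norm (proj_perp k g + m))\<^sup>2)"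
  let ?G = "\<lambda>j. gauss_array (N j) :: (nat \<times> 'p \<Rightarrow> real) measure"
  have \<theta>0: "norm \<theta>0 = 1" using orthogonal_matrix_mult_inverse(3)[OF T, of "axis k 1"] T0 by simp
  have Nge: "\<forall>\<^sub>F j in sequentially. N j \<ge> b" for b using N by (auto simp: filterlim_at_top)
  have rN: "(\<lambda>j. r (N j)) \<longlonglongrightarrow> \<delta>" by (rule filterlim_compose[OF r(2) N])
  have nrN: "filterlim (\<lambda>j. sqrt (N j) * r (N j)) at_top sequentially" by (rule filterlim_compose[OF r(3) N])
  have Xm: "X j \<in> measurable (?G j) (sample_space (N j))" for j unfolding X_def[abs_def] by (rule sample_map_measurable)
  have Lm: "invertible (L j)" if "N j \<ge> 1" "norm (\<theta> j) = 1" for j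
  proof -
    have "det T \<noteq> 0" using det_orthogonal_matrix[OF T] by auto
    moreover have "det (spike_mat (sqrt (1 + r (N j) * v) - 1) (\<theta> j)) > 0"
      using r(1)[OF that(1)] v by (simp add: det_spike_mat[OF that(2)] add_pos_pos)
    ultimately show ?thesis by (simp add: L_def invertible_det_nz det_mul)
  qed
  have np: "\<forall>\<^sub>F j in sequentially. AE z in ?G j. no_eigenvector_perp \<theta>0 (sample_cov (N j) (X j z))"
    using Nge[of "2 * CARD('p)"] Nge[of 1] \<theta>
  proof eventually_elim
    case (elim j)
    have "sample_cov (N j) (X j z) = sample_cov (N j) (\<lambda>i. L j *v (\<chi> l. z (i, l)))" for z
      by (rule sample_cov_cong) (simp add: X_def)
    then show ?case using AE_no_eigenvector_perp[OF \<theta>0 elim(1) Lm[OF elim(2,3)]] by simp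
  qed
  have lim: "(\<lambda>j. measure (?G j) {z \<in> space (?G j). Q_HPV \<theta>0 E (N j) (X j z) \<le> q}) \<longlonglongrightarrow> cdf \<mu> q"
  proof (rule prob_tendsto_of_close[where Y="\<lambda>j z. (norm (score (N j) k z + m))\<^sup>2"])
    show "real_distribution \<mu>" unfolding \<mu>_def by (rule real_distribution_norm_proj_shift)
    show "isCont (cdf \<mu>) q" unfolding \<mu>_def by (rule isCont_cdf_norm_proj_shift[OF p])
    show "\<forall>\<^sub>F j in sequentially. prob_space (?G j) \<and> (\<lambda>z. Q_HPV \<theta>0 E (N j) (X j z)) \<in> borel_measurable (?G j) \<and>
       (\<lambda>z. (norm (score (N j) k z + m))\<^sup>2) \<in> borel_measurable (?G j) \<and> distr (?G j) borel (\<lambda>z. (norm (score (N j) k z + m))\<^sup>2) = \<mu>"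
      using Nge[of 1]
    proof eventually_elim
      case (elim j)
      have "distr (?G j) borel (\<lambda>z. (norm (score (N j) k z + m))\<^sup>2) = distr (distr (?G j) borel (score (N j) k)) borel (\<lambda>w. (norm (w + m))\<^sup>2)"
        by (subst distr_distr) (auto simp: o_def)
      also have "\<dots> = \<mu>" unfolding distr_score[OF elim p] \<mu>_def by (subst distr_distr) (auto simp: o_def)
      finally have 1: "distr (?G j) borel (\<lambda>z. (norm (score (N j) k z + m))\<^sup>2) = \<mu>" .
      have 2: "(\<lambda>z. Q_HPV \<theta>0 E (N j) (X j z)) \<in> borel_measurable (?G j)"
        using measurable_compose[OF Xm Q_HPV_measurable[OF E elim]] .
      have 3: "(\<lambda>z. (norm (score (N j) k z + m))\<^sup>2) \<in> borel_measurable (?G j)"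
        by measurable
      show ?case using 1 2 3 prob_space_PiM_std_normal by blast
    qed
  next
    fix \<epsilon> \<eta> :: real assume \<epsilon>: "\<epsilon> > 0" and \<eta>: "\<eta> > 0"
    obtain K where K: "\<And>n. n \<ge> 1 \<Longrightarrow> measure (gauss_array n) {z \<in> space (gauss_array n). tight_bound n k z > K} \<le> \<epsilon>"
      using tightness[OF p \<epsilon>, of k] by blast
    define B where "B j z \<longleftrightarrow> tight_bound (N j) k z \<le> K \<and> no_eigenvector_perp \<theta>0 (sample_cov (N j) (X j z))" for j z
    \<comment> \<open>A property holds eventually along this filter iff, for all large j, it holds
      for every array satisfying \<open>B\<close>. Convergence along it is uniform convergence on
      the good set.\<close>
    define F where "F = inf (filtercomap fst sequentially) (principal {(j, z). B j z})"
    have fstF: "filterlim fst sequentially F" unfolding F_def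
      by (rule filterlim_mono[OF filterlim_filtercomap order_refl]) simp
    have BF: "\<forall>\<^sub>F y in F. B (fst y) (snd y)" unfolding F_def eventually_inf_principal by (simp add: case_prod_beta)
    interpret L: spiked_limit F "\<lambda>y. N (fst y)" snd "\<lambda>y. r (N (fst y))" v \<delta> K k
    proof
      show "filterlim (\<lambda>y. N (fst y)) at_top F" by (rule filterlim_compose[OF N fstF])
      show "((\<lambda>y. r (N (fst y))) \<longlongrightarrow> \<delta>) F" by (rule filterlim_compose[OF rN fstF])
      show "filterlim (\<lambda>y. sqrt (N (fst y)) * r (N (fst y))) at_top F" by (rule filterlim_compose[OF nrN fstF])
      show "\<forall>\<^sub>F y in F. r (N (fst y)) > 0"
        using eventually_compose_filterlim[OF Nge[of 1] fstF] by eventually_elim (rule r(1))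
      show "\<forall>\<^sub>F y in F. tight_bound (N (fst y)) k (snd y) \<le> K" using BF by eventually_elim (simp add: B_def)
    qed (use v \<delta> in auto)
    have "((\<lambda>y. Q_HPV \<theta>0 E (N (fst y)) (\<lambda>i\<in>{1..N (fst y)}. (spike_mat (L.a y) (\<theta> (fst y)) ** T) *v (\<chi> l. snd y (i, l)))
       - (norm (score (N (fst y)) k (snd y) + (v / L.\<sigma>) *\<^sub>R (transpose T *v \<tau>)))\<^sup>2) \<longlongrightarrow> 0) F"
    proof (rule L.Q_HPV_limit[OF T T0 _ _ E])
      show "\<forall>\<^sub>F y in F. norm (\<theta> (fst y)) = 1" by (rule eventually_compose_filterlim[OF \<theta> fstF])
      show "((\<lambda>y. (sqrt (N (fst y)) * r (N (fst y))) *\<^sub>R (\<theta> (fst y) - \<theta>0)) \<longlongrightarrow> \<tau>) F" by (rule filterlim_compose[OF \<tau> fstF])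
      show "\<forall>\<^sub>F y in F. no_eigenvector_perp \<theta>0 (sample_cov (N (fst y)) (\<lambda>i\<in>{1..N (fst y)}. (spike_mat (L.a y) (\<theta> (fst y)) ** T) *v (\<chi> l. snd y (i, l))))"
        using BF by eventually_elim (simp add: B_def X_def L_def L.a_def)
    qed
    then have "((\<lambda>y. Q_HPV \<theta>0 E (N (fst y)) (X (fst y) (snd y)) - (norm (score (N (fst y)) k (snd y) + m))\<^sup>2) \<longlongrightarrow> 0) F"
      by (simp add: X_def L_def L.a_def L.\<sigma>_def m_def)
    from tendstoD[OF this \<eta>]
    have "\<forall>\<^sub>F y in F. \<bar>Q_HPV \<theta>0 E (N (fst y)) (X (fst y) (snd y)) - (norm (score (N (fst y)) k (snd y) + m))\<^sup>2\<bar> < \<eta>" by simp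
    then have "\<forall>\<^sub>F y in filtercomap fst sequentially. B (fst y) (snd y) \<longrightarrow> \<bar>Q_HPV \<theta>0 E (N (fst y)) (X (fst y) (snd y)) - (norm (score (N (fst y)) k (snd y) + m))\<^sup>2\<bar> < \<eta>"
      unfolding F_def eventually_inf_principal by (simp add: case_prod_beta)
    then have ev: "\<forall>\<^sub>F j in sequentially. \<forall>z. B j z \<longrightarrow> \<bar>Q_HPV \<theta>0 E (N j) (X j z) - (norm (score (N j) k z + m))\<^sup>2\<bar> < \<eta>"
      unfolding eventually_filtercomap by (auto elim!: eventually_mono)
    show "\<forall>\<^sub>F j in sequentially. measure (?G j) {z \<in> space (?G j). \<bar>Q_HPV \<theta>0 E (N j) (X j z) - (norm (score (N j) k z + m))\<^sup>2\<bar> > \<eta>} \<le> \<epsilon>"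
      using ev np Nge[of 1]
    proof eventually_elim
      case (elim j)
      interpret prob_space "?G j" by (rule prob_space_PiM_std_normal)
      have close: "B j z \<Longrightarrow> \<bar>Q_HPV \<theta>0 E (N j) (X j z) - (norm (score (N j) k z + m))\<^sup>2\<bar> < \<eta>" for z
        using elim(1) by blast
      \<comment> \<open>Up to the null event where some eigenvector is orthogonal to
        \<open>\<theta>0\<close>, closeness can fail only where the tightness bound fails.\<close>
      have "measure (?G j) {z \<in> space (?G j). \<bar>Q_HPV \<theta>0 E (N j) (X j z) - (norm (score (N j) k z + m))\<^sup>2\<bar> > \<eta>}
         \<le> measure (?G j) {z \<in> space (?G j). tight_bound (N j) k z > K}"
      proof (rule finite_measure_mono_AE)
        show "AE z in ?G j. z \<in> {z \<in> space (?G j). \<bar>Q_HPV \<theta>0 E (N j) (X j z) - (norm (score (N j) k z + m))\<^sup>2\<bar> > \<eta>} \<longrightarrow>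
          z \<in> {z \<in> space (?G j). tight_bound (N j) k z > K}"
          using elim(2)
        proof eventually_elim
          case (elim z)
          then show ?case using close[of z] by (cases "tight_bound (N j) k z \<le> K") (auto simp: B_def)
        qed
        show "{z \<in> space (?G j). tight_bound (N j) k z > K} \<in> sets (?G j)" by measurable
      qed
      also have "\<dots> \<le> \<epsilon>" by (rule K[OF elim(3)])
      finally show ?case .
    qed
  qed
  have ev: "\<forall>\<^sub>F j in sequentially. measure (?G j) {z \<in> space (?G j). Q_HPV \<theta>0 E (N j) (X j z) \<le> q}
     = measure (spiked_model r v (N j) (\<theta> j)) {x \<in> space (sample_space (N j)). Q_HPV \<theta>0 E (N j) x \<le> q}"
    using Nge[of 1] \<theta>
  proof eventually_elim
    case (elim j)
    have rv: "r (N j) * v > 0" using r(1)[OF elim(1)] v by simp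
    have [measurable]: "Q_HPV \<theta>0 E (N j) \<in> borel_measurable (sample_space (N j))" by (rule Q_HPV_measurable[OF E elim(1)])
    have "spiked_model r v (N j) (\<theta> j) = distr (?G j) (sample_space (N j)) (X j)"
      unfolding X_def[abs_def] by (rule spiked_model_eq_distr[where r=r and v=v, OF T elim(2,1) rv L_def[of j]])
    then show ?case
      using measurable_space[OF Xm] by (simp add: measure_distr[OF Xm]) (auto intro!: arg_cong[where f="measure (?G j)"])
  qed
  define f where "f j = measure (?G j) {z \<in> space (?G j). Q_HPV \<theta>0 E (N j) (X j z) \<le> q}" for j
  define g where "g j = measure (spiked_model r v (N j) (\<theta> j)) {x \<in> space (sample_space (N j)). Q_HPV \<theta>0 E (N j) x \<le> q}" for j
  have "f \<longlonglongrightarrow> cdf \<mu> q" using lim by (simp only: f_def[abs_def])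
  moreover have "\<forall>\<^sub>F j in sequentially. f j = g j" using ev by (simp only: f_def g_def)
  ultimately have "g \<longlonglongrightarrow> cdf \<mu> q" by (rule Lim_transform_eventually)
  then show ?thesis by (simp only: g_def[abs_def] m_def[symmetric] \<mu>_def[symmetric])
qed

section \<open>Averages over the sphere of alternatives\<close>

text \<open>The direction of the projected Gaussian vector is uniform on the unit sphere orthogonal
  to axis \<open>k\<close>. This is therefore the likelihood ratio of the uniform mixture of
  Gaussian shifts of length \<open>\<alpha>\<close>.\<close>

definition sphere_avg :: "'p \<Rightarrow> real \<Rightarrow> real^'p \<Rightarrow> ennreal" where
  "sphere_avg k \<alpha> w = (\<integral>\<^sup>+g. ennreal (exp (\<alpha> * (sgn (proj_perp k g) \<bullet> w) - \<alpha>\<^sup>2 / 2)) \<partial>std_gauss)"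

lemma emeasure_std_gauss_UNIV [simp]: "emeasure std_gauss UNIV = 1"
  using prob_space.emeasure_space_1[OF prob_space_std_gauss] by simp

lemma sphere_avg_measurable [measurable]: "sphere_avg k \<alpha> \<in> borel_measurable borel"
proof -
  interpret prob_space "std_gauss :: (real^'p) measure" by (rule prob_space_std_gauss)
  show ?thesis unfolding sphere_avg_def by measurable
qed

lemma norm_sgn_le: "norm (sgn x) \<le> 1" for x :: "'a::real_normed_vector"
  by (simp add: norm_sgn)

lemma sphere_avg_finite: "sphere_avg k \<alpha> (w :: real^'p) < \<top>"
proof -
  interpret prob_space "std_gauss :: (real^'p) measure" by (rule prob_space_std_gauss)
  have "sphere_avg k \<alpha> w \<le> (\<integral>\<^sup>+g. ennreal (exp (\<bar>\<alpha>\<bar> * norm w)) \<partial>(std_gauss :: (real^'p) measure))"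
    unfolding sphere_avg_def
  proof (intro nn_integral_mono ennreal_leI)
    fix g :: "real^'p"
    have "\<bar>sgn (proj_perp k g) \<bullet> w\<bar> \<le> norm (sgn (proj_perp k g)) * norm w" by (rule Cauchy_Schwarz_ineq2)
    also have "\<dots> \<le> 1 * norm w" by (intro mult_right_mono norm_sgn_le) auto
    finally have "\<alpha> * (sgn (proj_perp k g) \<bullet> w) \<le> \<bar>\<alpha>\<bar> * norm w"
      using mult_left_mono[of "\<bar>sgn (proj_perp k g) \<bullet> w\<bar>" "norm w" "\<bar>\<alpha>\<bar>"] abs_ge_self[of "\<alpha> * (sgn (proj_perp k g) \<bullet> w)"]
      by (simp add: abs_mult)
    then have "\<alpha> * (sgn (proj_perp k g) \<bullet> w) - \<alpha>\<^sup>2 / 2 \<le> \<bar>\<alpha>\<bar> * norm w"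
      using zero_le_power2[of \<alpha>] by linarith
    then show "exp (\<alpha> * (sgn (proj_perp k g) \<bullet> w) - \<alpha>\<^sup>2 / 2) \<le> exp (\<bar>\<alpha>\<bar> * norm w)" by simp
  qed
  also have "\<dots> < \<top>" by simp
  finally show ?thesis .
qed

lemma sgn_orthogonal:
  assumes "orthogonal_transformation f"
  shows "sgn (f x) = f (sgn x)"
  using orthogonal_transformation_norm[OF assms, of x] linear_scale[OF orthogonal_transformation_linear[OF assms]]
  by (simp add: sgn_div_norm)

lemma std_gauss_nn_integral_orthogonal:
  fixes h :: "real^'p \<Rightarrow> ennreal" and f :: "real^'p \<Rightarrow> real^'p"
  assumes f: "orthogonal_transformation f" and [measurable]: "h \<in> borel_measurable borel"
  shows "(\<integral>\<^sup>+g. h (f g) \<partial>std_gauss) = (\<integral>\<^sup>+g. h g \<partial>std_gauss)"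
proof -
  have "f \<in> borel_measurable borel"
    using f by (intro borel_measurable_continuous_onI linear_continuous_on linear_conv_bounded_linear[THEN iffD1])
       (simp add: orthogonal_transformation)
  then have [measurable]: "f \<in> measurable std_gauss borel" by simp
  have "(\<integral>\<^sup>+g. h (f g) \<partial>std_gauss) = (\<integral>\<^sup>+g. h g \<partial>distr std_gauss borel f)"
    by (subst nn_integral_distr) auto
  then show ?thesis by (simp only: std_gauss_orthogonal[OF f])
qed

text \<open>The reflection swapping \<open>w\<close> and \<open>w'\<close> leaves axis
  \<open>k\<close> fixed, so it commutes with the projection and preserves both the Gaussian law and
  the inner products.\<close>

lemma sphere_avg_rotate:
  fixes w w' :: "real^'p"
  assumes w: "w $ k = 0" "w' $ k = 0" and n: "norm w = norm w'"
  shows "sphere_avg k \<alpha> w = sphere_avg k \<alpha> w'"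
proof -
  define u where "u = w - w'"
  have uk: "u $ k = 0" using w by (simp add: u_def)
  note R = orthogonal_householder[of u]
  have Rw: "householder u w = w'" unfolding u_def by (rule householder_swap[OF n])
  have "sphere_avg k \<alpha> w' = (\<integral>\<^sup>+g. ennreal (exp (\<alpha> * (sgn (proj_perp k (householder u g)) \<bullet> w') - \<alpha>\<^sup>2 / 2)) \<partial>std_gauss)"
    unfolding sphere_avg_def by (rule std_gauss_nn_integral_orthogonal[OF R, symmetric]) measurable
  also have "\<dots> = sphere_avg k \<alpha> w"
    unfolding sphere_avg_def
  proof (rule nn_integral_cong)
    fix g
    have "sgn (proj_perp k (householder u g)) \<bullet> w' = householder u (sgn (proj_perp k g)) \<bullet> householder u w"
      by (simp only: proj_perp_householder[OF uk] sgn_orthogonal[OF R] Rw)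
    also have "\<dots> = sgn (proj_perp k g) \<bullet> w" using R by (simp only: orthogonal_transformation_def)
    finally show "ennreal (exp (\<alpha> * (sgn (proj_perp k (householder u g)) \<bullet> w') - \<alpha>\<^sup>2 / 2)) = ennreal (exp (\<alpha> * (sgn (proj_perp k g) \<bullet> w) - \<alpha>\<^sup>2 / 2))"
      by simp
  qed
  finally show ?thesis by simp
qed

text \<open>The average is a function of \<open>norm w\<close>, and after symmetrisation an average of hyperbolic cosines.\<close>

lemma sphere_avg_mono:
  fixes w w' :: "real^'p"
  assumes p: "CARD('p) \<ge> 2" and w: "w $ k = 0" "w' $ k = 0" and n: "norm w \<le> norm w'"
  shows "sphere_avg k \<alpha> w \<le> sphere_avg k \<alpha> w'"
proof -
  obtain j :: 'p where j: "j \<noteq> k" using exists_other_coordinate[OF p] by blast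
  define c where "c g = \<alpha> * sgn (proj_perp k g) $ j" for g
  have [measurable]: "c \<in> borel_measurable borel" unfolding c_def by measurable
  have avg: "2 * sphere_avg k \<alpha> (y *\<^sub>R axis j 1) = (\<integral>\<^sup>+g. ennreal (exp (- \<alpha>\<^sup>2 / 2) * (2 * cosh (c g * y))) \<partial>std_gauss)" for y
  proof -
    have s: "sphere_avg k \<alpha> (y *\<^sub>R axis j 1) = (\<integral>\<^sup>+g. ennreal (exp (c g * y - \<alpha>\<^sup>2 / 2)) \<partial>std_gauss)"
      by (simp add: sphere_avg_def c_def inner_axis mult_ac)
    have "(\<integral>\<^sup>+g. ennreal (exp (c (- g) * y - \<alpha>\<^sup>2 / 2)) \<partial>std_gauss) = (\<integral>\<^sup>+g. ennreal (exp (c g * y - \<alpha>\<^sup>2 / 2)) \<partial>std_gauss)"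
      by (rule std_gauss_nn_integral_orthogonal[of uminus "\<lambda>g. ennreal (exp (c g * y - \<alpha>\<^sup>2 / 2))"])
         (auto simp: orthogonal_transformation_def module_hom_uminus linear_uminus)
    moreover have "c (- g) = - c g" for g
      by (simp add: c_def linear_neg[OF linear_proj_perp] sgn_minus)
    ultimately have s': "sphere_avg k \<alpha> (y *\<^sub>R axis j 1) = (\<integral>\<^sup>+g. ennreal (exp (- c g * y - \<alpha>\<^sup>2 / 2)) \<partial>std_gauss)"
      using s by simp
    have "2 * sphere_avg k \<alpha> (y *\<^sub>R axis j 1) = (\<integral>\<^sup>+g. ennreal (exp (c g * y - \<alpha>\<^sup>2 / 2)) \<partial>std_gauss) + (\<integral>\<^sup>+g. ennreal (exp (- c g * y - \<alpha>\<^sup>2 / 2)) \<partial>std_gauss)"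
      unfolding s[symmetric] s'[symmetric] by (rule mult_2)
    also have "\<dots> = (\<integral>\<^sup>+g. ennreal (exp (c g * y - \<alpha>\<^sup>2 / 2)) + ennreal (exp (- c g * y - \<alpha>\<^sup>2 / 2)) \<partial>std_gauss)"
      by (rule nn_integral_add[symmetric]) measurable
    also have "\<dots> = (\<integral>\<^sup>+g. ennreal (exp (- \<alpha>\<^sup>2 / 2) * (2 * cosh (c g * y))) \<partial>std_gauss)"
    proof (rule nn_integral_cong)
      fix g
      have e: "exp (a - b) = exp (- b) * exp a" for a b :: real by (simp flip: exp_add)
      have "exp (c g * y - \<alpha>\<^sup>2 / 2) + exp (- c g * y - \<alpha>\<^sup>2 / 2) = exp (- \<alpha>\<^sup>2 / 2) * (2 * cosh (c g * y))"
        unfolding e by (simp add: cosh_field_def algebra_simps)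
      then show "ennreal (exp (c g * y - \<alpha>\<^sup>2 / 2)) + ennreal (exp (- c g * y - \<alpha>\<^sup>2 / 2)) = ennreal (exp (- \<alpha>\<^sup>2 / 2) * (2 * cosh (c g * y)))"
        by (simp flip: ennreal_plus)
    qed
    finally show ?thesis .
  qed
  have rot: "sphere_avg k \<alpha> w = sphere_avg k \<alpha> (norm w *\<^sub>R axis j 1)" if "w $ k = 0" for w
  proof (rule sphere_avg_rotate[OF that])
    show "(norm w *\<^sub>R axis j (1::real)) $ k = 0" using j by (simp add: axis_def)
    show "norm w = norm (norm w *\<^sub>R axis j (1::real))" by (simp add: norm_axis_1)
  qed
  have "2 * sphere_avg k \<alpha> w \<le> 2 * sphere_avg k \<alpha> w'"
    unfolding rot[OF w(1)] rot[OF w(2)] avg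
  proof (intro nn_integral_mono ennreal_leI mult_left_mono)
    fix g
    have "cosh \<bar>c g * norm w\<bar> \<le> cosh \<bar>c g * norm w'\<bar>"
      using n by (subst cosh_real_nonneg_le_iff) (auto simp: abs_mult intro!: mult_left_mono)
    then show "cosh (c g * norm w) \<le> cosh (c g * norm w')" by (simp only: cosh_real_abs)
  qed auto
  then show ?thesis by (simp add: ennreal_mult_le_mult_iff)
qed

lemma std_gauss_shift_prob:
  fixes m :: "real^'p"
  assumes m: "m $ k = 0"
  shows "(\<integral>\<^sup>+w. ennreal (exp (m \<bullet> proj_perp k w - (norm m)\<^sup>2 / 2)) * indicator {w. (norm (proj_perp k w))\<^sup>2 \<le> q} w \<partial>std_gauss)
    = emeasure std_gauss {w. (norm (proj_perp k w + m))\<^sup>2 \<le> q}"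
proof -
  have "m \<bullet> proj_perp k w = m \<bullet> w" for w using inner_proj_perp[OF m] by (simp add: inner_commute)
  then have "(\<integral>\<^sup>+w. ennreal (exp (m \<bullet> proj_perp k w - (norm m)\<^sup>2 / 2)) * indicator {w. (norm (proj_perp k w))\<^sup>2 \<le> q} w \<partial>std_gauss)
    = (\<integral>\<^sup>+w. ennreal (exp (m \<bullet> w - (norm m)\<^sup>2 / 2)) * indicator {w. (norm (proj_perp k w))\<^sup>2 \<le> q} w \<partial>std_gauss)" by simp
  also have "\<dots> = emeasure (density std_gauss (\<lambda>w. ennreal (exp (m \<bullet> w - (norm m)\<^sup>2 / 2)))) {w. (norm (proj_perp k w))\<^sup>2 \<le> q}"
    by (rule emeasure_density[symmetric]) measurable
  also have "\<dots> = emeasure (distr std_gauss borel (\<lambda>x. x + m)) {w. (norm (proj_perp k w))\<^sup>2 \<le> q}"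
    by (simp only: std_gauss_shift)
  also have "\<dots> = emeasure std_gauss {w. (norm (proj_perp k w + m))\<^sup>2 \<le> q}"
    using proj_perp_id[OF m] by (subst emeasure_distr) (auto simp: linear_add[OF linear_proj_perp])
  finally show ?thesis .
qed

lemma AE_proj_perp_nonzero:
  assumes p: "CARD('p) \<ge> 2"
  shows "AE g in (std_gauss :: (real^'p) measure). proj_perp k g \<noteq> 0"
  using AE_norm_proj_shift_neq[OF p, of k 0 0] by simp

text \<open>The acceptance probability of the limiting test at shift \<open>m\<close>; for
  \<open>m\<close> orthogonal to axis \<open>k\<close> it is a noncentral chi-square distribution
  function.\<close>

definition shifted_cdf :: "'p \<Rightarrow> real \<Rightarrow> real^'p \<Rightarrow> real" where
  "shifted_cdf k q m = measure std_gauss {w. (norm (proj_perp k w + m))\<^sup>2 \<le> q}"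

lemma cdf_norm_proj_shift:
  "cdf (distr std_gauss borel (\<lambda>g. (norm (proj_perp k g + m))\<^sup>2)) q = shifted_cdf k q m"
  unfolding cdf_def shifted_cdf_def by (subst measure_distr) (auto intro!: arg_cong[where f="measure std_gauss"])

lemma shifted_cdf_rotate:
  fixes m m' :: "real^'p"
  assumes p: "CARD('p) \<ge> 2" and m: "m $ k = 0" "m' $ k = 0" "norm m = norm m'"
  shows "shifted_cdf k q m = shifted_cdf k q m'"
  unfolding cdf_norm_proj_shift[symmetric] distr_norm_proj_shift[OF p m(1)] distr_norm_proj_shift[OF p m(2)] m(3) ..

text \<open>After exchanging the integrals each direction contributes the acceptance probability at
  a shift of length \<open>\<alpha>\<close>, and these all agree by rotation.\<close>

lemma sphere_avg_prob:
  fixes m :: "real^'p"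
  assumes p: "CARD('p) \<ge> 2" and \<alpha>: "\<alpha> \<ge> 0" and m: "m $ k = 0" "norm m = \<alpha>"
  shows "(\<integral>\<^sup>+w. sphere_avg k \<alpha> (proj_perp k w) * indicator {w. (norm (proj_perp k w))\<^sup>2 \<le> q} w \<partial>std_gauss) = ennreal (shifted_cdf k q m)"
proof -
  interpret G: prob_space "std_gauss :: (real^'p) measure" by (rule prob_space_std_gauss)
  interpret P: pair_sigma_finite "std_gauss :: (real^'p) measure" "std_gauss :: (real^'p) measure" ..
  let ?I = "\<lambda>w. indicator {w. (norm (proj_perp k w))\<^sup>2 \<le> q} w :: ennreal"
  let ?f = "\<lambda>g w. ennreal (exp (\<alpha> * (sgn (proj_perp k g) \<bullet> proj_perp k w) - \<alpha>\<^sup>2 / 2)) * ?I w"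
  have "(\<integral>\<^sup>+w. sphere_avg k \<alpha> (proj_perp k w) * ?I w \<partial>std_gauss) = (\<integral>\<^sup>+w. (\<integral>\<^sup>+g. ?f g w \<partial>std_gauss) \<partial>std_gauss)"
    unfolding sphere_avg_def by (intro nn_integral_cong nn_integral_multc[symmetric]) measurable
  also have "\<dots> = (\<integral>\<^sup>+g. (\<integral>\<^sup>+w. ?f g w \<partial>std_gauss) \<partial>std_gauss)"
    by (rule P.Fubini') measurable
  also have "\<dots> = (\<integral>\<^sup>+g. ennreal (shifted_cdf k q m) \<partial>(std_gauss :: (real^'p) measure))"
  proof (rule nn_integral_cong_AE, use AE_proj_perp_nonzero[OF p, of k] in eventually_elim)
    fix g :: "real^'p" assume g: "proj_perp k g \<noteq> 0"
    define s where "s = \<alpha> *\<^sub>R sgn (proj_perp k g)"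
    have s: "s $ k = 0" "norm s = \<alpha>" using g \<alpha> by (simp_all add: s_def sgn_div_norm norm_sgn)
    have "(\<integral>\<^sup>+w. ?f g w \<partial>std_gauss) = (\<integral>\<^sup>+w. ennreal (exp (s \<bullet> proj_perp k w - (norm s)\<^sup>2 / 2)) * ?I w \<partial>std_gauss)"
      unfolding s(2) by (simp add: s_def)
    also have "\<dots> = emeasure std_gauss {w. (norm (proj_perp k w + s))\<^sup>2 \<le> q}" by (rule std_gauss_shift_prob[OF s(1)])
    also have "\<dots> = ennreal (shifted_cdf k q s)" by (simp add: shifted_cdf_def G.emeasure_eq_measure)
    also have "shifted_cdf k q s = shifted_cdf k q m" by (rule shifted_cdf_rotate[OF p s(1) m(1)]) (simp add: s m)
    finally show "(\<integral>\<^sup>+w. ?f g w \<partial>std_gauss) = ennreal (shifted_cdf k q m)" .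
  qed
  also have "\<dots> = ennreal (shifted_cdf k q m)" by simp
  finally show ?thesis .
qed

lemma alternative_unit:
  fixes \<theta>0 :: "real^'p"
  assumes T: "orthogonal_matrix T" and T0: "T *v axis k 1 = \<theta>0" and s: "norm s = 1" "s $ k = 0"
    and cs: "cs\<^sup>2 + sn\<^sup>2 = 1"
  shows "norm (cs *\<^sub>R \<theta>0 + sn *\<^sub>R (T *v s)) = 1"
    and "(norm (cs *\<^sub>R \<theta>0 + sn *\<^sub>R (T *v s) - \<theta>0))\<^sup>2 = 2 * (1 - cs)"
proof -
  have Tin: "(T *v x) \<bullet> (T *v y) = x \<bullet> y" for x y
    using inner_transpose_mult[of x T "T *v y"] by (simp only: orthogonal_matrix_mult_inverse[OF T])
  have i: "\<theta>0 \<bullet> \<theta>0 = 1" "\<theta>0 \<bullet> (T *v s) = 0" "(T *v s) \<bullet> \<theta>0 = 0" "(T *v s) \<bullet> (T *v s) = 1"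
    unfolding T0[symmetric] Tin using s by (simp_all add: inner_axis inner_axis' norm_eq_1)
  have "(norm (cs *\<^sub>R \<theta>0 + sn *\<^sub>R (T *v s)))\<^sup>2 = cs\<^sup>2 + sn\<^sup>2"
    unfolding power2_norm_eq_inner by (simp add: inner_add_left inner_add_right i) (simp add: power2_eq_square)
  then show "norm (cs *\<^sub>R \<theta>0 + sn *\<^sub>R (T *v s)) = 1" unfolding cs by (metis norm_ge_zero power2_eq_1_iff abs_norm_cancel abs_neg_one zero_neq_one abs_le_zero_iff neg_0_le_iff_le not_one_le_zero)
  have "(norm (cs *\<^sub>R \<theta>0 + sn *\<^sub>R (T *v s) - \<theta>0))\<^sup>2 = (cs - 1)\<^sup>2 + sn\<^sup>2"
    unfolding power2_norm_eq_inner by (simp add: inner_add_left inner_add_right inner_diff_left inner_diff_right i) (simp add: power2_eq_square algebra_simps)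
  also have "\<dots> = (cs\<^sup>2 + sn\<^sup>2) + 1 - 2 * cs" by (simp add: power2_eq_square algebra_simps)
  finally show "(norm (cs *\<^sub>R \<theta>0 + sn *\<^sub>R (T *v s) - \<theta>0))\<^sup>2 = 2 * (1 - cs)" unfolding cs by simp
qed

text \<open>Neyman-Pearson against the uniform mixture of alternatives: on the event \<open>B\<close> the likelihood ratio in
  direction \<open>s\<close> is at least \<open>exp (- \<epsilon>)\<close> times that of the limiting Gaussian shift.\<close>

lemma minimax_power_bound:
  fixes T :: "real^'p^'p" and k :: 'p and W :: "'a \<Rightarrow> real^'p"
  assumes p: "CARD('p) \<ge> 2" and \<alpha>: "\<alpha> \<ge> 0" and m: "m $ k = 0" "norm m = \<alpha>" and q: "q \<ge> 0"
    and M: "prob_space M" and W [measurable]: "W \<in> borel_measurable M" and WM: "distr M borel W = distr std_gauss borel (proj_perp k)"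
    and \<psi> [measurable]: "\<psi> \<in> borel_measurable M" and \<psi>01: "\<And>z. z \<in> space M \<Longrightarrow> 0 \<le> \<psi> z \<and> \<psi> z \<le> 1"
    and B [measurable]: "B \<in> sets M" and \<beta>: "measure M (space M - B) \<le> \<epsilon>'"
    and power: "\<And>s. norm s = 1 \<Longrightarrow> s $ k = 0 \<Longrightarrow>
      (\<integral>\<^sup>+z. ennreal (1 - \<psi> z) * indicator B z * ennreal (exp (- \<epsilon>) * exp (\<alpha> * (s \<bullet> W z) - \<alpha>\<^sup>2 / 2)) \<partial>M) \<le> ennreal u"
    and u: "u \<ge> 0"
    and k0: "ennreal k0 = sphere_avg k \<alpha> (sqrt q *\<^sub>R axis j 1)" "k0 \<ge> 0" and j: "j \<noteq> k"
  shows "exp (- \<epsilon>) * (shifted_cdf k q m + k0 * (1 - shifted_cdf k q 0 - (\<integral>z. \<psi> z \<partial>M) - \<epsilon>')) \<le> u"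
proof -
  interpret prob_space M by (rule M)
  interpret G: prob_space "std_gauss :: (real^'p) measure" by (rule prob_space_std_gauss)
  interpret P: pair_sigma_finite M "std_gauss :: (real^'p) measure" ..
  \<comment> \<open>Needed because monotonicity of the sphere average compares only vectors
    orthogonal to axis \<open>k\<close>; the law of \<open>W\<close> is carried by that
    hyperplane.\<close>
  have Wk: "AE z in M. W z $ k = 0"
  proof -
    have "AE w in distr std_gauss borel (proj_perp k). w $ k = (0::real)"
      by (subst AE_distr_iff) auto
    then have "AE w in distr M borel W. w $ k = 0" by (simp only: WM)
    then show ?thesis by (subst (asm) AE_distr_iff) auto
  qed
  define A where "A = {w::real^'p. (norm (proj_perp k w))\<^sup>2 \<le> q}"
  have [measurable]: "A \<in> sets borel" unfolding A_def by measurable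
  \<comment> \<open>The mixture likelihood truncated at \<open>k0\<close>, its value on the boundary
    of the acceptance region. As the average increases with the norm, it is at most
    \<open>k0\<close> inside the region and at least \<open>k0\<close> outside, so \<open>mm\<close>
    is the minimum of the two.\<close>
  define mm where "mm w = sphere_avg k \<alpha> (proj_perp k w) * indicator A w + ennreal k0 * indicator (- A) w" for w
  have [measurable]: "mm \<in> borel_measurable borel" unfolding mm_def by measurable
  have nj: "norm (sqrt q *\<^sub>R axis j (1::real) :: real^'p) = sqrt q" using q by (simp add: norm_axis_1)
  have jk: "(sqrt q *\<^sub>R axis j (1::real) :: real^'p) $ k = 0" using j by (simp add: axis_def)
  have mm_le: "mm w \<le> sphere_avg k \<alpha> (proj_perp k w)" for w
  proof (cases "w \<in> A")
    case False
    then have "(sqrt q)\<^sup>2 \<le> (norm (proj_perp k w))\<^sup>2" using q by (simp add: A_def)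
    then have "sqrt q \<le> norm (proj_perp k w)" by (rule power2_le_imp_le) simp
    then have "ennreal k0 \<le> sphere_avg k \<alpha> (proj_perp k w)"
      unfolding k0 by (intro sphere_avg_mono[OF p jk]) (simp_all add: nj del: norm_scaleR)
    then show ?thesis using False by (simp add: mm_def)
  qed (simp add: mm_def)
  have mm_k0: "mm w \<le> ennreal k0" for w
  proof (cases "w \<in> A")
    case True
    then have "norm (proj_perp k w) \<le> sqrt q" using q by (simp add: A_def real_le_rsqrt)
    then have "sphere_avg k \<alpha> (proj_perp k w) \<le> ennreal k0"
      unfolding k0 by (intro sphere_avg_mono[OF p _ jk]) (simp_all add: nj del: norm_scaleR)
    then show ?thesis using True by (simp add: mm_def)
  qed (simp add: mm_def)
  let ?h = "\<lambda>g z. ennreal (1 - \<psi> z) * indicator B z * ennreal (exp (- \<epsilon>) * exp (\<alpha> * (sgn (proj_perp k g) \<bullet> W z) - \<alpha>\<^sup>2 / 2))"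
  have "(\<integral>\<^sup>+g. (\<integral>\<^sup>+z. ?h g z \<partial>M) \<partial>(std_gauss :: (real^'p) measure)) \<le> (\<integral>\<^sup>+g. ennreal u \<partial>(std_gauss :: (real^'p) measure))"
  proof (rule nn_integral_mono_AE, use AE_proj_perp_nonzero[OF p, of k] in eventually_elim)
    fix g :: "real^'p" assume "proj_perp k g \<noteq> 0"
    then show "(\<integral>\<^sup>+z. ?h g z \<partial>M) \<le> ennreal u" by (intro power) (simp_all add: norm_sgn sgn_div_norm)
  qed
  also have "\<dots> = ennreal u" by simp
  also have "(\<integral>\<^sup>+g. (\<integral>\<^sup>+z. ?h g z \<partial>M) \<partial>(std_gauss :: (real^'p) measure)) = (\<integral>\<^sup>+z. (\<integral>\<^sup>+g. ?h g z \<partial>std_gauss) \<partial>M)"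
    by (rule P.Fubini') measurable
  also have "\<dots> = (\<integral>\<^sup>+z. ennreal (1 - \<psi> z) * indicator B z * (ennreal (exp (- \<epsilon>)) * sphere_avg k \<alpha> (W z)) \<partial>M)"
  proof (rule nn_integral_cong)
    fix z
    have "(\<integral>\<^sup>+g. ?h g z \<partial>std_gauss) = (\<integral>\<^sup>+g. (ennreal (1 - \<psi> z) * indicator B z * ennreal (exp (- \<epsilon>))) * ennreal (exp (\<alpha> * (sgn (proj_perp k g) \<bullet> W z) - \<alpha>\<^sup>2 / 2)) \<partial>std_gauss)"
      by (intro nn_integral_cong) (simp add: ennreal_mult mult_ac)
    also have "\<dots> = (ennreal (1 - \<psi> z) * indicator B z * ennreal (exp (- \<epsilon>))) * sphere_avg k \<alpha> (W z)"
      unfolding sphere_avg_def by (rule nn_integral_cmult) measurable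
    finally show "(\<integral>\<^sup>+g. ?h g z \<partial>std_gauss) = ennreal (1 - \<psi> z) * indicator B z * (ennreal (exp (- \<epsilon>)) * sphere_avg k \<alpha> (W z))" by (simp add: mult_ac)
  qed
  finally have 1: "(\<integral>\<^sup>+z. ennreal (1 - \<psi> z) * indicator B z * (ennreal (exp (- \<epsilon>)) * sphere_avg k \<alpha> (W z)) \<partial>M) \<le> ennreal u" .
  have "ennreal (exp (- \<epsilon>)) * (\<integral>\<^sup>+z. ennreal (1 - \<psi> z) * indicator B z * mm (W z) \<partial>M)
      = (\<integral>\<^sup>+z. ennreal (exp (- \<epsilon>)) * (ennreal (1 - \<psi> z) * indicator B z * mm (W z)) \<partial>M)"
    by (rule nn_integral_cmult[symmetric]) measurable
  also have "\<dots> \<le> (\<integral>\<^sup>+z. ennreal (1 - \<psi> z) * indicator B z * (ennreal (exp (- \<epsilon>)) * sphere_avg k \<alpha> (W z)) \<partial>M)"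
  proof (rule nn_integral_mono_AE, use Wk in eventually_elim)
    fix z assume "W z $ k = 0"
    then have "mm (W z) \<le> sphere_avg k \<alpha> (W z)" using mm_le[of "W z"] by (simp add: proj_perp_id)
    then have "(ennreal (exp (- \<epsilon>)) * (ennreal (1 - \<psi> z) * indicator B z)) * mm (W z) \<le> (ennreal (exp (- \<epsilon>)) * (ennreal (1 - \<psi> z) * indicator B z)) * sphere_avg k \<alpha> (W z)"
      by (rule mult_left_mono) simp
    then show "ennreal (exp (- \<epsilon>)) * (ennreal (1 - \<psi> z) * indicator B z * mm (W z)) \<le> ennreal (1 - \<psi> z) * indicator B z * (ennreal (exp (- \<epsilon>)) * sphere_avg k \<alpha> (W z))"
      by (simp add: mult_ac)
  qed
  finally have 2: "ennreal (exp (- \<epsilon>)) * (\<integral>\<^sup>+z. ennreal (1 - \<psi> z) * indicator B z * mm (W z) \<partial>M) \<le> ennreal u" using 1 by (rule order_trans)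
  have mmW: "(\<integral>\<^sup>+z. mm (W z) \<partial>M) = ennreal (shifted_cdf k q m + k0 * (1 - shifted_cdf k q 0))"
  proof -
    have "(\<integral>\<^sup>+z. mm (W z) \<partial>M) = (\<integral>\<^sup>+w. mm w \<partial>distr M borel W)" by (subst nn_integral_distr) auto
    also have "\<dots> = (\<integral>\<^sup>+w. mm (proj_perp k w) \<partial>std_gauss)" unfolding WM by (subst nn_integral_distr) auto
    also have "\<dots> = (\<integral>\<^sup>+w. sphere_avg k \<alpha> (proj_perp k w) * indicator A w + ennreal k0 * indicator (- A) w \<partial>std_gauss)"
      by (intro nn_integral_cong) (simp add: mm_def A_def indicator_def proj_perp_id)
    also have "\<dots> = (\<integral>\<^sup>+w. sphere_avg k \<alpha> (proj_perp k w) * indicator A w \<partial>std_gauss) + (\<integral>\<^sup>+w. ennreal k0 * indicator (- A) w \<partial>std_gauss)"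
      by (rule nn_integral_add) measurable
    also have "(\<integral>\<^sup>+w. sphere_avg k \<alpha> (proj_perp k w) * indicator A w \<partial>std_gauss) = ennreal (shifted_cdf k q m)"
      unfolding A_def by (rule sphere_avg_prob[OF p \<alpha> m])
    also have "(\<integral>\<^sup>+w. ennreal k0 * indicator (- A) w \<partial>std_gauss) = ennreal k0 * emeasure std_gauss (- A)"
      by (rule nn_integral_cmult_indicator) measurable
    also have "emeasure std_gauss (- A) = ennreal (1 - shifted_cdf k q 0)"
    proof -
      have "measure std_gauss (space std_gauss - A) = 1 - measure std_gauss A" by (rule G.prob_compl) simp
      then show ?thesis by (simp add: G.emeasure_eq_measure shifted_cdf_def A_def Compl_eq_Diff_UNIV)
    qed
    also have "ennreal (shifted_cdf k q m) + ennreal k0 * ennreal (1 - shifted_cdf k q 0) = ennreal (shifted_cdf k q m + k0 * (1 - shifted_cdf k q 0))"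
      using k0 by (simp add: shifted_cdf_def ennreal_mult ennreal_plus)
    finally show ?thesis .
  qed
  \<comment> \<open>The Neyman-Pearson step: since \<open>mm\<close> is at most \<open>k0\<close>,
    what the weight 1 - psi on \<open>B\<close> omits costs at most \<open>k0\<close> times the
    level plus \<open>k0\<close> times the probability of leaving \<open>B\<close>.\<close>
  have "(\<integral>\<^sup>+z. mm (W z) \<partial>M) \<le> (\<integral>\<^sup>+z. ennreal (1 - \<psi> z) * indicator B z * mm (W z) + (ennreal k0 * ennreal (\<psi> z) + ennreal k0 * indicator (space M - B) z) \<partial>M)"
  proof (rule nn_integral_mono)
    fix z assume z: "z \<in> space M"
    show "mm (W z) \<le> ennreal (1 - \<psi> z) * indicator B z * mm (W z) + (ennreal k0 * ennreal (\<psi> z) + ennreal k0 * indicator (space M - B) z)"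
    proof (cases "z \<in> B")
      case True
      have "ennreal (1 - \<psi> z) + ennreal (\<psi> z) = 1" using \<psi>01[OF z] by (simp flip: ennreal_plus)
      then have "mm (W z) = ennreal (1 - \<psi> z) * mm (W z) + ennreal (\<psi> z) * mm (W z)" by (simp flip: distrib_right)
      also have "\<dots> \<le> ennreal (1 - \<psi> z) * mm (W z) + ennreal (\<psi> z) * ennreal k0"
        by (intro add_left_mono mult_left_mono mm_k0) auto
      finally show ?thesis using True by (simp add: mult.commute)
    next
      case False
      have "mm (W z) \<le> ennreal k0 * ennreal (\<psi> z) + ennreal k0"
        by (rule add_increasing[OF _ mm_k0]) simp
      moreover have "indicator B z = (0::ennreal)" "indicator (space M - B) z = (1::ennreal)"
        by (rule indicator_simps(2)[OF False], rule indicator_simps(1)[OF DiffI[OF z False]])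
      ultimately show ?thesis by (simp only: mult_zero_left mult_zero_right add_0_left mult_1_right)
    qed
  qed
  also have "\<dots> = (\<integral>\<^sup>+z. ennreal (1 - \<psi> z) * indicator B z * mm (W z) \<partial>M) + (\<integral>\<^sup>+z. ennreal k0 * ennreal (\<psi> z) + ennreal k0 * indicator (space M - B) z \<partial>M)"
    by (rule nn_integral_add) measurable
  also have "(\<integral>\<^sup>+z. ennreal k0 * ennreal (\<psi> z) + ennreal k0 * indicator (space M - B) z \<partial>M) = (\<integral>\<^sup>+z. ennreal k0 * ennreal (\<psi> z) \<partial>M) + (\<integral>\<^sup>+z. ennreal k0 * indicator (space M - B) z \<partial>M)"
    by (rule nn_integral_add) measurable
  also have "(\<integral>\<^sup>+z. ennreal k0 * ennreal (\<psi> z) \<partial>M) = ennreal (k0 * (\<integral>z. \<psi> z \<partial>M))"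
  proof -
    have "integrable M \<psi>" by (rule integrable_const_bound[of _ 1]) (use \<psi>01 in auto)
    then have "(\<integral>\<^sup>+z. ennreal (\<psi> z) \<partial>M) = ennreal (\<integral>z. \<psi> z \<partial>M)" by (rule nn_integral_eq_integral) (use \<psi>01 in auto)
    then show ?thesis using k0 by (simp add: nn_integral_cmult ennreal_mult')
  qed
  also have "(\<integral>\<^sup>+z. ennreal k0 * indicator (space M - B) z \<partial>M) = ennreal (k0 * measure M (space M - B))"
    using k0 by (subst nn_integral_cmult_indicator) (auto simp: emeasure_eq_measure ennreal_mult')
  finally have 3: "ennreal (shifted_cdf k q m + k0 * (1 - shifted_cdf k q 0)) \<le> (\<integral>\<^sup>+z. ennreal (1 - \<psi> z) * indicator B z * mm (W z) \<partial>M)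
      + (ennreal (k0 * (\<integral>z. \<psi> z \<partial>M)) + ennreal (k0 * measure M (space M - B)))" unfolding mmW .
  have E0: "0 \<le> (\<integral>z. \<psi> z \<partial>M)" by (rule integral_nonneg_AE) (use \<psi>01 in auto)
  define I where "I = (\<integral>\<^sup>+z. ennreal (1 - \<psi> z) * indicator B z * mm (W z) \<partial>M)"
  have "I < \<top>"
  proof (rule ccontr)
    assume "\<not> I < \<top>"
    then have "ennreal (exp (- \<epsilon>)) * I = \<top>" by (simp add: less_top[symmetric] ennreal_mult_top)
    then show False using 2 by (simp add: I_def top_unique)
  qed
  then obtain i where i: "I = ennreal i" "i \<ge> 0" by (cases I) auto
  have e2: "exp (- \<epsilon>) * i \<le> u" using 2 i u unfolding I_def[symmetric] by (simp add: ennreal_mult'[symmetric])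
  have "shifted_cdf k q m + k0 * (1 - shifted_cdf k q 0) \<le> i + (k0 * (\<integral>z. \<psi> z \<partial>M) + k0 * measure M (space M - B))"
  proof -
    have "0 \<le> k0 * (\<integral>z. \<psi> z \<partial>M)" "0 \<le> k0 * measure M (space M - B)" using k0 E0 by auto
    then show ?thesis using 3 i unfolding I_def[symmetric] by (simp flip: ennreal_plus)
  qed
  also have "\<dots> \<le> i + (k0 * (\<integral>z. \<psi> z \<partial>M) + k0 * \<epsilon>')"
    using \<beta> k0 by (intro add_left_mono mult_left_mono) auto
  finally have "shifted_cdf k q m + k0 * (1 - shifted_cdf k q 0 - (\<integral>z. \<psi> z \<partial>M) - \<epsilon>') \<le> i" by (simp add: algebra_simps)
  then have "exp (- \<epsilon>) * (shifted_cdf k q m + k0 * (1 - shifted_cdf k q 0 - (\<integral>z. \<psi> z \<partial>M) - \<epsilon>')) \<le> exp (- \<epsilon>) * i"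
    by (intro mult_left_mono) auto
  then show ?thesis using e2 by linarith
qed

lemma log_lr_measurable:
  "log_lr b n \<theta>0 \<theta> \<in> borel_measurable (sample_space n :: (nat \<Rightarrow> real^'p) measure)"
  unfolding log_lr_def
  by (intro borel_measurable_times borel_measurable_const borel_measurable_sum borel_measurable_diff borel_measurable_power
      borel_measurable_inner sample_component_measurable)

section \<open>Asymptotic maximinity\<close>

text \<open>Both cases of the theorem are merged into one limit \<open>\<delta>\<close> of r and the
  divergence of sqrt n r. The rotation \<open>T\<close> makes the null direction axis
  \<open>k\<close>, and \<open>j\<close> picks a reference direction orthogonal to it.\<close>

locale spiked_testing =
  fixes \<theta>0 :: "real^'p" and r :: "nat \<Rightarrow> real" and v \<delta> :: real and T :: "real^'p^'p" and k j :: 'p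
  assumes p: "CARD('p) \<ge> 2" and v: "v > 0" and \<delta>: "\<delta> \<ge> 0"
    and r_pos: "\<And>n. n \<ge> 1 \<Longrightarrow> r n > 0" and r_lim: "r \<longlonglongrightarrow> \<delta>"
    and nr: "filterlim (\<lambda>n. sqrt (real n) * r n) at_top sequentially"
    and T: "orthogonal_matrix T" and T0: "T *v axis k 1 = \<theta>0" and j: "j \<noteq> k"
begin

abbreviation "\<Gamma> n \<equiv> gauss_array n :: (nat \<times> 'p \<Rightarrow> real) measure"
abbreviation "P \<equiv> spiked_model r v :: nat \<Rightarrow> real^'p \<Rightarrow> (nat \<Rightarrow> real^'p) measure"
abbreviation "w n \<equiv> sqrt (real n) * r n"

definition "\<sigma> = sqrt (1 + \<delta> * v)"
text \<open>The limiting shift caused by an alternative at rescaled distance \<open>t\<close>,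
  turned into the reference direction; by rotation invariance only its length matters.\<close>

definition "shift_vec t = (v * t / \<sigma>) *\<^sub>R (axis j 1 :: real^'p)"

lemma \<sigma>: "\<sigma> > 0" "\<sigma>\<^sup>2 = 1 + \<delta> * v"
proof -
  have "1 + \<delta> * v > 0" using \<delta> v by (intro add_pos_nonneg) auto
  then show "\<sigma> > 0" "\<sigma>\<^sup>2 = 1 + \<delta> * v" by (simp_all add: \<sigma>_def)
qed

lemma shift_vec: "shift_vec t $ k = 0" "t \<ge> 0 \<Longrightarrow> norm (shift_vec t) = v * t / \<sigma>"
proof -
  show "shift_vec t $ k = 0" using j by (simp add: shift_vec_def axis_def)
  show "norm (shift_vec t) = v * t / \<sigma>" if "t \<ge> 0" using that v \<sigma>(1) by (simp add: shift_vec_def norm_axis_1)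
qed

lemma \<theta>0: "norm \<theta>0 = 1"
  using orthogonal_matrix_mult_inverse(3)[OF T, of "axis k 1"] T0 by simp

lemma P_eq_distr:
  assumes "n \<ge> 1" "norm \<theta> = 1"
  shows "P n \<theta> = distr (\<Gamma> n) (sample_space n) (\<lambda>z. \<lambda>i\<in>{1..n}. (spike_mat (sqrt (1 + r n * v) - 1) \<theta> ** T) *v (\<chi> j. z (i, j)))"
  by (rule spiked_model_eq_distr[OF T assms(2,1) _ refl]) (simp add: r_pos assms v)

lemma sets_P [simp]: "n \<ge> 1 \<Longrightarrow> norm \<theta> = 1 \<Longrightarrow> sets (P n \<theta>) = sets (sample_space n)"
  by (simp add: P_eq_distr)

lemma space_P [simp]: "n \<ge> 1 \<Longrightarrow> norm \<theta> = 1 \<Longrightarrow> space (P n \<theta>) = space (sample_space n)"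
  by (simp add: P_eq_distr)

lemma prob_space_P: "n \<ge> 1 \<Longrightarrow> norm \<theta> = 1 \<Longrightarrow> prob_space (P n \<theta>)"
  by (simp only: P_eq_distr) (intro prob_space.prob_space_distr prob_space_PiM_std_normal sample_map_measurable)

lemma test_integrable:
  assumes \<psi>: "test_sequence \<psi>" and n: "n \<ge> 1" "norm \<theta> = 1"
  shows "integrable (P n \<theta>) (\<psi> n)" "0 \<le> (\<integral>x. \<psi> n x \<partial>P n \<theta>)" "(\<integral>x. \<psi> n x \<partial>P n \<theta>) \<le> 1"
    "(\<integral>\<^sup>+x. ennreal (1 - \<psi> n x) \<partial>P n \<theta>) = ennreal (1 - (\<integral>x. \<psi> n x \<partial>P n \<theta>))"
proof -
  interpret prob_space "P n \<theta>" by (rule prob_space_P[OF n])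
  have m: "\<psi> n \<in> borel_measurable (sample_space n)" and b: "\<And>x. x \<in> space (sample_space n) \<Longrightarrow> 0 \<le> \<psi> n x \<and> \<psi> n x \<le> 1"
    using \<psi> n unfolding test_sequence_def by auto
  have [measurable]: "\<psi> n \<in> borel_measurable (P n \<theta>)" using m n by (simp cong: measurable_cong_sets)
  have b': "AE x in P n \<theta>. 0 \<le> \<psi> n x \<and> \<psi> n x \<le> 1" using b n by (intro AE_I2) simp
  show i: "integrable (P n \<theta>) (\<psi> n)" by (rule integrable_const_bound[of _ 1]) (use b' in auto)
  show "0 \<le> (\<integral>x. \<psi> n x \<partial>P n \<theta>)" by (rule integral_nonneg_AE) (use b' in auto)
  have "(\<integral>x. \<psi> n x \<partial>P n \<theta>) \<le> (\<integral>x. 1 \<partial>P n \<theta>)" by (rule integral_mono_AE[OF i]) (use b' in auto)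
  then show "(\<integral>x. \<psi> n x \<partial>P n \<theta>) \<le> 1" by (simp add: prob_space)
  have "(\<integral>\<^sup>+x. ennreal (1 - \<psi> n x) \<partial>P n \<theta>) = ennreal (\<integral>x. 1 - \<psi> n x \<partial>P n \<theta>)"
    by (rule nn_integral_eq_integral) (use i b' in auto)
  then show "(\<integral>\<^sup>+x. ennreal (1 - \<psi> n x) \<partial>P n \<theta>) = ennreal (1 - (\<integral>x. \<psi> n x \<partial>P n \<theta>))" using i by (simp add: prob_space)
qed

section \<open>Local alternatives on a sphere and the upper bound for their minimal power\<close>

definition "cs t n = 1 - t\<^sup>2 / (2 * (w n)\<^sup>2)"
definition "sn t n = sqrt (1 - (cs t n)\<^sup>2)"
definition "alternative t n s = cs t n *\<^sub>R \<theta>0 + sn t n *\<^sub>R (T *v s)"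

lemma alternative:
  assumes t: "t > 0"
  shows "\<forall>\<^sub>F n in sequentially. \<forall>s. norm s = 1 \<and> s $ k = 0 \<longrightarrow> norm (alternative t n s) = 1 \<and> norm (alternative t n s - \<theta>0) = t / w n"
  using filterlim_at_top_dense[THEN iffD1, OF nr, rule_format, of t]
proof eventually_elim
  case (elim n)
  have w: "w n > 0" using elim t by linarith
  have "t\<^sup>2 \<le> (w n)\<^sup>2" using elim t by (intro power_mono) auto
  then have "t\<^sup>2 / (2 * (w n)\<^sup>2) \<le> 1 / 2" using zero_less_power[OF w, of 2] by (simp add: field_simps)
  moreover have "0 \<le> t\<^sup>2 / (2 * (w n)\<^sup>2)" by simp
  ultimately have "0 \<le> cs t n" "cs t n \<le> 1" unfolding cs_def by linarith+
  then have "(cs t n)\<^sup>2 \<le> 1" by (simp add: power_le_one)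
  then have c: "(cs t n)\<^sup>2 + (sn t n)\<^sup>2 = 1" by (simp add: sn_def)
  show ?case
  proof (intro allI impI, elim conjE)
    fix s :: "real^'p" assume s: "norm s = 1" "s $ k = 0"
    note au = alternative_unit[OF T T0 s c, folded alternative_def]
    have "(norm (alternative t n s - \<theta>0))\<^sup>2 = (t / w n)\<^sup>2"
      unfolding au(2) cs_def by (simp add: power_divide)
    then have "norm (alternative t n s - \<theta>0) = t / w n"
      using t w by (metis abs_norm_cancel divide_nonneg_pos less_imp_le power2_eq_iff_nonneg norm_ge_zero)
    then show "norm (alternative t n s) = 1 \<and> norm (alternative t n s - \<theta>0) = t / w n" using au(1) by simp
  qed
qed

lemma alternative_mem:
  assumes t: "t > 0" "c \<le> t" "t \<le> C"
  shows "\<forall>\<^sub>F n in sequentially. \<forall>s. norm s = 1 \<and> s $ k = 0 \<longrightarrow> alternative t n s \<in> local_alternatives \<theta>0 (1 / w n) c C"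
  using alternative[OF t(1)] filterlim_at_top_dense[THEN iffD1, OF nr, rule_format, of 0]
  by eventually_elim (use t in \<open>auto simp: local_alternatives_def\<close>)

text \<open>The threshold for n is common to all arrays within the bound and to all directions, as
  the mixture over directions requires.\<close>

lemma log_lr_lower:
  assumes t: "t \<ge> 0" and \<epsilon>: "\<epsilon> > 0"
  shows "\<forall>\<^sub>F n in sequentially. \<forall>z s. tight_bound n k z \<le> K \<and> norm s = 1 \<and> s $ k = 0 \<longrightarrow>
    v * t / \<sigma> * (s \<bullet> score n k z) - (v * t / \<sigma>)\<^sup>2 / 2 - \<epsilon>
     \<le> log_lr (r n * v) n \<theta>0 (alternative t n s) (\<lambda>i\<in>{1..n}. (spike_mat (sqrt (1 + r n * v) - 1) \<theta>0 ** T) *v (\<chi> j. z (i, j)))"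
proof -
  \<comment> \<open>The direction becomes a component of the index, so that a limit along the filter
    is uniform in it as well.\<close>
  define B where "B y \<longleftrightarrow> tight_bound (fst y) k (fst (snd y)) \<le> K \<and> norm (snd (snd y)) = 1 \<and> snd (snd y) $ k = 0"
    for y :: "nat \<times> (nat \<times> 'p \<Rightarrow> real) \<times> (real^'p)"
  define F where "F = inf (filtercomap fst sequentially) (principal {y. B y})"
  have fstF: "filterlim fst sequentially F" unfolding F_def
    by (rule filterlim_mono[OF filterlim_filtercomap order_refl]) simp
  have BF: "\<forall>\<^sub>F y in F. B y" unfolding F_def eventually_inf_principal by simp
  interpret L: spiked_limit F fst "\<lambda>y. fst (snd y)" "\<lambda>y. r (fst y)" v \<delta> K k
  proof
    show "filterlim fst at_top F" by (rule fstF)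
    show "((\<lambda>y. r (fst y)) \<longlongrightarrow> \<delta>) F" by (rule filterlim_compose[OF r_lim fstF])
    show "filterlim (\<lambda>y. sqrt (fst y) * r (fst y)) at_top F" by (rule filterlim_compose[OF nr fstF])
    show "\<forall>\<^sub>F y in F. r (fst y) > 0"
      using eventually_compose_filterlim[OF eventually_ge_at_top[of 1] fstF] by eventually_elim (rule r_pos)
    show "\<forall>\<^sub>F y in F. tight_bound (fst y) k (fst (snd y)) \<le> K" using BF by eventually_elim (simp add: B_def)
  qed (use v \<delta> in auto)
  have "((\<lambda>y. log_lr (r (fst y) * v) (fst y) \<theta>0 (L.cs t y *\<^sub>R \<theta>0 + L.sn t y *\<^sub>R (T *v snd (snd y)))
      (\<lambda>i\<in>{1..fst y}. (spike_mat (L.a y) \<theta>0 ** T) *v (\<chi> j. fst (snd y) (i, j)))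
    - (v * t / L.\<sigma> * (snd (snd y) \<bullet> score (fst y) k (fst (snd y))) - (v * t / L.\<sigma>)\<^sup>2 / 2)) \<longlongrightarrow> 0) F"
    by (rule L.log_lr_limit[OF T T0 t]) (use BF in eventually_elim, simp add: B_def)+
  from tendstoD[OF this \<epsilon>]
  have "\<forall>\<^sub>F y in F. v * t / \<sigma> * (snd (snd y) \<bullet> score (fst y) k (fst (snd y))) - (v * t / \<sigma>)\<^sup>2 / 2 - \<epsilon>
     \<le> log_lr (r (fst y) * v) (fst y) \<theta>0 (alternative t (fst y) (snd (snd y)))
        (\<lambda>i\<in>{1..fst y}. (spike_mat (sqrt (1 + r (fst y) * v) - 1) \<theta>0 ** T) *v (\<chi> j. fst (snd y) (i, j)))"
  proof eventually_elim
    case (elim y)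
    then show ?case
      unfolding L.cs_def L.sn_def L.a_def L.\<sigma>_def cs_def sn_def alternative_def \<sigma>_def dist_real_def diff_zero abs_less_iff
      by linarith
  qed
  then have "\<forall>\<^sub>F y in filtercomap fst sequentially. B y \<longrightarrow> v * t / \<sigma> * (snd (snd y) \<bullet> score (fst y) k (fst (snd y))) - (v * t / \<sigma>)\<^sup>2 / 2 - \<epsilon>
     \<le> log_lr (r (fst y) * v) (fst y) \<theta>0 (alternative t (fst y) (snd (snd y)))
        (\<lambda>i\<in>{1..fst y}. (spike_mat (sqrt (1 + r (fst y) * v) - 1) \<theta>0 ** T) *v (\<chi> j. fst (snd y) (i, j)))"
    unfolding F_def eventually_inf_principal by simp
  then obtain Q where Q: "eventually Q sequentially" and
    QB: "\<And>y. Q (fst y) \<Longrightarrow> B y \<longrightarrow> v * t / \<sigma> * (snd (snd y) \<bullet> score (fst y) k (fst (snd y))) - (v * t / \<sigma>)\<^sup>2 / 2 - \<epsilon>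
     \<le> log_lr (r (fst y) * v) (fst y) \<theta>0 (alternative t (fst y) (snd (snd y)))
        (\<lambda>i\<in>{1..fst y}. (spike_mat (sqrt (1 + r (fst y) * v) - 1) \<theta>0 ** T) *v (\<chi> j. fst (snd y) (i, j)))"
    unfolding eventually_filtercomap by blast
  from Q show ?thesis
  proof eventually_elim
    case (elim n)
    show ?case
    proof (intro allI impI)
      fix z and s :: "real^'p" assume "tight_bound n k z \<le> K \<and> norm s = 1 \<and> s $ k = 0"
      then show "v * t / \<sigma> * (s \<bullet> score n k z) - (v * t / \<sigma>)\<^sup>2 / 2 - \<epsilon>
        \<le> log_lr (r n * v) n \<theta>0 (alternative t n s) (\<lambda>i\<in>{1..n}. (spike_mat (sqrt (1 + r n * v) - 1) \<theta>0 ** T) *v (\<chi> j. z (i, j)))"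
        using QB[of "(n, z, s)"] elim by (simp only: B_def fst_conv snd_conv)
    qed
  qed
qed

text \<open>The infimum over the shell is at most the power at each alternative of radius
  \<open>t\<close>. All directions are covered with the same error, so
  \<open>minimax_power_bound\<close> applies.\<close>

lemma maximin_upper:
  assumes q: "q \<ge> 0" and \<psi>: "test_sequence \<psi>"
    and level: "limsup (\<lambda>n. ereal (\<integral>x. \<psi> n x \<partial>P n \<theta>0)) \<le> ereal (1 - shifted_cdf k q 0)"
    and t: "0 < t" "c \<le> t" "t \<le> C"
  shows "limsup (\<lambda>n. INF \<theta>\<in>local_alternatives \<theta>0 (1 / w n) c C. ereal (\<integral>x. \<psi> n x \<partial>P n \<theta>)) \<le> ereal (1 - shifted_cdf k q (shift_vec t))"
proof (rule ereal_le_epsilon2)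
  fix \<zeta> :: real assume \<zeta>: "\<zeta> > 0"
  define \<alpha> where "\<alpha> = v * t / \<sigma>"
  have \<alpha>: "\<alpha> \<ge> 0" using v t \<sigma>(1) by (simp add: \<alpha>_def)
  obtain k0 where k0: "ennreal k0 = sphere_avg k \<alpha> (sqrt q *\<^sub>R axis j 1)" "k0 \<ge> 0"
    using sphere_avg_finite[of k \<alpha> "sqrt q *\<^sub>R axis j 1"] by (cases "sphere_avg k \<alpha> (sqrt q *\<^sub>R axis j 1)") auto
  \<comment> \<open>One \<open>\<epsilon>'\<close> pays for the asymptotic level and one for leaving
    the tightness event. Both get multiplied by \<open>k0\<close>, and this choice keeps the total
    below \<open>\<zeta> / 2\<close>.\<close>
  define \<epsilon>' where "\<epsilon>' = \<zeta> / (4 * (k0 + 1))"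
  have \<epsilon>': "\<epsilon>' > 0" using \<zeta> k0 by (simp add: \<epsilon>'_def)
  have k0\<epsilon>: "k0 * (2 * \<epsilon>') \<le> \<zeta> / 2"
  proof -
    have "k0 + 1 > 0" using k0 by simp
    then have "k0 * (2 * \<epsilon>') = (k0 / (k0 + 1)) * (\<zeta> / 2)" by (simp add: \<epsilon>'_def divide_simps)
    also have "\<dots> \<le> 1 * (\<zeta> / 2)" using k0 \<zeta> by (intro mult_right_mono) auto
    finally show ?thesis by simp
  qed
  obtain K where K: "\<And>n. n \<ge> 1 \<Longrightarrow> measure (\<Gamma> n) {z \<in> space (\<Gamma> n). tight_bound n k z > K} \<le> \<epsilon>'"
    using tightness[OF p \<epsilon>', of k] by blast
  have "limsup (\<lambda>n. ereal (\<integral>x. \<psi> n x \<partial>P n \<theta>0)) < ereal (1 - shifted_cdf k q 0 + \<epsilon>')"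
    using level \<epsilon>' by (rule_tac le_less_trans) auto
  from Limsup_lessD[OF this]
  have lev: "\<forall>\<^sub>F n in sequentially. (\<integral>x. \<psi> n x \<partial>P n \<theta>0) < 1 - shifted_cdf k q 0 + \<epsilon>'" by simp
  have \<zeta>2: "\<zeta> / 2 > 0" using \<zeta> by simp
  have "\<forall>\<^sub>F n in sequentially. (INF \<theta>\<in>local_alternatives \<theta>0 (1 / w n) c C. ereal (\<integral>x. \<psi> n x \<partial>P n \<theta>)) \<le> ereal (1 - shifted_cdf k q (shift_vec t) + \<zeta>)"
    using lev log_lr_lower[OF less_imp_le[OF t(1)] \<zeta>2, of K] alternative_mem[OF t] eventually_ge_at_top[of 1]
  proof eventually_elim
    case (elim n)
    note n = elim(4)
    let ?A = "local_alternatives \<theta>0 (1 / w n) c C"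
    let ?I = "INF \<theta>\<in>?A. ereal (\<integral>x. \<psi> n x \<partial>P n \<theta>)"
    have A1: "norm \<theta> = 1" if "\<theta> \<in> ?A" for \<theta> using that by (simp add: local_alternatives_def)
    have alt: "alternative t n s \<in> ?A" if "norm s = 1" "s $ k = 0" for s using elim(3) that by blast
    have ax: "norm (axis j (1::real) :: real^'p) = 1" "(axis j (1::real) :: real^'p) $ k = 0"
      using j by (simp_all add: norm_axis_1) (simp add: axis_def)
    from alt[OF ax] have "?I \<le> ereal (\<integral>x. \<psi> n x \<partial>P n (alternative t n (axis j 1)))" by (rule INF_lower)
    also have "\<dots> \<le> ereal 1" using test_integrable(3)[OF \<psi> n A1[OF alt[OF ax]]] by simp
    finally have I1: "?I \<le> ereal 1" .
    have I0: "ereal 0 \<le> ?I" by (intro INF_greatest) (simp add: test_integrable(2)[OF \<psi> n A1])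
    \<comment> \<open>The infimum lies in [0, 1], hence is a real number, and 1 - b bounds the
      acceptance probability at every alternative of the shell.\<close>
    obtain b where b: "?I = ereal b" using I0 I1 by (cases ?I) auto
    have b01: "0 \<le> b" "b \<le> 1" using I0 I1 unfolding b by auto
    have ble: "b \<le> (\<integral>x. \<psi> n x \<partial>P n \<theta>)" if "\<theta> \<in> ?A" for \<theta>
    proof -
      have "?I \<le> ereal (\<integral>x. \<psi> n x \<partial>P n \<theta>)" using that by (rule INF_lower)
      then show ?thesis unfolding b by simp
    qed
    define X where "X z = (\<lambda>i\<in>{1..n}. (spike_mat (sqrt (1 + r n * v) - 1) \<theta>0 ** T) *v (\<chi> j. z (i, j)))" for z :: "nat \<times> 'p \<Rightarrow> real"
    have Xm [measurable]: "X \<in> measurable (\<Gamma> n) (sample_space n)" unfolding X_def[abs_def] by (rule sample_map_measurable)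
    have PX: "P n \<theta>0 = distr (\<Gamma> n) (sample_space n) X" unfolding X_def[abs_def] by (rule P_eq_distr[OF n \<theta>0])
    have \<psi>m [measurable]: "\<psi> n \<in> borel_measurable (sample_space n)" and \<psi>b: "\<And>x. x \<in> space (sample_space n) \<Longrightarrow> 0 \<le> \<psi> n x \<and> \<psi> n x \<le> 1"
      using \<psi> n unfolding test_sequence_def by auto
    interpret G: prob_space "\<Gamma> n" by (rule prob_space_PiM_std_normal)
    let ?B = "{z \<in> space (\<Gamma> n). tight_bound n k z \<le> K}"
    have power: "(\<integral>\<^sup>+z. ennreal (1 - \<psi> n (X z)) * indicator ?B z * ennreal (exp (- (\<zeta> / 2)) * exp (\<alpha> * (s \<bullet> score n k z) - \<alpha>\<^sup>2 / 2)) \<partial>\<Gamma> n) \<le> ennreal (1 - b)"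
      if s: "norm s = 1" "s $ k = 0" for s
    proof -
      let ?\<theta> = "alternative t n s"
      have \<theta>1: "norm ?\<theta> = 1" by (rule A1[OF alt[OF s]])
      note [measurable] = log_lr_measurable[of "r n * v" n \<theta>0 ?\<theta>]
      have "(\<integral>\<^sup>+z. ennreal (1 - \<psi> n (X z)) * indicator ?B z * ennreal (exp (- (\<zeta> / 2)) * exp (\<alpha> * (s \<bullet> score n k z) - \<alpha>\<^sup>2 / 2)) \<partial>\<Gamma> n)
        \<le> (\<integral>\<^sup>+z. ennreal (exp (log_lr (r n * v) n \<theta>0 ?\<theta> (X z))) * ennreal (1 - \<psi> n (X z)) \<partial>\<Gamma> n)"
      proof (rule nn_integral_mono)
        fix z assume "z \<in> space (\<Gamma> n)"
        show "ennreal (1 - \<psi> n (X z)) * indicator ?B z * ennreal (exp (- (\<zeta> / 2)) * exp (\<alpha> * (s \<bullet> score n k z) - \<alpha>\<^sup>2 / 2))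
          \<le> ennreal (exp (log_lr (r n * v) n \<theta>0 ?\<theta> (X z))) * ennreal (1 - \<psi> n (X z))"
        proof (cases "z \<in> ?B")
          case True
          then have "\<alpha> * (s \<bullet> score n k z) - \<alpha>\<^sup>2 / 2 - \<zeta> / 2 \<le> log_lr (r n * v) n \<theta>0 ?\<theta> (X z)"
            using elim(2) s unfolding \<alpha>_def X_def by blast
          then have "exp (- (\<zeta> / 2)) * exp (\<alpha> * (s \<bullet> score n k z) - \<alpha>\<^sup>2 / 2) \<le> exp (log_lr (r n * v) n \<theta>0 ?\<theta> (X z))"
            by (simp flip: exp_add)
          then have "ennreal (exp (- (\<zeta> / 2)) * exp (\<alpha> * (s \<bullet> score n k z) - \<alpha>\<^sup>2 / 2)) \<le> ennreal (exp (log_lr (r n * v) n \<theta>0 ?\<theta> (X z)))"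
            by (rule ennreal_leI)
          from mult_left_mono[OF this, of "ennreal (1 - \<psi> n (X z))"] True show ?thesis by (simp add: mult.commute)
        qed simp
      qed
      also have "\<dots> = (\<integral>\<^sup>+x. ennreal (exp (log_lr (r n * v) n \<theta>0 ?\<theta> x)) * ennreal (1 - \<psi> n x) \<partial>P n \<theta>0)"
        unfolding PX by (rule nn_integral_distr[symmetric]) measurable
      also have "\<dots> = (\<integral>\<^sup>+x. ennreal (1 - \<psi> n x) \<partial>P n ?\<theta>)"
      proof -
        have "r n * v > 0" using r_pos[OF n] v by simp
        then have d: "P n ?\<theta> = density (P n \<theta>0) (\<lambda>x. ennreal (exp (log_lr (r n * v) n \<theta>0 ?\<theta> x)))"
          by (rule spiked_model_density[OF \<theta>1 \<theta>0])
        show ?thesis unfolding d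
          by (rule nn_integral_density[symmetric]) (simp_all add: n \<theta>0 cong: measurable_cong_sets)
      qed
      also have "\<dots> = ennreal (1 - (\<integral>x. \<psi> n x \<partial>P n ?\<theta>))" by (rule test_integrable(4)[OF \<psi> n \<theta>1])
      also have "\<dots> \<le> ennreal (1 - b)" using ble[OF alt[OF s]] by (intro ennreal_leI) simp
      finally show ?thesis .
    qed
    have Bc: "measure (\<Gamma> n) (space (\<Gamma> n) - ?B) \<le> \<epsilon>'"
    proof -
      have "space (\<Gamma> n) - ?B = {z \<in> space (\<Gamma> n). tight_bound n k z > K}" by auto
      then show ?thesis using K[OF n] by simp
    qed
    have E0: "(\<integral>z. \<psi> n (X z) \<partial>\<Gamma> n) = (\<integral>x. \<psi> n x \<partial>P n \<theta>0)" unfolding PX by (rule integral_distr[symmetric]) measurable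
    have bound: "exp (- (\<zeta> / 2)) * (shifted_cdf k q (shift_vec t) + k0 * (1 - shifted_cdf k q 0 - (\<integral>z. \<psi> n (X z) \<partial>\<Gamma> n) - \<epsilon>')) \<le> 1 - b"
    proof (rule minimax_power_bound[OF p \<alpha> shift_vec(1) _ q G.prob_space_axioms score_measurable distr_score[OF n p] _ _ _ Bc power _ k0 j])
      show "norm (shift_vec t) = \<alpha>" using shift_vec(2)[of t] t by (simp add: \<alpha>_def)
      show "(\<lambda>z. \<psi> n (X z)) \<in> borel_measurable (\<Gamma> n)" by measurable
      show "0 \<le> \<psi> n (X z) \<and> \<psi> n (X z) \<le> 1" if "z \<in> space (\<Gamma> n)" for z using \<psi>b[OF measurable_space[OF Xm that]] .
      show "?B \<in> sets (\<Gamma> n)" by measurable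
    qed (use b01 in auto)
    define S where "S = shifted_cdf k q (shift_vec t)"
    interpret SG: prob_space "std_gauss :: (real^'p) measure" by (rule prob_space_std_gauss)
    have S01: "0 \<le> S" "S \<le> 1" by (simp_all add: S_def shifted_cdf_def)
    have "k0 * (1 - shifted_cdf k q 0 - (\<integral>z. \<psi> n (X z) \<partial>\<Gamma> n) - \<epsilon>') \<ge> k0 * (- (2 * \<epsilon>'))"
      using elim(1) k0 unfolding E0 by (intro mult_left_mono) auto
    then have "S - \<zeta> / 2 \<le> S + k0 * (1 - shifted_cdf k q 0 - (\<integral>z. \<psi> n (X z) \<partial>\<Gamma> n) - \<epsilon>')" using k0\<epsilon> by simp
    then have "exp (- (\<zeta> / 2)) * (S - \<zeta> / 2) \<le> 1 - b"
      using bound mult_left_mono[of "S - \<zeta> / 2" _ "exp (- (\<zeta> / 2))"] unfolding S_def[symmetric] by (meson exp_ge_zero order_trans)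
    \<comment> \<open>Since \<open>S\<close> is at most 1, replacing the factor exp (- zeta / 2) by
      1 costs at most another zeta / 2.\<close>
    moreover have "S - \<zeta> \<le> exp (- (\<zeta> / 2)) * (S - \<zeta> / 2)"
    proof (cases "S - \<zeta> / 2 \<ge> 0")
      case True
      have "1 - \<zeta> / 2 \<le> exp (- (\<zeta> / 2))" using exp_ge_add_one_self[of "- (\<zeta> / 2)"] by simp
      from mult_right_mono[OF this True] have "(1 - \<zeta> / 2) * (S - \<zeta> / 2) \<le> exp (- (\<zeta> / 2)) * (S - \<zeta> / 2)" .
      moreover have "\<zeta> / 2 * (S - \<zeta> / 2) \<le> \<zeta> / 2 * 1" using \<zeta> S01 by (intro mult_left_mono) auto
      ultimately show ?thesis by (simp add: left_diff_distrib)
    next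
      case False
      have "exp (- (\<zeta> / 2)) \<le> 1" using \<zeta> by simp
      then have "1 * (S - \<zeta> / 2) \<le> exp (- (\<zeta> / 2)) * (S - \<zeta> / 2)" using False by (intro mult_right_mono_neg) auto
      then show ?thesis using \<zeta> by simp
    qed
    ultimately show ?case unfolding b S_def by simp
  qed
  then have "limsup (\<lambda>n. INF \<theta>\<in>local_alternatives \<theta>0 (1 / w n) c C. ereal (\<integral>x. \<psi> n x \<partial>P n \<theta>)) \<le> ereal (1 - shifted_cdf k q (shift_vec t) + \<zeta>)"
    by (rule Limsup_bounded)
  then show "limsup (\<lambda>n. INF \<theta>\<in>local_alternatives \<theta>0 (1 / w n) c C. ereal (\<integral>x. \<psi> n x \<partial>P n \<theta>)) \<le> ereal (1 - shifted_cdf k q (shift_vec t)) + ereal \<zeta>"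
    by simp
qed

section \<open>Limiting power of the test and attainment of the bound\<close>

lemma cdf_limit:
  assumes E: "sample_eigenvectors E" and N: "filterlim N at_top sequentially"
    and \<theta>: "\<forall>\<^sub>F i in sequentially. norm (\<theta> i) = 1" and \<tau>: "(\<lambda>i. w (N i) *\<^sub>R (\<theta> i - \<theta>0)) \<longlonglongrightarrow> \<tau>"
  shows "(\<lambda>i. measure (P (N i) (\<theta> i)) {x \<in> space (sample_space (N i)). Q_HPV \<theta>0 E (N i) x \<le> q}) \<longlonglongrightarrow> shifted_cdf k q (shift_vec (norm \<tau>))"
    and "distr std_gauss borel (\<lambda>g. (norm (proj_perp k g + shift_vec (norm \<tau>)))\<^sup>2) = noncentral_chi_square (CARD('p) - 1) (v\<^sup>2 / (1 + \<delta> * v) * (norm \<tau>)\<^sup>2)"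
proof -
  define m where "m = (v / \<sigma>) *\<^sub>R (transpose T *v \<tau>)"
  have wN: "filterlim (\<lambda>i. w (N i)) at_top sequentially" by (rule filterlim_compose[OF nr N])
  have "\<theta>0 \<bullet> \<tau> = 0" by (rule tangent_limit(2)[OF _ wN \<theta> \<theta>0 \<tau>]) simp
  moreover have "(transpose T *v \<tau>) $ k = \<theta>0 \<bullet> \<tau>"
    using inner_transpose_mult[of "axis k 1" T \<tau>] by (simp add: T0 inner_axis' del: transpose_matrix_vector)
  ultimately have mk: "m $ k = 0" by (simp add: m_def del: transpose_matrix_vector)
  have nm: "norm m = norm (shift_vec (norm \<tau>))"
    using v \<sigma>(1) by (simp only: m_def norm_scaleR orthogonal_matrix_mult_inverse[OF T] shift_vec(2)[OF norm_ge_zero]) simp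
  have "(\<lambda>i. measure (P (N i) (\<theta> i)) {x \<in> space (sample_space (N i)). Q_HPV \<theta>0 E (N i) x \<le> q}) \<longlonglongrightarrow> shifted_cdf k q m"
    using Q_HPV_cdf_limit[OF p v \<delta> r_pos r_lim nr E T T0 N \<theta> \<tau>] by (simp only: cdf_norm_proj_shift m_def \<sigma>_def)
  also have "shifted_cdf k q m = shifted_cdf k q (shift_vec (norm \<tau>))" by (rule shifted_cdf_rotate[OF p mk shift_vec(1) nm])
  finally show "(\<lambda>i. measure (P (N i) (\<theta> i)) {x \<in> space (sample_space (N i)). Q_HPV \<theta>0 E (N i) x \<le> q}) \<longlonglongrightarrow> shifted_cdf k q (shift_vec (norm \<tau>))" .
  have "(norm (shift_vec (norm \<tau>)))\<^sup>2 = v\<^sup>2 / (1 + \<delta> * v) * (norm \<tau>)\<^sup>2"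
    by (simp only: shift_vec(2)[OF norm_ge_zero]) (simp add: power_divide power_mult_distrib \<sigma>(2))
  then show "distr std_gauss borel (\<lambda>g. (norm (proj_perp k g + shift_vec (norm \<tau>)))\<^sup>2) = noncentral_chi_square (CARD('p) - 1) (v\<^sup>2 / (1 + \<delta> * v) * (norm \<tau>)\<^sup>2)"
    using distr_norm_proj_shift[OF p shift_vec(1)] by simp
qed

lemma integral_phi_HPV:
  assumes E: "sample_eigenvectors E" and n: "n \<ge> 1" "norm \<theta> = 1"
    and q: "q = quantile (chi_square (CARD('p) - 1)) (1 - \<alpha>)"
  shows "(\<integral>x. phi_HPV \<theta>0 E \<alpha> n x \<partial>P n \<theta>) = 1 - measure (P n \<theta>) {x \<in> space (sample_space n). Q_HPV \<theta>0 E n x \<le> q}"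
proof -
  interpret prob_space "P n \<theta>" by (rule prob_space_P[OF n])
  have "Q_HPV \<theta>0 E n \<in> borel_measurable (sample_space n)" by (rule Q_HPV_measurable[OF E n(1)])
  then have [measurable]: "Q_HPV \<theta>0 E n \<in> borel_measurable (P n \<theta>)" using n by (simp cong: measurable_cong_sets)
  have s: "space (P n \<theta>) = space (sample_space n)" using n by simp
  have "(\<integral>x. phi_HPV \<theta>0 E \<alpha> n x \<partial>P n \<theta>) = measure (P n \<theta>) ({x. Q_HPV \<theta>0 E n x > q} \<inter> space (P n \<theta>))"
    by (simp add: phi_HPV_def q)
  also have "{x. Q_HPV \<theta>0 E n x > q} \<inter> space (P n \<theta>) = space (P n \<theta>) - {x \<in> space (P n \<theta>). Q_HPV \<theta>0 E n x \<le> q}" by auto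
  also have "measure (P n \<theta>) \<dots> = 1 - measure (P n \<theta>) {x \<in> space (P n \<theta>). Q_HPV \<theta>0 E n x \<le> q}" by (rule prob_compl) measurable
  finally show ?thesis by (simp only: s)
qed

lemma phi_HPV_limit:
  assumes E: "sample_eigenvectors E" and N: "filterlim N at_top sequentially"
    and \<theta>: "\<forall>\<^sub>F i in sequentially. norm (\<theta> i) = 1" and \<tau>: "(\<lambda>i. w (N i) *\<^sub>R (\<theta> i - \<theta>0)) \<longlonglongrightarrow> \<tau>"
    and q: "q = quantile (chi_square (CARD('p) - 1)) (1 - \<alpha>)"
  shows "(\<lambda>i. \<integral>x. phi_HPV \<theta>0 E \<alpha> (N i) x \<partial>P (N i) (\<theta> i)) \<longlonglongrightarrow> 1 - shifted_cdf k q (shift_vec (norm \<tau>))"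
proof -
  define f where "f i = 1 - measure (P (N i) (\<theta> i)) {x \<in> space (sample_space (N i)). Q_HPV \<theta>0 E (N i) x \<le> q}" for i
  define g where "g i = (\<integral>x. phi_HPV \<theta>0 E \<alpha> (N i) x \<partial>P (N i) (\<theta> i))" for i
  have "f \<longlonglongrightarrow> 1 - shifted_cdf k q (shift_vec (norm \<tau>))"
    unfolding f_def[abs_def] by (intro tendsto_diff tendsto_const cdf_limit(1)[OF E N \<theta> \<tau>])
  moreover have "\<forall>\<^sub>F i in sequentially. N i \<ge> 1" using N by (auto simp: filterlim_at_top)
  then have "\<forall>\<^sub>F i in sequentially. f i = g i"
    using \<theta> by eventually_elim (simp only: f_def g_def integral_phi_HPV[OF E _ _ q])
  ultimately have "g \<longlonglongrightarrow> 1 - shifted_cdf k q (shift_vec (norm \<tau>))" by (rule Lim_transform_eventually)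
  then show ?thesis by (simp only: g_def[abs_def])
qed

text \<open>Choose alternatives within 1/n of the infimum, pass to a subsequence realising the lower
  limit, then to one along which the rescaled displacements converge. The limit theorem identifies
  the limiting power, and \<open>t\<close> is the norm of the limiting displacement.\<close>

lemma maximin_lower:
  assumes E: "sample_eigenvectors E" and c: "0 < c" "c \<le> C"
    and q: "q = quantile (chi_square (CARD('p) - 1)) (1 - \<alpha>)"
  obtains t where "c \<le> t" "t \<le> C"
    "ereal (1 - shifted_cdf k q (shift_vec t)) \<le> liminf (\<lambda>n. INF \<theta>\<in>local_alternatives \<theta>0 (1 / w n) c C. ereal (\<integral>x. phi_HPV \<theta>0 E \<alpha> n x \<partial>P n \<theta>))"
proof -
  let ?A = "\<lambda>n. local_alternatives \<theta>0 (1 / w n) c C"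
  let ?\<phi> = "\<lambda>n \<theta>. \<integral>x. phi_HPV \<theta>0 E \<alpha> n x \<partial>P n \<theta>"
  define f where "f n = (INF \<theta>\<in>?A n. ereal (?\<phi> n \<theta>))" for n
  have \<phi>: "test_sequence (phi_HPV \<theta>0 E \<alpha>)" by (rule test_sequence_phi_HPV[OF E])
  have "\<forall>\<^sub>F n in sequentially. n \<ge> 1 \<and> w n > 0 \<and> (\<exists>\<theta>. \<theta> \<in> ?A n)"
    using alternative_mem[OF c(1) order_refl c(2)] eventually_ge_at_top[of 1] filterlim_at_top_dense[THEN iffD1, OF nr, rule_format, of 0]
  proof eventually_elim
    case (elim n)
    have "norm (axis j (1::real) :: real^'p) = 1" "(axis j (1::real) :: real^'p) $ k = 0"
      using j by (simp_all add: norm_axis_1) (simp add: axis_def)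
    then show ?case using elim by blast
  qed
  \<comment> \<open>From \<open>n0\<close> on the shell is nonempty, so its infimum is finite and
    near-minimisers exist; the choice of \<open>\<theta>\<close> below is meaningful there.\<close>
  then obtain n0 where n0: "\<And>n. n \<ge> n0 \<Longrightarrow> n \<ge> 1 \<and> w n > 0 \<and> (\<exists>\<theta>. \<theta> \<in> ?A n)"
    unfolding eventually_sequentially by blast
  have near: "\<exists>\<theta>. \<theta> \<in> ?A n \<and> ereal (?\<phi> n \<theta>) \<le> f n + ereal (1 / real n)" if n: "n \<ge> n0" for n
  proof -
    have n1: "n \<ge> 1" using n0[OF n] by simp
    obtain \<theta> where \<theta>: "\<theta> \<in> ?A n" using n0[OF n] by blast
    have I0: "ereal 0 \<le> f n" unfolding f_def
    proof (rule INF_greatest)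
      fix \<theta> assume "\<theta> \<in> ?A n"
      then have "norm \<theta> = 1" by (simp add: local_alternatives_def)
      then show "ereal 0 \<le> ereal (?\<phi> n \<theta>)" using test_integrable(2)[OF \<phi> n1] by simp
    qed
    have "f n \<le> ereal (?\<phi> n \<theta>)" unfolding f_def using \<theta> by (rule INF_lower)
    then have fin: "\<bar>f n\<bar> \<noteq> \<infinity>" using I0 by (cases "f n") auto
    then have "f n < f n + ereal (1 / real n)" using n1 by (cases "f n") auto
    then obtain \<theta>' where "\<theta>' \<in> ?A n" "ereal (?\<phi> n \<theta>') < f n + ereal (1 / real n)"
      unfolding f_def INF_less_iff by blast
    then show ?thesis using less_imp_le by blast
  qed
  define \<theta> where "\<theta> n = (SOME \<theta>. \<theta> \<in> ?A n \<and> ereal (?\<phi> n \<theta>) \<le> f n + ereal (1 / real n))" for n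
  have \<theta>A: "\<theta> n \<in> ?A n" and \<theta>f: "ereal (?\<phi> n (\<theta> n)) \<le> f n + ereal (1 / real n)" if "n \<ge> n0" for n
    using someI_ex[OF near[OF that]] unfolding \<theta>_def by blast+
  obtain s0 where s0: "strict_mono s0" "(f \<circ> s0) \<longlonglongrightarrow> liminf f" using liminf_subseq_lim[of f] by blast
  \<comment> \<open>A strictly increasing sequence dominates its index, so dropping
    \<open>n0\<close> terms places all chosen sample sizes at or beyond \<open>n0\<close>.\<close>
  define s where "s i = s0 (i + n0)" for i
  have s_ge: "s i \<ge> n0" for i using seq_suble[OF s0(1), of "i + n0"] by (simp add: s_def)
  have s_lim: "(\<lambda>i. f (s i)) \<longlonglongrightarrow> liminf f" using LIMSEQ_ignore_initial_segment[OF s0(2), of n0] by (simp add: s_def o_def)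
  have s_mono: "strict_mono s" using s0(1) by (simp add: s_def strict_mono_def)
  define \<tau> where "\<tau> i = w (s i) *\<^sub>R (\<theta> (s i) - \<theta>0)" for i
  have \<tau>: "c \<le> norm (\<tau> i)" "norm (\<tau> i) \<le> C" for i
    using \<theta>A[OF s_ge] n0[OF s_ge, of i] by (auto simp: local_alternatives_def \<tau>_def)
  \<comment> \<open>The rescaled displacements lie between the radii c and C; a limit point does
    too, which puts \<open>t\<close> into [c, C].\<close>
  have "bounded (range \<tau>)" using \<tau>(2) by (auto simp: bounded_iff)
  then obtain l u where u: "strict_mono u" and l: "(\<tau> \<circ> u) \<longlonglongrightarrow> l"
    using bounded_imp_convergent_subsequence by blast
  have nl: "(\<lambda>i. norm (\<tau> (u i))) \<longlonglongrightarrow> norm l" using tendsto_norm[OF l] by (simp add: o_def)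
  have l_ge: "c \<le> norm l" by (rule tendsto_lowerbound[OF nl]) (use \<tau> in auto)
  have l_le: "norm l \<le> C" by (rule tendsto_upperbound[OF nl]) (use \<tau> in auto)
  define N where "N i = s (u i)" for i
  have Nm: "strict_mono N" using strict_mono_o[OF s_mono u] by (simp add: N_def[abs_def] o_def)
  have N: "filterlim N at_top sequentially" by (rule filterlim_subseq[OF Nm])
  have \<theta>1: "\<forall>\<^sub>F i in sequentially. norm (\<theta> (N i)) = 1"
    using \<theta>A[OF s_ge] by (intro always_eventually) (simp add: N_def local_alternatives_def)
  have \<tau>N: "(\<lambda>i. w (N i) *\<^sub>R (\<theta> (N i) - \<theta>0)) \<longlonglongrightarrow> l" using l by (simp add: \<tau>_def[abs_def] N_def o_def)
  have lim1: "(\<lambda>i. ereal (?\<phi> (N i) (\<theta> (N i)))) \<longlonglongrightarrow> ereal (1 - shifted_cdf k q (shift_vec (norm l)))"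
    by (intro tendsto_ereal phi_HPV_limit[OF E N \<theta>1 \<tau>N q])
  have "(\<lambda>i. f (N i)) \<longlonglongrightarrow> liminf f"
    using LIMSEQ_subseq_LIMSEQ[OF s_lim u] by (simp add: o_def N_def)
  moreover have "(\<lambda>i. ereal (1 / real (N i))) \<longlonglongrightarrow> ereal 0"
    by (intro tendsto_ereal real_tendsto_divide_at_top[OF tendsto_const] filterlim_compose[OF filterlim_real_sequentially N])
  ultimately have lim2: "(\<lambda>i. f (N i) + ereal (1 / real (N i))) \<longlonglongrightarrow> liminf f + ereal 0"
    by (intro tendsto_add_ereal_general1) auto
  have "ereal (1 - shifted_cdf k q (shift_vec (norm l))) \<le> liminf f + ereal 0"
    by (rule LIMSEQ_le[OF lim1 lim2]) (use \<theta>f s_ge in \<open>auto simp: N_def\<close>)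
  then have "ereal (1 - shifted_cdf k q (shift_vec (norm l))) \<le> liminf f" by simp
  then show thesis using that[OF l_ge l_le] unfolding f_def by simp
qed

text \<open>Continuity of the limit law makes the level exact. A negative quantile would give
  acceptance probability 0, contradicting alpha below 1.\<close>

lemma chi_square_quantile:
  assumes \<alpha>: "0 < \<alpha>" "\<alpha> < 1"
  defines "q \<equiv> quantile (chi_square (CARD('p) - 1)) (1 - \<alpha>)"
  shows "shifted_cdf k q 0 = 1 - \<alpha>" and "q \<ge> 0"
proof -
  have chi: "chi_square (CARD('p) - 1) = distr std_gauss borel (\<lambda>g. (norm (proj_perp k g + 0))\<^sup>2)"
    using distr_norm_proj_shift[OF p, of 0 k] by (simp add: chi_square_def)
  have "cdf (chi_square (CARD('p) - 1)) q = 1 - \<alpha>"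
    unfolding q_def chi
    by (rule cdf_quantile[OF real_distribution_norm_proj_shift isCont_cdf_norm_proj_shift[OF p]]) (use \<alpha> in auto)
  then show c: "shifted_cdf k q 0 = 1 - \<alpha>" unfolding chi cdf_norm_proj_shift .
  show "q \<ge> 0"
  proof (rule ccontr)
    assume "\<not> q \<ge> 0"
    then have "\<not> (norm (proj_perp k w + 0))\<^sup>2 \<le> q" for w :: "real^'p"
      using zero_le_power2[of "norm (proj_perp k w + 0)"] by linarith
    then have "shifted_cdf k q 0 = 0" by (simp only: shifted_cdf_def) simp
    then show False using c \<alpha> by simp
  qed
qed

lemma phi_HPV_maximin:
  assumes E: "sample_eigenvectors E" and \<alpha>: "0 < \<alpha>" "\<alpha> < 1"
  shows "locally_asymptotically_maximin P (\<lambda>n. 1 / w n) \<theta>0 \<alpha> (phi_HPV \<theta>0 E \<alpha>)"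
proof -
  define q where "q = quantile (chi_square (CARD('p) - 1)) (1 - \<alpha>)"
  note cq = chi_square_quantile[OF \<alpha>, folded q_def]
  have level: "asymptotic_level (\<lambda>n. P n \<theta>0) \<alpha> (phi_HPV \<theta>0 E \<alpha>)"
  proof -
    \<comment> \<open>The null hypothesis is the constant sequence with zero displacement, so the
      level follows from the power limit at tau = 0.\<close>
    have "(\<lambda>n. \<integral>x. phi_HPV \<theta>0 E \<alpha> n x \<partial>P n \<theta>0) \<longlonglongrightarrow> 1 - shifted_cdf k q (shift_vec (norm (0 :: real^'p)))"
      by (rule phi_HPV_limit[OF E filterlim_ident _ _ q_def]) (simp_all add: \<theta>0)
    then have "(\<lambda>n. ereal (\<integral>x. phi_HPV \<theta>0 E \<alpha> n x \<partial>P n \<theta>0)) \<longlonglongrightarrow> ereal \<alpha>" by (simp add: shift_vec_def cq)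
    from lim_imp_Limsup[OF _ this] show ?thesis by (simp add: asymptotic_level_def)
  qed
  show ?thesis
    unfolding locally_asymptotically_maximin_def
  proof (intro conjI allI impI level test_sequence_phi_HPV[OF E])
    fix c C :: real and \<psi> :: "nat \<Rightarrow> (nat \<Rightarrow> real^'p) \<Rightarrow> real"
    assume c: "0 < c \<and> c \<le> C" and \<psi>: "test_sequence \<psi> \<and> asymptotic_level (\<lambda>n. P n \<theta>0) \<alpha> \<psi>"
    obtain t where t: "c \<le> t" "t \<le> C"
      and lower: "ereal (1 - shifted_cdf k q (shift_vec t)) \<le> liminf (\<lambda>n. INF \<theta>\<in>local_alternatives \<theta>0 (1 / w n) c C. ereal (\<integral>x. phi_HPV \<theta>0 E \<alpha> n x \<partial>P n \<theta>))"
      using maximin_lower[OF E _ _ q_def] c by blast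
    have "limsup (\<lambda>n. INF \<theta>\<in>local_alternatives \<theta>0 (1 / w n) c C. ereal (\<integral>x. \<psi> n x \<partial>P n \<theta>)) \<le> ereal (1 - shifted_cdf k q (shift_vec t))"
      by (rule maximin_upper[OF cq(2)]) (use \<psi> c t in \<open>auto simp: asymptotic_level_def cq\<close>)
    then show "limsup (\<lambda>n. INF \<theta>\<in>local_alternatives \<theta>0 (1 / w n) c C. ereal (\<integral>x. \<psi> n x \<partial>P n \<theta>))
      \<le> liminf (\<lambda>n. INF \<theta>\<in>local_alternatives \<theta>0 (1 / w n) c C. ereal (\<integral>x. phi_HPV \<theta>0 E \<alpha> n x \<partial>P n \<theta>))"
      using lower by (rule order_trans)
  qed
qed

lemma Q_HPV_weak_conv:
  assumes E: "sample_eigenvectors E" and \<tau>: "\<tau>s \<longlonglongrightarrow> \<tau>"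
    and unit: "\<forall>n\<ge>1. norm (\<theta>0 + (1 / w n) *\<^sub>R \<tau>s n) = 1"
  shows "weak_conv_m (\<lambda>n. distr (P n (\<theta>0 + (1 / w n) *\<^sub>R \<tau>s n)) borel (Q_HPV \<theta>0 E n))
     (noncentral_chi_square (CARD('p) - 1) (v\<^sup>2 / (1 + \<delta> * v) * (norm \<tau>)\<^sup>2))"
  unfolding weak_conv_m_def weak_conv_def
proof (intro allI impI)
  fix q
  define \<theta> where "\<theta> n = \<theta>0 + (1 / w n) *\<^sub>R \<tau>s n" for n
  have \<theta>1: "\<forall>\<^sub>F n in sequentially. norm (\<theta> n) = 1"
    using unit by (auto simp: \<theta>_def eventually_sequentially)
  have lim: "(\<lambda>n. w n *\<^sub>R (\<theta> n - \<theta>0)) \<longlonglongrightarrow> \<tau>"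
  proof (rule Lim_transform_eventually[OF \<tau>])
    show "\<forall>\<^sub>F n in sequentially. \<tau>s n = w n *\<^sub>R (\<theta> n - \<theta>0)"
      using filterlim_at_top_dense[THEN iffD1, OF nr, rule_format, of 0]
    proof eventually_elim
      case (elim n)
      then have "w n \<noteq> 0" by (rule less_imp_neq[THEN not_sym])
      then have "w n * (1 / w n) = 1" by (simp only: times_divide_eq_right mult_1_right divide_self not_False_eq_True)
      then show ?case by (simp only: \<theta>_def add_diff_cancel_left' scaleR_scaleR scaleR_one)
    qed
  qed
  note lims = cdf_limit[OF E filterlim_ident \<theta>1 lim]
  define f where "f n = measure (P n (\<theta> n)) {x \<in> space (sample_space n). Q_HPV \<theta>0 E n x \<le> q}" for n
  define g where "g n = cdf (distr (P n (\<theta> n)) borel (Q_HPV \<theta>0 E n)) q" for n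
  have "f \<longlonglongrightarrow> shifted_cdf k q (shift_vec (norm \<tau>))" using lims(1) by (simp only: f_def[abs_def])
  moreover have "\<forall>\<^sub>F n in sequentially. f n = g n"
    using \<theta>1 eventually_ge_at_top[of 1]
  proof eventually_elim
    case (elim n)
    have "Q_HPV \<theta>0 E n \<in> borel_measurable (sample_space n)" by (rule Q_HPV_measurable[OF E elim(2)])
    then have [measurable]: "Q_HPV \<theta>0 E n \<in> borel_measurable (P n (\<theta> n))" using elim by (simp cong: measurable_cong_sets)
    show ?case
      unfolding f_def g_def cdf_def using elim
      by (subst measure_distr) (auto intro!: arg_cong[where f="measure (P n (\<theta> n))"])
  qed
  ultimately have "g \<longlonglongrightarrow> shifted_cdf k q (shift_vec (norm \<tau>))" by (rule Lim_transform_eventually)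
  then have "g \<longlonglongrightarrow> cdf (noncentral_chi_square (CARD('p) - 1) (v\<^sup>2 / (1 + \<delta> * v) * (norm \<tau>)\<^sup>2)) q"
    by (simp only: lims(2)[symmetric] cdf_norm_proj_shift)
  then show "(\<lambda>n. cdf (distr (P n (\<theta>0 + (1 / w n) *\<^sub>R \<tau>s n)) borel (Q_HPV \<theta>0 E n)) q)
     \<longlonglongrightarrow> cdf (noncentral_chi_square (CARD('p) - 1) (v\<^sup>2 / (1 + \<delta> * v) * (norm \<tau>)\<^sup>2)) q"
    by (simp only: g_def[abs_def] \<theta>_def)
qed

end

theorem theorem4p2:
  fixes \<theta>0 :: "real ^ 'p"
    and r :: "nat \<Rightarrow> real"
    and v \<delta> :: real
    and E :: "nat \<Rightarrow> nat \<Rightarrow> (nat \<Rightarrow> real ^ 'p) \<Rightarrow> real ^ 'p"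
  assumes "CARD('p) \<ge> 2"
    and "norm \<theta>0 = 1"
    and "v > 0"
    and "\<And>n. n \<ge> 1 \<Longrightarrow> r n > 0"
    and "(\<forall>n\<ge>1. r n = 1) \<and> \<delta> = 1 \<or>
         r \<longlonglongrightarrow> 0 \<and> filterlim (\<lambda>n. sqrt (real n) * r n) at_top sequentially \<and> \<delta> = 0"
    and "sample_eigenvectors E"
  shows "(\<forall>\<alpha>. 0 < \<alpha> \<and> \<alpha> < 1 \<longrightarrow>
            locally_asymptotically_maximin (spiked_model r v) (\<lambda>n. 1 / (sqrt (real n) * r n)) \<theta>0 \<alpha>
              (phi_HPV \<theta>0 E \<alpha>)) \<and>
         (\<forall>(\<tau>s :: nat \<Rightarrow> real ^ 'p) \<tau>.
            \<tau>s \<longlonglongrightarrow> \<tau> \<and> (\<forall>n\<ge>1. norm (\<theta>0 + (1 / (sqrt (real n) * r n)) *\<^sub>R \<tau>s n) = 1) \<longrightarrow>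
            weak_conv_m
              (\<lambda>n. distr (spiked_model r v n (\<theta>0 + (1 / (sqrt (real n) * r n)) *\<^sub>R \<tau>s n)) borel
                     (Q_HPV \<theta>0 E n))
              (noncentral_chi_square (CARD('p) - 1) (v\<^sup>2 / (1 + \<delta> * v) * (norm \<tau>)\<^sup>2)))"
proof -
  have sqrt_top: "filterlim (\<lambda>n. sqrt (real n)) at_top sequentially"
    by (rule filterlim_compose[OF sqrt_at_top filterlim_real_sequentially])
  have rd: "\<delta> \<ge> 0" "r \<longlonglongrightarrow> \<delta>" "filterlim (\<lambda>n. sqrt (real n) * r n) at_top sequentially"
  proof -
    have "r \<longlonglongrightarrow> 1 \<and> filterlim (\<lambda>n. sqrt (real n) * r n) at_top sequentially" if r1: "\<forall>n\<ge>1. r n = 1"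
    proof
      \<comment> \<open>In case (i) r is 1 from n = 1 on, so the statement about r is used
        eventually.\<close>
      have ev: "\<forall>\<^sub>F n in sequentially. r n = 1" using r1 by (auto simp: eventually_sequentially)
      show "r \<longlonglongrightarrow> 1" using ev by (rule tendsto_eventually)
      show "filterlim (\<lambda>n. sqrt (real n) * r n) at_top sequentially"
        by (rule filterlim_cong[THEN iffD2, OF refl refl _ sqrt_top]) (use ev in eventually_elim, simp)
    qed
    then show "\<delta> \<ge> 0" "r \<longlonglongrightarrow> \<delta>" "filterlim (\<lambda>n. sqrt (real n) * r n) at_top sequentially"
      using assms(5) by auto
  qed
  obtain k :: 'p where True by blast
  obtain T where T: "orthogonal_matrix T" "T *v axis k 1 = \<theta>0" using orthogonal_matrix_with_column[OF assms(2)] by blast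
  obtain j :: 'p where j: "j \<noteq> k" using exists_other_coordinate[OF assms(1)] by blast
  interpret spiked_testing \<theta>0 r v \<delta> T k j
    by standard (use assms rd T j in auto)
  show ?thesis using phi_HPV_maximin[OF assms(6)] Q_HPV_weak_conv[OF assms(6)] by blast
qed

end
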